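(* Let $\mathcal V=\mathbb R^{2N}(u_1,v_1,\dots,u_N,v_N)$ and define the matrices depending on $(u,v)\in\mathcal V$, $\lambda$ and the parameter $h$: $$U=\sum_{k=1}^N u_kE_{kk}+\lambda\sum_{k=1}^N E_{k+1,k},\qquad V=I+\lambda^{-1}\sum_{k=1}^N v_kE_{k,k+1},\qquad C=I-h\lambda^{-1}\sum_{k=1}^N u_kv_kE_{k,k+1}.$$ (1) The triples $(U,C^{-1},V)$ form a Poisson Lax matrix map $\mathcal V\to\mathfrak g\otimes\mathfrak g\otimes\mathfrak g$, if $\mathcal V$ carries the Poisson bracket whose nonvanishing brackets are $$\{u_k,v_k\}_2=-u_kv_k,\qquad \{v_k,u_{k+1}\}_2=-v_ku_{k+1},$$ and $\mathfrak g\otimes\mathfrak g\otimes\mathfrak g$ carries the bracket ${\rm PB}_2(\mathbf A_1,\mathbf A_2,\mathbf S)$ with $$\mathbf A_1=\begin{pmatrix}A_1&-S&-S\\ S^*&A_1&S^*\\ S^*&-S&A_1\end{pmatrix},\quad \mathbf A_2=\begin{pmatrix}A_2&-S^*&-S^*\\ S&A_2&-S^*\\ S&S&A_2\end{pmatrix},\quad \mathbf S=\begin{pmatrix}S&S&S\\ S&-S^*&-S^*\\ S&S&-S^*\end{pmatrix}.$$ (2) The maps $L_-=UVC^{-1}$, $VC^{-1}U$, $C^{-1}UV:\mathcal V\to\mathfrak g$ are Poisson if the target $\mathfrak g$ is equipped with ${\rm PB}_2(A_1,A_2,S)$. (3) The hierarchy of continuous time flows is described by the Lax triads (with either choice of sign)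 $$\dot U=\pm U\,\pi_\pm\big(f(VC^{-1}U)\big)\mp\pi_\pm\big(f(UVC^{-1})\big)\,U,$$ $$\dot C=\pm C\,\pi_\pm\big(f(C^{-1}UV)\big)\mp\pi_\pm\big(f(UVC^{-1})\big)\,C,$$ $$\dot V=\pm V\,\pi_\pm\big(f(C^{-1}UV)\big)\mp\pi_\pm\big(f(VC^{-1}U)\big)\,V,$$ and, as a consequence, $L_-=UVC^{-1}$ satisfies $\dot L_-=[L_-,\pm\pi_\pm(f(L_-))]$. (4) In particular, the "first" flow, corresponding to $f(L)=L$, coincides with $$\dot u_k=u_k(v_k-v_{k-1}+hu_kv_k-hu_{k-1}v_{k-1}),\qquad \dot v_k=v_k(u_{k+1}-u_k+hu_{k+1}v_{k+1}-hu_kv_k),$$ and the auxiliary matrices in the Lax triads are given by $$\pi_+(UVC^{-1})=\sum_{k=1}^N(u_k+v_{k-1}+hu_{k-1}v_{k-1})E_{kk}+\lambda\sum_{k=1}^NE_{k+1,k},$$ $$\pi_+(C^{-1}UV)=\sum_{k=1}^N(u_k+v_{k-1}+hu_kv_k)E_{kk}+\lambda\sum_{k=1}^NE_{k+1,k},$$ $$\pi_+(VC^{-1}U)=\sum_{k=1}^N(u_k+v_k+hu_kv_k)E_{kk}+\lambda\sum_{k=1}^NE_{k+1,k}.$$ (5) The map $(u,v)\mapsto(\widetilde u,\widetilde v)$ defined by $$\widetilde u_k(1+hv_{k-1})=u_k(1+hv_k),\qquad \widetilde v_k(1+h\widetilde u_k)=v_k(1+h\widetilde u_{k+1})$$ belongs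 to this hierarchy (in particular, it is Poisson with respect to $\{\cdot,\cdot\}_2$) and corresponds to $f(L)=h^{-1}\log(I+hL)$; that is, it is the time $h$ shift along the flow of the hierarchy with this $f$.
   Context: All subscripts are taken mod $N$ (periodic boundary conditions). $h$ is a (small) real parameter. $E_{jk}$ is the $N\times N$ matrix unit, $E_{N+1,N}=E_{1,N}$, $E_{N,N+1}=E_{N,1}$. Poisson brackets on phase spaces are given by listing all nonvanishing brackets of coordinate functions (up to skew-symmetry). Hamiltonian flows are $\dot x=\{H,x\}$. Algebra: $\mathcal E=\lambda\sum_kE_{k+1,k}$, $\mathcal E^{-1}=\lambda^{-1}\sum_kE_{k,k+1}$. $\mathfrak g$ is the twisted loop algebra over $gl(N)$ of elements $L(\lambda)=\sum_p\ell^{(p)}\mathcal E^p$ with $\ell^{(p)}$ diagonal $N\times N$ matrices independent of $\lambda$ (Laurent polynomials in $\lambda$; when $C^{-1}$ occurs, infinite series in negative powers of $\lambda$ are allowed, $C^{-1}=\sum_{n\ge0}(I-C)^n$). Scalar product: $\langle L,M\rangle={\rm tr}(LM)_0$, the subscript $0$ denoting the $\lambda^0$ coefficient. $\mathfrak g=\mathfrak g_+\oplus\mathfrak g_-$ with $\mathfrak g_+=\{\sum_{p\ge0}\ell^{(p)}\mathcal E^p\}$, $\mathfrak g_-=\{\sum_{p<0}\ell^{(p)}\mathcal E^p\}$, and $\pi_\pm$ are the corresponding projections. $R=\pi_+-\pi_-$, $R_0=(R-R^* )/2$, $P_0=(R+R^* )/2$ (so $P_0(L)=\ell^{(0)}$).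 The skew-symmetric operator $W$ acts on diagonal matrices by $W(E_{jj})=\sum_{k<j}E_{kk}-\sum_{k>j}E_{kk}$ ($1\le j,k\le N$) and on $\mathfrak g$ by $W=W\circ P_0$. Set $A_1=R_0+W$, $A_2=R_0-W$, $S=P_0-W$, $S^*=P_0+W$. $\mathfrak g\otimes\mathfrak g\otimes\mathfrak g$ denotes the direct product $\boldsymbol{\mathfrak g}$ of $m=3$ copies of $\mathfrak g$, with elements $\mathbf L=(L_1,\dots,L_m)$ and scalar product $\sum_k\langle L_k,M_k\rangle$. A linear operator $\mathbf A$ on it has components $(\mathbf A)_{ij}$: $(\mathbf A(\mathbf L))_i=\sum_j(\mathbf A)_{ij}(L_j)$. For a smooth function $\Phi$, $d_j\Phi=L_j\nabla_j\Phi$, $d'_j\Phi=\nabla_j\Phi\,L_j$. The bracket ${\rm PB}_2(\mathbf A_1,\mathbf A_2,\mathbf S)$ is $$\{\Phi,\Psi\}=\tfrac12\sum_{i,j}\langle(\mathbf A_1)_{ij}(d'_j\Phi),d'_i\Psi\rangle-\tfrac12\sum_{i,j}\langle(\mathbf A_2)_{ij}(d_j\Phi),d_i\Psi\rangle+\tfrac12\sum_{i,j}\langle\mathbf S_{ij}(d_j\Phi),d'_i\Psi\rangle-\tfrac12\sum_{i,j}\langle(\mathbf S^* )_{ij}(d'_j\Phi),d_i\Psi\rangle;$$ ${\rm PB}_2(A_1,A_2,S)$ on $\mathfrak g$ is the same formula with $m=1$. The hierarchy: for an ${\rm Ad}$-invariant (conjugation invariant) function $\varphi$ on $\mathfrak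 g$, with ${\rm Ad}$-covariant $f(L)=L\nabla\varphi(L)$, one considers the Hamiltonian flow on $(\mathcal V,\{\cdot,\cdot\}_2)$ with Hamilton function $\varphi(UVC^{-1})$. *)

theory Defs
  imports
    "HOL-Analysis.Analysis"
    "HOL-Library.Function_Algebras"
    "Berlekamp_Zassenhaus.Finite_Field"
begin

text \<open>
  The number of sites is \<open>N = CARD('a)\<close> (any \<open>N \<ge> 1\<close>); the type \<open>'a mod_ring\<close> of site indices is the
  set of residues mod \<open>N\<close>, so all subscripts are periodic. The residue class of \<open>0\<close> is the site
  called \<open>N\<close> in the labelling \<open>1, \<dots>, N\<close>.
\<close>

definition shift :: "int \<Rightarrow> 'a::finite mod_ring \<Rightarrow> 'a mod_ring" where
  "shift p k = k + of_int_mod_ring p"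

abbreviation nxt :: "'a::finite mod_ring \<Rightarrow> 'a mod_ring" where "nxt k \<equiv> shift 1 k"
abbreviation prv :: "'a::finite mod_ring \<Rightarrow> 'a mod_ring" where "prv k \<equiv> shift (-1) k"

text \<open>The representative of a site in \<open>{1..N}\<close>; it is used only for the (non-periodic) order in \<open>W\<close>.\<close>

definition pos :: "'a::finite mod_ring \<Rightarrow> int" where
  "pos k = to_int_mod_ring (prv k) + 1"


section \<open>The twisted loop algebra\<close>

text \<open>
  A Laurent series in \<open>\<lambda>\<close> with matrix coefficients is the function sending \<open>p\<close> to the coefficient
  of \<open>\<lambda>\<^sup>p\<close>. Addition, subtraction and negation of series (and of operators on series) are the
  pointwise operations of the function type.
\<close>

type_synonym 'a loop = "int \<Rightarrow> real^'a mod_ring^'a mod_ring"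

definition E :: "'a::finite mod_ring \<Rightarrow> 'a mod_ring \<Rightarrow> real^'a mod_ring^'a mod_ring" where
  "E j k = (\<chi> a b. if a = j \<and> b = k then 1 else 0)"

definition lam :: "int \<Rightarrow> real^'a mod_ring^'a mod_ring \<Rightarrow> 'a::finite loop" where
  "lam p A = (\<lambda>q. if q = p then A else 0)"

definition lone :: "'a::finite loop" where
  "lone = lam 0 (mat 1)"

text \<open>
  The Cauchy product. The sum is finite for series with degrees bounded above and absolutely
  convergent for series with absolutely summable coefficients.
\<close>

definition lmul :: "'a::finite loop \<Rightarrow> 'a loop \<Rightarrow> 'a loop"  (infixl "\<star>" 70) where
  "L \<star> M = (\<lambda>p. \<Sum>\<^sub>\<infinity>q. L q ** M (p - q))"

primrec lpow :: "'a::finite loop \<Rightarrow> nat \<Rightarrow> 'a loop" where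
  "lpow L 0 = lone"
| "lpow L (Suc n) = L \<star> lpow L n"

definition pairing :: "'a::finite loop \<Rightarrow> 'a loop \<Rightarrow> real" where
  "pairing L M = trace ((L \<star> M) 0)"

text \<open>
  \<open>Epow p\<close> is the constant matrix with \<open>\<E>\<^sup>p = \<lambda>\<^sup>p Epow p\<close>, where \<open>\<E> = \<lambda> (\<Sum>k. E (nxt k) k)\<close>;
  a series is twisted if it has the form \<open>\<Sum>p. \<ell>\<^sub>p \<E>\<^sup>p\<close> with diagonal \<open>\<ell>\<^sub>p\<close>.
\<close>

definition Epow :: "int \<Rightarrow> real^'a mod_ring^'a::finite mod_ring" where
  "Epow p = (\<Sum>k\<in>UNIV. E (shift p k) k)"

definition diagm :: "real^'a mod_ring \<Rightarrow> real^'a mod_ring^'a::finite mod_ring" where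
  "diagm l = (\<Sum>k\<in>UNIV. (l $ k) *\<^sub>R E k k)"

definition twisted :: "'a::finite loop \<Rightarrow> bool" where
  "twisted L \<longleftrightarrow> (\<exists>l. \<forall>p. L p = diagm (l p) ** Epow p)"

text \<open>Infinitely many negative powers of \<open>\<lambda>\<close> are allowed, as they occur in \<open>C\<^sup>-\<^sup>1\<close>.\<close>

definition loop_alg :: "'a::finite loop set" where
  "loop_alg = {L. twisted L \<and> (\<exists>d. \<forall>p>d. L p = 0)}"

lemma shift_eq_iff: "i = shift p k \<longleftrightarrow> k = shift (-p) i"
proof -
  have "of_int_mod_ring (-p) = - (of_int_mod_ring p :: 'a::finite mod_ring)"
    by (transfer) (simp add: mod_minus_eq zmod_zminus1_eq_if)
  then show ?thesis by (auto simp: shift_def)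
qed

lemma Epow_nth: "Epow p $ i $ k = (if i = shift p k then 1 else 0)"
proof -
  have "Epow p $ i $ k = (\<Sum>j\<in>UNIV. if i = shift p j \<and> k = j then 1 else (0::real))"
    by (simp add: Epow_def E_def)
  also have "\<dots> = (\<Sum>j\<in>UNIV. if j = k then (if i = shift p j then 1 else 0) else 0)"
    by (rule sum.cong) auto
  finally show ?thesis by simp
qed

lemma diagm_nth: "diagm l $ i $ k = (if i = k then l $ k else 0)"
proof -
  have "diagm l $ i $ k = (\<Sum>j\<in>UNIV. if k = j \<and> i = j then l $ j else 0)"
    by (simp add: diagm_def E_def if_distrib cong: if_cong) (rule sum.cong, auto)
  also have "\<dots> = (\<Sum>j\<in>UNIV. if j = k then (if i = j then l $ j else 0) else 0)"
    by (rule sum.cong) auto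
  finally show ?thesis by simp
qed

lemma diagm_Epow_nth: "(diagm l ** Epow p) $ i $ k = (if i = shift p k then l $ i else 0)"
proof -
  have "(diagm l ** Epow p) $ i $ k
      = (\<Sum>j\<in>UNIV. if j = i then (if j = shift p k then l $ j else 0) else 0)"
    unfolding matrix_matrix_mult_def vec_lambda_beta diagm_nth Epow_nth
    by (rule sum.cong) auto
  then show ?thesis by simp
qed

lemma twisted_iff: "twisted L \<longleftrightarrow> (\<forall>p i k. i \<noteq> shift p k \<longrightarrow> L p $ i $ k = 0)"
proof
  assume "\<forall>p i k. i \<noteq> shift p k \<longrightarrow> L p $ i $ k = 0"
  then have "\<forall>p. L p = diagm (\<chi> i. L p $ i $ shift (-p) i) ** Epow p"
    by (auto simp: vec_eq_iff diagm_Epow_nth) (metis shift_eq_iff)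
  then show "twisted L" unfolding twisted_def
    by (intro exI[of _ "\<lambda>p. \<chi> i. L p $ i $ shift (-p) i"])
qed (auto simp: twisted_def diagm_Epow_nth)


section \<open>Operators on the loop algebra\<close>

definition pi_plus :: "'a::finite loop \<Rightarrow> 'a loop" where
  "pi_plus L = (\<lambda>p. if p \<ge> 0 then L p else 0)"

definition pi_minus :: "'a::finite loop \<Rightarrow> 'a loop" where
  "pi_minus L = (\<lambda>p. if p < 0 then L p else 0)"

text \<open>The adjoint with respect to the pairing; it is unique on the loop algebra.\<close>

definition is_adj :: "('a::finite loop \<Rightarrow> 'a loop) \<Rightarrow> ('a loop \<Rightarrow> 'a loop) \<Rightarrow> bool" where
  "is_adj T T' \<longleftrightarrow> (\<forall>M\<in>loop_alg. T' M \<in> loop_alg \<and>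
     (\<forall>L\<in>loop_alg. pairing (T L) M = pairing L (T' M)))"

definition adj :: "('a::finite loop \<Rightarrow> 'a loop) \<Rightarrow> 'a loop \<Rightarrow> 'a loop" where
  "adj T = (SOME T'. is_adj T T')"

definition R_op :: "'a::finite loop \<Rightarrow> 'a loop" where
  "R_op = pi_plus - pi_minus"

definition R0 :: "'a::finite loop \<Rightarrow> 'a loop" where
  "R0 = (\<lambda>L p. (1/2) *\<^sub>R (R_op L - adj R_op L) p)"

definition P0 :: "'a::finite loop \<Rightarrow> 'a loop" where
  "P0 = (\<lambda>L p. (1/2) *\<^sub>R (R_op L + adj R_op L) p)"

text \<open>The linear extension of \<open>W (E j j) = (\<Sum>k<j. E k k) - (\<Sum>k>j. E k k)\<close> to diagonal matrices.\<close>

definition W_diag :: "real^'a mod_ring^'a mod_ring \<Rightarrow> real^'a mod_ring^'a::finite mod_ring" where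
  "W_diag D = (\<Sum>j\<in>UNIV. (D $ j $ j) *\<^sub>R
     ((\<Sum>k\<in>{k. pos k < pos j}. E k k) - (\<Sum>k\<in>{k. pos k > pos j}. E k k)))"

definition W :: "'a::finite loop \<Rightarrow> 'a loop" where
  "W L = lam 0 (W_diag (P0 L 0))"

definition A1 :: "'a::finite loop \<Rightarrow> 'a loop" where "A1 = R0 + W"
definition A2 :: "'a::finite loop \<Rightarrow> 'a loop" where "A2 = R0 - W"
definition S :: "'a::finite loop \<Rightarrow> 'a loop" where "S = P0 - W"
definition Sst :: "'a::finite loop \<Rightarrow> 'a loop" where "Sst = P0 + W"

text \<open>Operators on a direct product of \<open>m\<close> copies are \<open>m \<times> m\<close> matrices, given by the list of rows.\<close>

type_synonym 'a opmat = "('a loop \<Rightarrow> 'a loop) list list"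

definition A1_mat :: "'a::finite opmat" where
  "A1_mat = [[A1, -S, -S], [Sst, A1, Sst], [Sst, -S, A1]]"

definition A2_mat :: "'a::finite opmat" where
  "A2_mat = [[A2, -Sst, -Sst], [S, A2, -Sst], [S, S, A2]]"

definition S_mat :: "'a::finite opmat" where
  "S_mat = [[S, S, S], [S, -Sst, -Sst], [S, S, -Sst]]"


section \<open>Gradients and the bracket \<open>PB\<^sub>2\<close>\<close>

text \<open>
  \<open>formal_curve \<gamma> M\<close>: the curve \<open>\<gamma>\<close> in the loop algebra has degrees bounded above, and each of its
  coefficients is differentiable at time \<open>0\<close>, with velocity \<open>M\<close>.
\<close>

definition formal_curve :: "(real \<Rightarrow> 'a::finite loop) \<Rightarrow> 'a loop \<Rightarrow> bool" where
  "formal_curve \<gamma> M \<longleftrightarrow> range \<gamma> \<subseteq> loop_alg \<and> (\<exists>d. \<forall>t. \<forall>p>d. \<gamma> t p = 0) \<and>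
     (\<forall>p. ((\<lambda>t. \<gamma> t p) has_vector_derivative M p) (at 0))"

text \<open>
  \<open>Gs\<close> is the gradient of \<open>\<Phi>\<close> at \<open>Ls\<close> (Hadamard differentiability): along every differentiable curve
  through \<open>Ls\<close> with velocity \<open>Ms\<close>, the derivative of \<open>\<Phi>\<close> is \<open>\<Sum>i. \<langle>Gs\<^sub>i, Ms\<^sub>i\<rangle>\<close>.
  The parameters are the algebra \<open>X\<close> containing the gradient and the class \<open>\<C>\<close> of curves.
  In particular every \<open>\<Phi>\<close> which is smooth in a stronger sense, with gradient in the algebra, is covered.
\<close>

definition has_grad ::
    "'a::finite loop set \<Rightarrow> ((real \<Rightarrow> 'a loop) \<Rightarrow> 'a loop \<Rightarrow> bool) \<Rightarrow>
     ('a loop list \<Rightarrow> real) \<Rightarrow> 'a loop list \<Rightarrow> 'a loop list \<Rightarrow> bool" where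
  "has_grad X \<C> \<Phi> Ls Gs \<longleftrightarrow> length Gs = length Ls \<and> set Gs \<subseteq> X \<and>
     (\<forall>\<gamma> Ms. length Ms = length Ls \<longrightarrow> (\<forall>t. length (\<gamma> t) = length Ls) \<longrightarrow> \<gamma> 0 = Ls \<longrightarrow>
        (\<forall>i<length Ls. \<C> (\<lambda>t. \<gamma> t ! i) (Ms ! i)) \<longrightarrow>
        ((\<lambda>t. \<Phi> (\<gamma> t)) has_real_derivative (\<Sum>i<length Ls. pairing (Gs ! i) (Ms ! i))) (at 0))"

definition grad :: "('a::finite loop list \<Rightarrow> real) \<Rightarrow> 'a loop list \<Rightarrow> 'a loop list" where
  "grad \<Phi> Ls = (SOME Gs. has_grad loop_alg formal_curve \<Phi> Ls Gs)"

definition PB2 :: "'a::finite opmat \<Rightarrow> 'a opmat \<Rightarrow> 'a opmat \<Rightarrow>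
    ('a loop list \<Rightarrow> real) \<Rightarrow> ('a loop list \<Rightarrow> real) \<Rightarrow> 'a loop list \<Rightarrow> real" where
  "PB2 AA1 AA2 SS \<Phi> \<Psi> Ls =
    (let m = length Ls;
         d = (\<lambda>\<Phi> j. Ls ! j \<star> grad \<Phi> Ls ! j);
         d' = (\<lambda>\<Phi> j. grad \<Phi> Ls ! j \<star> Ls ! j)
     in 1/2 * (\<Sum>i<m. \<Sum>j<m. pairing ((AA1 ! i ! j) (d' \<Phi> j)) (d' \<Psi> i))
      - 1/2 * (\<Sum>i<m. \<Sum>j<m. pairing ((AA2 ! i ! j) (d \<Phi> j)) (d \<Psi> i))
      + 1/2 * (\<Sum>i<m. \<Sum>j<m. pairing ((SS ! i ! j) (d \<Phi> j)) (d' \<Psi> i))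
      - 1/2 * (\<Sum>i<m. \<Sum>j<m. pairing (adj (SS ! j ! i) (d' \<Phi> j)) (d \<Psi> i)))"


section \<open>The phase space\<close>

type_synonym 'a phase = "(real^'a mod_ring) \<times> (real^'a mod_ring)"

definition du :: "('a::finite phase \<Rightarrow> real) \<Rightarrow> 'a mod_ring \<Rightarrow> 'a phase \<Rightarrow> real" where
  "du F k x = deriv (\<lambda>t. F (fst x + t *\<^sub>R axis k 1, snd x)) 0"

definition dv :: "('a::finite phase \<Rightarrow> real) \<Rightarrow> 'a mod_ring \<Rightarrow> 'a phase \<Rightarrow> real" where
  "dv F k x = deriv (\<lambda>t. F (fst x, snd x + t *\<^sub>R axis k 1)) 0"

text \<open>The bracket with \<open>{u\<^sub>k, v\<^sub>k} = - u\<^sub>k v\<^sub>k\<close> and \<open>{v\<^sub>k, u\<^sub>k\<^sub>+\<^sub>1} = - v\<^sub>k u\<^sub>k\<^sub>+\<^sub>1\<close>.\<close>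

definition pb :: "('a::finite phase \<Rightarrow> real) \<Rightarrow> ('a phase \<Rightarrow> real) \<Rightarrow> 'a phase \<Rightarrow> real" where
  "pb F G x = (\<Sum>k\<in>UNIV.
      - (fst x $ k * snd x $ k) * (du F k x * dv G k x - dv F k x * du G k x)
      - (snd x $ k * fst x $ nxt k) * (dv F k x * du G (nxt k) x - du F (nxt k) x * dv G k x))"

text \<open>The Hamiltonian vector field \<open>x \<mapsto> {H, x}\<close>, coordinate by coordinate.\<close>

definition ham_field :: "('a::finite phase \<Rightarrow> real) \<Rightarrow> 'a phase \<Rightarrow> 'a phase" where
  "ham_field H x = (\<chi> k. pb H (\<lambda>y. fst y $ k) x, \<chi> k. pb H (\<lambda>y. snd y $ k) x)"

text \<open>A map into the product of \<open>m\<close> loop algebras, with \<open>PB\<^sub>2\<close> on the target, is Poisson.\<close>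

definition poisson_lax_map :: "nat \<Rightarrow> 'a::finite opmat \<Rightarrow> 'a opmat \<Rightarrow> 'a opmat \<Rightarrow>
    ('a phase \<Rightarrow> 'a loop list) \<Rightarrow> bool" where
  "poisson_lax_map m AA1 AA2 SS T \<longleftrightarrow>
     (\<forall>x. length (T x) = m \<and> set (T x) \<subseteq> loop_alg) \<and>
     (\<forall>x p. \<forall>i<m. (\<lambda>y. (T y ! i) p) differentiable (at x)) \<and>
     (\<forall>x \<Phi> \<Psi>. (\<exists>Gs. has_grad loop_alg formal_curve \<Phi> (T x) Gs) \<longrightarrow>
               (\<exists>Gs. has_grad loop_alg formal_curve \<Psi> (T x) Gs) \<longrightarrow>
        pb (\<lambda>y. \<Phi> (T y)) (\<lambda>y. \<Psi> (T y)) x = PB2 AA1 AA2 SS \<Phi> \<Psi> (T x))"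

definition U :: "'a::finite phase \<Rightarrow> 'a loop" where
  "U x = lam 0 (\<Sum>k\<in>UNIV. (fst x $ k) *\<^sub>R E k k) + lam 1 (\<Sum>k\<in>UNIV. E (nxt k) k)"

definition V :: "'a::finite phase \<Rightarrow> 'a loop" where
  "V x = lone + lam (-1) (\<Sum>k\<in>UNIV. (snd x $ k) *\<^sub>R E k (nxt k))"

definition C :: "real \<Rightarrow> 'a::finite phase \<Rightarrow> 'a loop" where
  "C h x = lone - lam (-1) (\<Sum>k\<in>UNIV. (h * fst x $ k * snd x $ k) *\<^sub>R E k (nxt k))"

text \<open>\<open>I - C\<close> is concentrated in degree \<open>-1\<close>, so for each \<open>p\<close> at most one term is nonzero.\<close>

definition Cinv :: "real \<Rightarrow> 'a::finite phase \<Rightarrow> 'a loop" where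
  "Cinv h x = (\<lambda>p. \<Sum>n. lpow (lone - C h x) n p)"

abbreviation UVC :: "real \<Rightarrow> 'a::finite phase \<Rightarrow> 'a loop" where
  "UVC h x \<equiv> U x \<star> V x \<star> Cinv h x"

abbreviation VCU :: "real \<Rightarrow> 'a::finite phase \<Rightarrow> 'a loop" where
  "VCU h x \<equiv> V x \<star> Cinv h x \<star> U x"

abbreviation CUV :: "real \<Rightarrow> 'a::finite phase \<Rightarrow> 'a loop" where
  "CUV h x \<equiv> Cinv h x \<star> U x \<star> V x"


section \<open>The hierarchy\<close>

text \<open>
  \<open>\<phi>\<close> is conjugation invariant on the domain \<open>D\<close> in the algebra \<open>X\<close>, is differentiable there, and
  \<open>f L = L \<nabla>\<phi>(L)\<close>.
\<close>

definition ad_hamiltonian ::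
    "'a::finite loop set \<Rightarrow> ((real \<Rightarrow> 'a loop) \<Rightarrow> 'a loop \<Rightarrow> bool) \<Rightarrow> 'a loop set \<Rightarrow>
     ('a loop \<Rightarrow> real) \<Rightarrow> ('a loop \<Rightarrow> 'a loop) \<Rightarrow> bool" where
  "ad_hamiltonian X \<C> D \<phi> f \<longleftrightarrow>
     (\<forall>A\<in>X. \<forall>B\<in>X. \<forall>L\<in>D. A \<star> B = lone \<longrightarrow> B \<star> A = lone \<longrightarrow> A \<star> L \<star> B \<in> D \<longrightarrow>
        \<phi> (A \<star> L \<star> B) = \<phi> L) \<and>
     (\<forall>L\<in>D. \<exists>G. has_grad X \<C> (\<lambda>Ls. \<phi> (hd Ls)) [L] [G] \<and> f L = L \<star> G)"

definition has_loop_derivative ::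
    "(real \<Rightarrow> 'a::finite loop) \<Rightarrow> 'a loop \<Rightarrow> real filter \<Rightarrow> bool"
    (infix "has'_loop'_derivative" 50) where
  "(X has_loop_derivative D) F \<longleftrightarrow> (\<forall>p. ((\<lambda>t. X t p) has_vector_derivative D p) F)"

text \<open>\<open>pm_pi True\<close> is \<open>+\<pi>\<^sub>+\<close> and \<open>pm_pi False\<close> is \<open>-\<pi>\<^sub>-\<close>.\<close>

definition pm_pi :: "bool \<Rightarrow> 'a::finite loop \<Rightarrow> 'a loop" where
  "pm_pi s L = (if s then pi_plus L else - pi_minus L)"

text \<open>Hamilton's equations with Hamilton function \<open>\<phi> (U V C\<^sup>-\<^sup>1)\<close>, and the Lax triads, along a curve \<open>x\<close>.\<close>

definition hier_eq :: "real \<Rightarrow> ('a::finite loop \<Rightarrow> real) \<Rightarrow> (real \<Rightarrow> 'a phase) \<Rightarrow>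
    real \<Rightarrow> real set \<Rightarrow> bool" where
  "hier_eq h \<phi> x t T \<longleftrightarrow>
     (x has_vector_derivative ham_field (\<lambda>y. \<phi> (UVC h y)) (x t)) (at t within T)"

definition lax_triad :: "bool \<Rightarrow> real \<Rightarrow> ('a::finite loop \<Rightarrow> 'a loop) \<Rightarrow> (real \<Rightarrow> 'a phase) \<Rightarrow>
    real \<Rightarrow> real set \<Rightarrow> bool" where
  "lax_triad s h f x t T \<longleftrightarrow>
     ((\<lambda>\<tau>. U (x \<tau>)) has_loop_derivative
        U (x t) \<star> pm_pi s (f (VCU h (x t))) - pm_pi s (f (UVC h (x t))) \<star> U (x t)) (at t within T) \<and>
     ((\<lambda>\<tau>. C h (x \<tau>)) has_loop_derivative
        C h (x t) \<star> pm_pi s (f (CUV h (x t))) - pm_pi s (f (UVC h (x t))) \<star> C h (x t)) (at t within T) \<and>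
     ((\<lambda>\<tau>. V (x \<tau>)) has_loop_derivative
        V (x t) \<star> pm_pi s (f (CUV h (x t))) - pm_pi s (f (VCU h (x t))) \<star> V (x t)) (at t within T)"

definition first_flow :: "real \<Rightarrow> 'a::finite phase \<Rightarrow> 'a phase" where
  "first_flow h x = (let u = fst x; v = snd x in
     (\<chi> k. u $ k * (v $ k - v $ prv k + h * u $ k * v $ k - h * u $ prv k * v $ prv k),
      \<chi> k. v $ k * (u $ nxt k - u $ k + h * u $ nxt k * v $ nxt k - h * u $ k * v $ k)))"


section \<open>The discrete time map\<close>

definition dmap_rel :: "real \<Rightarrow> 'a::finite phase \<Rightarrow> 'a phase \<Rightarrow> bool" where
  "dmap_rel h x y \<longleftrightarrow>
     (\<forall>k. fst y $ k * (1 + h * snd x $ prv k) = fst x $ k * (1 + h * snd x $ k)) \<and>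
     (\<forall>k. snd y $ k * (1 + h * fst y $ k) = snd x $ k * (1 + h * fst y $ nxt k))"

definition dmap :: "real \<Rightarrow> 'a::finite phase \<Rightarrow> 'a phase" where
  "dmap h x = (let u = fst x; v = snd x;
                   u' = (\<chi> k. u $ k * (1 + h * v $ k) / (1 + h * v $ prv k))
               in (u', \<chi> k. v $ k * (1 + h * u' $ nxt k) / (1 + h * u' $ k)))"

text \<open>The open set on which no denominator of the (rational) map vanishes.\<close>

definition dmap_dom :: "real \<Rightarrow> 'a::finite phase set" where
  "dmap_dom h = {x. \<forall>k. 1 + h * snd x $ k \<noteq> 0 \<and> 1 + h * fst (dmap h x) $ k \<noteq> 0}"

text \<open>
  \<open>log(I + h L)\<close> is infinite in both directions, since \<open>L\<close> has a term of positive degree; it lives in the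
  Wiener algebra of twisted series with absolutely summable coefficients, in which \<open>h L\<close> must be small.
\<close>

definition wiener :: "'a::finite loop set" where
  "wiener = {L. twisted L \<and> (\<lambda>p. norm (L p)) summable_on UNIV}"

definition wnorm :: "'a::finite loop \<Rightarrow> real" where
  "wnorm L = (\<Sum>\<^sub>\<infinity>p. norm (L p))"

definition wiener_curve :: "(real \<Rightarrow> 'a::finite loop) \<Rightarrow> 'a loop \<Rightarrow> bool" where
  "wiener_curve \<gamma> M \<longleftrightarrow> range \<gamma> \<subseteq> wiener \<and> M \<in> wiener \<and>
     ((\<lambda>t. wnorm (\<lambda>p. (1 / t) *\<^sub>R (\<gamma> t p - \<gamma> 0 p) - M p)) \<longlongrightarrow> 0) (at 0)"

definition wiener_log_dom :: "real \<Rightarrow> 'a::finite loop set" where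
  "wiener_log_dom h = {L \<in> wiener. \<bar>h\<bar> * wnorm L < 1}"

definition log1p :: "'a::finite loop \<Rightarrow> 'a loop" where
  "log1p X = (\<lambda>p. \<Sum>n. ((-1) ^ n / real (Suc n)) *\<^sub>R lpow X (Suc n) p)"

definition f_log :: "real \<Rightarrow> 'a::finite loop \<Rightarrow> 'a loop" where
  "f_log h L = (\<lambda>p. (1 / h) *\<^sub>R log1p (\<lambda>q. h *\<^sub>R L q) p)"

text \<open>\<open>\<phi>(L) = tr F(L)\<^sub>0\<close> with \<open>z F'(z) = h\<^sup>-\<^sup>1 log(1 + h z)\<close>.\<close>

definition phi_log :: "real \<Rightarrow> 'a::finite loop \<Rightarrow> real" where
  "phi_log h L = (\<Sum>n. (-1) ^ n * h ^ n / (real (Suc n))\<^sup>2 * trace (lpow L (Suc n) 0))"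


section \<open>Adjoints\<close>

lemma E_in_loop_alg: "i = shift p j \<Longrightarrow> lam p (E i j) \<in> loop_alg"
  unfolding loop_alg_def twisted_iff
  by (auto simp: lam_def E_def intro!: exI[of _ p])

lemma pairing_lam: "pairing (lam q A) M = trace (A ** M (- q))"
proof -
  have "(\<Sum>\<^sub>\<infinity>r. lam q A r ** M (0 - r)) = (\<Sum>\<^sub>\<infinity>r\<in>{q}. A ** M (- r))"
    by (rule infsum_cong_neutral) (auto simp: lam_def)
  then show ?thesis by (simp add: pairing_def lmul_def)
qed

lemma trace_E: "trace (E i j ** X) = X $ j $ i"
proof -
  have "(E i j ** X) $ a $ a = (if a = i then X $ j $ i else 0)" for a
  proof -
    have "(E i j ** X) $ a $ a = (\<Sum>k\<in>UNIV. if k = j then (if a = i then X $ k $ a else 0) else 0)"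
      unfolding matrix_matrix_mult_def E_def vec_lambda_beta by (rule sum.cong) auto
    then show ?thesis by simp
  qed
  then show ?thesis by (simp add: trace_def)
qed

lemma pairing_nondegenerate:
  assumes "M \<in> loop_alg" "M' \<in> loop_alg"
    and eq: "\<And>L. L \<in> loop_alg \<Longrightarrow> pairing L M = pairing L M'"
  shows "M = M'"
proof (intro ext, simp add: vec_eq_iff, intro allI)
  fix p :: int and i k :: "'a mod_ring"
  show "M p $ i $ k = M' p $ i $ k"
  proof (cases "i = shift p k")
    case True
    then have "k = shift (-p) i" using shift_eq_iff by blast
    from eq[OF E_in_loop_alg[OF this]] show ?thesis
      by (simp add: pairing_lam trace_E)
  next
    case False
    then show ?thesis using assms(1,2) by (auto simp: loop_alg_def twisted_iff)
  qed
qed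

lemma adj_eq:
  assumes "is_adj T T'" "M \<in> loop_alg"
  shows "adj T M = T' M"
proof -
  have "is_adj T (adj T)" unfolding adj_def using assms(1) by (rule someI[of "is_adj T"])
  then show ?thesis using assms unfolding is_adj_def
    by (intro pairing_nondegenerate) auto
qed

lemma is_adj_R: "is_adj R_op (\<lambda>M p. if p \<le> 0 then M p else - M p)"
proof -
  have mm: "(- A) ** B = A ** (- B)" for A B :: "real^'a mod_ring^'a mod_ring"
    by (simp add: matrix_matrix_mult_def vec_eq_iff sum_negf)
  show ?thesis
    unfolding is_adj_def
    by (auto simp: loop_alg_def twisted_iff pairing_def lmul_def R_op_def pi_plus_def pi_minus_def mm
        intro!: arg_cong[where f = trace] infsum_cong)
qed

lemma R0_eq:
  assumes "L \<in> loop_alg"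
  shows "R0 L = (\<lambda>p. if p > 0 then L p else if p < 0 then - L p else 0)"
  by (rule ext, simp add: R0_def adj_eq[OF is_adj_R assms])
    (auto simp: R_op_def pi_plus_def pi_minus_def simp flip: scaleR_2)

lemma P0_eq:
  assumes "L \<in> loop_alg"
  shows "P0 L = lam 0 (L 0)"
  by (rule ext, simp add: P0_def adj_eq[OF is_adj_R assms])
    (auto simp: R_op_def pi_plus_def pi_minus_def lam_def simp flip: scaleR_2)

end

(*
  With a gradient of a function of the triple, or of one of the three products, every term of the
  quadratic bracket is evaluated degree by degree: U and V have two degrees each, so only the
  diagonal parts of the products of Lax matrices and gradients survive, and W acts on them by a
  telescoping sum. The same diagonal parts give the Lax triads. In logarithmic coordinates the
  bracket is constant, and the discrete map is a composition of two shears which preserve it.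

  For the interpolating flow let L_1, L_2, L_3 be the products UVC^-1, VC^-1U, C^-1UV at the initial
  point and let F_i = h^-1 log(1 + h L_i). In a Banach algebra of absolutely summable series,
  exp(t F_i) is factorized into a series without negative powers times a series 1 + (negative
  powers). Conjugation with the factors maps U, V, C to matrices of the same shape, which solve the
  Lax triads. At t = h one has exp(h F_i) = 1 + h L_i, and the factors are explicit: C, the matrix
  1 - h sum v_k u'_{k+1} E_{k,k+1} / lambda, and the matrix C at the image point (u', v').
*)
theory Submission
  imports Defs
begin

section \<open>Twisted Laurent series: coordinates, products, inverses\<close>

section \<open>Series in coordinates\<close>

text \<open>Two algebras are used: series bounded above contain C^-1 and carry arbitrary functions,
  but no norm, while log (I + h L) is infinite in both directions. Both feed into
  \<open>slots\<close>, which keeps only the partial derivatives of a function, and into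
  \<open>ham_field_triad\<close>, which asks only for twisted series. \<open>ad_hamiltonian\<close>
  does not postulate covariance of f. It follows from the invariance of \<phi>, and G L = L G
  follows by conjugating L with itself; this uses that U, V, C have leading coefficient 1 and hence
  are invertible at every point. Along the interpolating flow the conjugated C must remain the C of
  the conjugated U and V. Lowest coefficients of the nonnegative factors turn this into three scalar
  identities, two of which multiply to the third. The constants form a chain: the bound 1/20 gives
  |exp (t F) - 1| <= 1/5, a contraction with rate 1/5 gives |Y - 1| <= 1/4 for the negative factor Y
  and |exp (t F) Y - 1| <= 1/2, and diagonals in [1/2, 3/2] let the coefficients of C - I grow at
  most by 3, whence the bound 1/3 on I - C at the start.\<close>

lemma shift_add: "shift p (shift q k) = shift (p + q) k"
proof -
  have "of_int_mod_ring (p + q) = (of_int_mod_ring p + of_int_mod_ring q :: 'a::finite mod_ring)"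
    by transfer (simp add: mod_add_eq)
  then show ?thesis by (simp add: shift_def add.assoc add.commute)
qed

lemma shift_0 [simp]: "shift 0 k = k"
  by (simp add: shift_def)

lemma shift_inj [simp]: "shift p i = shift p k \<longleftrightarrow> i = k"
  by (simp add: shift_def)

lemma shift_cancel [simp]: "shift p (shift (- p) k) = k" "shift (- p) (shift p k) = k"
  by (simp_all add: shift_add)

lemma shift_cancel1 [simp]: "nxt (prv k) = k" "prv (nxt k) = k"
  by (simp_all add: shift_add)

lemma bij_shift: "bij (shift p)"
  by (rule o_bij[of "shift (- p)"]) (auto simp: fun_eq_iff)

lemma sum_shift: "(\<Sum>k\<in>UNIV. f (shift p k)) = (\<Sum>k\<in>UNIV. f k)"
  using bij_shift by (rule sum.reindex_bij_betw)

text \<open>Row \<open>i\<close> of a twisted matrix of degree \<open>p\<close> has its only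
  possible entry in column \<open>shift (- p) i\<close>; this reads off the diagonal that multiplies
  the p-th power of \<E>. Indexing by rows makes left multiplication by a diagonal matrix
  pointwise.\<close>

definition coef :: "'a::finite loop \<Rightarrow> int \<Rightarrow> 'a mod_ring \<Rightarrow> real" where
  "coef L p i = L p $ i $ shift (- p) i"

lemma twisted_nth:
  assumes "twisted L"
  shows "L p $ i $ k = (if k = shift (- p) i then coef L p i else 0)"
  using assms unfolding twisted_iff coef_def by (metis shift_eq_iff)

lemma twisted_eqI:
  assumes "twisted L" "twisted M" "\<And>p i. coef L p i = coef M p i"
  shows "L = M"
  by (intro ext) (simp add: vec_eq_iff twisted_nth[OF assms(1)] twisted_nth[OF assms(2)] assms(3))

lemma twisted_coefI: "(\<And>p i k. k \<noteq> shift (- p) i \<Longrightarrow> L p $ i $ k = 0) \<Longrightarrow> twisted L"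
  unfolding twisted_iff by (metis shift_eq_iff)

lemma coef_add [simp]: "coef (L + M) p i = coef L p i + coef M p i"
  and coef_diff [simp]: "coef (L - M) p i = coef L p i - coef M p i"
  and coef_minus [simp]: "coef (- L) p i = - coef L p i"
  and coef_zero [simp]: "coef 0 p i = 0"
  by (simp_all add: coef_def)

lemma coef_pi_plus: "coef (pi_plus L) p i = (if p \<ge> 0 then coef L p i else 0)"
  and coef_pi_minus: "coef (pi_minus L) p i = (if p < 0 then coef L p i else 0)"
  by (simp_all add: coef_def pi_plus_def pi_minus_def)

lemma coef_lam: "coef (lam q A) p i = (if p = q then A $ i $ shift (- p) i else 0)"
  by (simp add: coef_def lam_def)

lemma coef_lone: "coef lone p i = (if p = 0 then 1 else 0)"
  by (simp add: lone_def coef_lam mat_def)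

lemma trace_coef: "trace (L 0) = (\<Sum>i\<in>UNIV. coef L 0 i)"
  by (simp add: trace_def coef_def)

lemma twisted_add: "twisted L \<Longrightarrow> twisted M \<Longrightarrow> twisted (L + M)"
  and twisted_diff: "twisted L \<Longrightarrow> twisted M \<Longrightarrow> twisted (L - M)"
  and twisted_minus: "twisted L \<Longrightarrow> twisted (- L)"
  and twisted_zero: "twisted 0"
  and twisted_pi_plus: "twisted L \<Longrightarrow> twisted (pi_plus L)"
  and twisted_pi_minus: "twisted L \<Longrightarrow> twisted (pi_minus L)"
  and twisted_lone: "twisted lone"
  by (auto simp: twisted_iff pi_plus_def pi_minus_def lone_def lam_def mat_def)

lemma twisted_scale: "twisted L \<Longrightarrow> twisted (\<lambda>p. c *\<^sub>R L p)"
  by (auto simp: twisted_iff)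

lemma coef_scale: "coef (\<lambda>p. c *\<^sub>R L p) p i = c * coef L p i"
  by (simp add: coef_def)


section \<open>The product of series\<close>

lemma bounded_linear_matmul_left: "bounded_linear (\<lambda>X::real^'n^'m. X ** (A::real^'k^'n))"
  and bounded_linear_matmul_right: "bounded_linear (\<lambda>X::real^'k^'n. (B::real^'n^'m) ** X)"
proof -
  have "linear (\<lambda>X::real^'n^'m. X ** (A::real^'k^'n))"
    by (rule linearI) (simp_all add: vec_eq_iff matrix_matrix_mult_def sum.distrib
        distrib_right sum_distrib_left mult.assoc)
  moreover have "linear (\<lambda>X::real^'k^'n. (B::real^'n^'m) ** X)"
    by (rule linearI) (simp_all add: vec_eq_iff matrix_matrix_mult_def sum.distrib
        distrib_left sum_distrib_left mult.left_commute)
  ultimately show "bounded_linear (\<lambda>X::real^'n^'m. X ** (A::real^'k^'n))"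
    "bounded_linear (\<lambda>X::real^'k^'n. (B::real^'n^'m) ** X)"
    by (auto simp: linear_conv_bounded_linear)
qed

lemma bounded_linear_trace: "bounded_linear (trace :: real^'n^'n \<Rightarrow> real)"
proof -
  have "linear (trace :: real^'n^'n \<Rightarrow> real)"
    by (rule linearI) (simp_all add: trace_def sum.distrib sum_distrib_left)
  then show ?thesis by (simp add: linear_conv_bounded_linear)
qed

lemma infsum_bounded_linear':
  assumes "bounded_linear h" "f summable_on A"
  shows "infsum (\<lambda>x. h (f x)) A = h (infsum f A)"
  using has_sum_bounded_linear[OF assms(1) has_sum_infsum[OF assms(2)]]
  by (simp add: infsumI o_def)

text \<open>\<open>infsum\<close> of a family that is not summable is 0 by default.
  \<open>conv\<close> excludes this default, so that additivity and the interchange with bounded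
  linear maps hold.\<close>

definition conv :: "'a::finite loop \<Rightarrow> 'a loop \<Rightarrow> bool" where
  "conv L M \<longleftrightarrow> (\<forall>p. (\<lambda>q. L q ** M (p - q)) summable_on UNIV)"

lemma lmul_finite:
  assumes "finite F" "\<And>q. q \<notin> F \<Longrightarrow> L q ** M (p - q) = 0"
  shows "(L \<star> M) p = (\<Sum>q\<in>F. L q ** M (p - q))"
proof -
  have "(L \<star> M) p = (\<Sum>\<^sub>\<infinity>q\<in>F. L q ** M (p - q))"
    unfolding lmul_def by (rule infsum_cong_neutral) (use assms in auto)
  then show ?thesis using assms(1) by simp
qed

lemma lmul_finite_left:
  assumes "finite F" "\<And>q. q \<notin> F \<Longrightarrow> L q = 0"
  shows "(L \<star> M) p = (\<Sum>q\<in>F. L q ** M (p - q))"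
  by (rule lmul_finite) (use assms in auto)

lemma lmul_finite_right:
  assumes "finite F" "\<And>q. q \<notin> F \<Longrightarrow> M q = 0"
  shows "(L \<star> M) p = (\<Sum>q\<in>F. L (p - q) ** M q)"
proof -
  have "(L \<star> M) p = (\<Sum>q\<in>(\<lambda>q. p - q) ` F. L q ** M (p - q))"
  proof (rule lmul_finite)
    fix q assume "q \<notin> (\<lambda>q. p - q) ` F"
    then have "p - q \<notin> F" by (metis image_eqI diff_diff_eq2 add_diff_cancel_left')
    then show "L q ** M (p - q) = 0" using assms by simp
  qed (use assms in auto)
  also have "\<dots> = (\<Sum>q\<in>F. L (p - q) ** M q)"
    by (subst sum.reindex) (auto simp: inj_on_def)
  finally show ?thesis .
qed

lemma conv_neutral: "finite F \<Longrightarrow> (\<And>q. q \<notin> F \<Longrightarrow> L q ** M (p - q) = 0) \<Longrightarrow>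
    (\<lambda>q. L q ** M (p - q)) summable_on UNIV"
  by (subst summable_on_cong_neutral[of F UNIV _ "\<lambda>q. L q ** M (p - q)"]) auto

lemma lmul_add_left: "conv L N \<Longrightarrow> conv M N \<Longrightarrow> (L + M) \<star> N = L \<star> N + M \<star> N"
proof (rule ext)
  fix p assume a: "conv L N" "conv M N"
  have "((L + M) \<star> N) p = (\<Sum>\<^sub>\<infinity>q. L q ** N (p - q) + M q ** N (p - q))"
    by (simp add: lmul_def bounded_linear.linear[OF bounded_linear_matmul_left, THEN linear_add])
  also have "\<dots> = (L \<star> N) p + (M \<star> N) p"
    unfolding lmul_def by (rule infsum_add) (use a in \<open>auto simp: conv_def\<close>)
  finally show "((L + M) \<star> N) p = (L \<star> N + M \<star> N) p" by simp
qed

lemma lmul_add_right: "conv N L \<Longrightarrow> conv N M \<Longrightarrow> N \<star> (L + M) = N \<star> L + N \<star> M"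
proof (rule ext)
  fix p assume a: "conv N L" "conv N M"
  have "(N \<star> (L + M)) p = (\<Sum>\<^sub>\<infinity>q. N q ** L (p - q) + N q ** M (p - q))"
    by (simp add: lmul_def bounded_linear.linear[OF bounded_linear_matmul_right, THEN linear_add])
  also have "\<dots> = (N \<star> L) p + (N \<star> M) p"
    unfolding lmul_def by (rule infsum_add) (use a in \<open>auto simp: conv_def\<close>)
  finally show "(N \<star> (L + M)) p = (N \<star> L + N \<star> M) p" by simp
qed

lemma matmul_scale: "(c *\<^sub>R A) ** (B::real^'k^'n) = c *\<^sub>R ((A::real^'n^'m) ** B)"
  "A ** (c *\<^sub>R B) = c *\<^sub>R (A ** B)"
  using bounded_linear.linear[OF bounded_linear_matmul_left, THEN linear_scale]
    bounded_linear.linear[OF bounded_linear_matmul_right, THEN linear_scale] by auto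

lemma matmul_minus: "(- A) ** (B::real^'k^'n) = - ((A::real^'n^'m) ** B)"
  "A ** (- B) = - (A ** B)"
  using matmul_scale[of "-1"] matmul_scale(2)[of A "-1" B] by auto

lemma lmul_scale_left: "(\<lambda>p. c *\<^sub>R L p) \<star> M = (\<lambda>p. c *\<^sub>R (L \<star> M) p)"
  by (rule ext) (simp add: lmul_def matmul_scale infsum_scaleR_right)

lemma lmul_scale_right: "L \<star> (\<lambda>p. c *\<^sub>R M p) = (\<lambda>p. c *\<^sub>R (L \<star> M) p)"
  by (rule ext) (simp add: lmul_def matmul_scale infsum_scaleR_right)

lemma lmul_minus_left: "(- L) \<star> M = - (L \<star> M)"
  by (rule ext) (simp add: lmul_def matmul_minus infsum_uminus)

lemma lmul_minus_right: "L \<star> (- M) = - (L \<star> M)"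
  by (rule ext) (simp add: lmul_def matmul_minus infsum_uminus)

lemma lmul_lone_left [simp]: "lone \<star> L = L"
  by (rule ext) (subst lmul_finite_left[of "{0}"], auto simp: lone_def lam_def)

lemma lmul_lone_right [simp]: "L \<star> lone = L"
  by (rule ext) (subst lmul_finite_right[of "{0}"], auto simp: lone_def lam_def)

text \<open>Fubini, with \<open>q\<close> the degree of the first product and \<open>r\<close> the
  degree taken from \<open>L\<close>. Joint summability is a hypothesis because it has two sources:
  finite support for series bounded above, absolute convergence in the Wiener algebra.\<close>

lemma lmul_assoc_gen:
  assumes "conv L M" "conv M N"
    and s: "\<And>p. (\<lambda>(q, r). L r ** M (q - r) ** N (p - q)) summable_on UNIV \<times> UNIV"
  shows "(L \<star> M) \<star> N = L \<star> (M \<star> N)"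
proof (rule ext)
  fix p
  have "((L \<star> M) \<star> N) p = (\<Sum>\<^sub>\<infinity>q. \<Sum>\<^sub>\<infinity>r. L r ** M (q - r) ** N (p - q))"
    unfolding lmul_def using assms(1)
    by (subst infsum_bounded_linear'[OF bounded_linear_matmul_left]) (auto simp: conv_def)
  also have "\<dots> = (\<Sum>\<^sub>\<infinity>r. \<Sum>\<^sub>\<infinity>q. L r ** M (q - r) ** N (p - q))"
    by (rule infsum_swap_banach[OF s])
  also have "\<dots> = (\<Sum>\<^sub>\<infinity>r. \<Sum>\<^sub>\<infinity>q. L r ** (M q ** N ((p - r) - q)))"
  proof (rule infsum_cong)
    fix r
    have b: "bij_betw (\<lambda>q. q + r) (UNIV :: int set) UNIV"
      by (rule bij_betwI[where g = "\<lambda>q. q - r"]) auto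
    show "(\<Sum>\<^sub>\<infinity>q. L r ** M (q - r) ** N (p - q)) = (\<Sum>\<^sub>\<infinity>q. L r ** (M q ** N ((p - r) - q)))"
      by (subst infsum_reindex_bij_betw[OF b, symmetric])
        (auto intro!: infsum_cong simp: matrix_mul_assoc algebra_simps)
  qed
  also have "\<dots> = (L \<star> (M \<star> N)) p"
    unfolding lmul_def using assms(2)
    by (subst infsum_bounded_linear'[OF bounded_linear_matmul_right]) (auto simp: conv_def)
  finally show "((L \<star> M) \<star> N) p = (L \<star> (M \<star> N)) p" .
qed

lemma matmul_twisted:
  assumes "twisted L"
  shows "(L q ** A) $ i $ j = coef L q i * A $ shift (- q) i $ j"
proof -
  have "(L q ** A) $ i $ j = (\<Sum>k\<in>UNIV. if k = shift (- q) i then coef L q i * A $ k $ j else 0)"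
    unfolding matrix_matrix_mult_def vec_lambda_beta
    by (rule sum.cong) (auto simp: twisted_nth[OF assms])
  then show ?thesis by simp
qed

lemma matmul_coef:
  assumes "twisted L" "twisted M"
  shows "(L q ** M r) $ i $ shift (- (q + r)) i = coef L q i * coef M r (shift (- q) i)"
proof -
  have "shift (- (q + r)) i = shift (- r) (shift (- q) i)"
    by (simp add: shift_add add.commute)
  then show ?thesis by (simp add: matmul_twisted[OF assms(1)] coef_def)
qed

lemma coef_sum_matmul:
  assumes "twisted L" "twisted M" "(L \<star> M) p = (\<Sum>q\<in>F. L q ** M (p - q))"
  shows "coef (L \<star> M) p i = (\<Sum>q\<in>F. coef L q i * coef M (p - q) (shift (- q) i))"
  unfolding coef_def[of "L \<star> M"] assms(3) sum_component
proof (rule sum.cong)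
  fix q
  show "(L q ** M (p - q)) $ i $ shift (- p) i = coef L q i * coef M (p - q) (shift (- q) i)"
    using matmul_coef[OF assms(1,2), of q "p - q" i] by simp
qed simp

lemma twisted_lmul:
  assumes "conv L M" "twisted L" "twisted M"
  shows "twisted (L \<star> M)"
proof (rule twisted_coefI)
  fix p i k assume k: "k \<noteq> shift (- p) (i :: 'a mod_ring)"
  have bl: "bounded_linear (\<lambda>A::real^'a mod_ring^'a mod_ring. A $ i $ k)"
    by (intro bounded_linear_compose[OF bounded_linear_vec_nth] bounded_linear_vec_nth)
  have "(L \<star> M) p $ i $ k = (\<Sum>\<^sub>\<infinity>q. (L q ** M (p - q)) $ i $ k)"
    unfolding lmul_def using assms(1)
    by (subst infsum_bounded_linear'[OF bl, of "\<lambda>q. L q ** M (p - q)"]) (auto simp: conv_def)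
  also have "\<dots> = 0"
    using k by (intro infsum_0) (simp add: matmul_twisted[OF assms(2)] twisted_nth[OF assms(3)] shift_add)
  finally show "(L \<star> M) p $ i $ k = 0" .
qed

text \<open>Cyclicity of the matrix trace in each degree. The pairing matches degree q with -q, so
  the two sums differ by a reflection of the index.\<close>

lemma pairing_sym:
  assumes "conv L M" "conv M L"
  shows "pairing L M = pairing M L"
proof -
  have b: "bij_betw uminus (UNIV :: int set) UNIV"
    by (rule bij_betwI[where g = uminus]) auto
  have "pairing L M = (\<Sum>\<^sub>\<infinity>q. trace (L q ** M (0 - q)))"
    unfolding pairing_def lmul_def using assms(1)[unfolded conv_def, rule_format, of 0]
    by (subst infsum_bounded_linear'[OF bounded_linear_trace]) auto
  also have "\<dots> = (\<Sum>\<^sub>\<infinity>q. trace (L (- q) ** M q))"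
    using infsum_reindex_bij_betw[OF b, of "\<lambda>q. trace (L q ** M (0 - q))"] by simp
  also have "\<dots> = (\<Sum>\<^sub>\<infinity>q. trace (M q ** L (0 - q)))"
    by (rule infsum_cong) (subst trace_mul_sym, simp)
  also have "\<dots> = pairing M L"
    unfolding pairing_def lmul_def using assms(2)[unfolded conv_def, rule_format, of 0]
    by (subst infsum_bounded_linear'[OF bounded_linear_trace]) auto
  finally show ?thesis .
qed


section \<open>Closure of the loop algebra\<close>

lemma loop_algE:
  assumes "L \<in> loop_alg"
  obtains d where "twisted L" "\<And>p. p > d \<Longrightarrow> L p = 0"
  using assms by (auto simp: loop_alg_def)

lemma loop_algI: "twisted L \<Longrightarrow> (\<And>p. p > d \<Longrightarrow> L p = 0) \<Longrightarrow> L \<in> loop_alg"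
  by (auto simp: loop_alg_def)

lemma loop_twisted [intro, simp]: "L \<in> loop_alg \<Longrightarrow> twisted L"
  by (simp add: loop_alg_def)

lemma loop_pair_bound:
  assumes "L \<in> loop_alg" "M \<in> loop_alg"
  obtains d where "\<And>p. p > d \<Longrightarrow> L p = 0" "\<And>p. p > d \<Longrightarrow> M p = 0"
proof -
  obtain d e where "\<And>p. p > d \<Longrightarrow> L p = 0" "\<And>p. p > e \<Longrightarrow> M p = 0"
    using assms by (metis loop_algE)
  then show ?thesis using that[of "max d e"] by auto
qed

lemma loop_conv [simp]:
  assumes "L \<in> loop_alg" "M \<in> loop_alg"
  shows "conv L M"
proof -
  obtain d where d: "\<And>p. p > d \<Longrightarrow> L p = 0" "\<And>p. p > d \<Longrightarrow> M p = 0"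
    using loop_pair_bound[OF assms] by metis
  show ?thesis unfolding conv_def
  proof
    fix p
    have "L q ** M (p - q) = 0" if "q \<notin> {p - d..d}" for q
    proof (cases "q > d")
      case False
      then have "p - q > d" using that by auto
      then show ?thesis by (simp add: d)
    qed (simp add: d)
    then show "(\<lambda>q. L q ** M (p - q)) summable_on UNIV"
      by (intro conv_neutral[of "{p - d..d}"]) auto
  qed
qed

lemma lmul_bounded:
  assumes "\<And>p. p > d \<Longrightarrow> L p = 0" "\<And>p. p > e \<Longrightarrow> M p = 0"
  shows "(L \<star> M) p = (\<Sum>q\<in>{p - e..d}. L q ** M (p - q))"
proof (rule lmul_finite)
  fix q assume q: "q \<notin> {p - e..d}"
  show "L q ** M (p - q) = 0"
  proof (cases "q > d")
    case False
    then have "p - q > e" using q by auto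
    then show ?thesis by (simp add: assms)
  qed (simp add: assms)
qed simp

lemma loop_lmul [simp, intro]:
  assumes "L \<in> loop_alg" "M \<in> loop_alg"
  shows "L \<star> M \<in> loop_alg"
proof -
  obtain d where d: "\<And>p. p > d \<Longrightarrow> L p = 0" "\<And>p. p > d \<Longrightarrow> M p = 0"
    using loop_pair_bound[OF assms] by metis
  show ?thesis
    by (rule loop_algI[of _ "2 * d"]) (auto simp: assms twisted_lmul lmul_bounded[OF d])
qed

lemma loop_add [simp, intro]:
  assumes "L \<in> loop_alg" "M \<in> loop_alg"
  shows "L + M \<in> loop_alg"
proof -
  obtain d where d: "\<And>p. p > d \<Longrightarrow> L p = 0" "\<And>p. p > d \<Longrightarrow> M p = 0"
    using loop_pair_bound[OF assms] by metis
  show ?thesis by (rule loop_algI[of _ d]) (auto simp: assms twisted_add d)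
qed

lemma loop_minus [simp, intro]:
  assumes "L \<in> loop_alg"
  shows "- L \<in> loop_alg"
proof -
  obtain d where d: "\<And>p. p > d \<Longrightarrow> L p = 0"
    using loop_algE[OF assms] by metis
  show ?thesis by (rule loop_algI[of _ d]) (auto simp: assms twisted_minus d)
qed

lemma loop_diff [simp, intro]: "L \<in> loop_alg \<Longrightarrow> M \<in> loop_alg \<Longrightarrow> L - M \<in> loop_alg"
  by (metis diff_conv_add_uminus loop_add loop_minus)

lemma loop_lone [simp, intro]: "lone \<in> loop_alg"
  by (rule loop_algI[of _ 0]) (auto simp: twisted_lone, auto simp: lone_def lam_def)

lemma loop_pi [simp, intro]:
  assumes "L \<in> loop_alg"
  shows "pi_plus L \<in> loop_alg" "pi_minus L \<in> loop_alg"
proof -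
  obtain d where d: "\<And>p. p > d \<Longrightarrow> L p = 0"
    using loop_algE[OF assms] by metis
  have "pi_plus L p = 0" "pi_minus L p = 0" if "p > d" for p
    using d[OF that] by (simp_all add: pi_plus_def pi_minus_def)
  then show "pi_plus L \<in> loop_alg" "pi_minus L \<in> loop_alg"
    using loop_algI[of "pi_plus L" d] loop_algI[of "pi_minus L" d] loop_twisted[OF assms]
    by (simp_all add: twisted_pi_plus twisted_pi_minus)
qed

lemma loop_assoc:
  assumes "L \<in> loop_alg" "M \<in> loop_alg" "N \<in> loop_alg"
  shows "L \<star> M \<star> N = L \<star> (M \<star> N)"
proof -
  obtain d1 where d1: "\<And>p. p > d1 \<Longrightarrow> L p = 0" "\<And>p. p > d1 \<Longrightarrow> M p = 0"
    using loop_pair_bound[OF assms(1,2)] by metis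
  obtain d2 where d2: "\<And>p. p > d2 \<Longrightarrow> N p = 0" using loop_algE[OF assms(3)] by metis
  have s: "(\<lambda>(q, r). L r ** M (q - r) ** N (p - q)) summable_on UNIV \<times> UNIV" for p
  proof -
  let ?F = "{p - d2..2 * d1} \<times> {p - d2 - d1..d1}"
  have "(\<lambda>(q, r). L r ** M (q - r) ** N (p - q)) summable_on ?F"
    by (rule summable_on_finite) auto
  moreover have zero: "L r ** M (q - r) ** N (p - q) = 0" if "(q, r) \<notin> ?F" for q r
  proof -
    have "r > d1 \<or> q - r > d1 \<or> p - q > d2"
      using that by auto
    then show ?thesis by (auto simp add: d1 d2)
  qed
  moreover have "(\<lambda>(q, r). L r ** M (q - r) ** N (p - q)) summable_on ?F \<longleftrightarrow>
      (\<lambda>(q, r). L r ** M (q - r) ** N (p - q)) summable_on UNIV \<times> UNIV"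
  proof (rule summable_on_cong_neutral)
    fix x assume "x \<in> UNIV \<times> UNIV - ?F"
    then show "(case x of (q, r) \<Rightarrow> L r ** M (q - r) ** N (p - q)) = 0"
      using zero[of "fst x" "snd x"] by (simp add: case_prod_beta)
  qed auto
  ultimately show "(\<lambda>(q, r). L r ** M (q - r) ** N (p - q)) summable_on UNIV \<times> UNIV"
    by blast
  qed
  show ?thesis
    by (rule lmul_assoc_gen[OF loop_conv[OF assms(1,2)] loop_conv[OF assms(2,3)] s])
qed

lemma loop_distrib:
  assumes "L \<in> loop_alg" "M \<in> loop_alg" "N \<in> loop_alg"
  shows "(L + M) \<star> N = L \<star> N + M \<star> N" "N \<star> (L + M) = N \<star> L + N \<star> M"
    "(L - M) \<star> N = L \<star> N - M \<star> N" "N \<star> (L - M) = N \<star> L - N \<star> M"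
proof -
  note cv = loop_conv[OF assms(1,3)] loop_conv[OF assms(2,3)] loop_conv[OF assms(3,1)]
    loop_conv[OF assms(3,2)] loop_conv[OF loop_minus[OF assms(2)] assms(3)]
    loop_conv[OF assms(3) loop_minus[OF assms(2)]]
  show "(L + M) \<star> N = L \<star> N + M \<star> N" "N \<star> (L + M) = N \<star> L + N \<star> M"
    by (rule lmul_add_left[OF cv(1,2)], rule lmul_add_right[OF cv(3,4)])
  show "(L - M) \<star> N = L \<star> N - M \<star> N"
    using lmul_add_left[OF cv(1,5)] unfolding lmul_minus_left by (simp only: diff_conv_add_uminus)
  show "N \<star> (L - M) = N \<star> L - N \<star> M"
    using lmul_add_right[OF cv(3,6)] unfolding lmul_minus_right by (simp only: diff_conv_add_uminus)
qed

lemma loop_pairing_sym: "L \<in> loop_alg \<Longrightarrow> M \<in> loop_alg \<Longrightarrow> pairing L M = pairing M L"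
  by (intro pairing_sym loop_conv)

lemma loop_pairing_cyclic:
  assumes "L \<in> loop_alg" "M \<in> loop_alg" "N \<in> loop_alg"
  shows "pairing (L \<star> M) N = pairing L (M \<star> N)" "pairing (L \<star> M) N = pairing M (N \<star> L)"
proof -
  show 1: "pairing (L \<star> M) N = pairing L (M \<star> N)"
    unfolding pairing_def loop_assoc[OF assms] ..
  have "pairing L (M \<star> N) = pairing (M \<star> N) L"
    by (rule loop_pairing_sym[OF assms(1) loop_lmul[OF assms(2,3)]])
  also have "\<dots> = pairing M (N \<star> L)"
    unfolding pairing_def loop_assoc[OF assms(2,3,1)] ..
  finally show "pairing (L \<star> M) N = pairing M (N \<star> L)" using 1 by simp
qed

lemma pairing_add:
  assumes "L \<in> loop_alg" "M \<in> loop_alg" "N \<in> loop_alg"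
  shows "pairing (L + M) N = pairing L N + pairing M N" "pairing N (L + M) = pairing N L + pairing N M"
    "pairing (L - M) N = pairing L N - pairing M N" "pairing N (L - M) = pairing N L - pairing N M"
  using assms by (simp_all add: pairing_def loop_distrib trace_add trace_sub)

lemma trace_minus: "trace (- A :: real^'n^'n) = - trace A"
  by (simp add: trace_def sum_negf)

lemma pairing_minus: "pairing (- L) N = - pairing L N" "pairing N (- L) = - pairing N L"
  by (simp_all add: pairing_def lmul_minus_left lmul_minus_right trace_minus)

section \<open>Homogeneous series\<close>

text \<open>The homogeneous element with diagonal \<open>y\<close> and power \<open>r\<close> of
  \<E>. U, V and C are sums of two of these, and their velocities are single ones.\<close>

definition mono_loop :: "int \<Rightarrow> ('a::finite mod_ring \<Rightarrow> real) \<Rightarrow> 'a loop" where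
  "mono_loop r y = lam r (\<chi> i j. if j = shift (- r) i then y i else 0)"

lemma mono_loop_neq: "p \<noteq> r \<Longrightarrow> mono_loop r y p = 0"
  by (simp add: mono_loop_def lam_def)

lemma coef_mono [simp]: "coef (mono_loop r y) p i = (if p = r then y i else 0)"
  by (simp add: mono_loop_def coef_lam)

lemma twisted_mono [simp]: "twisted (mono_loop r y)"
  by (rule twisted_coefI) (auto simp: mono_loop_def lam_def)

lemma loop_mono [simp]: "mono_loop r y \<in> loop_alg"
  by (rule loop_algI[of _ r]) (simp_all add: mono_loop_neq)

lemma conv_mono [simp]: "conv (mono_loop r y) M" "conv M (mono_loop r y)"
proof -
  show "conv (mono_loop r y) M" unfolding conv_def
    by (intro allI conv_neutral[of "{r}"]) (simp_all add: mono_loop_neq)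
  show "conv M (mono_loop r y)" unfolding conv_def
  proof
    fix p
    show "(\<lambda>q. M q ** mono_loop r y (p - q)) summable_on UNIV"
      by (rule conv_neutral[of "{p - r}"]) (simp_all add: mono_loop_neq)
  qed
qed

lemma coef_mono_left:
  assumes "twisted M"
  shows "coef (mono_loop r y \<star> M) p i = y i * coef M (p - r) (shift (- r) i)"
  using coef_sum_matmul[OF twisted_mono assms lmul_finite_left[of "{r}" "mono_loop r y" M p], of i]
  by (simp add: mono_loop_neq)

lemma coef_mono_right:
  assumes "twisted M"
  shows "coef (M \<star> mono_loop r y) p i = coef M (p - r) i * y (shift (r - p) i)"
proof -
  have "(M \<star> mono_loop r y) p = (\<Sum>q\<in>{p - r}. M q ** mono_loop r y (p - q))"
    by (rule lmul_finite) (simp_all add: mono_loop_neq)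
  from coef_sum_matmul[OF assms twisted_mono this] show ?thesis by simp
qed

lemma pairing_mono:
  assumes "twisted M"
  shows "pairing (mono_loop r y) M = (\<Sum>i\<in>UNIV. y i * coef M (- r) (shift (- r) i))"
  unfolding pairing_def trace_coef coef_mono_left[OF assms] by simp

lemma mono_add: "mono_loop r y + mono_loop r z = mono_loop r (\<lambda>i. y i + z i)"
  and mono_diff: "mono_loop r y - mono_loop r z = mono_loop r (\<lambda>i. y i - z i)"
  and mono_minus: "- mono_loop r y = mono_loop r (\<lambda>i. - y i)"
  by (rule ext, auto simp: mono_loop_def lam_def vec_eq_iff)+

lemma sum_scale_E_nth:
  "(\<Sum>k\<in>UNIV. w k *\<^sub>R E k (f k)) $ i $ j = (if j = f i then w i else 0)"
proof -
  have "(\<Sum>k\<in>UNIV. w k *\<^sub>R E k (f k)) $ i $ j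
      = (\<Sum>k\<in>UNIV. if k = i then (if j = f i then w i else 0) else 0)"
    unfolding sum_component E_def by (rule sum.cong) auto
  then show ?thesis by simp
qed

lemma sum_E_nth: "(\<Sum>k\<in>UNIV. E (nxt k) k) $ i $ j = (if j = prv i then 1 else 0)"
proof -
  have "(\<Sum>k\<in>UNIV. E (nxt k) k) = (\<Sum>k\<in>UNIV. E (nxt (prv k)) (prv k))"
    by (rule sum_shift[symmetric])
  also have "\<dots> = (\<Sum>k\<in>UNIV. 1 *\<^sub>R E k (prv k))"
    by (simp only: shift_cancel1 scaleR_one)
  finally have *: "(\<Sum>k\<in>UNIV. E (nxt k) k) = (\<Sum>k\<in>UNIV. 1 *\<^sub>R E k (prv k))" .
  show ?thesis unfolding * by (rule sum_scale_E_nth)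
qed

lemma lam_scale_E: "lam r (\<Sum>k\<in>UNIV. w k *\<^sub>R E k (shift (- r) k)) = mono_loop r w"
  unfolding mono_loop_def by (rule arg_cong[where f = "lam r"]) (simp add: vec_eq_iff sum_scale_E_nth del: sum_component)

lemma lam_E: "lam 1 (\<Sum>k\<in>UNIV. E (nxt k) k) = mono_loop 1 (\<lambda>_. 1)"
  unfolding mono_loop_def by (rule arg_cong[where f = "lam 1"]) (simp add: vec_eq_iff sum_E_nth del: sum_component)

lemma lone_mono: "lone = mono_loop 0 (\<lambda>_. 1)"
  by (rule twisted_eqI) (simp_all add: twisted_lone coef_lone)

lemma U_mono: "U x = mono_loop 0 (\<lambda>k. fst x $ k) + mono_loop 1 (\<lambda>_. 1)"
  using lam_scale_E[of 0 "\<lambda>k. fst x $ k"] by (simp add: U_def lam_E)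

text \<open>V and C have this common shape, so inverses, commutators and projections are treated
  once for both.\<close>

definition unip :: "('a::finite mod_ring \<Rightarrow> real) \<Rightarrow> 'a loop" where
  "unip w = mono_loop 0 (\<lambda>_. 1) + mono_loop (-1) w"

lemma V_unip: "V x = unip (\<lambda>k. snd x $ k)"
  using lam_scale_E[of "-1" "\<lambda>k. snd x $ k"] by (simp add: V_def lone_mono unip_def)

definition cfun :: "real \<Rightarrow> 'a::finite phase \<Rightarrow> 'a mod_ring \<Rightarrow> real" where
  "cfun h x = (\<lambda>k. - (h * fst x $ k * snd x $ k))"

lemma C_unip: "C h x = unip (cfun h x)"
  using lam_scale_E[of "-1" "\<lambda>k. h * fst x $ k * snd x $ k"]
  by (simp add: C_def lone_mono unip_def cfun_def mono_minus diff_conv_add_uminus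
      del: add_uminus_conv_diff)

lemma loop_U [simp]: "U x \<in> loop_alg" and loop_unip [simp]: "unip w \<in> loop_alg"
  by (simp_all add: U_mono unip_def)

lemma loop_V [simp]: "V x \<in> loop_alg" and loop_C [simp]: "C h x \<in> loop_alg"
  by (simp_all add: V_unip C_unip)

lemma coef_U: "coef (U x) p i = (if p = 0 then fst x $ i else if p = 1 then 1 else 0)"
  and coef_unip: "coef (unip w) p i = (if p = 0 then 1 else if p = -1 then w i else 0)"
  by (simp_all add: U_mono unip_def)

text \<open>With these rules every matrix identity containing U, V or C becomes a two-term scalar
  recursion.\<close>

lemma coef_U_left: "twisted M \<Longrightarrow>
    coef (U x \<star> M) p i = fst x $ i * coef M p i + coef M (p - 1) (prv i)"
  and coef_U_right: "twisted M \<Longrightarrow>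
    coef (M \<star> U x) p i = coef M p i * fst x $ shift (- p) i + coef M (p - 1) i"
  and coef_unip_left: "twisted M \<Longrightarrow>
    coef (unip w \<star> M) p i = coef M p i + w i * coef M (p + 1) (nxt i)"
  and coef_unip_right: "twisted M \<Longrightarrow>
    coef (M \<star> unip w) p i = coef M p i + coef M (p + 1) i * w (shift (- 1 - p) i)"
  by (simp_all add: U_mono unip_def lmul_add_left lmul_add_right coef_mono_left coef_mono_right)

text \<open>The inverse of \<open>unip w\<close>. Since \<open>unip w\<close> minus the identity is
  homogeneous, its n-th power occupies degree -n alone, and the geometric series has in each degree
  just one product along consecutive sites.\<close>

definition geo :: "('a::finite mod_ring \<Rightarrow> real) \<Rightarrow> 'a loop" where
  "geo w = (\<lambda>p. \<chi> i j. if p \<le> 0 \<and> j = shift (- p) i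
      then \<Prod>l<nat (- p). - w (shift (int l) i) else 0)"

lemma twisted_geo: "twisted (geo w)"
  by (rule twisted_coefI) (simp add: geo_def)

lemma loop_geo [simp]: "geo w \<in> loop_alg"
  by (rule loop_algI[of _ 0]) (simp_all add: twisted_geo, simp add: geo_def vec_eq_iff)

lemma coef_geo:
  "coef (geo w) p i = (if p \<le> 0 then \<Prod>l<nat (- p). - w (shift (int l) i) else 0)"
  by (simp add: coef_def geo_def)

text \<open>Splitting off the first or the last factor of the product; the two forms give the two
  one-sided inverses.\<close>

lemma coef_geo_Suc:
  assumes "p < 0"
  shows "coef (geo w) p i = - w i * coef (geo w) (p + 1) (nxt i)"
    "coef (geo w) p i = - coef (geo w) (p + 1) i * w (shift (- 1 - p) i)"
proof -
  define n where "n = nat (- p - 1)"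
  have n: "nat (- p) = Suc n" "nat (- (p + 1)) = n" "- 1 - p = int n"
    using assms by (auto simp: n_def)
  show "coef (geo w) p i = - w i * coef (geo w) (p + 1) (nxt i)"
    using assms by (simp add: coef_geo n prod.lessThan_Suc_shift shift_add add.commute del: prod.lessThan_Suc)
  show "coef (geo w) p i = - coef (geo w) (p + 1) i * w (shift (- 1 - p) i)"
    using assms by (simp add: coef_geo n(1,2)) (simp add: n(3) n(2)[simplified])
qed

lemma geo_inverse: "unip w \<star> geo w = lone" "geo w \<star> unip w = lone"
proof -
  show "unip w \<star> geo w = lone"
  proof (rule twisted_eqI)
    fix p i
    show "coef (unip w \<star> geo w) p i = coef lone p i"
      using coef_geo_Suc(1)[of p w i]
      by (cases "p < 0") (auto simp: coef_unip_left twisted_geo coef_lone coef_geo)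
  qed (auto simp: twisted_lone)
  show "geo w \<star> unip w = lone"
  proof (rule twisted_eqI)
    fix p i
    show "coef (geo w \<star> unip w) p i = coef lone p i"
      using coef_geo_Suc(2)[of p w i]
      by (cases "p < 0") (auto simp: coef_unip_right twisted_geo coef_lone coef_geo)
  qed (auto simp: twisted_lone)
qed

lemma lpow_mono:
  "lpow (mono_loop (-1) (\<lambda>k. - w k)) n = (\<lambda>p. if p = - int n then geo w p else 0)"
proof (induction n)
  case 0
  show ?case
  proof (rule twisted_eqI)
    show "twisted (\<lambda>p. if p = - int 0 then geo w p else 0)"
      using twisted_geo[of w] by (auto simp: twisted_iff)
    show "coef (lpow (mono_loop (-1) (\<lambda>k. - w k)) 0) p i
        = coef (\<lambda>p. if p = - int 0 then geo w p else 0) p i" for p i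
      by (simp add: coef_lone) (simp add: coef_def geo_def)
  qed (simp add: twisted_lone)
next
  case (Suc n)
  let ?M = "\<lambda>n p. if p = - int n then geo w p else 0"
  have t: "twisted (?M n)" for n
    using twisted_geo[of w] by (auto simp: twisted_iff)
  have c: "coef (?M n) p i = (if p = - int n then coef (geo w) p i else 0)" for n p i
    by (simp add: coef_def)
  show ?case unfolding lpow.simps Suc
  proof (rule twisted_eqI)
    fix p i
    show "coef (mono_loop (-1) (\<lambda>k. - w k) \<star> ?M n) p i = coef (?M (Suc n)) p i"
      unfolding c using coef_geo_Suc(1)[of p w i] by (auto simp: coef_mono_left[OF t] c)
  qed (rule twisted_lmul[OF conv_mono(1) twisted_mono t], rule t)
qed

lemma Cinv_geo: "Cinv h x = geo (cfun h x)"
proof (rule ext)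
  fix p
  have 1: "lone - C h x = mono_loop (-1) (\<lambda>k. - cfun h x k)"
    by (simp add: C_unip unip_def lone_mono mono_minus)
  have "Cinv h x p = (\<Sum>n. if p = - int n then geo (cfun h x) p else 0)"
    by (simp add: Cinv_def 1 lpow_mono)
  also have "\<dots> = (\<Sum>n\<in>{nat (- p)}. if p = - int n then geo (cfun h x) p else 0)"
    by (rule suminf_finite) auto
  also have "\<dots> = geo (cfun h x) p"
    by (auto simp: geo_def vec_eq_iff)
  finally show "Cinv h x p = geo (cfun h x) p" .
qed

lemma loop_Cinv [simp]: "Cinv h x \<in> loop_alg"
  by (simp add: Cinv_geo)

lemma C_Cinv [simp]: "C h x \<star> Cinv h x = lone" "Cinv h x \<star> C h x = lone"
  by (simp_all add: C_unip Cinv_geo geo_inverse)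

text \<open>Splitting off the top term \<E> leaves a unipotent factor with the u's moved by one
  site. Hence U is invertible also where some u_k vanish, and the conjugation argument for gradients
  is available at every point.\<close>

lemma U_invertible: "\<exists>Y\<in>loop_alg. U x \<star> Y = lone \<and> Y \<star> U x = lone"
proof -
  let ?s = "mono_loop 1 (\<lambda>_. 1) :: 'a loop" and ?t = "mono_loop (-1) (\<lambda>_. 1) :: 'a loop"
  let ?w = "\<lambda>k. fst x $ nxt k"
  have st: "?s \<star> ?t = lone" "?t \<star> ?s = lone"
    by (rule twisted_eqI; simp add: twisted_lone coef_mono_left coef_lone)+
  have u: "U x = ?s \<star> unip ?w"
    by (rule twisted_eqI) (auto simp: coef_mono_left coef_U coef_unip)
  have "U x \<star> (geo ?w \<star> ?t) = ?s \<star> (unip ?w \<star> geo ?w) \<star> ?t"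
    by (simp add: u loop_assoc)
  moreover have "geo ?w \<star> ?t \<star> U x = geo ?w \<star> (?t \<star> ?s) \<star> unip ?w"
    by (simp add: u loop_assoc)
  ultimately have "U x \<star> (geo ?w \<star> ?t) = lone" "geo ?w \<star> ?t \<star> U x = lone"
    by (simp_all add: geo_inverse st)
  then show ?thesis by (intro bexI[of _ "geo ?w \<star> ?t"]) auto
qed

lemma V_invertible: "\<exists>Y\<in>loop_alg. V x \<star> Y = lone \<and> Y \<star> V x = lone"
  by (intro bexI[of _ "geo (\<lambda>k. snd x $ k)"]) (simp_all add: V_unip geo_inverse)


section \<open>Operators of the bracket and derivatives of curves\<close>

section \<open>The operators of the bracket in coordinates\<close>

text \<open>The diagonal of W applied to the diagonal \<open>z\<close>. The signs refer to the order
  of the sites from 1 to N, so there is a cut between N and 1.\<close>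

definition wd :: "('a::finite mod_ring \<Rightarrow> real) \<Rightarrow> 'a mod_ring \<Rightarrow> real" where
  "wd z i = (\<Sum>j\<in>UNIV. z j * real_of_int (sgn (pos j - pos i)))"

lemma to_int_nxt: "to_int_mod_ring (nxt k :: 'a::finite mod_ring)
    = (to_int_mod_ring k + 1) mod int CARD('a)"
  unfolding shift_def by transfer (simp add: mod_simps)

lemma pos_eq_iff [simp]: "pos j = pos k \<longleftrightarrow> j = k"
  by (auto simp: pos_def)

lemma pos_bounds: "1 \<le> pos (k :: 'a::finite mod_ring)" "pos k \<le> int CARD('a)"
proof -
  have "to_int_mod_ring (prv k) \<in> {0..<int CARD('a)}"
    using range_to_int_mod_ring[where 'a = 'a] by blast
  then show "1 \<le> pos k" "pos k \<le> int CARD('a)" by (auto simp: pos_def)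
qed

lemma pos_nxt: "pos (nxt (k :: 'a::finite mod_ring)) = (if pos k = int CARD('a) then 1 else pos k + 1)"
proof -
  have "pos (nxt k) = (to_int_mod_ring (prv k) + 1) mod int CARD('a) + 1"
    using to_int_nxt[of "prv k"] by (simp add: pos_def)
  then show ?thesis
    using pos_bounds[of k] by (auto simp: pos_def)
qed

text \<open>Moving the base point by one site changes only the signs at the two sites themselves.
  Across the cut from N to 1 the other signs change as well, which costs a multiple of the total
  sum; as that sum is 0, the identity is periodic.\<close>

lemma wd_step:
  fixes z :: "'a::finite mod_ring \<Rightarrow> real"
  assumes "(\<Sum>j\<in>UNIV. z j) = 0"
  shows "wd z k - wd z (nxt k) = z k + z (nxt k)"
proof -
  \<comment> \<open>At the cut the sign difference is -1 - 1 for every site strictly between 1 and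
    N; the two end sites are corrected by +1 each.\<close>
  define c :: real where "c = (if pos k = int CARD('a) then -2 else 0)"
  have "wd z k - wd z (nxt k)
      = (\<Sum>j\<in>UNIV. z j * real_of_int (sgn (pos j - pos k) - sgn (pos j - pos (nxt k))))"
    by (simp add: wd_def sum_subtractf algebra_simps)
  also have "\<dots> = (\<Sum>j\<in>UNIV. c * z j + ((if j = k then z j else 0) + (if j = nxt k then z j else 0)))"
  proof (rule sum.cong)
    fix j :: "'a mod_ring"
    have "real_of_int (sgn (pos j - pos k) - sgn (pos j - pos (nxt k)))
        = c + ((if pos j = pos k then 1 else 0) + (if pos j = pos (nxt k) then 1 else 0))"
      using pos_bounds[of j] pos_bounds[of k] by (auto simp: pos_nxt c_def sgn_if simp del: pos_eq_iff)
    then show "z j * real_of_int (sgn (pos j - pos k) - sgn (pos j - pos (nxt k)))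
        = c * z j + ((if j = k then z j else 0) + (if j = nxt k then z j else 0))"
      by (simp add: algebra_simps)
  qed simp
  also have "\<dots> = c * (\<Sum>j\<in>UNIV. z j) + (z k + z (nxt k))"
    by (simp add: sum.distrib flip: sum_distrib_left)
  finally show ?thesis using assms by simp
qed

lemma wd_skew: "(\<Sum>i\<in>UNIV. wd y i * z i) = - (\<Sum>i\<in>UNIV. y i * wd z i)"
proof -
  have "(\<Sum>i\<in>UNIV. wd y i * z i)
      = (\<Sum>i\<in>UNIV. \<Sum>j\<in>UNIV. - (y j * (z i * real_of_int (sgn (pos i - pos j)))))"
    unfolding wd_def sum_distrib_right
    by (intro sum.cong refl) (auto simp: sgn_if algebra_simps)
  also have "\<dots> = (\<Sum>j\<in>UNIV. \<Sum>i\<in>UNIV. - (y j * (z i * real_of_int (sgn (pos i - pos j)))))"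
    by (rule sum.swap)
  also have "\<dots> = - (\<Sum>i\<in>UNIV. y i * wd z i)"
    unfolding wd_def by (simp add: sum_negf sum_distrib_left)
  finally show ?thesis .
qed

lemma wd_linear: "wd (\<lambda>i. y i + z i) k = wd y k + wd z k" "wd (\<lambda>i. y i - z i) k = wd y k - wd z k"
  by (simp_all add: wd_def sum.distrib sum_subtractf algebra_simps)

lemma W_diag_nth: "W_diag D $ i $ k = (if i = k then wd (\<lambda>j. D $ j $ j) i else 0)"
proof -
  have e: "(\<Sum>k\<in>A. E k k) $ i $ k = (if i = k \<and> i \<in> A then 1 else 0)" for A :: "'a mod_ring set" and i k
  proof -
    have "(\<Sum>k\<in>A. E k k) $ i $ k = (\<Sum>j\<in>A. if j = i then (if i = k then 1 else 0) else 0)"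
      unfolding sum_component E_def by (rule sum.cong) auto
    then show ?thesis by simp
  qed
  have s: "sgn (pos j - pos i) = (if pos i < pos j then 1 else if pos j < pos i then -1 else 0)" for j
    by (simp add: sgn_if)
  show ?thesis
    unfolding W_diag_def wd_def sum_component
    by (cases "i = k") (simp_all add: e s del: sum_component, auto intro!: sum.cong)
qed

lemma P0_mono: "L \<in> loop_alg \<Longrightarrow> P0 L = mono_loop 0 (coef L 0)"
  by (rule ext) (auto simp: P0_eq mono_loop_def lam_def vec_eq_iff twisted_nth[OF loop_twisted])

lemma W_mono: "L \<in> loop_alg \<Longrightarrow> W L = mono_loop 0 (wd (coef L 0))"
proof -
  assume L: "L \<in> loop_alg"
  have "P0 L 0 $ j $ j = coef L 0 j" for j
    using coef_mono[of 0 "coef L 0" 0 j] by (simp add: P0_mono[OF L] coef_def)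
  then show ?thesis
    by (simp add: W_def mono_loop_def, intro arg_cong[where f = "lam 0"])
      (auto simp: vec_eq_iff W_diag_nth)
qed

lemma R0_loop [simp]: "L \<in> loop_alg \<Longrightarrow> R0 L \<in> loop_alg"
proof -
  assume L: "L \<in> loop_alg"
  then obtain d where "twisted L" "\<And>p. p > d \<Longrightarrow> L p = 0" by (metis loop_algE)
  then show ?thesis
    by (intro loop_algI[of _ d]) (auto simp: R0_eq[OF L] twisted_iff)
qed

lemma coef_R0: "L \<in> loop_alg \<Longrightarrow>
    coef (R0 L) p i = (if p > 0 then coef L p i else if p < 0 then - coef L p i else 0)"
  by (simp add: R0_eq coef_def)

lemma S_mono: "L \<in> loop_alg \<Longrightarrow> S L = mono_loop 0 (\<lambda>i. coef L 0 i - wd (coef L 0) i)"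
  and Sst_mono: "L \<in> loop_alg \<Longrightarrow> Sst L = mono_loop 0 (\<lambda>i. coef L 0 i + wd (coef L 0) i)"
  and A1_mono: "L \<in> loop_alg \<Longrightarrow> A1 L = R0 L + mono_loop 0 (wd (coef L 0))"
  and A2_mono: "L \<in> loop_alg \<Longrightarrow> A2 L = R0 L - mono_loop 0 (wd (coef L 0))"
  by (simp_all add: S_def Sst_def A1_def A2_def P0_mono W_mono mono_add mono_diff)

lemma pairing_mono_right: "M \<in> loop_alg \<Longrightarrow>
    pairing M (mono_loop r y) = (\<Sum>i\<in>UNIV. y i * coef M (- r) (shift (- r) i))"
  by (simp add: loop_pairing_sym[of M] pairing_mono)

text \<open>\<open>P0\<close> is symmetric and W is skew, so passing to the adjoint flips the sign
  of W.\<close>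

lemma is_adj_S: "is_adj (S :: 'a::finite loop \<Rightarrow> _) Sst"
  and is_adj_Sst: "is_adj (Sst :: 'a loop \<Rightarrow> _) S"
proof -
  have sk: "(\<Sum>i\<in>UNIV. wd y i * z i) + (\<Sum>i\<in>UNIV. wd z i * y i) = 0"
    for y z :: "'a mod_ring \<Rightarrow> real"
    using wd_skew[of y z] by (simp add: mult.commute)
  have e: "(\<Sum>i\<in>UNIV. (y i + wd y i) * z i) = (\<Sum>i\<in>UNIV. (z i - wd z i) * y i)"
    for y z :: "'a mod_ring \<Rightarrow> real"
    using sk[of y z] by (simp add: algebra_simps sum.distrib sum_subtractf)
  show "is_adj (S :: 'a loop \<Rightarrow> _) Sst"
    unfolding is_adj_def
    by (auto simp: S_mono Sst_mono pairing_mono pairing_mono_right e)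
  show "is_adj (Sst :: 'a loop \<Rightarrow> _) S"
    unfolding is_adj_def
    by (auto simp: S_mono Sst_mono pairing_mono pairing_mono_right e)
qed

lemma is_adj_uminus: "is_adj T T' \<Longrightarrow> is_adj (- T) (- T')"
  unfolding is_adj_def by (auto simp: pairing_minus)

text \<open>\<open>adj\<close> is a choice, which the nondegenerate pairing determines on
  \<open>loop_alg\<close>; hence the membership hypotheses.\<close>

lemma adj_S: "L \<in> loop_alg \<Longrightarrow> adj S L = Sst L"
  and adj_minus_Sst: "L \<in> loop_alg \<Longrightarrow> adj (- Sst) L = - S L"
  using adj_eq[OF is_adj_S] adj_eq[OF is_adj_uminus[OF is_adj_Sst]] by auto

section \<open>Differentiating curves of series\<close>

lemma bounded_bilinear_matmul:
  "bounded_bilinear ((**) :: real^'n^'m \<Rightarrow> real^'k^'n \<Rightarrow> real^'k^'m)"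
  unfolding bilinear_conv_bounded_bilinear[symmetric] bilinear_def
  using bounded_linear_matmul_left bounded_linear_matmul_right
  by (auto simp: linear_conv_bounded_linear)

lemma has_derivative_vec_iff:
  fixes f :: "'b::real_normed_vector \<Rightarrow> ('c::euclidean_space)^'n"
  shows "(f has_derivative f') (at x within T) \<longleftrightarrow>
    (\<forall>i. ((\<lambda>y. f y $ i) has_derivative (\<lambda>y. f' y $ i)) (at x within T))"
proof
  assume "(f has_derivative f') (at x within T)"
  then show "\<forall>i. ((\<lambda>y. f y $ i) has_derivative (\<lambda>y. f' y $ i)) (at x within T)"
    using bounded_linear.has_derivative[OF bounded_linear_vec_nth] by blast
next
  assume a: "\<forall>i. ((\<lambda>y. f y $ i) has_derivative (\<lambda>y. f' y $ i)) (at x within T)"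
  show "(f has_derivative f') (at x within T)"
  proof (subst has_derivative_componentwise_within, rule ballI)
    fix b :: "'c^'n" assume "b \<in> Basis"
    then obtain i c where b: "b = axis i c" by (auto simp: Basis_vec_def)
    show "((\<lambda>y. f y \<bullet> b) has_derivative (\<lambda>y. f' y \<bullet> b)) (at x within T)"
      using a unfolding b inner_axis by (auto intro!: derivative_eq_intros)
  qed
qed

lemma has_vector_derivative_matrix_iff:
  fixes f :: "real \<Rightarrow> real^'m^'n"
  shows "(f has_vector_derivative D) (at t within T) \<longleftrightarrow>
    (\<forall>i j. ((\<lambda>\<tau>. f \<tau> $ i $ j) has_real_derivative D $ i $ j) (at t within T))"
proof -
  have e: "(\<lambda>y. y * c) = (*) c" for c :: real
    by (rule ext) (simp add: mult.commute)
  show ?thesis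
    unfolding has_vector_derivative_def has_derivative_vec_iff has_field_derivative_def
    by (simp add: e)
qed

lemma has_loop_derivative_iff:
  assumes "\<And>\<tau>. twisted (L \<tau>)" "twisted D"
  shows "(L has_loop_derivative D) (at t within T) \<longleftrightarrow>
    (\<forall>p i. ((\<lambda>\<tau>. coef (L \<tau>) p i) has_real_derivative coef D p i) (at t within T))"
proof
  assume "(L has_loop_derivative D) (at t within T)"
  then show "\<forall>p i. ((\<lambda>\<tau>. coef (L \<tau>) p i) has_real_derivative coef D p i) (at t within T)"
    unfolding has_loop_derivative_def has_vector_derivative_matrix_iff coef_def by blast
next
  assume a: "\<forall>p i. ((\<lambda>\<tau>. coef (L \<tau>) p i) has_real_derivative coef D p i) (at t within T)"
  show "(L has_loop_derivative D) (at t within T)"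
    unfolding has_loop_derivative_def has_vector_derivative_matrix_iff
      twisted_nth[OF assms(1)] twisted_nth[OF assms(2)]
    using a by auto
qed

lemma has_loop_derivative_lmul:
  assumes "(L has_loop_derivative L') (at t within T)" "(M has_loop_derivative M') (at t within T)"
    and d: "\<And>\<tau> p. p > d \<Longrightarrow> L \<tau> p = 0" "\<And>p. p > d \<Longrightarrow> L' p = 0"
      "\<And>\<tau> p. p > e \<Longrightarrow> M \<tau> p = 0" "\<And>p. p > e \<Longrightarrow> M' p = 0"
  shows "((\<lambda>\<tau>. L \<tau> \<star> M \<tau>) has_loop_derivative (\<lambda>p. (L' \<star> M t) p + (L t \<star> M') p)) (at t within T)"
  unfolding has_loop_derivative_def
proof
  fix p
  have 1: "(\<lambda>\<tau>. (L \<tau> \<star> M \<tau>) p) = (\<lambda>\<tau>. \<Sum>q\<in>{p - e..d}. L \<tau> q ** M \<tau> (p - q))"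
    by (rule ext) (rule lmul_bounded[OF d(1,3)])
  have 2: "(L' \<star> M t) p + (L t \<star> M') p
      = (\<Sum>q\<in>{p - e..d}. L t q ** M' (p - q) + L' q ** M t (p - q))"
    by (simp add: lmul_bounded[OF d(2,3)] lmul_bounded[OF d(1,4)] sum.distrib)
  show "((\<lambda>\<tau>. (L \<tau> \<star> M \<tau>) p) has_vector_derivative (L' \<star> M t) p + (L t \<star> M') p) (at t within T)"
    unfolding 1 2
    by (intro has_vector_derivative_sum bounded_bilinear.has_vector_derivative[OF bounded_bilinear_matmul])
      (use assms(1,2) in \<open>auto simp: has_loop_derivative_def\<close>)
qed

text \<open>A formal curve has velocities coefficient by coefficient. The velocity lies in the
  algebra because entries that vanish identically along the curve have derivative 0.\<close>

lemma formal_curve_velocity: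
  assumes "formal_curve \<gamma> M"
  shows "M \<in> loop_alg" "\<gamma> t \<in> loop_alg"
proof -
  from assms obtain d where d: "\<And>t p. p > d \<Longrightarrow> \<gamma> t p = 0" and r: "\<And>t. \<gamma> t \<in> loop_alg"
    and v: "\<And>p. ((\<lambda>t. \<gamma> t p) has_vector_derivative M p) (at 0)"
    unfolding formal_curve_def by auto
  show "\<gamma> t \<in> loop_alg" by (rule r)
  have "M p = 0" if "p > d" for p
  proof -
    have "((\<lambda>t. 0) has_vector_derivative M p) (at 0)" using v[of p] d[OF that] by simp
    from vector_derivative_unique_at[OF this has_vector_derivative_const] show ?thesis .
  qed
  moreover have "twisted M"
    unfolding twisted_iff
  proof (intro allI impI)
    fix p i k assume ik: "i \<noteq> shift p (k :: 'a mod_ring)"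
    have "((\<lambda>t. \<gamma> t p $ i $ k) has_real_derivative M p $ i $ k) (at 0)"
      using v[of p] unfolding has_vector_derivative_matrix_iff by blast
    moreover have "\<gamma> t p $ i $ k = 0" for t
      using r[of t] ik by (auto simp: loop_alg_def twisted_iff)
    ultimately show "M p $ i $ k = 0" by (auto intro: DERIV_unique)
  qed
  ultimately show "M \<in> loop_alg" by (rule loop_algI[rotated])
qed

lemma formal_curve_lmul:
  assumes "formal_curve \<gamma> M" "formal_curve \<delta> N"
  shows "formal_curve (\<lambda>t. \<gamma> t \<star> \<delta> t) (M \<star> \<delta> 0 + \<gamma> 0 \<star> N)"
proof -
  from assms obtain d e where d: "\<And>t p. p > d \<Longrightarrow> \<gamma> t p = 0" and e: "\<And>t p. p > e \<Longrightarrow> \<delta> t p = 0"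
    unfolding formal_curve_def by metis
  obtain d' e' where M: "\<And>p. p > d' \<Longrightarrow> M p = 0" and N: "\<And>p. p > e' \<Longrightarrow> N p = 0"
    using formal_curve_velocity(1)[OF assms(1)] formal_curve_velocity(1)[OF assms(2)] by (metis loop_algE)
  let ?d = "max d d'" and ?e = "max e e'"
  have b: "\<And>t p. p > ?d \<Longrightarrow> \<gamma> t p = 0" "\<And>p. p > ?d \<Longrightarrow> M p = 0"
    "\<And>t p. p > ?e \<Longrightarrow> \<delta> t p = 0" "\<And>p. p > ?e \<Longrightarrow> N p = 0"
    using d e M N by auto
  have "((\<lambda>\<tau>. \<gamma> \<tau> \<star> \<delta> \<tau>) has_loop_derivative (\<lambda>p. (M \<star> \<delta> 0) p + (\<gamma> 0 \<star> N) p)) (at 0 within UNIV)"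
  proof (rule has_loop_derivative_lmul[OF _ _ b])
    show "(\<gamma> has_loop_derivative M) (at 0 within UNIV)"
      using assms(1) by (simp add: formal_curve_def has_loop_derivative_def)
    show "(\<delta> has_loop_derivative N) (at 0 within UNIV)"
      using assms(2) by (simp add: formal_curve_def has_loop_derivative_def)
  qed
  moreover have "(\<gamma> t \<star> \<delta> t) p = 0" if "p > ?d + ?e" for t p
  proof -
    have "(\<gamma> t \<star> \<delta> t) p = (\<Sum>q\<in>{p - ?e..?d}. \<gamma> t q ** \<delta> t (p - q))"
      by (rule lmul_bounded[OF b(1,3)])
    moreover have "{p - ?e..?d} = {}" using that by simp
    ultimately show ?thesis by (simp only: sum.empty)
  qed
  ultimately show ?thesis
    unfolding formal_curve_def has_loop_derivative_def
    using formal_curve_velocity(2)[OF assms(1)] formal_curve_velocity(2)[OF assms(2)] by auto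
qed

lemma formal_curve_const: "L \<in> loop_alg \<Longrightarrow> formal_curve (\<lambda>_. L) 0"
  by (auto simp: formal_curve_def elim!: loop_algE)

lemma formal_curveI:
  assumes "(\<gamma> has_loop_derivative M) (at 0)" "\<And>t. \<gamma> t \<in> loop_alg" "\<And>t p. p > d \<Longrightarrow> \<gamma> t p = 0"
  shows "formal_curve \<gamma> M"
  using assms unfolding formal_curve_def has_loop_derivative_def by (auto intro!: exI[of _ d])

lemma formal_curve_line: "L \<in> loop_alg \<Longrightarrow> M \<in> loop_alg \<Longrightarrow> formal_curve (\<lambda>t p. L p + t *\<^sub>R M p) M"
proof -
  assume LM: "L \<in> loop_alg" "M \<in> loop_alg"
  then obtain d where d: "\<And>p. p > d \<Longrightarrow> L p = 0" "\<And>p. p > d \<Longrightarrow> M p = 0"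
    using loop_pair_bound by metis
  show ?thesis
  proof (rule formal_curveI[of _ _ d])
    show "((\<lambda>t p. L p + t *\<^sub>R M p) has_loop_derivative M) (at 0)"
      unfolding has_loop_derivative_def by (auto intro!: derivative_eq_intros)
    show "(\<lambda>p. L p + t *\<^sub>R M p) \<in> loop_alg" for t
      using twisted_add[OF loop_twisted[OF LM(1)] twisted_scale[OF loop_twisted[OF LM(2)], of t]]
      by (intro loop_algI[of _ d]) (auto simp: d plus_fun_def)
  qed (simp add: d)
qed

text \<open>The directional derivative of \<open>cfun h\<close> at \<open>x\<close> along
  \<open>y\<close>.\<close>

definition dcf :: "real \<Rightarrow> 'a::finite phase \<Rightarrow> 'a phase \<Rightarrow> 'a mod_ring \<Rightarrow> real" where
  "dcf h x y = (\<lambda>k. - (h * (fst y $ k * snd x $ k + fst x $ k * snd y $ k)))"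

lemma U_above: "p > 1 \<Longrightarrow> U x p = 0"
  and unip_above: "p > 0 \<Longrightarrow> unip w p = 0"
  and geo_above: "p > 0 \<Longrightarrow> geo w p = 0"
  by (simp_all add: U_mono unip_def mono_loop_neq geo_def vec_eq_iff)

lemma phase_components:
  assumes "(x has_vector_derivative y) (at t within T)"
  shows "((\<lambda>\<tau>. fst (x \<tau>) $ k) has_real_derivative fst y $ k) (at t within T)"
    "((\<lambda>\<tau>. snd (x \<tau>) $ k) has_real_derivative snd y $ k) (at t within T)"
  using bounded_linear.has_vector_derivative[OF bounded_linear_compose[OF bounded_linear_vec_nth bounded_linear_fst] assms]
    bounded_linear.has_vector_derivative[OF bounded_linear_compose[OF bounded_linear_vec_nth bounded_linear_snd] assms]
  by (auto simp: has_real_derivative_iff_has_vector_derivative)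

text \<open>The rule for the derivative of an inverse. In the absence of a norm it is verified by
  induction on the degree: candidate and derivative obey the same recursion.\<close>

lemma has_loop_derivative_geo:
  fixes w :: "real \<Rightarrow> 'a::finite mod_ring \<Rightarrow> real"
  assumes w: "\<And>k. ((\<lambda>\<tau>. w \<tau> k) has_real_derivative w' k) (at t within T)"
  shows "((\<lambda>\<tau>. geo (w \<tau>)) has_loop_derivative - (geo (w t) \<star> mono_loop (-1) w' \<star> geo (w t))) (at t within T)"
proof -
  let ?g = "geo (w t)" and ?m = "mono_loop (-1) w'"
  define D where "D = - (?g \<star> ?m \<star> ?g)"
  have D: "D \<in> loop_alg" by (simp add: D_def)
  have "unip (w t) \<star> D = - (unip (w t) \<star> ?g \<star> ?m \<star> ?g)"
    by (simp add: D_def loop_assoc lmul_minus_right)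
  then have uD: "unip (w t) \<star> D = - (?m \<star> ?g)"
    by (simp add: geo_inverse)
  \<comment> \<open>Degree p of \<open>unip (w t) \<star> D = - (?m \<star> ?g)\<close>. The same
    recursion arises by differentiating \<open>coef_geo_Suc\<close>.\<close>
  have rec: "coef D p i = - w t i * coef D (p + 1) (nxt i) - w' i * coef ?g (p + 1) (nxt i)" for p i
  proof -
    have "coef (unip (w t) \<star> D) p i = coef D p i + w t i * coef D (p + 1) (nxt i)"
      by (rule coef_unip_left) (rule loop_twisted[OF D])
    moreover have "coef (- (?m \<star> ?g)) p i = - (w' i * coef ?g (p + 1) (nxt i))"
      by (simp add: coef_mono_left)
    ultimately show ?thesis unfolding uD by simp
  qed
  obtain e where e: "\<And>p. p > e \<Longrightarrow> D p = 0" using loop_algE[OF D] by metis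
  have zero: "coef D p i = 0" if "p \<ge> 0" for p i
  proof -
    \<comment> \<open>Descent from the degree bound \<open>e\<close>: for p >= 0 the inhomogeneous
      term of \<open>rec\<close> sits in degree p + 1 > 0, where \<open>geo\<close>
      vanishes.\<close>
    have "coef D (e + 1 - int n) i = 0" if "e + 1 - int n \<ge> 0" for n i
      using that
    proof (induction n arbitrary: i)
      case 0
      then show ?case unfolding coef_def by (subst e) simp_all
    next
      case (Suc n)
      have "coef D (e + 1 - int (Suc n)) i = - w t i * coef D (e + 1 - int n) (nxt i)
          - w' i * coef ?g (e + 1 - int n) (nxt i)"
        by (subst rec) (simp add: algebra_simps)
      also have "\<dots> = 0" using Suc by (simp add: coef_geo)
      finally show ?case .
    qed
    note n = this
    show ?thesis
    proof (cases "p \<le> e")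
      case True
      then show ?thesis using n[of "nat (e + 1 - p)" i] that by simp
    next
      case False
      then show ?thesis unfolding coef_def by (subst e) simp_all
    qed
  qed
  have main: "((\<lambda>\<tau>. coef (geo (w \<tau>)) (- int n) i) has_real_derivative coef D (- int n) i) (at t within T)" for n i
  proof (induction n arbitrary: i)
    case 0
    have "coef (geo (w \<tau>)) 0 i = 1" for \<tau> by (simp add: coef_geo)
    then show ?case using zero[of 0 i] by simp
  next
    case (Suc n)
    have g: "(\<lambda>\<tau>. coef (geo (w \<tau>)) (- int (Suc n)) i) = (\<lambda>\<tau>. - w \<tau> i * coef (geo (w \<tau>)) (- int n) (nxt i))"
      by (rule ext) (subst coef_geo_Suc(1), simp_all)
    show ?case
      unfolding g rec[of "- int (Suc n)" i]
      by (rule derivative_eq_intros w Suc refl | simp)+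
  qed
  show ?thesis unfolding D_def[symmetric]
  proof (subst has_loop_derivative_iff)
    show "\<forall>p i. ((\<lambda>\<tau>. coef (geo (w \<tau>)) p i) has_real_derivative coef D p i) (at t within T)"
    proof (intro allI)
      fix p i
      show "((\<lambda>\<tau>. coef (geo (w \<tau>)) p i) has_real_derivative coef D p i) (at t within T)"
      proof (cases "p \<le> 0")
        case True
        then show ?thesis using main[of "nat (- p)" i] by simp
      next
        case False
        then show ?thesis using zero[of p i] by (simp add: coef_geo)
      qed
    qed
  qed (use D in auto)
qed

context
  fixes x :: "real \<Rightarrow> 'a::finite phase" and y t T
  assumes x: "(x has_vector_derivative y) (at t within T)"
begin

lemma U_derivative:
  "((\<lambda>\<tau>. U (x \<tau>)) has_loop_derivative mono_loop 0 (\<lambda>k. fst y $ k)) (at t within T)"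
  by (subst has_loop_derivative_iff)
    (auto simp: coef_U intro: phase_components(1)[OF x])

lemma V_derivative:
  "((\<lambda>\<tau>. V (x \<tau>)) has_loop_derivative mono_loop (-1) (\<lambda>k. snd y $ k)) (at t within T)"
proof (subst has_loop_derivative_iff)
  show "\<forall>p i. ((\<lambda>\<tau>. coef (V (x \<tau>)) p i) has_real_derivative
      coef (mono_loop (-1) (\<lambda>k. snd y $ k)) p i) (at t within T)"
  proof (intro allI)
    show "((\<lambda>\<tau>. coef (V (x \<tau>)) p i) has_real_derivative
      coef (mono_loop (-1) (\<lambda>k. snd y $ k)) p i) (at t within T)" for p i
      by (cases "p = 0"; cases "p = -1") (auto simp: V_unip coef_unip intro: phase_components(2)[OF x])
  qed
qed auto

lemma cfun_derivative:
  "((\<lambda>\<tau>. cfun h (x \<tau>) k) has_real_derivative dcf h (x t) y k) (at t within T)"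
  unfolding cfun_def dcf_def
  by (rule derivative_eq_intros phase_components[OF x] refl | simp add: algebra_simps)+

lemma C_derivative:
  "((\<lambda>\<tau>. C h (x \<tau>)) has_loop_derivative mono_loop (-1) (dcf h (x t) y)) (at t within T)"
proof (subst has_loop_derivative_iff)
  show "\<forall>p i. ((\<lambda>\<tau>. coef (C h (x \<tau>)) p i) has_real_derivative
      coef (mono_loop (-1) (dcf h (x t) y)) p i) (at t within T)"
  proof (intro allI)
    show "((\<lambda>\<tau>. coef (C h (x \<tau>)) p i) has_real_derivative
      coef (mono_loop (-1) (dcf h (x t) y)) p i) (at t within T)" for p i
      by (cases "p = 0"; cases "p = -1") (auto simp: C_unip coef_unip intro: cfun_derivative)
  qed
qed auto

lemma Cinv_derivative:
  "((\<lambda>\<tau>. Cinv h (x \<tau>)) has_loop_derivative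
     - (Cinv h (x t) \<star> mono_loop (-1) (dcf h (x t) y) \<star> Cinv h (x t))) (at t within T)"
  unfolding Cinv_geo by (rule has_loop_derivative_geo) (rule cfun_derivative)

end

lemma formal_curves_phase:
  assumes "(x has_vector_derivative y) (at 0)"
  shows "formal_curve (\<lambda>\<tau>. U (x \<tau>)) (mono_loop 0 (\<lambda>k. fst y $ k))"
    "formal_curve (\<lambda>\<tau>. V (x \<tau>)) (mono_loop (-1) (\<lambda>k. snd y $ k))"
    "formal_curve (\<lambda>\<tau>. Cinv h (x \<tau>)) (- (Cinv h (x 0) \<star> mono_loop (-1) (dcf h (x 0) y) \<star> Cinv h (x 0)))"
  by (rule formal_curveI[of _ _ 1], rule U_derivative[OF assms], simp_all add: U_above)
    (rule formal_curveI[of _ _ 0], rule V_derivative[OF assms], simp_all add: V_unip unip_above,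
     rule formal_curveI[of _ _ 0], rule Cinv_derivative[OF assms], simp_all add: Cinv_geo geo_above)

section \<open>Poisson maps into the loop algebra and its triple product\<close>

section \<open>Degree-wise evaluation of the bracket\<close>

text \<open>\<open>R0\<close> is the identity on positive and minus the identity on negative
  degrees. So U M = N U kills the commutator except in degrees 0 and 1, where the two neighbouring
  coefficients that meet receive different factors.\<close>

lemma U_R0_commutator:
  assumes "M \<in> loop_alg" "N \<in> loop_alg" and eq: "U x \<star> M = N \<star> U x"
  shows "U x \<star> (R0 M + mono_loop 0 p) - (R0 N + mono_loop 0 q) \<star> U x
    = mono_loop 0 (\<lambda>i. fst x $ i * (coef M 0 i - coef N 0 i + p i - q i))
      + mono_loop 1 (\<lambda>i. coef N 0 i - coef M 0 (prv i) + p (prv i) - q i)"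
proof (rule twisted_eqI)
  fix r i
  have "coef (U x \<star> M) r i = coef (N \<star> U x) r i" by (simp only: eq)
  then have e: "fst x $ i * coef M r i + coef M (r - 1) (prv i)
      = coef N r i * fst x $ shift (- r) i + coef N (r - 1) i"
    by (simp add: coef_U_left coef_U_right assms(1,2))
  have t: "twisted (R0 M + mono_loop 0 p)" "twisted (R0 N + mono_loop 0 q)"
    using assms by auto
  consider "r < 0" | "r = 0" | "r = 1" | "r > 1" by linarith
  then show "coef (U x \<star> (R0 M + mono_loop 0 p) - (R0 N + mono_loop 0 q) \<star> U x) r i
    = coef (mono_loop 0 (\<lambda>i. fst x $ i * (coef M 0 i - coef N 0 i + p i - q i))
      + mono_loop 1 (\<lambda>i. coef N 0 i - coef M 0 (prv i) + p (prv i) - q i)) r i"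
    using e by cases (simp_all add: coef_U_left[OF t(1)] coef_U_right[OF t(2)] coef_R0 assms algebra_simps)
qed (use assms in auto)

text \<open>Here degrees r and r + 1 meet, so the cut leaves degrees -1 and 0.\<close>

lemma unip_R0_commutator:
  assumes "M \<in> loop_alg" "N \<in> loop_alg" and eq: "unip w \<star> M = N \<star> unip w"
  shows "unip w \<star> (R0 M + mono_loop 0 p) - (R0 N + mono_loop 0 q) \<star> unip w
    = mono_loop 0 (\<lambda>i. coef N 0 i - coef M 0 i + p i - q i)
      + mono_loop (-1) (\<lambda>i. w i * (coef M 0 (nxt i) - coef N 0 i + p (nxt i) - q i))"
proof (rule twisted_eqI)
  fix r i
  have "coef (unip w \<star> M) r i = coef (N \<star> unip w) r i" by (simp only: eq)
  then have e: "coef M r i + w i * coef M (r + 1) (nxt i)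
      = coef N r i + coef N (r + 1) i * w (shift (- 1 - r) i)"
    by (simp add: coef_unip_left coef_unip_right assms(1,2))
  have t: "twisted (R0 M + mono_loop 0 p)" "twisted (R0 N + mono_loop 0 q)"
    using assms by auto
  consider "r < -1" | "r = -1" | "r = 0" | "r > 0" by linarith
  then show "coef (unip w \<star> (R0 M + mono_loop 0 p) - (R0 N + mono_loop 0 q) \<star> unip w) r i
    = coef (mono_loop 0 (\<lambda>i. coef N 0 i - coef M 0 i + p i - q i)
      + mono_loop (-1) (\<lambda>i. w i * (coef M 0 (nxt i) - coef N 0 i + p (nxt i) - q i))) r i"
    using e by cases (simp_all add: coef_unip_left[OF t(1)] coef_unip_right[OF t(2)] coef_R0 assms algebra_simps)
qed (use assms in auto)

text \<open>Cyclicity turns the two terms of one slot, tested with \<open>G\<close>, into a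
  commutator with the Lax matrix \<open>L\<close>, which has only two degrees.\<close>

lemma pairing_commutator:
  assumes "L \<in> loop_alg" "G \<in> loop_alg" "P \<in> loop_alg" "Q \<in> loop_alg"
  shows "pairing P (G \<star> L) - pairing Q (L \<star> G) = pairing (L \<star> P - Q \<star> L) G"
  using assms by (simp add: pairing_add loop_pairing_cyclic(1)[of Q L G] loop_pairing_cyclic(2)[of L P G])

text \<open>The trace of a commutator; it supplies the hypothesis of \<open>wd_step\<close>.\<close>

lemma sum_trace_commutator:
  assumes "L \<in> loop_alg" "M \<in> loop_alg"
  shows "(\<Sum>i\<in>UNIV. coef (L \<star> M) 0 i - coef (M \<star> L) 0 i) = 0"
  using loop_pairing_sym[OF assms] by (simp add: pairing_def trace_coef sum_subtractf)

text \<open>The u-component of the Hamiltonian field, where \<open>g\<close> lists the partial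
  derivatives of the Hamilton function in v; in \<open>hamv\<close>, \<open>f\<close> lists those in
  u.\<close>

definition hamu :: "'a::finite phase \<Rightarrow> ('a mod_ring \<Rightarrow> real) \<Rightarrow> 'a mod_ring \<Rightarrow> real" where
  "hamu x g k = fst x $ k * (snd x $ k * g k - snd x $ prv k * g (prv k))"

definition hamv :: "'a::finite phase \<Rightarrow> ('a mod_ring \<Rightarrow> real) \<Rightarrow> 'a mod_ring \<Rightarrow> real" where
  "hamv x f k = snd x $ k * (fst x $ nxt k * f (nxt k) - fst x $ k * f k)"

lemma pb_ham:
  "pb F G x = (\<Sum>k\<in>UNIV. hamu x (\<lambda>k. dv F k x) k * du G k x + hamv x (\<lambda>k. du F k x) k * dv G k x)"
proof -
  let ?t = "\<lambda>k. snd x $ k * fst x $ nxt k * dv F k x * du G (nxt k) x"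
  have "(\<Sum>k\<in>UNIV. snd x $ prv k * fst x $ k * dv F (prv k) x * du G k x) = (\<Sum>k\<in>UNIV. ?t (prv k))"
    by simp
  also have "\<dots> = (\<Sum>k\<in>UNIV. ?t k)" by (rule sum_shift)
  finally show ?thesis
    unfolding pb_def hamu_def hamv_def
    by (simp add: algebra_simps sum.distrib sum_subtractf sum_negf)
qed

text \<open>
  The three slots are the matrices \<open>U\<close>, \<open>C\<close>, \<open>V\<close>. Since \<open>U a' = a U\<close>, \<open>C b = b' C\<close> and \<open>V c' = c V\<close>,
  each of the commutators \<open>L P - Q L\<close> has only two degrees, and one of them vanishes by \<open>wd_step\<close>.
\<close>

lemma slot_bracket:
  fixes x :: "'a::finite phase"
  assumes [simp]: "J \<in> loop_alg" "K \<in> loop_alg" "H \<in> loop_alg" "J' \<in> loop_alg" "K' \<in> loop_alg" "H' \<in> loop_alg"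
    and a: "a = U x \<star> J" "a' = J \<star> U x" and b: "b = K \<star> C h x" "b' = C h x \<star> K"
    and c: "c = V x \<star> H" "c' = H \<star> V x"
    and al: "\<And>i. al i = coef a' 0 i - coef a 0 i" and be: "\<And>i. be i = coef b' 0 i - coef b 0 i"
    and ga: "\<And>i. ga i = coef c' 0 i - coef c 0 i" and z: "z = (\<lambda>i. al i + be i + ga i)"
    and f: "\<And>k. f k = coef J 0 k + h * snd x $ k * coef K 1 (nxt k)"
    and g: "\<And>k. g k = coef H 1 (nxt k) + h * fst x $ k * coef K 1 (nxt k)"
    and f': "\<And>k. f' k = coef J' 0 k + h * snd x $ k * coef K' 1 (nxt k)"
    and g': "\<And>k. g' k = coef H' 1 (nxt k) + h * fst x $ k * coef K' 1 (nxt k)"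
  shows "pairing (R0 a' + mono_loop 0 (\<lambda>i. wd z i + coef a 0 i - be i - ga i)) (J' \<star> U x)
      - pairing (R0 a + mono_loop 0 (\<lambda>i. wd z i + coef a' 0 i + be i + ga i)) (U x \<star> J')
      + pairing (R0 b' + mono_loop 0 (\<lambda>i. wd z i + coef a 0 i + coef a' 0 i + ga i - coef b 0 i)) (C h x \<star> K')
      - pairing (R0 b + mono_loop 0 (\<lambda>i. wd z i + coef a 0 i + coef a' 0 i - coef b' 0 i + ga i)) (K' \<star> C h x)
      + pairing (R0 c' + mono_loop 0 (\<lambda>i. wd z i + coef a 0 i + coef a' 0 i - be i - coef c 0 i)) (H' \<star> V x)
      - pairing (R0 c + mono_loop 0 (\<lambda>i. wd z i + coef a 0 i + coef a' 0 i - be i - coef c' 0 i)) (V x \<star> H')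
    = 2 * (\<Sum>k\<in>UNIV. hamu x g k * f' k + hamv x f k * g' k)"
proof -
  have [simp]: "a \<in> loop_alg" "a' \<in> loop_alg" "b \<in> loop_alg" "b' \<in> loop_alg" "c \<in> loop_alg" "c' \<in> loop_alg"
    by (simp_all add: a b c)
  have "(\<Sum>i\<in>UNIV. al i) = 0" "(\<Sum>i\<in>UNIV. be i) = 0" "(\<Sum>i\<in>UNIV. ga i) = 0"
    using sum_trace_commutator[of J "U x"] sum_trace_commutator[of "C h x" K] sum_trace_commutator[of H "V x"]
    by (simp_all add: al be ga a b c)
  then have "(\<Sum>i\<in>UNIV. z i) = 0" by (simp add: z sum.distrib)
  note st = wd_step[OF this]
  have stz: "wd z k - wd z (nxt k) = al k + be k + ga k + al (nxt k) + be (nxt k) + ga (nxt k)" for k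
    using st[of k] by (simp add: z)
  let ?w = "cfun h x"
  have C: "C h x = unip ?w" and V: "V x = unip (\<lambda>k. snd x $ k)"
    by (simp_all add: C_unip V_unip)
  have bev: "be k = ?w k * coef K 1 (nxt k) - coef K 1 k * ?w (prv k)" for k
    by (simp add: be b C coef_unip_left coef_unip_right)
  have gav: "ga k = snd x $ prv k * coef H 1 k - snd x $ k * coef H 1 (nxt k)" for k
    by (simp add: ga c V coef_unip_left coef_unip_right)
  \<comment> \<open>The field in u is governed by the diagonal commutators of the slots of C and V,
    which are differences over neighbouring sites.\<close>
  have hu: "hamu x g k = - fst x $ k * (be k + ga k)" for k
    by (simp add: hamu_def g bev gav cfun_def algebra_simps)
  have av: "coef a 0 (nxt k) - coef a' 0 k = fst x $ nxt k * coef J 0 (nxt k) - fst x $ k * coef J 0 k" for k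
    by (simp add: a coef_U_left coef_U_right)
  have hv: "hamv x f k = snd x $ k * (coef a 0 (nxt k) - be (nxt k) - coef a' 0 k)" for k
  proof -
    have "coef a 0 (nxt k) - be (nxt k) - coef a' 0 k = fst x $ nxt k * f (nxt k) - fst x $ k * f k"
      using av[of k] by (simp add: f bev cfun_def algebra_simps)
    then show ?thesis by (simp add: hamv_def)
  qed
  have "U x \<star> a' = a \<star> U x" by (simp add: a loop_assoc)
  note u = U_R0_commutator[OF _ _ this, of "\<lambda>i. wd z i + coef a 0 i - be i - ga i"
    "\<lambda>i. wd z i + coef a' 0 i + be i + ga i"]
  have 1: "pairing (R0 a' + mono_loop 0 (\<lambda>i. wd z i + coef a 0 i - be i - ga i)) (J' \<star> U x)
      - pairing (R0 a + mono_loop 0 (\<lambda>i. wd z i + coef a' 0 i + be i + ga i)) (U x \<star> J')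
      = (\<Sum>k\<in>UNIV. 2 * hamu x g k * coef J' 0 k)"
  proof -
    \<comment> \<open>The coefficient of degree 1. U is constant in this degree, and accordingly the
      coefficient vanishes by the telescoping of \<open>wd\<close>.\<close>
    have "coef a 0 i - coef a' 0 (prv i) + (wd z (prv i) + coef a 0 (prv i) - be (prv i) - ga (prv i))
        - (wd z i + coef a' 0 i + be i + ga i) = 0" for i
      using stz[of "prv i"] by (simp add: al)
    then have *: "U x \<star> (R0 a' + mono_loop 0 (\<lambda>i. wd z i + coef a 0 i - be i - ga i))
      - (R0 a + mono_loop 0 (\<lambda>i. wd z i + coef a' 0 i + be i + ga i)) \<star> U x
      = mono_loop 0 (\<lambda>i. 2 * hamu x g i) + mono_loop 1 (\<lambda>_. 0)"
      by (subst u) (simp_all add: hu algebra_simps)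
    show ?thesis
      by (subst pairing_commutator) (simp_all add: * pairing_add pairing_mono)
  qed
  have "unip ?w \<star> b = b' \<star> unip ?w" by (simp add: b C loop_assoc)
  note u = unip_R0_commutator[OF _ _ this,
    of "\<lambda>i. wd z i + coef a 0 i + coef a' 0 i - coef b' 0 i + ga i"
    "\<lambda>i. wd z i + coef a 0 i + coef a' 0 i + ga i - coef b 0 i"]
  have 2: "pairing (R0 b' + mono_loop 0 (\<lambda>i. wd z i + coef a 0 i + coef a' 0 i + ga i - coef b 0 i)) (C h x \<star> K')
      - pairing (R0 b + mono_loop 0 (\<lambda>i. wd z i + coef a 0 i + coef a' 0 i - coef b' 0 i + ga i)) (K' \<star> C h x)
      = (\<Sum>k\<in>UNIV. 2 * h * (snd x $ k * hamu x g k + fst x $ k * hamv x f k) * coef K' 1 (nxt k))"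
  proof -
    let ?y = "\<lambda>i. ?w i * (coef b 0 (nxt i) - coef b' 0 i
        + (wd z (nxt i) + coef a 0 (nxt i) + coef a' 0 (nxt i) - coef b' 0 (nxt i) + ga (nxt i))
        - (wd z i + coef a 0 i + coef a' 0 i + ga i - coef b 0 i))"
    \<comment> \<open>Up to the factor 2 this is the derivative of the coefficient - h u v of C
      along the Hamiltonian field, as it has to be for C to stay a function of u and v.\<close>
    have y: "?y i = - (2 * h * (snd x $ i * hamu x g i + fst x $ i * hamv x f i))" for i
    proof -
      have e: "coef b 0 (nxt i) - coef b' 0 i
        + (wd z (nxt i) + coef a 0 (nxt i) + coef a' 0 (nxt i) - coef b' 0 (nxt i) + ga (nxt i))
        - (wd z i + coef a 0 i + coef a' 0 i + ga i - coef b 0 i)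
        = 2 * (coef a 0 (nxt i) - be (nxt i) - coef a' 0 i - ga i - be i)"
        using stz[of i] by (simp add: al be)
      show ?thesis unfolding e by (simp add: hu hv cfun_def algebra_simps)
    qed
    have *: "unip ?w \<star> (R0 b + mono_loop 0 (\<lambda>i. wd z i + coef a 0 i + coef a' 0 i - coef b' 0 i + ga i))
      - (R0 b' + mono_loop 0 (\<lambda>i. wd z i + coef a 0 i + coef a' 0 i + ga i - coef b 0 i)) \<star> unip ?w
      = mono_loop 0 (\<lambda>_. 0) + mono_loop (-1) (\<lambda>i. - (2 * h * (snd x $ i * hamu x g i + fst x $ i * hamv x f i)))"
      by (subst u) (simp_all only: y, simp_all)
    \<comment> \<open>\<open>b\<close> and \<open>b'\<close> are interchanged because - K acts as
      the gradient with respect to C; this produces the sign.\<close>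
    have "pairing (R0 b + mono_loop 0 (\<lambda>i. wd z i + coef a 0 i + coef a' 0 i - coef b' 0 i + ga i)) (K' \<star> unip ?w)
      - pairing (R0 b' + mono_loop 0 (\<lambda>i. wd z i + coef a 0 i + coef a' 0 i + ga i - coef b 0 i)) (unip ?w \<star> K')
      = - (\<Sum>k\<in>UNIV. 2 * h * (snd x $ k * hamu x g k + fst x $ k * hamv x f k) * coef K' 1 (nxt k))"
      by (subst pairing_commutator) (simp_all add: * pairing_add pairing_mono sum_negf)
    then show ?thesis by (simp add: C)
  qed
  let ?v = "\<lambda>k. snd x $ k"
  have "unip ?v \<star> c' = c \<star> unip ?v" by (simp add: c V loop_assoc)
  note u = unip_R0_commutator[OF _ _ this,
    of "\<lambda>i. wd z i + coef a 0 i + coef a' 0 i - be i - coef c 0 i"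
    "\<lambda>i. wd z i + coef a 0 i + coef a' 0 i - be i - coef c' 0 i"]
  have 3: "pairing (R0 c' + mono_loop 0 (\<lambda>i. wd z i + coef a 0 i + coef a' 0 i - be i - coef c 0 i)) (H' \<star> V x)
      - pairing (R0 c + mono_loop 0 (\<lambda>i. wd z i + coef a 0 i + coef a' 0 i - be i - coef c' 0 i)) (V x \<star> H')
      = (\<Sum>k\<in>UNIV. 2 * hamv x f k * coef H' 1 (nxt k))"
  proof -
    let ?y = "\<lambda>i. snd x $ i * (coef c' 0 (nxt i) - coef c 0 i
        + (wd z (nxt i) + coef a 0 (nxt i) + coef a' 0 (nxt i) - be (nxt i) - coef c 0 (nxt i))
        - (wd z i + coef a 0 i + coef a' 0 i - be i - coef c' 0 i))"
    have y: "?y i = 2 * hamv x f i" for i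
    proof -
      have "coef c' 0 (nxt i) - coef c 0 i
        + (wd z (nxt i) + coef a 0 (nxt i) + coef a' 0 (nxt i) - be (nxt i) - coef c 0 (nxt i))
        - (wd z i + coef a 0 i + coef a' 0 i - be i - coef c' 0 i)
        = 2 * (coef a 0 (nxt i) - be (nxt i) - coef a' 0 i)"
        using stz[of i] by (simp add: al ga)
      then show ?thesis by (simp add: hv)
    qed
    have *: "unip ?v \<star> (R0 c' + mono_loop 0 (\<lambda>i. wd z i + coef a 0 i + coef a' 0 i - be i - coef c 0 i))
      - (R0 c + mono_loop 0 (\<lambda>i. wd z i + coef a 0 i + coef a' 0 i - be i - coef c' 0 i)) \<star> unip ?v
      = mono_loop 0 (\<lambda>_. 0) + mono_loop (-1) (\<lambda>i. 2 * hamv x f i)"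
      by (subst u) (simp_all only: y, simp_all)
    show ?thesis unfolding V
      by (subst pairing_commutator) (simp_all add: * pairing_add pairing_mono)
  qed
  have "2 * (\<Sum>k\<in>UNIV. hamu x g k * f' k + hamv x f k * g' k)
    = (\<Sum>k\<in>UNIV. 2 * hamu x g k * coef J' 0 k)
    + (\<Sum>k\<in>UNIV. 2 * h * (snd x $ k * hamu x g k + fst x $ k * hamv x f k) * coef K' 1 (nxt k))
    + (\<Sum>k\<in>UNIV. 2 * hamv x f k * coef H' 1 (nxt k))"
    by (simp add: f' g' sum_distrib_left algebra_simps flip: sum.distrib)
  with 1 2 3 show ?thesis by linarith
qed

section \<open>The Poisson property of the Lax matrix maps\<close>

text \<open>
  \<open>J\<close>, \<open>- K\<close>, \<open>H\<close> act as the gradients of \<open>F\<close> with respect to \<open>U\<close>, \<open>C\<close>, \<open>V\<close>. Using \<open>C\<close> instead of \<open>C\<^sup>-\<^sup>1\<close>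
  (whose gradient is \<open>G = C K C\<close>) leaves only matrices with at most two degrees.
\<close>

definition slots :: "real \<Rightarrow> ('a::finite phase \<Rightarrow> real) \<Rightarrow> 'a phase \<Rightarrow> 'a loop \<Rightarrow> 'a loop \<Rightarrow> 'a loop \<Rightarrow> bool" where
  "slots h F x J K H \<longleftrightarrow>
     (\<forall>k. du F k x = coef J 0 k + h * snd x $ k * coef K 1 (nxt k)) \<and>
     (\<forall>k. dv F k x = coef H 1 (nxt k) + h * fst x $ k * coef K 1 (nxt k))"

lemma slotsI:
  assumes "\<And>\<xi> y. (\<xi> has_vector_derivative y) (at 0) \<Longrightarrow> \<xi> 0 = x \<Longrightarrow>
    ((\<lambda>t. F (\<xi> t)) has_real_derivative (\<Sum>i\<in>UNIV. fst y $ i * coef J 0 i)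
      - (\<Sum>i\<in>UNIV. dcf h x y i * coef K 1 (nxt i)) + (\<Sum>i\<in>UNIV. snd y $ i * coef H 1 (nxt i))) (at 0)"
  shows "slots h F x J K H"
  unfolding slots_def
proof (intro conjI allI)
  fix k
  have ax: "(\<Sum>i\<in>UNIV. axis k (1::real) $ i * w i) = w k" for w :: "'a mod_ring \<Rightarrow> real"
  proof -
    have "(\<Sum>i\<in>UNIV. axis k (1::real) $ i * w i) = (\<Sum>i\<in>UNIV. if i = k then w i else 0)"
      by (rule sum.cong) (auto simp: axis_def)
    then show ?thesis by simp
  qed
  have 1: "((\<lambda>t. (fst x + t *\<^sub>R axis k 1, snd x)) has_vector_derivative (axis k 1, 0)) (at 0)"
    by (auto intro!: derivative_eq_intros has_vector_derivative_Pair)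
  have 2: "((\<lambda>t. (fst x, snd x + t *\<^sub>R axis k 1)) has_vector_derivative (0, axis k 1)) (at 0)"
    by (auto intro!: derivative_eq_intros has_vector_derivative_Pair)
  have d1: "(\<Sum>i\<in>UNIV. dcf h x (axis k 1, 0) i * coef K 1 (nxt i)) = - (h * snd x $ k * coef K 1 (nxt k))"
    using ax[of "\<lambda>i. h * snd x $ i * coef K 1 (nxt i)"]
    by (simp add: dcf_def sum_negf algebra_simps)
  have d2: "(\<Sum>i\<in>UNIV. dcf h x (0, axis k 1) i * coef K 1 (nxt i)) = - (h * fst x $ k * coef K 1 (nxt k))"
    using ax[of "\<lambda>i. h * fst x $ i * coef K 1 (nxt i)"]
    by (simp add: dcf_def sum_negf algebra_simps)
  from DERIV_imp_deriv[OF assms[OF 1]]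
  show "du F k x = coef J 0 k + h * snd x $ k * coef K 1 (nxt k)"
    unfolding du_def by (simp add: d1 ax)
  from DERIV_imp_deriv[OF assms[OF 2]]
  show "dv F k x = coef H 1 (nxt k) + h * fst x $ k * coef K 1 (nxt k)"
    unfolding dv_def by (simp add: d2 ax)
qed

lemma slots_pairingI:
  assumes J: "J \<in> loop_alg" "K \<in> loop_alg" "H \<in> loop_alg"
    and "\<And>\<xi> y. (\<xi> has_vector_derivative y) (at 0) \<Longrightarrow> \<xi> 0 = x \<Longrightarrow>
    ((\<lambda>t. F (\<xi> t)) has_real_derivative pairing J (mono_loop 0 (\<lambda>k. fst y $ k))
      - pairing K (mono_loop (-1) (dcf h x y)) + pairing H (mono_loop (-1) (\<lambda>k. snd y $ k))) (at 0)"
  shows "slots h F x J K H"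
  by (rule slotsI) (use assms(4) in \<open>simp add: pairing_mono_right J\<close>)

lemma pairing_sandwich:
  assumes "G \<in> loop_alg" "A \<in> loop_alg" "B \<in> loop_alg" "M \<in> loop_alg"
  shows "pairing G (A \<star> M \<star> B) = pairing (B \<star> G \<star> A) M"
    "pairing G (M \<star> B) = pairing (B \<star> G) M" "pairing G (A \<star> M) = pairing (G \<star> A) M"
proof -
  have "pairing G (A \<star> M \<star> B) = pairing (B \<star> G) (A \<star> M)"
    using assms by (simp only: loop_lmul loop_pairing_cyclic(2)[of B G "A \<star> M"])
  also have "\<dots> = pairing (B \<star> G \<star> A) M"
    using assms by (simp only: loop_lmul loop_pairing_cyclic(1)[of "B \<star> G" A M])
  finally show "pairing G (A \<star> M \<star> B) = pairing (B \<star> G \<star> A) M" .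
  show "pairing G (M \<star> B) = pairing (B \<star> G) M" "pairing G (A \<star> M) = pairing (G \<star> A) M"
    using assms by (simp_all only: loop_pairing_cyclic(1)[of G A M] loop_pairing_cyclic(2)[of B G M])
qed

lemma has_grad3:
  assumes "has_grad X \<C> \<Phi> [L1, L2, L3] Gs"
  obtains G1 G2 G3 where "Gs = [G1, G2, G3]" "G1 \<in> X" "G2 \<in> X" "G3 \<in> X"
proof -
  have "length Gs = Suc (Suc (Suc 0))" "set Gs \<subseteq> X" using assms by (auto simp: has_grad_def)
  then show ?thesis using that by (auto simp: length_Suc_conv)
qed

lemma has_grad1:
  assumes "has_grad X \<C> \<Phi> [L] Gs"
  obtains G where "Gs = [G]" "G \<in> X"
proof -
  have "length Gs = Suc 0" "set Gs \<subseteq> X" using assms by (auto simp: has_grad_def)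
  then show ?thesis using that by (auto simp: length_Suc_conv)
qed

lemma has_gradD3:
  assumes "has_grad X \<C> \<Phi> [\<gamma>1 0, \<gamma>2 0, \<gamma>3 0] [G1, G2, G3]"
    and "\<C> \<gamma>1 M1" "\<C> \<gamma>2 M2" "\<C> \<gamma>3 M3"
  shows "((\<lambda>t. \<Phi> [\<gamma>1 t, \<gamma>2 t, \<gamma>3 t]) has_real_derivative
    pairing G1 M1 + pairing G2 M2 + pairing G3 M3) (at 0)"
proof -
  have "\<C> (\<lambda>t. [\<gamma>1 t, \<gamma>2 t, \<gamma>3 t] ! i) ([M1, M2, M3] ! i)" if "i < 3" for i
    using that assms(2-4) by (auto simp: less_Suc_eq numeral_3_eq_3)
  moreover have "\<forall>\<gamma> Ms. length Ms = 3 \<longrightarrow> (\<forall>t. length (\<gamma> t) = 3) \<longrightarrow> \<gamma> 0 = [\<gamma>1 0, \<gamma>2 0, \<gamma>3 0] \<longrightarrow>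
      (\<forall>i<3. \<C> (\<lambda>t. \<gamma> t ! i) (Ms ! i)) \<longrightarrow>
      ((\<lambda>t. \<Phi> (\<gamma> t)) has_real_derivative (\<Sum>i<3. pairing ([G1, G2, G3] ! i) (Ms ! i))) (at 0)"
    using assms(1) unfolding has_grad_def by (simp add: numeral_3_eq_3)
  ultimately have "((\<lambda>t. \<Phi> [\<gamma>1 t, \<gamma>2 t, \<gamma>3 t]) has_real_derivative
      (\<Sum>i<3. pairing ([G1, G2, G3] ! i) ([M1, M2, M3] ! i))) (at 0)"
    by (elim allE[of _ "\<lambda>t. [\<gamma>1 t, \<gamma>2 t, \<gamma>3 t]"] allE[of _ "[M1, M2, M3]"]) auto
  then show ?thesis by (simp add: numeral_3_eq_3)
qed

lemma has_gradD1:
  assumes "has_grad X \<C> \<Phi> [\<gamma> 0] [G]" and "\<C> \<gamma> M"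
  shows "((\<lambda>t. \<Phi> [\<gamma> t]) has_real_derivative pairing G M) (at 0)"
proof -
  have "\<forall>\<delta> Ms. length Ms = 1 \<longrightarrow> (\<forall>t. length (\<delta> t) = 1) \<longrightarrow> \<delta> 0 = [\<gamma> 0] \<longrightarrow>
      (\<forall>i<1. \<C> (\<lambda>t. \<delta> t ! i) (Ms ! i)) \<longrightarrow>
      ((\<lambda>t. \<Phi> (\<delta> t)) has_real_derivative (\<Sum>i<1. pairing ([G] ! i) (Ms ! i))) (at 0)"
    using assms(1) unfolding has_grad_def by simp
  then have "((\<lambda>t. \<Phi> [\<gamma> t]) has_real_derivative (\<Sum>i<1. pairing ([G] ! i) ([M] ! i))) (at 0)"
    by (elim allE[of _ "\<lambda>t. [\<gamma> t]"] allE[of _ "[M]"]) (use assms(2) in auto)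
  then show ?thesis by simp
qed

lemma slots_triple:
  assumes "has_grad loop_alg formal_curve \<Phi> [U x, Cinv h x, V x] [G1, G2, G3]"
    and G: "G1 \<in> loop_alg" "G2 \<in> loop_alg" "G3 \<in> loop_alg"
  shows "slots h (\<lambda>y. \<Phi> [U y, Cinv h y, V y]) x G1 (Cinv h x \<star> G2 \<star> Cinv h x) G3"
proof (rule slots_pairingI)
  fix \<xi> :: "real \<Rightarrow> 'a phase" and y assume \<xi>: "(\<xi> has_vector_derivative y) (at 0)" "\<xi> 0 = x"
  note d = has_gradD3[of loop_alg formal_curve \<Phi> "\<lambda>t. U (\<xi> t)" "\<lambda>t. Cinv h (\<xi> t)" "\<lambda>t. V (\<xi> t)",
      unfolded \<xi>(2), OF assms(1) formal_curves_phase(1)[OF \<xi>(1)] formal_curves_phase(3)[OF \<xi>(1)]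
      formal_curves_phase(2)[OF \<xi>(1)]]
  show "((\<lambda>t. \<Phi> [U (\<xi> t), Cinv h (\<xi> t), V (\<xi> t)]) has_real_derivative
      pairing G1 (mono_loop 0 (\<lambda>k. fst y $ k))
      - pairing (Cinv h x \<star> G2 \<star> Cinv h x) (mono_loop (-1) (dcf h x y))
      + pairing G3 (mono_loop (-1) (\<lambda>k. snd y $ k))) (at 0)"
    using d pairing_sandwich(1)[of G2 "Cinv h x" "Cinv h x" "mono_loop (-1) (dcf h x y)"]
    by (simp add: \<xi>(2) pairing_minus G)
qed (use G in auto)

text \<open>Leibniz rule and cyclicity: the gradient with respect to a factor is the cyclic word in
  G, U, V, C^-1 cut open at that factor. For C^-1 the resulting word G U V is enclosed in C^-1 on
  both sides, with the sign absorbed in the convention for K.\<close>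

lemma slots_UVC:
  assumes "has_grad loop_alg formal_curve \<Phi> [UVC h x] [G]" and G: "G \<in> loop_alg"
  shows "slots h (\<lambda>y. \<Phi> [UVC h y]) x (V x \<star> Cinv h x \<star> G)
    (Cinv h x \<star> (G \<star> U x \<star> V x) \<star> Cinv h x) (Cinv h x \<star> G \<star> U x)"
proof (rule slots_pairingI)
  fix \<xi> :: "real \<Rightarrow> 'a phase" and y assume \<xi>: "(\<xi> has_vector_derivative y) (at 0)" "\<xi> 0 = x"
  note f = formal_curves_phase[OF \<xi>(1), unfolded \<xi>(2)]
  note d = has_gradD1[of loop_alg formal_curve \<Phi> "\<lambda>t. UVC h (\<xi> t)", unfolded \<xi>(2), OF assms(1)
      formal_curve_lmul[OF formal_curve_lmul[OF f(1,2)] f(3)]]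
  show "((\<lambda>t. \<Phi> [UVC h (\<xi> t)]) has_real_derivative
      pairing (V x \<star> Cinv h x \<star> G) (mono_loop 0 (\<lambda>k. fst y $ k))
      - pairing (Cinv h x \<star> (G \<star> U x \<star> V x) \<star> Cinv h x) (mono_loop (-1) (dcf h x y))
      + pairing (Cinv h x \<star> G \<star> U x) (mono_loop (-1) (\<lambda>k. snd y $ k))) (at 0)"
    using d pairing_sandwich(2)[OF G _ _ loop_mono, of "U x" "V x \<star> Cinv h x" 0 "\<lambda>k. fst y $ k"]
      pairing_sandwich(1)[OF G _ _ loop_mono, of "U x" "Cinv h x" "-1" "\<lambda>k. snd y $ k"]
      pairing_sandwich(1)[OF G _ _ loop_mono, of "U x \<star> V x \<star> Cinv h x" "Cinv h x" "-1" "dcf h x y"]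
    by (simp add: \<xi>(2) G loop_distrib pairing_add lmul_minus_right lmul_minus_left pairing_minus loop_assoc
        algebra_simps)
qed (use G in auto)

lemma slots_VCU:
  assumes "has_grad loop_alg formal_curve \<Phi> [VCU h x] [G]" and G: "G \<in> loop_alg"
  shows "slots h (\<lambda>y. \<Phi> [VCU h y]) x (G \<star> V x \<star> Cinv h x)
    (Cinv h x \<star> (U x \<star> G \<star> V x) \<star> Cinv h x) (Cinv h x \<star> U x \<star> G)"
proof (rule slots_pairingI)
  fix \<xi> :: "real \<Rightarrow> 'a phase" and y assume \<xi>: "(\<xi> has_vector_derivative y) (at 0)" "\<xi> 0 = x"
  note f = formal_curves_phase[OF \<xi>(1), unfolded \<xi>(2)]
  note d = has_gradD1[of loop_alg formal_curve \<Phi> "\<lambda>t. VCU h (\<xi> t)", unfolded \<xi>(2), OF assms(1)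
      formal_curve_lmul[OF formal_curve_lmul[OF f(2,3)] f(1)]]
  show "((\<lambda>t. \<Phi> [VCU h (\<xi> t)]) has_real_derivative
      pairing (G \<star> V x \<star> Cinv h x) (mono_loop 0 (\<lambda>k. fst y $ k))
      - pairing (Cinv h x \<star> (U x \<star> G \<star> V x) \<star> Cinv h x) (mono_loop (-1) (dcf h x y))
      + pairing (Cinv h x \<star> U x \<star> G) (mono_loop (-1) (\<lambda>k. snd y $ k))) (at 0)"
    using d pairing_sandwich(3)[OF G _ _ loop_mono, of "V x \<star> Cinv h x" "U x" 0 "\<lambda>k. fst y $ k"]
      pairing_sandwich(2)[OF G _ _ loop_mono, of "U x" "Cinv h x \<star> U x" "-1" "\<lambda>k. snd y $ k"]
      pairing_sandwich(1)[OF G _ _ loop_mono, of "V x \<star> Cinv h x" "Cinv h x \<star> U x" "-1" "dcf h x y"]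
    by (simp add: \<xi>(2) G loop_distrib pairing_add lmul_minus_right lmul_minus_left pairing_minus loop_assoc
        algebra_simps)
qed (use G in auto)

lemma slots_CUV:
  assumes "has_grad loop_alg formal_curve \<Phi> [CUV h x] [G]" and G: "G \<in> loop_alg"
  shows "slots h (\<lambda>y. \<Phi> [CUV h y]) x (V x \<star> G \<star> Cinv h x)
    (Cinv h x \<star> (U x \<star> V x \<star> G) \<star> Cinv h x) (G \<star> Cinv h x \<star> U x)"
proof (rule slots_pairingI)
  fix \<xi> :: "real \<Rightarrow> 'a phase" and y assume \<xi>: "(\<xi> has_vector_derivative y) (at 0)" "\<xi> 0 = x"
  note f = formal_curves_phase[OF \<xi>(1), unfolded \<xi>(2)]
  note d = has_gradD1[of loop_alg formal_curve \<Phi> "\<lambda>t. CUV h (\<xi> t)", unfolded \<xi>(2), OF assms(1)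
      formal_curve_lmul[OF formal_curve_lmul[OF f(3,1)] f(2)]]
  show "((\<lambda>t. \<Phi> [CUV h (\<xi> t)]) has_real_derivative
      pairing (V x \<star> G \<star> Cinv h x) (mono_loop 0 (\<lambda>k. fst y $ k))
      - pairing (Cinv h x \<star> (U x \<star> V x \<star> G) \<star> Cinv h x) (mono_loop (-1) (dcf h x y))
      + pairing (G \<star> Cinv h x \<star> U x) (mono_loop (-1) (\<lambda>k. snd y $ k))) (at 0)"
    using d pairing_sandwich(1)[OF G _ _ loop_mono, of "Cinv h x" "V x" 0 "\<lambda>k. fst y $ k"]
      pairing_sandwich(3)[OF G _ _ loop_mono, of "Cinv h x \<star> U x" "U x" "-1" "\<lambda>k. snd y $ k"]
      pairing_sandwich(1)[OF G _ _ loop_mono, of "Cinv h x" "Cinv h x \<star> U x \<star> V x" "-1" "dcf h x y"]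
    by (simp add: \<xi>(2) G loop_distrib pairing_add lmul_minus_right lmul_minus_left pairing_minus loop_assoc
        algebra_simps)
qed (use G in auto)

lemma pb_slots:
  assumes "slots h F x J K H" "slots h F' x J' K' H'"
  shows "pb F F' x = (\<Sum>k\<in>UNIV. hamu x (\<lambda>k. coef H 1 (nxt k) + h * fst x $ k * coef K 1 (nxt k)) k
        * (coef J' 0 k + h * snd x $ k * coef K' 1 (nxt k))
      + hamv x (\<lambda>k. coef J 0 k + h * snd x $ k * coef K 1 (nxt k)) k
        * (coef H' 1 (nxt k) + h * fst x $ k * coef K' 1 (nxt k)))"
proof -
  have "(\<lambda>k. dv F k x) = (\<lambda>k. coef H 1 (nxt k) + h * fst x $ k * coef K 1 (nxt k))"
    "(\<lambda>k. du F k x) = (\<lambda>k. coef J 0 k + h * snd x $ k * coef K 1 (nxt k))"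
    using assms(1) by (auto simp: slots_def)
  then show ?thesis using assms(2) unfolding pb_ham slots_def by simp
qed

text \<open>The entries of the three block matrices are collected for each of the six products of a
  Lax matrix and its gradient. All six sums contain the same term \<open>wd z\<close>; they differ
  in the signs of the diagonal parts, which stem from \<open>P0\<close> in \<open>S\<close> and
  \<open>Sst\<close>.\<close>

lemma PB2_triple:
  fixes a a' b b' c c' :: "'a::finite loop"
  assumes G: "grad \<Phi> [L1, L2, L3] = [G1, G2, G3]" "grad \<Psi> [L1, L2, L3] = [G1', G2', G3']"
    and a: "a = L1 \<star> G1" "a' = G1 \<star> L1" and b: "b = L2 \<star> G2" "b' = G2 \<star> L2"
    and c: "c = L3 \<star> G3" "c' = G3 \<star> L3"
    and [simp]: "L1 \<in> loop_alg" "L2 \<in> loop_alg" "L3 \<in> loop_alg" "G1 \<in> loop_alg" "G2 \<in> loop_alg"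
      "G3 \<in> loop_alg" "G1' \<in> loop_alg" "G2' \<in> loop_alg" "G3' \<in> loop_alg"
    and al: "\<And>i. al i = coef a' 0 i - coef a 0 i" and be: "\<And>i. be i = coef b' 0 i - coef b 0 i"
    and ga: "\<And>i. ga i = coef c' 0 i - coef c 0 i" and z: "z = (\<lambda>i. al i + be i + ga i)"
  shows "2 * PB2 A1_mat A2_mat S_mat \<Phi> \<Psi> [L1, L2, L3] =
      pairing (R0 a' + mono_loop 0 (\<lambda>i. wd z i + coef a 0 i - be i - ga i)) (G1' \<star> L1)
      - pairing (R0 a + mono_loop 0 (\<lambda>i. wd z i + coef a' 0 i + be i + ga i)) (L1 \<star> G1')
      + pairing (R0 b' + mono_loop 0 (\<lambda>i. wd z i + coef a 0 i + coef a' 0 i + ga i - coef b 0 i)) (G2' \<star> L2)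
      - pairing (R0 b + mono_loop 0 (\<lambda>i. wd z i + coef a 0 i + coef a' 0 i - coef b' 0 i + ga i)) (L2 \<star> G2')
      + pairing (R0 c' + mono_loop 0 (\<lambda>i. wd z i + coef a 0 i + coef a' 0 i - be i - coef c 0 i)) (G3' \<star> L3)
      - pairing (R0 c + mono_loop 0 (\<lambda>i. wd z i + coef a 0 i + coef a' 0 i - be i - coef c' 0 i)) (L3 \<star> G3')"
proof -
  have [simp]: "a \<in> loop_alg" "a' \<in> loop_alg" "b \<in> loop_alg" "b' \<in> loop_alg" "c \<in> loop_alg" "c' \<in> loop_alg"
    by (simp_all add: a b c)
  have wz: "wd z i = wd (coef a' 0) i - wd (coef a 0) i + (wd (coef b' 0) i - wd (coef b 0) i)
      + (wd (coef c' 0) i - wd (coef c 0) i)" for i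
    by (simp add: z al be ga wd_linear)
  note ops = A1_mono A2_mono S_mono Sst_mono
  have p1: "A1 a' - S b' - S c' + S a + S b + S c
      = R0 a' + mono_loop 0 (\<lambda>i. wd z i + coef a 0 i - be i - ga i)"
    by (rule twisted_eqI) (simp_all add: ops wz be ga)
  have q1: "A2 a - Sst b - Sst c + Sst a' + Sst b' + Sst c'
      = R0 a + mono_loop 0 (\<lambda>i. wd z i + coef a' 0 i + be i + ga i)"
    by (rule twisted_eqI) (simp_all add: ops wz be ga)
  have p2: "Sst a' + A1 b' + Sst c' + S a - Sst b - Sst c
      = R0 b' + mono_loop 0 (\<lambda>i. wd z i + coef a 0 i + coef a' 0 i + ga i - coef b 0 i)"
    by (rule twisted_eqI) (simp_all add: ops wz be ga)
  have q2: "S a + A2 b - Sst c + Sst a' - S b' + Sst c'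
      = R0 b + mono_loop 0 (\<lambda>i. wd z i + coef a 0 i + coef a' 0 i - coef b' 0 i + ga i)"
    by (rule twisted_eqI) (simp_all add: ops wz be ga)
  have p3: "Sst a' - S b' + A1 c' + S a + S b - Sst c
      = R0 c' + mono_loop 0 (\<lambda>i. wd z i + coef a 0 i + coef a' 0 i - be i - coef c 0 i)"
    by (rule twisted_eqI) (simp_all add: ops wz be ga)
  have q3: "S a + S b + A2 c + Sst a' - S b' - S c'
      = R0 c + mono_loop 0 (\<lambda>i. wd z i + coef a 0 i + coef a' 0 i - be i - coef c' 0 i)"
    by (rule twisted_eqI) (simp_all add: ops wz be ga)
  have [simp]: "A1 M \<in> loop_alg" "A2 M \<in> loop_alg" "S M \<in> loop_alg" "Sst M \<in> loop_alg"
    if "M \<in> loop_alg" for M :: "'a loop"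
    using that by (simp_all add: ops)
  show ?thesis
    unfolding PB2_def G Let_def p1[symmetric] q1[symmetric] p2[symmetric] q2[symmetric]
      p3[symmetric] q3[symmetric]
    by (simp add: numeral_3_eq_3 A1_mat_def A2_mat_def S_mat_def adj_S adj_minus_Sst
        pairing_add pairing_minus flip: a b c)
      (simp add: add_divide_distrib diff_divide_distrib)
qed

lemma PB2_single:
  fixes d d' :: "'a::finite loop"
  assumes G: "grad \<Phi> [L] = [G]" "grad \<Psi> [L] = [G']"
    and d: "d = L \<star> G" "d' = G \<star> L"
    and [simp]: "L \<in> loop_alg" "G \<in> loop_alg" "G' \<in> loop_alg"
    and z: "z = (\<lambda>i. coef d' 0 i - coef d 0 i)"
  shows "2 * PB2 [[A1]] [[A2]] [[S]] \<Phi> \<Psi> [L] =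
      pairing (R0 d' + mono_loop 0 (\<lambda>i. wd z i + coef d 0 i)) (G' \<star> L)
      - pairing (R0 d + mono_loop 0 (\<lambda>i. wd z i + coef d' 0 i)) (L \<star> G')"
proof -
  have [simp]: "d \<in> loop_alg" "d' \<in> loop_alg" by (simp_all add: d)
  note ops = A1_mono A2_mono S_mono Sst_mono
  have p: "A1 d' + S d = R0 d' + mono_loop 0 (\<lambda>i. wd z i + coef d 0 i)"
    by (rule twisted_eqI) (simp_all add: ops z wd_linear)
  have q: "A2 d + Sst d' = R0 d + mono_loop 0 (\<lambda>i. wd z i + coef d' 0 i)"
    by (rule twisted_eqI) (simp_all add: ops z wd_linear)
  have [simp]: "A1 M \<in> loop_alg" "A2 M \<in> loop_alg" "S M \<in> loop_alg" "Sst M \<in> loop_alg"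
    if "M \<in> loop_alg" for M :: "'a loop"
    using that by (simp_all add: ops)
  show ?thesis
    unfolding PB2_def G Let_def p[symmetric] q[symmetric]
    by (simp add: adj_S pairing_add flip: d)
qed

lemma differentiable_coordinate:
  "(\<lambda>y. fst y $ k) differentiable (at (x :: 'a::finite phase))"
  "(\<lambda>y. snd y $ k) differentiable (at (x :: 'a::finite phase))"
  by (rule bounded_linear_imp_differentiable, intro bounded_linear_compose[OF bounded_linear_vec_nth]
      bounded_linear_fst bounded_linear_snd)+

lemma differentiable_mono:
  assumes "\<And>k. (\<lambda>y. w y k) differentiable (at x)"
  shows "(\<lambda>y. mono_loop r (w y) p) differentiable (at x)"
proof -
  have "(\<lambda>y. mono_loop r (w y) p) = (\<lambda>y. if p = r then \<Sum>k\<in>UNIV. w y k *\<^sub>R E k (shift (- r) k) else 0)"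
    by (rule ext) (simp add: lam_def flip: lam_scale_E)
  moreover have "(\<lambda>y. \<Sum>k\<in>UNIV. w y k *\<^sub>R E k (shift (- r) k)) differentiable (at x)"
  proof (intro differentiable_sum ballI finite)
    show "(\<lambda>y. w y k *\<^sub>R E k (shift (- r) k)) differentiable (at x)" for k
      using assms[of k] unfolding differentiable_def
      by (elim exE) (rule exI, erule has_derivative_scaleR_left)
  qed
  ultimately show ?thesis by (cases "p = r") auto
qed

lemma differentiable_matmul:
  fixes A :: "'b::real_normed_vector \<Rightarrow> real^'n^'m" and B :: "'b \<Rightarrow> real^'k^'n"
  assumes "A differentiable (at x)" "B differentiable (at x)"
  shows "(\<lambda>y. A y ** B y) differentiable (at x)"
  using assms bounded_bilinear.FDERIV[OF bounded_bilinear_matmul] unfolding differentiable_def by blast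

lemma differentiable_lmul:
  assumes "\<And>q. (\<lambda>y. L y q) differentiable (at x)" "\<And>q. (\<lambda>y. M y q) differentiable (at x)"
    and b: "\<And>y p. p > d \<Longrightarrow> L y p = 0" "\<And>y p. p > e \<Longrightarrow> M y p = 0"
  shows "(\<lambda>y. (L y \<star> M y) p) differentiable (at x)"
proof -
  have "(\<lambda>y. (L y \<star> M y) p) = (\<lambda>y. \<Sum>q\<in>{p - e..d}. L y q ** M y (p - q))"
    by (rule ext) (rule lmul_bounded[OF b])
  then show ?thesis
    by (simp only:) (intro differentiable_sum ballI differentiable_matmul assms finite_atLeastAtMost_int)
qed

lemma differentiable_add_loop:
  assumes "(\<lambda>y. L y p) differentiable (at x)" "(\<lambda>y. M y p) differentiable (at x)"
  shows "(\<lambda>y. (L y + M y) p) differentiable (at x)"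
  using assms by simp

lemma differentiable_U: "(\<lambda>y. U y p) differentiable (at x)"
  unfolding U_mono
  by (intro differentiable_add_loop differentiable_mono differentiable_coordinate differentiable_const)

lemma differentiable_V: "(\<lambda>y. V y p) differentiable (at x)"
  unfolding V_unip unip_def
  by (intro differentiable_add_loop differentiable_mono differentiable_coordinate differentiable_const)

lemma differentiable_cfun: "(\<lambda>y. cfun h y k) differentiable (at x)"
  unfolding cfun_def
  by (intro differentiable_minus differentiable_mult differentiable_coordinate differentiable_const)

text \<open>Induction on the degree: C C^-1 = I expresses each coefficient of C^-1 through the
  preceding one.\<close>

lemma differentiable_Cinv: "(\<lambda>y. Cinv h y p) differentiable (at x)"
proof -
  have rec: "Cinv h y (- int (Suc n)) = - (mono_loop (-1) (cfun h y) (-1) ** Cinv h y (- int n))" for y n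
  proof -
    have 1: "(C h y \<star> Cinv h y) (- int (Suc n)) = 0" by (simp add: lone_mono mono_loop_neq)
    have 2: "C h y \<star> Cinv h y = Cinv h y + mono_loop (-1) (cfun h y) \<star> Cinv h y"
      by (simp add: C_unip unip_def lmul_add_left flip: lone_mono)
    have 3: "(mono_loop (-1) (cfun h y) \<star> Cinv h y) (- int (Suc n))
        = mono_loop (-1) (cfun h y) (-1) ** Cinv h y (- int n)"
      by (subst lmul_finite_left[of "{-1}"]) (simp_all add: mono_loop_neq)
    show ?thesis using 1 unfolding 2 by (simp only: plus_fun_def 3 eq_neg_iff_add_eq_0)
  qed
  have "(\<lambda>y. Cinv h y (- int n)) differentiable (at x)" for n
  proof (induction n)
    case 0
    have "Cinv h y 0 = mat 1" for y :: "'a phase"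
      by (simp add: Cinv_geo geo_def mat_def vec_eq_iff)
    then show ?case by simp
  next
    case (Suc n)
    show ?case unfolding rec
      by (intro differentiable_minus differentiable_matmul differentiable_mono differentiable_cfun Suc)
  qed
  from this[of "nat (- p)"] show ?thesis
    by (cases "p \<le> 0") (simp_all add: Cinv_geo geo_above)
qed

lemma C_Cinv_assoc: "M \<in> loop_alg \<Longrightarrow> C h x \<star> (Cinv h x \<star> M) = M"
  "M \<in> loop_alg \<Longrightarrow> Cinv h x \<star> (C h x \<star> M) = M"
  by (simp_all flip: loop_assoc)

lemma Cinv_above: "p > 0 \<Longrightarrow> Cinv h x p = 0"
  and V_above: "p > 0 \<Longrightarrow> V x p = 0"
  by (simp_all add: Cinv_geo geo_above V_unip unip_above)

lemma lmul_above:
  assumes "\<And>p. p > d \<Longrightarrow> L p = 0" "\<And>p. p > e \<Longrightarrow> M p = 0" "p > d + e"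
  shows "(L \<star> M) p = 0"
  using lmul_bounded[of d L e M p] assms by simp

theorem poisson_lax_triple:
  "poisson_lax_map 3 A1_mat A2_mat S_mat (\<lambda>x :: 'a::finite phase. [U x, Cinv h x, V x])"
  unfolding poisson_lax_map_def
proof (intro conjI allI impI)
  fix x :: "'a phase" and p :: int and i :: nat
  assume "i < 3"
  then consider "i = 0" | "i = 1" | "i = 2" by linarith
  then show "(\<lambda>y. ([U y, Cinv h y, V y] ! i) p) differentiable (at x)"
    by cases (simp_all add: differentiable_U differentiable_V differentiable_Cinv)
next
  fix x :: "'a phase" and \<Phi> \<Psi>
  let ?T = "\<lambda>x. [U x, Cinv h x, V x]"
  assume "\<exists>Gs. has_grad loop_alg formal_curve \<Phi> (?T x) Gs" "\<exists>Gs. has_grad loop_alg formal_curve \<Psi> (?T x) Gs"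
  \<comment> \<open>\<open>grad\<close> is a choice, so the existence of a gradient makes the chosen
    list one.\<close>
  then have g: "has_grad loop_alg formal_curve \<Phi> (?T x) (grad \<Phi> (?T x))"
    "has_grad loop_alg formal_curve \<Psi> (?T x) (grad \<Psi> (?T x))"
    unfolding grad_def by (auto intro: someI_ex)
  obtain G1 G2 G3 where G: "grad \<Phi> (?T x) = [G1, G2, G3]" "G1 \<in> loop_alg" "G2 \<in> loop_alg" "G3 \<in> loop_alg"
    using has_grad3[OF g(1)] by metis
  obtain G1' G2' G3' where G': "grad \<Psi> (?T x) = [G1', G2', G3']" "G1' \<in> loop_alg" "G2' \<in> loop_alg" "G3' \<in> loop_alg"
    using has_grad3[OF g(2)] by metis
  let ?K = "Cinv h x \<star> G2 \<star> Cinv h x" and ?K' = "Cinv h x \<star> G2' \<star> Cinv h x"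
  \<comment> \<open>With K = C^-1 G C^-1 the products K C and C K equal C^-1 G and G C^-1, so the
    slot of C reproduces the slot of C^-1 in the bracket.\<close>
  have k: "?K \<star> C h x = Cinv h x \<star> G2" "C h x \<star> ?K = G2 \<star> Cinv h x"
    "?K' \<star> C h x = Cinv h x \<star> G2'" "C h x \<star> ?K' = G2' \<star> Cinv h x"
    using G G' by (simp_all add: loop_assoc C_Cinv_assoc)
  have "2 * PB2 A1_mat A2_mat S_mat \<Phi> \<Psi> (?T x) = 2 * pb (\<lambda>y. \<Phi> (?T y)) (\<lambda>y. \<Psi> (?T y)) x"
    unfolding pb_slots[OF slots_triple[OF g(1)[unfolded G(1)] G(2-4)] slots_triple[OF g(2)[unfolded G'(1)] G'(2-4)]]
    by (subst slot_bracket[OF G(2) _ G(4) G'(2) _ G'(4) refl refl refl refl refl refl refl refl refl refl refl refl refl refl,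
        of ?K ?K', symmetric], simp add: G, simp add: G', unfold k,
        rule PB2_triple[OF G(1) G'(1)]) (simp_all add: G G')
  then show "pb (\<lambda>y. \<Phi> (?T y)) (\<lambda>y. \<Psi> (?T y)) x = PB2 A1_mat A2_mat S_mat \<Phi> \<Psi> (?T x)" by simp
qed simp_all

text \<open>
  For a function of \<open>L = U V C\<^sup>-\<^sup>1\<close> (or of a cyclic permutation), with gradient \<open>G\<close>, the six products of
  the slots reduce to \<open>L G\<close>, \<open>G L\<close> and two further products whose contributions cancel.
\<close>

lemma pb_single:
  fixes x :: "'a::finite phase"
  assumes T: "\<And>\<Phi> G. has_grad loop_alg formal_curve \<Phi> [L x] [G] \<Longrightarrow> G \<in> loop_alg \<Longrightarrow>
      slots h (\<lambda>y. \<Phi> [L y]) x (J G) (K G) (H G)"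
    and JKH: "\<And>G. G \<in> loop_alg \<Longrightarrow> J G \<in> loop_alg" "\<And>G. G \<in> loop_alg \<Longrightarrow> K G \<in> loop_alg"
      "\<And>G. G \<in> loop_alg \<Longrightarrow> H G \<in> loop_alg"
    and L: "L x \<in> loop_alg"
    and cases: "(\<forall>G\<in>loop_alg. U x \<star> J G = L x \<star> G \<and> C h x \<star> K G = G \<star> L x \<and>
         J G \<star> U x = V x \<star> H G \<and> K G \<star> C h x = H G \<star> V x)
      \<or> (\<forall>G\<in>loop_alg. V x \<star> H G = L x \<star> G \<and> J G \<star> U x = G \<star> L x \<and>
         U x \<star> J G = C h x \<star> K G \<and> K G \<star> C h x = H G \<star> V x)
      \<or> (\<forall>G\<in>loop_alg. K G \<star> C h x = L x \<star> G \<and> H G \<star> V x = G \<star> L x \<and>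
         U x \<star> J G = C h x \<star> K G \<and> J G \<star> U x = V x \<star> H G)"
    and g: "\<exists>Gs. has_grad loop_alg formal_curve \<Phi> [L x] Gs" "\<exists>Gs. has_grad loop_alg formal_curve \<Psi> [L x] Gs"
  shows "pb (\<lambda>y. \<Phi> [L y]) (\<lambda>y. \<Psi> [L y]) x = PB2 [[A1]] [[A2]] [[S]] \<Phi> \<Psi> [L x]"
proof -
  have g: "has_grad loop_alg formal_curve \<Phi> [L x] (grad \<Phi> [L x])"
    "has_grad loop_alg formal_curve \<Psi> [L x] (grad \<Psi> [L x])"
    using g unfolding grad_def by (auto intro: someI_ex)
  obtain G where G: "grad \<Phi> [L x] = [G]" "G \<in> loop_alg" using has_grad1[OF g(1)] by metis
  obtain G' where G': "grad \<Psi> [L x] = [G']" "G' \<in> loop_alg" using has_grad1[OF g(2)] by metis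
  note pb = pb_slots[OF T[OF g(1)[unfolded G(1)] G(2)] T[OF g(2)[unfolded G'(1)] G'(2)]]
  note sb = slot_bracket[OF JKH[OF G(2)] JKH[OF G'(2)] refl refl refl refl refl refl
    refl refl refl refl refl refl refl refl, where x = x and h = h]
  note PB = PB2_single[OF G(1) G'(1) refl refl L G(2) G'(2) refl]
  have "2 * PB2 [[A1]] [[A2]] [[S]] \<Phi> \<Psi> [L x] = 2 * pb (\<lambda>y. \<Phi> [L y]) (\<lambda>y. \<Psi> [L y]) x"
    using cases
  proof (elim disjE)
    \<comment> \<open>The case L = U V C^-1: the slots of U and C carry L G and G L, while the other
      four products coincide in pairs and their terms cancel. The remaining two cases are the cyclic
      permutations V C^-1 U and C^-1 U V.\<close>
    assume a: "\<forall>G\<in>loop_alg. U x \<star> J G = L x \<star> G \<and> C h x \<star> K G = G \<star> L x \<and>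
         J G \<star> U x = V x \<star> H G \<and> K G \<star> C h x = H G \<star> V x"
    have e: "U x \<star> J G = L x \<star> G" "C h x \<star> K G = G \<star> L x" "J G \<star> U x = V x \<star> H G" "K G \<star> C h x = H G \<star> V x"
      "U x \<star> J G' = L x \<star> G'" "C h x \<star> K G' = G' \<star> L x" "J G' \<star> U x = V x \<star> H G'" "K G' \<star> C h x = H G' \<star> V x"
      using a G(2) G'(2) by auto
    show ?thesis unfolding PB pb sb[symmetric, unfolded e]
      by (simp add: algebra_simps)
  next
    assume a: "\<forall>G\<in>loop_alg. V x \<star> H G = L x \<star> G \<and> J G \<star> U x = G \<star> L x \<and>
         U x \<star> J G = C h x \<star> K G \<and> K G \<star> C h x = H G \<star> V x"
    have e: "V x \<star> H G = L x \<star> G" "J G \<star> U x = G \<star> L x" "U x \<star> J G = C h x \<star> K G" "K G \<star> C h x = H G \<star> V x"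
      "V x \<star> H G' = L x \<star> G'" "J G' \<star> U x = G' \<star> L x" "U x \<star> J G' = C h x \<star> K G'" "K G' \<star> C h x = H G' \<star> V x"
      using a G(2) G'(2) by auto
    show ?thesis unfolding PB pb sb[symmetric, unfolded e]
      by (simp add: algebra_simps)
  next
    assume a: "\<forall>G\<in>loop_alg. K G \<star> C h x = L x \<star> G \<and> H G \<star> V x = G \<star> L x \<and>
         U x \<star> J G = C h x \<star> K G \<and> J G \<star> U x = V x \<star> H G"
    have e: "K G \<star> C h x = L x \<star> G" "H G \<star> V x = G \<star> L x" "U x \<star> J G = C h x \<star> K G" "J G \<star> U x = V x \<star> H G"
      "K G' \<star> C h x = L x \<star> G'" "H G' \<star> V x = G' \<star> L x" "U x \<star> J G' = C h x \<star> K G'" "J G' \<star> U x = V x \<star> H G'"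
      using a G(2) G'(2) by auto
    show ?thesis unfolding PB pb sb[symmetric, unfolded e]
      by (simp add: algebra_simps)
  qed
  then show ?thesis by simp
qed

lemma products_above:
  "p > 1 \<Longrightarrow> (U x \<star> V x) p = 0" "p > 0 \<Longrightarrow> (V x \<star> Cinv h x) p = 0" "p > 1 \<Longrightarrow> (Cinv h x \<star> U x) p = 0"
  by (rule lmul_above[of 1 _ 0], auto simp: U_above V_above Cinv_above)
    (rule lmul_above[of 0 _ 0], auto simp: U_above V_above Cinv_above,
     rule lmul_above[of 0 _ 1], auto simp: U_above V_above Cinv_above)

theorem poisson_lax_products:
  "poisson_lax_map 1 [[A1]] [[A2]] [[S]] (\<lambda>x :: 'a::finite phase. [UVC h x])"
  "poisson_lax_map 1 [[A1]] [[A2]] [[S]] (\<lambda>x :: 'a phase. [VCU h x])"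
  "poisson_lax_map 1 [[A1]] [[A2]] [[S]] (\<lambda>x :: 'a phase. [CUV h x])"
proof -
  have d: "(\<lambda>y. UVC h y p) differentiable (at x)" "(\<lambda>y. VCU h y p) differentiable (at x)"
    "(\<lambda>y. CUV h y p) differentiable (at x)" for p and x :: "'a phase"
    by (intro differentiable_lmul[where d = 1 and e = 0] differentiable_lmul[where d = 0 and e = 0]
       differentiable_lmul[where d = 0 and e = 1]
       differentiable_U differentiable_V differentiable_Cinv; simp add: products_above U_above V_above Cinv_above)+
  show "poisson_lax_map 1 [[A1]] [[A2]] [[S]] (\<lambda>x :: 'a phase. [UVC h x])"
    unfolding poisson_lax_map_def
  proof (intro conjI allI impI)
    fix x :: "'a phase" and \<Phi> \<Psi>
    assume g: "\<exists>Gs. has_grad loop_alg formal_curve \<Phi> [UVC h x] Gs" "\<exists>Gs. has_grad loop_alg formal_curve \<Psi> [UVC h x] Gs"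
    show "pb (\<lambda>y. \<Phi> [UVC h y]) (\<lambda>y. \<Psi> [UVC h y]) x = PB2 [[A1]] [[A2]] [[S]] \<Phi> \<Psi> [UVC h x]"
      by (rule pb_single[where L = "\<lambda>x. UVC h x" and h = h and J = "\<lambda>G. V x \<star> Cinv h x \<star> G"
          and K = "\<lambda>G. Cinv h x \<star> (G \<star> U x \<star> V x) \<star> Cinv h x" and H = "\<lambda>G. Cinv h x \<star> G \<star> U x", OF slots_UVC _ _ _ _ _ g])
        (simp_all add: loop_assoc C_Cinv_assoc)
  qed (auto simp: d)
  show "poisson_lax_map 1 [[A1]] [[A2]] [[S]] (\<lambda>x :: 'a phase. [VCU h x])"
    unfolding poisson_lax_map_def
  proof (intro conjI allI impI)
    fix x :: "'a phase" and \<Phi> \<Psi>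
    assume g: "\<exists>Gs. has_grad loop_alg formal_curve \<Phi> [VCU h x] Gs" "\<exists>Gs. has_grad loop_alg formal_curve \<Psi> [VCU h x] Gs"
    show "pb (\<lambda>y. \<Phi> [VCU h y]) (\<lambda>y. \<Psi> [VCU h y]) x = PB2 [[A1]] [[A2]] [[S]] \<Phi> \<Psi> [VCU h x]"
      by (rule pb_single[where L = "\<lambda>x. VCU h x" and h = h and J = "\<lambda>G. G \<star> V x \<star> Cinv h x"
          and K = "\<lambda>G. Cinv h x \<star> (U x \<star> G \<star> V x) \<star> Cinv h x" and H = "\<lambda>G. Cinv h x \<star> U x \<star> G", OF slots_VCU _ _ _ _ _ g])
        (simp_all add: loop_assoc C_Cinv_assoc)
  qed (auto simp: d)
  show "poisson_lax_map 1 [[A1]] [[A2]] [[S]] (\<lambda>x :: 'a phase. [CUV h x])"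
    unfolding poisson_lax_map_def
  proof (intro conjI allI impI)
    fix x :: "'a phase" and \<Phi> \<Psi>
    assume g: "\<exists>Gs. has_grad loop_alg formal_curve \<Phi> [CUV h x] Gs" "\<exists>Gs. has_grad loop_alg formal_curve \<Psi> [CUV h x] Gs"
    show "pb (\<lambda>y. \<Phi> [CUV h y]) (\<lambda>y. \<Psi> [CUV h y]) x = PB2 [[A1]] [[A2]] [[S]] \<Phi> \<Psi> [CUV h x]"
      by (rule pb_single[where L = "\<lambda>x. CUV h x" and h = h and J = "\<lambda>G. V x \<star> G \<star> Cinv h x"
          and K = "\<lambda>G. Cinv h x \<star> (U x \<star> V x \<star> G) \<star> Cinv h x" and H = "\<lambda>G. G \<star> Cinv h x \<star> U x", OF slots_CUV _ _ _ _ _ g])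
        (simp_all add: loop_assoc C_Cinv_assoc)
  qed (auto simp: d)
qed

section \<open>From invariant Hamilton functions to Lax triads\<close>

section \<open>The hierarchy and its Lax triads\<close>

lemma conv_add: "conv L N \<Longrightarrow> conv M N \<Longrightarrow> conv (L + M) N"
  unfolding conv_def
  by (auto simp: bounded_linear.linear[OF bounded_linear_matmul_left, THEN linear_add] intro: summable_on_add)

lemma conv_add_right: "conv N L \<Longrightarrow> conv N M \<Longrightarrow> conv N (L + M)"
  unfolding conv_def
  by (auto simp: bounded_linear.linear[OF bounded_linear_matmul_right, THEN linear_add] intro: summable_on_add)

lemma conv_U [simp]: "conv (U x) M" "conv M (U x)"
  and conv_unip [simp]: "conv (unip w) M" "conv M (unip w)"
  by (simp_all add: U_mono unip_def conv_add conv_add_right)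

lemma du_coordinates:
  "du (\<lambda>y. fst y $ k) j x = (if j = k then 1 else 0)" "dv (\<lambda>y. fst y $ k) j x = 0"
  "du (\<lambda>y. snd y $ k) j x = 0" "dv (\<lambda>y. snd y $ k) j x = (if j = k then 1 else 0)"
proof -
  have "deriv (\<lambda>t. a + t * b) 0 = b" for a b :: real
    by (rule DERIV_imp_deriv) (auto intro!: derivative_eq_intros)
  note d = this this[of _ 0, simplified]
  show "du (\<lambda>y. fst y $ k) j x = (if j = k then 1 else 0)" "dv (\<lambda>y. fst y $ k) j x = 0"
    "du (\<lambda>y. snd y $ k) j x = 0" "dv (\<lambda>y. snd y $ k) j x = (if j = k then 1 else 0)"
    unfolding du_def dv_def by (auto simp: d axis_def)
qed

lemma ham_field_ham:
  "ham_field F x = (\<chi> k. hamu x (\<lambda>k. dv F k x) k, \<chi> k. hamv x (\<lambda>k. du F k x) k)"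
proof -
  have "(\<Sum>j\<in>UNIV. w j * (if j = k then 1 else 0)) = w k" for w :: "'a mod_ring \<Rightarrow> real" and k
    by (simp add: if_distrib[of "\<lambda>z. _ * z"] cong: if_cong)
  then show ?thesis by (simp add: ham_field_def pb_ham du_coordinates)
qed

text \<open>The field on (u, v) induced by the Lax triads when \<open>a\<close>, \<open>b\<close>,
  \<open>c\<close> stand for f at U V C^-1, V C^-1 U, C^-1 U V. Only their diagonal parts
  enter.\<close>

definition triad_field :: "'a::finite phase \<Rightarrow> 'a loop \<Rightarrow> 'a loop \<Rightarrow> 'a loop \<Rightarrow> 'a phase" where
  "triad_field x a b c = (\<chi> k. fst x $ k * (coef b 0 k - coef a 0 k),
     \<chi> k. snd x $ k * (coef c 0 (nxt k) - coef b 0 k))"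

text \<open>Each of \<open>a\<close>, \<open>b\<close>, \<open>c\<close> factors through two of the
  slots, so its diagonal has two expressions; comparing them turns the partial derivatives into
  differences of diagonals. J, K, H are merely twisted, which makes the result available in both
  algebras.\<close>

lemma ham_field_triad:
  assumes s: "slots h F x J K H" and [simp]: "twisted J" "twisted K" "twisted H"
    and a: "a = U x \<star> J" "a = C h x \<star> K" and b: "b = J \<star> U x" "b = V x \<star> H"
    and c: "c = H \<star> V x" "c = K \<star> C h x"
  shows "ham_field F x = triad_field x a b c"
proof -
  have a0: "coef a 0 k = fst x $ k * coef J 0 k + coef J (-1) (prv k)"
    "coef a 0 k = coef K 0 k + cfun h x k * coef K 1 (nxt k)" for k
    using arg_cong[OF a(1), of "\<lambda>M. coef M 0 k"] arg_cong[OF a(2), of "\<lambda>M. coef M 0 k"]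
    by (simp_all add: coef_U_left C_unip coef_unip_left)
  have b0: "coef b 0 k = coef J 0 k * fst x $ k + coef J (-1) k"
    "coef b 0 k = coef H 0 k + snd x $ k * coef H 1 (nxt k)" for k
    using arg_cong[OF b(1), of "\<lambda>M. coef M 0 k"] arg_cong[OF b(2), of "\<lambda>M. coef M 0 k"]
    by (simp_all add: coef_U_right V_unip coef_unip_left)
  have c0: "coef c 0 k = coef H 0 k + coef H 1 k * snd x $ prv k"
    "coef c 0 k = coef K 0 k + coef K 1 k * cfun h x (prv k)" for k
    using arg_cong[OF c(1), of "\<lambda>M. coef M 0 k"] arg_cong[OF c(2), of "\<lambda>M. coef M 0 k"]
    by (simp_all add: C_unip V_unip coef_unip_right)
  have du: "(\<lambda>k. du F k x) = (\<lambda>k. coef J 0 k + h * snd x $ k * coef K 1 (nxt k))"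
    and dv: "(\<lambda>k. dv F k x) = (\<lambda>k. coef H 1 (nxt k) + h * fst x $ k * coef K 1 (nxt k))"
    using s by (auto simp: slots_def)
  have 1: "snd x $ k * dv F k x - snd x $ prv k * dv F (prv k) x = coef b 0 k - coef a 0 k" for k
    using b0(2)[of k] a0(2)[of k] c0[of k]
    by (simp add: fun_cong[OF dv] cfun_def algebra_simps)
  have 2: "fst x $ nxt k * du F (nxt k) x - fst x $ k * du F k x = coef c 0 (nxt k) - coef b 0 k" for k
    using a0[of "nxt k"] a0[of k] b0(1)[of k] c0(2)[of "nxt k"]
    by (simp add: fun_cong[OF du] cfun_def algebra_simps)
  show ?thesis
    unfolding ham_field_ham triad_field_def hamu_def hamv_def 1 2 by simp
qed

lemma coef_pm_pi: "coef (pm_pi s M) p i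
    = (if s then (if p \<ge> 0 then coef M p i else 0) else (if p < 0 then - coef M p i else 0))"
  by (simp add: pm_pi_def coef_pi_plus coef_pi_minus)

lemma twisted_pm_pi [simp]: "twisted M \<Longrightarrow> twisted (pm_pi s M)"
  by (simp add: pm_pi_def twisted_pi_plus twisted_pi_minus twisted_minus)

lemma loop_pm_pi [simp]: "M \<in> loop_alg \<Longrightarrow> pm_pi s M \<in> loop_alg"
  by (simp add: pm_pi_def loop_pi loop_minus)

text \<open>Cutting \<open>a\<close> and \<open>b\<close> between degrees -1 and 0 respects U b = a
  U in every degree except 0, the only one in which coefficients from both sides of the cut meet.
  Both signs leave the same remainder, because the difference of \<open>pi_plus\<close> and
  \<open>- pi_minus\<close> is the identity.\<close>

lemma U_pm_pi:
  assumes [simp]: "twisted a" "twisted b" and eq: "U x \<star> b = a \<star> U x"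
  shows "U x \<star> pm_pi s b - pm_pi s a \<star> U x = mono_loop 0 (\<lambda>k. fst x $ k * (coef b 0 k - coef a 0 k))"
proof (rule twisted_eqI)
  fix p k
  have e: "fst x $ k * coef b p k + coef b (p - 1) (prv k)
      = coef a p k * fst x $ shift (- p) k + coef a (p - 1) k"
    using arg_cong[OF eq, of "\<lambda>M. coef M p k"] by (simp add: coef_U_left coef_U_right)
  consider "p < 0" | "p = 0" | "p > 0" by linarith
  then show "coef (U x \<star> pm_pi s b - pm_pi s a \<star> U x) p k
      = coef (mono_loop 0 (\<lambda>k. fst x $ k * (coef b 0 k - coef a 0 k))) p k"
    using e by cases (simp_all add: coef_U_left coef_U_right coef_pm_pi algebra_simps)
qed (simp_all add: twisted_diff twisted_lmul)

lemma unip_pm_pi: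
  assumes [simp]: "twisted a" "twisted b" and eq: "unip w \<star> b = a \<star> unip w"
  shows "unip w \<star> pm_pi s b - pm_pi s a \<star> unip w = mono_loop (-1) (\<lambda>k. w k * (coef b 0 (nxt k) - coef a 0 k))"
proof (rule twisted_eqI)
  fix p k
  have e: "coef b p k + w k * coef b (p + 1) (nxt k)
      = coef a p k + coef a (p + 1) k * w (shift (- 1 - p) k)"
    using arg_cong[OF eq, of "\<lambda>M. coef M p k"] by (simp add: coef_unip_left coef_unip_right)
  consider "p < -1" | "p = -1" | "p > -1" by linarith
  then show "coef (unip w \<star> pm_pi s b - pm_pi s a \<star> unip w) p k
      = coef (mono_loop (-1) (\<lambda>k. w k * (coef b 0 (nxt k) - coef a 0 k))) p k"
    using e by cases (simp_all add: coef_unip_left coef_unip_right coef_pm_pi algebra_simps)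
qed (simp_all add: twisted_diff twisted_lmul)

lemma C_pm_pi: "twisted a \<Longrightarrow> twisted b \<Longrightarrow> C h x \<star> b = a \<star> C h x \<Longrightarrow>
    C h x \<star> pm_pi s b - pm_pi s a \<star> C h x
      = mono_loop (-1) (\<lambda>k. cfun h x k * (coef b 0 (nxt k) - coef a 0 k))"
  unfolding C_unip by (rule unip_pm_pi)

lemma V_pm_pi: "twisted a \<Longrightarrow> twisted b \<Longrightarrow> V x \<star> b = a \<star> V x \<Longrightarrow>
    V x \<star> pm_pi s b - pm_pi s a \<star> V x
      = mono_loop (-1) (\<lambda>k. snd x $ k * (coef b 0 (nxt k) - coef a 0 k))"
  unfolding V_unip by (rule unip_pm_pi)

lemma has_vector_derivative_phase:
  fixes x :: "real \<Rightarrow> 'a::finite phase"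
  assumes "\<And>k. ((\<lambda>\<tau>. fst (x \<tau>) $ k) has_real_derivative fst y $ k) (at t within T)"
    "\<And>k. ((\<lambda>\<tau>. snd (x \<tau>) $ k) has_real_derivative snd y $ k) (at t within T)"
  shows "(x has_vector_derivative y) (at t within T)"
proof -
  have "((\<lambda>\<tau>. (f \<tau> :: real^'a mod_ring)) has_vector_derivative f') (at t within T)"
    if "\<And>k. ((\<lambda>\<tau>. f \<tau> $ k) has_real_derivative f' $ k) (at t within T)" for f f'
  proof -
    have "(\<lambda>y. y * c) = (*) c" for c :: real
      by (rule ext) (simp add: mult.commute)
    then show ?thesis
      using that unfolding has_vector_derivative_def has_derivative_vec_iff has_field_derivative_def by simp
  qed
  from has_vector_derivative_Pair[OF this[of "\<lambda>\<tau>. fst (x \<tau>)" "fst y"] this[of "\<lambda>\<tau>. snd (x \<tau>)" "snd y"]]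
  show ?thesis using assms by simp
qed

text \<open>The equation for C is implied by the other two: u_k and v_k have growth rates b_k - a_k
  and c_{k+1} - b_k, so u_k v_k has rate c_{k+1} - a_k.\<close>

lemma lax_triad_iff:
  assumes tw: "twisted (f (UVC h (x t)))" "twisted (f (VCU h (x t)))" "twisted (f (CUV h (x t)))"
    and eq: "U (x t) \<star> f (VCU h (x t)) = f (UVC h (x t)) \<star> U (x t)"
      "C h (x t) \<star> f (CUV h (x t)) = f (UVC h (x t)) \<star> C h (x t)"
      "V (x t) \<star> f (CUV h (x t)) = f (VCU h (x t)) \<star> V (x t)"
  shows "lax_triad s h f x t T \<longleftrightarrow>
    (x has_vector_derivative triad_field (x t) (f (UVC h (x t))) (f (VCU h (x t))) (f (CUV h (x t)))) (at t within T)"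
    (is "_ \<longleftrightarrow> (x has_vector_derivative ?y) _")
proof -
  note e = U_pm_pi[OF tw(1,2) eq(1)] C_pm_pi[OF tw(1,3) eq(2)] V_pm_pi[OF tw(2,3) eq(3)]
  have iff: "lax_triad s h f x t T \<longleftrightarrow>
     ((\<lambda>\<tau>. U (x \<tau>)) has_loop_derivative mono_loop 0 (\<lambda>k. fst ?y $ k)) (at t within T) \<and>
     ((\<lambda>\<tau>. C h (x \<tau>)) has_loop_derivative mono_loop (-1) (dcf h (x t) ?y)) (at t within T) \<and>
     ((\<lambda>\<tau>. V (x \<tau>)) has_loop_derivative mono_loop (-1) (\<lambda>k. snd ?y $ k)) (at t within T)"
  proof -
    have "(\<lambda>k. cfun h (x t) k * (coef (f (CUV h (x t))) 0 (nxt k) - coef (f (UVC h (x t))) 0 k)) = dcf h (x t) ?y"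
      by (rule ext) (simp add: cfun_def dcf_def triad_field_def algebra_simps)
    then show ?thesis
      unfolding lax_triad_def e by (simp add: triad_field_def)
  qed
  show ?thesis
  proof
    assume "lax_triad s h f x t T"
    with iff have d: "((\<lambda>\<tau>. U (x \<tau>)) has_loop_derivative mono_loop 0 (\<lambda>k. fst ?y $ k)) (at t within T)"
      "((\<lambda>\<tau>. V (x \<tau>)) has_loop_derivative mono_loop (-1) (\<lambda>k. snd ?y $ k)) (at t within T)"
      by auto
    show "(x has_vector_derivative ?y) (at t within T)"
    proof (rule has_vector_derivative_phase)
      fix k
      show "((\<lambda>\<tau>. fst (x \<tau>) $ k) has_real_derivative fst ?y $ k) (at t within T)"
        using d(1) by (subst (asm) has_loop_derivative_iff)
          (auto simp: coef_U dest!: spec[of _ 0] spec[of _ k])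
      show "((\<lambda>\<tau>. snd (x \<tau>) $ k) has_real_derivative snd ?y $ k) (at t within T)"
        using d(2) by (subst (asm) has_loop_derivative_iff)
          (auto simp: V_unip coef_unip dest!: spec[of _ "-1"] spec[of _ k])
    qed
  next
    assume "(x has_vector_derivative ?y) (at t within T)"
    from U_derivative[OF this] C_derivative[OF this] V_derivative[OF this]
    show "lax_triad s h f x t T" unfolding iff by blast
  qed
qed

lemma ad_hamiltonianD:
  assumes "ad_hamiltonian X \<C> D \<phi> f" "L \<in> D"
  obtains G where "has_grad X \<C> (\<lambda>Ls. \<phi> (hd Ls)) [L] [G]" "G \<in> X" "f L = L \<star> G"
  using assms unfolding ad_hamiltonian_def by (fastforce simp: has_grad_def)

text \<open>The invariance of \<phi> is differentiated along the conjugate of a straight line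
  through L, and the pairing is nondegenerate. This is the source of the covariance of f.\<close>

lemma grad_covariant:
  assumes ad: "ad_hamiltonian loop_alg formal_curve loop_alg \<phi> f"
    and [simp]: "A \<in> loop_alg" "B \<in> loop_alg" "L \<in> loop_alg" and AB: "A \<star> B = lone" "B \<star> A = lone"
    and G: "has_grad loop_alg formal_curve (\<lambda>Ls. \<phi> (hd Ls)) [L] [G]"
    and G': "has_grad loop_alg formal_curve (\<lambda>Ls. \<phi> (hd Ls)) [A \<star> L \<star> B] [G']"
  shows "G' = A \<star> G \<star> B"
proof -
  have [simp]: "G \<in> loop_alg" "G' \<in> loop_alg" using G G' by (auto simp: has_grad_def)
  have "pairing G M = pairing (B \<star> G' \<star> A) M" if M [simp]: "M \<in> loop_alg" for M
  proof -
    let ?\<gamma> = "\<lambda>t p. L p + t *\<^sub>R M p"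
    have c: "formal_curve ?\<gamma> M" by (rule formal_curve_line) simp_all
    have "formal_curve (\<lambda>t. A \<star> ?\<gamma> t \<star> B) ((0 \<star> ?\<gamma> 0 + A \<star> M) \<star> B + A \<star> ?\<gamma> 0 \<star> 0)"
      by (intro formal_curve_lmul formal_curve_const c) simp_all
    moreover have "0 \<star> N = 0" "N \<star> 0 = 0" for N :: "'a loop"
      by (auto simp: lmul_def)
    ultimately have c': "formal_curve (\<lambda>t. A \<star> ?\<gamma> t \<star> B) (A \<star> M \<star> B)" by simp
    have "((\<lambda>t. \<phi> (A \<star> ?\<gamma> t \<star> B)) has_real_derivative pairing G' (A \<star> M \<star> B)) (at 0)"
      using has_gradD1[of loop_alg formal_curve "\<lambda>Ls. \<phi> (hd Ls)" "\<lambda>t. A \<star> ?\<gamma> t \<star> B", OF _ c'] G' by simp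
    moreover have "\<phi> (A \<star> ?\<gamma> t \<star> B) = \<phi> (?\<gamma> t)" for t
      using ad formal_curve_velocity(2)[OF c, of t] AB unfolding ad_hamiltonian_def by auto
    moreover have "((\<lambda>t. \<phi> (?\<gamma> t)) has_real_derivative pairing G M) (at 0)"
      using has_gradD1[of loop_alg formal_curve "\<lambda>Ls. \<phi> (hd Ls)" ?\<gamma>, OF _ c] G by simp
    ultimately have "pairing G' (A \<star> M \<star> B) = pairing G M" by (auto intro: DERIV_unique)
    then show ?thesis by (simp add: pairing_sandwich)
  qed
  then have "G = B \<star> G' \<star> A"
    by (intro pairing_nondegenerate) (simp_all add: loop_pairing_sym[of _ G] loop_pairing_sym[of _ "B \<star> G' \<star> A"])
  then have "A \<star> G \<star> B = (A \<star> B) \<star> G' \<star> (A \<star> B)" by (simp add: loop_assoc)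
  then show ?thesis by (simp add: AB)
qed

lemma UVC_invertible: "\<exists>Y\<in>loop_alg. UVC h x \<star> Y = lone \<and> Y \<star> UVC h x = lone"
proof -
  obtain Yu Yv where Y [simp]: "Yu \<in> loop_alg" "Yv \<in> loop_alg"
    and i: "U x \<star> Yu = lone" "Yu \<star> U x = lone" "V x \<star> Yv = lone" "Yv \<star> V x = lone"
    using U_invertible V_invertible by metis
  have "UVC h x \<star> (C h x \<star> Yv \<star> Yu) = U x \<star> (V x \<star> (Cinv h x \<star> C h x) \<star> Yv) \<star> Yu"
    by (simp add: loop_assoc C_Cinv_assoc)
  moreover have "(C h x \<star> Yv \<star> Yu) \<star> UVC h x = C h x \<star> (Yv \<star> (Yu \<star> U x) \<star> V x) \<star> Cinv h x"
    by (simp add: loop_assoc C_Cinv_assoc)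
  ultimately show ?thesis by (intro bexI[of _ "C h x \<star> Yv \<star> Yu"]) (simp_all add: i)
qed

lemma ad_hamiltonian_triad:
  fixes x :: "'a::finite phase"
  assumes ad: "ad_hamiltonian loop_alg formal_curve loop_alg \<phi> f"
  shows "ham_field (\<lambda>y. \<phi> (UVC h y)) x = triad_field x (f (UVC h x)) (f (VCU h x)) (f (CUV h x))"
    and "f (UVC h x) \<in> loop_alg" "f (VCU h x) \<in> loop_alg" "f (CUV h x) \<in> loop_alg"
    and "U x \<star> f (VCU h x) = f (UVC h x) \<star> U x" "C h x \<star> f (CUV h x) = f (UVC h x) \<star> C h x"
      "V x \<star> f (CUV h x) = f (VCU h x) \<star> V x"
proof -
  let ?L = "UVC h x"
  obtain G where G: "has_grad loop_alg formal_curve (\<lambda>Ls. \<phi> (hd Ls)) [?L] [G]"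
    and [simp]: "G \<in> loop_alg" and f: "f ?L = ?L \<star> G"
    by (rule ad_hamiltonianD[OF ad, of ?L]) auto
  have cov: "f (A \<star> ?L \<star> B) = A \<star> ?L \<star> G \<star> B"
    if [simp]: "A \<in> loop_alg" "B \<in> loop_alg" and AB: "A \<star> B = lone" "B \<star> A = lone" for A B
  proof -
    obtain G' where G': "has_grad loop_alg formal_curve (\<lambda>Ls. \<phi> (hd Ls)) [A \<star> ?L \<star> B] [G']"
      and [simp]: "G' \<in> loop_alg" and f': "f (A \<star> ?L \<star> B) = A \<star> ?L \<star> B \<star> G'"
      by (rule ad_hamiltonianD[OF ad, of "A \<star> ?L \<star> B"]) auto
    have G'G: "G' = A \<star> G \<star> B" by (rule grad_covariant[OF ad _ _ _ AB G G']) simp_all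
    have "f (A \<star> ?L \<star> B) = A \<star> ?L \<star> (B \<star> A) \<star> G \<star> B"
      unfolding f' G'G by (simp add: loop_assoc)
    then show ?thesis by (simp add: AB)
  qed
  obtain Y where [simp]: "Y \<in> loop_alg" and Y: "?L \<star> Y = lone" "Y \<star> ?L = lone"
    using UVC_invertible by metis
  \<comment> \<open>L conjugated with itself is L, so covariance of the gradient says that G
    commutes with L.\<close>
  have "?L \<star> ?L \<star> Y = ?L"
    by (subst loop_assoc) (simp_all only: Y loop_lmul loop_U loop_V loop_Cinv \<open>Y \<in> loop_alg\<close> lmul_lone_right)
  then have "G = ?L \<star> G \<star> Y"
    by (intro grad_covariant[OF ad _ _ _ Y G]) (simp_all only: G loop_lmul loop_U loop_V loop_Cinv \<open>Y \<in> loop_alg\<close>)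
  then have "G \<star> ?L = ?L \<star> G \<star> Y \<star> ?L" by (rule arg_cong[where f = "\<lambda>M. M \<star> ?L"])
  also have "\<dots> = ?L \<star> G \<star> (Y \<star> ?L)"
    by (rule loop_assoc) simp_all
  finally have comm: "G \<star> ?L = ?L \<star> G" by (simp only: Y lmul_lone_right)
  \<comment> \<open>Forms of the commutation relation for right-nested products: G passes a full
    block U V C^-1. A block that lacks C^-1 is completed with C^-1 C first.\<close>
  have commN: "G \<star> (U x \<star> (V x \<star> Cinv h x)) = U x \<star> (V x \<star> (Cinv h x \<star> G))"
    using comm by (simp add: loop_assoc)
  have commT: "G \<star> (U x \<star> (V x \<star> (Cinv h x \<star> M))) = U x \<star> (V x \<star> (Cinv h x \<star> (G \<star> M)))"
    if [simp]: "M \<in> loop_alg" for M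
  proof -
    have "G \<star> (U x \<star> (V x \<star> (Cinv h x \<star> M))) = G \<star> (U x \<star> (V x \<star> Cinv h x)) \<star> M"
      by (simp add: loop_assoc)
    then show ?thesis unfolding commN by (simp add: loop_assoc)
  qed
  have commV: "G \<star> (U x \<star> V x) = U x \<star> (V x \<star> (Cinv h x \<star> (G \<star> C h x)))"
    using commT[of "C h x"] by simp
  obtain Yv where [simp]: "Yv \<in> loop_alg" and Yv: "V x \<star> Yv = lone" "Yv \<star> V x = lone"
    using V_invertible by metis
  have YvV: "V x \<star> (Yv \<star> M) = M" "Yv \<star> (V x \<star> M) = M" if "M \<in> loop_alg" for M
    using that by (simp_all add: Yv flip: loop_assoc)
  have commY: "U x \<star> (V x \<star> (Cinv h x \<star> (G \<star> (C h x \<star> Yv)))) = G \<star> U x"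
  proof -
    have "G \<star> (U x \<star> V x) \<star> Yv = G \<star> U x" by (simp add: loop_assoc Yv)
    then show ?thesis unfolding commV by (simp add: loop_assoc)
  qed
  have c: "f (CUV h x) = Cinv h x \<star> (G \<star> (U x \<star> V x))"
  proof -
    have "f (CUV h x) = f (Cinv h x \<star> ?L \<star> C h x)" by (simp add: loop_assoc)
    also have "\<dots> = Cinv h x \<star> ?L \<star> G \<star> C h x" by (rule cov) simp_all
    finally show ?thesis by (simp add: loop_assoc commV)
  qed
  have b: "f (VCU h x) = V x \<star> Cinv h x \<star> G \<star> U x"
  proof -
    \<comment> \<open>V C^-1 U is the conjugate of U V C^-1 by V C^-1, whose inverse is C
      V^-1.\<close>
    have "f (VCU h x) = f ((V x \<star> Cinv h x) \<star> ?L \<star> (C h x \<star> Yv))"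
      by (simp add: loop_assoc C_Cinv_assoc Yv)
    also have "\<dots> = (V x \<star> Cinv h x) \<star> ?L \<star> G \<star> (C h x \<star> Yv)"
      by (rule cov) (simp_all add: loop_assoc C_Cinv_assoc YvV Yv)
    finally show ?thesis by (simp add: loop_assoc commY)
  qed
  let ?J = "V x \<star> Cinv h x \<star> G" and ?K = "Cinv h x \<star> (G \<star> U x \<star> V x) \<star> Cinv h x" and ?H = "Cinv h x \<star> G \<star> U x"
  have "slots h (\<lambda>y. \<phi> (UVC h y)) x ?J ?K ?H"
    using slots_UVC[OF G] by simp
  from this show "ham_field (\<lambda>y. \<phi> (UVC h y)) x = triad_field x (f ?L) (f (VCU h x)) (f (CUV h x))"
    unfolding b c f
    by (rule ham_field_triad) (simp_all add: loop_assoc C_Cinv_assoc commN commT commV)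
  show "f (UVC h x) \<in> loop_alg" "f (VCU h x) \<in> loop_alg" "f (CUV h x) \<in> loop_alg"
    by (simp_all add: b c f)
  show "U x \<star> f (VCU h x) = f (UVC h x) \<star> U x" "C h x \<star> f (CUV h x) = f (UVC h x) \<star> C h x"
    "V x \<star> f (CUV h x) = f (VCU h x) \<star> V x"
    unfolding b c f by (simp_all add: loop_assoc C_Cinv_assoc commN commT commV)
qed

theorem hierarchy_triads:
  fixes x :: "real \<Rightarrow> 'a::finite phase"
  assumes ad: "ad_hamiltonian loop_alg formal_curve loop_alg \<phi> f"
  shows "hier_eq h \<phi> x t T \<longleftrightarrow> lax_triad s h f x t T"
    and "hier_eq h \<phi> x t T \<Longrightarrow> ((\<lambda>\<tau>. UVC h (x \<tau>)) has_loop_derivative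
      UVC h (x t) \<star> pm_pi s (f (UVC h (x t))) - pm_pi s (f (UVC h (x t))) \<star> UVC h (x t)) (at t within T)"
proof -
  let ?a = "f (UVC h (x t))" and ?b = "f (VCU h (x t))" and ?c = "f (CUV h (x t))"
  note F = ad_hamiltonian_triad[OF ad, where h = h]
  note tw = F(2-4)[THEN loop_twisted]
  show iff: "hier_eq h \<phi> x t T \<longleftrightarrow> lax_triad s h f x t T"
    unfolding lax_triad_iff[OF tw F(5-7)] hier_eq_def F(1) ..
  assume "hier_eq h \<phi> x t T"
  then have x: "(x has_vector_derivative triad_field (x t) ?a ?b ?c) (at t within T)"
    (is "(x has_vector_derivative ?y) _") unfolding hier_eq_def F(1) .
  have "((\<lambda>\<tau>. U (x \<tau>) \<star> V (x \<tau>)) has_loop_derivative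
      (\<lambda>p. (mono_loop 0 (\<lambda>k. fst ?y $ k) \<star> V (x t)) p + (U (x t) \<star> mono_loop (-1) (\<lambda>k. snd ?y $ k)) p))
      (at t within T)"
    by (rule has_loop_derivative_lmul[OF U_derivative[OF x] V_derivative[OF x], of 1 0])
      (auto simp: U_above V_above mono_loop_neq)
  then have uv: "((\<lambda>\<tau>. U (x \<tau>) \<star> V (x \<tau>)) has_loop_derivative
      mono_loop 0 (\<lambda>k. fst ?y $ k) \<star> V (x t) + U (x t) \<star> mono_loop (-1) (\<lambda>k. snd ?y $ k))
      (at t within T)" (is "(_ has_loop_derivative ?M) _")
    by (simp only: plus_fun_def)
  let ?N = "- (Cinv h (x t) \<star> mono_loop (-1) (dcf h (x t) ?y) \<star> Cinv h (x t))"
  have M: "?M p = 0" if "p > 1" for p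
  proof -
    have "(mono_loop 0 (\<lambda>k. fst ?y $ k) \<star> V (x t)) p = 0"
      by (rule lmul_above[of 0 _ 0]) (use that in \<open>simp_all add: V_above mono_loop_neq\<close>)
    moreover have "(U (x t) \<star> mono_loop (-1) (\<lambda>k. snd ?y $ k)) p = 0"
      by (rule lmul_above[of 1 _ "-1"]) (use that in \<open>simp_all add: U_above mono_loop_neq\<close>)
    ultimately show ?thesis by (simp only: plus_fun_def add_0)
  qed
  have N: "?N p = 0" if "p > 0" for p
  proof -
    have "(Cinv h (x t) \<star> mono_loop (-1) (dcf h (x t) ?y)) q = 0" if "q > -1" for q
      by (rule lmul_above[of 0 _ "-1"]) (use that in \<open>simp_all add: Cinv_above mono_loop_neq\<close>)
    then have "(Cinv h (x t) \<star> mono_loop (-1) (dcf h (x t) ?y) \<star> Cinv h (x t)) p = 0"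
      by (rule lmul_above[of "-1" _ 0]) (use that in \<open>simp_all add: Cinv_above\<close>)
    then show ?thesis by simp
  qed
  have "((\<lambda>\<tau>. UVC h (x \<tau>)) has_loop_derivative
      (\<lambda>p. (?M \<star> Cinv h (x t)) p + (U (x t) \<star> V (x t) \<star> ?N) p)) (at t within T)"
    by (rule has_loop_derivative_lmul[OF uv Cinv_derivative[OF x, of h] products_above(1) M Cinv_above N])
  then have d: "((\<lambda>\<tau>. UVC h (x \<tau>)) has_loop_derivative
      ?M \<star> Cinv h (x t) + U (x t) \<star> V (x t) \<star> ?N) (at t within T)"
    by (simp only: plus_fun_def)
  have m: "mono_loop 0 (\<lambda>k. fst ?y $ k) = U (x t) \<star> pm_pi s ?b - pm_pi s ?a \<star> U (x t)"
    "mono_loop (-1) (\<lambda>k. snd ?y $ k) = V (x t) \<star> pm_pi s ?c - pm_pi s ?b \<star> V (x t)"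
    using U_pm_pi[OF tw(1,2) F(5), where s = s] V_pm_pi[OF tw(2,3) F(7), where s = s]
    by (simp_all add: triad_field_def)
  have mc: "mono_loop (-1) (dcf h (x t) ?y) = C h (x t) \<star> pm_pi s ?c - pm_pi s ?a \<star> C h (x t)"
  proof -
    have "dcf h (x t) ?y = (\<lambda>k. cfun h (x t) k * (coef ?c 0 (nxt k) - coef ?a 0 k))"
      by (rule ext) (simp add: cfun_def dcf_def triad_field_def algebra_simps)
    then show ?thesis using C_pm_pi[OF tw(1,3) F(6), where s = s] by simp
  qed
  show "((\<lambda>\<tau>. UVC h (x \<tau>)) has_loop_derivative
      UVC h (x t) \<star> pm_pi s ?a - pm_pi s ?a \<star> UVC h (x t)) (at t within T)"
  proof -
    define pa pb pc where p: "pa = pm_pi s ?a" "pb = pm_pi s ?b" "pc = pm_pi s ?c"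
    have [simp]: "pa \<in> loop_alg" "pb \<in> loop_alg" "pc \<in> loop_alg"
      unfolding p by (intro loop_pm_pi F(2-4))+
    \<comment> \<open>In the Leibniz rule for U V C^-1 the inner terms with \<open>pb\<close> and
      \<open>pc\<close> cancel between neighbouring factors.\<close>
    show ?thesis
      using d[unfolded m mc, folded p] unfolding p[symmetric]
      by (simp add: loop_distrib loop_assoc C_Cinv_assoc lmul_minus_right)
  qed
qed


section \<open>The first flow\<close>

lemma has_grad1I:
  assumes "G \<in> X" "\<And>\<gamma> M. \<gamma> 0 = L \<Longrightarrow> \<C> \<gamma> M \<Longrightarrow> ((\<lambda>t. \<phi> (\<gamma> t)) has_real_derivative pairing G M) (at 0)"
  shows "has_grad X \<C> (\<lambda>Ls. \<phi> (hd Ls)) [L] [G]"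
  unfolding has_grad_def
proof (intro conjI allI impI)
  fix \<gamma> :: "real \<Rightarrow> 'a loop list" and Ms
  assume a: "length Ms = length [L]" "\<forall>t. length (\<gamma> t) = length [L]" "\<gamma> 0 = [L]"
    "\<forall>i<length [L]. \<C> (\<lambda>t. \<gamma> t ! i) (Ms ! i)"
  have "hd (\<gamma> t) = \<gamma> t ! 0" for t using a(2) by (metis hd_conv_nth length_0_conv list.size(3) length_Cons nat.distinct(1))
  then show "((\<lambda>t. \<phi> (hd (\<gamma> t))) has_real_derivative (\<Sum>i<length [L]. pairing ([G] ! i) (Ms ! i))) (at 0)"
    using assms(2)[of "\<lambda>t. \<gamma> t ! 0" "Ms ! 0"] a by simp
qed (use assms(1) in auto)

text \<open>The gradient of tr L_0 is the identity. So f(L) = L does occur in the hierarchy, and the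
  statement on the first flow is not vacuous.\<close>

lemma ad_hamiltonian_trace:
  "ad_hamiltonian loop_alg formal_curve loop_alg (\<lambda>L :: 'a::finite loop. trace (L 0)) (\<lambda>L. L)"
  unfolding ad_hamiltonian_def
proof (intro conjI ballI impI)
  fix A B L :: "'a loop"
  assume [simp]: "A \<in> loop_alg" "B \<in> loop_alg" "L \<in> loop_alg" and AB: "B \<star> A = lone"
  have "pairing A (L \<star> B) = pairing (L \<star> B) A" by (rule loop_pairing_sym) simp_all
  then show "trace ((A \<star> L \<star> B) 0) = trace (L 0)"
    by (simp add: pairing_def loop_assoc AB)
next
  fix L :: "'a loop" assume L: "L \<in> loop_alg"
  have "has_grad loop_alg formal_curve (\<lambda>Ls. trace (hd Ls 0)) [L] [lone]"
  proof (rule has_grad1I)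
    fix \<gamma> and M :: "'a loop" assume "formal_curve \<gamma> M"
    then have "((\<lambda>t. \<gamma> t 0) has_vector_derivative M 0) (at 0)" by (simp add: formal_curve_def)
    from bounded_linear.has_vector_derivative[OF bounded_linear_trace this]
    show "((\<lambda>t. trace (\<gamma> t 0)) has_real_derivative pairing lone M) (at 0)"
      by (simp add: pairing_def has_real_derivative_iff_has_vector_derivative)
  qed simp
  then show "\<exists>G. has_grad loop_alg formal_curve (\<lambda>Ls. trace (hd Ls 0)) [L] [G] \<and> L = L \<star> G"
    by (intro exI[of _ lone]) simp
qed

lemma coef_Cinv: "coef (Cinv h x) 0 k = 1" "coef (Cinv h x) (-1) k = h * fst x $ k * snd x $ k"
  "p > 0 \<Longrightarrow> coef (Cinv h x) p k = 0"
  by (simp_all add: Cinv_geo coef_geo cfun_def)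

lemma coef_UVC:
  "coef (UVC h x) 0 k = fst x $ k + snd x $ prv k + h * fst x $ prv k * snd x $ prv k"
  "coef (UVC h x) 1 k = 1" "p > 1 \<Longrightarrow> coef (UVC h x) p k = 0"
  by (simp_all add: loop_assoc coef_U_left V_unip coef_unip_left coef_Cinv)

lemma coef_CUV:
  "coef (CUV h x) 0 k = fst x $ k + snd x $ prv k + h * fst x $ k * snd x $ k"
  "coef (CUV h x) 1 k = 1" "p > 1 \<Longrightarrow> coef (CUV h x) p k = 0"
  by (simp_all add: coef_U_right V_unip coef_unip_right coef_Cinv)

lemma coef_VCU:
  "coef (VCU h x) 0 k = fst x $ k + snd x $ k + h * fst x $ k * snd x $ k"
  "coef (VCU h x) 1 k = 1" "p > 1 \<Longrightarrow> coef (VCU h x) p k = 0"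
  by (simp_all add: coef_U_right V_unip coef_unip_left coef_Cinv algebra_simps)

lemma pi_plus_eqI:
  assumes "L \<in> loop_alg" "\<And>k. coef L 0 k = w k" "\<And>k. coef L 1 k = 1" "\<And>p k. p > 1 \<Longrightarrow> coef L p k = 0"
  shows "pi_plus L = lam 0 (\<Sum>k\<in>UNIV. w k *\<^sub>R E k k) + lam 1 (\<Sum>k\<in>UNIV. E (nxt k) k)"
proof -
  have "pi_plus L = mono_loop 0 w + mono_loop 1 (\<lambda>_. 1)"
  proof (rule twisted_eqI)
    fix p :: int and k
    consider "p < 0" | "p = 0" | "p = 1" | "p > 1" by linarith
    then show "coef (pi_plus L) p k = coef (mono_loop 0 w + mono_loop 1 (\<lambda>_. 1)) p k"
      by cases (simp_all add: coef_pi_plus assms)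
  qed (use assms(1) in \<open>simp_all add: twisted_add twisted_pi_plus\<close>)
  then show ?thesis using lam_scale_E[of 0 w] by (simp add: lam_E)
qed

lemma pi_plus_lax:
  fixes x :: "'a::finite phase"
  shows "let u = fst x; v = snd x in
     pi_plus (UVC h x) = lam 0 (\<Sum>k\<in>UNIV. (u $ k + v $ prv k + h * u $ prv k * v $ prv k) *\<^sub>R E k k)
                               + lam 1 (\<Sum>k\<in>UNIV. E (nxt k) k)
     \<and> pi_plus (CUV h x) = lam 0 (\<Sum>k\<in>UNIV. (u $ k + v $ prv k + h * u $ k * v $ k) *\<^sub>R E k k)
                               + lam 1 (\<Sum>k\<in>UNIV. E (nxt k) k)
     \<and> pi_plus (VCU h x) = lam 0 (\<Sum>k\<in>UNIV. (u $ k + v $ k + h * u $ k * v $ k) *\<^sub>R E k k)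
                               + lam 1 (\<Sum>k\<in>UNIV. E (nxt k) k)"
  unfolding Let_def
  by (intro conjI pi_plus_eqI) (simp_all only: loop_lmul loop_U loop_V loop_Cinv coef_UVC coef_CUV coef_VCU)

lemma first_flow_eq:
  fixes x :: "'a::finite phase"
  assumes "ad_hamiltonian loop_alg formal_curve loop_alg \<phi> (\<lambda>L. L)"
  shows "ham_field (\<lambda>y. \<phi> (UVC h y)) x = first_flow h x"
  unfolding ad_hamiltonian_triad(1)[OF assms] triad_field_def first_flow_def Let_def
    coef_UVC coef_CUV coef_VCU
  by (simp add: vec_eq_iff algebra_simps)


section \<open>The discrete map in logarithmic coordinates\<close>

section \<open>The discrete time map is Poisson\<close>

text \<open>\<open>du\<close> and \<open>dv\<close> are derivatives along coordinate lines; for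
  differentiable F they determine the whole differential.\<close>

lemma deriv_phase:
  fixes F :: "'a::finite phase \<Rightarrow> real"
  assumes F: "F differentiable (at z)" and z: "(\<zeta> has_vector_derivative y) (at 0)" "\<zeta> 0 = z"
  shows "((\<lambda>t. F (\<zeta> t)) has_real_derivative (\<Sum>k\<in>UNIV. fst y $ k * du F k z + snd y $ k * dv F k z)) (at 0)"
proof -
  obtain F' where F': "(F has_derivative F') (at z)" using F by (auto simp: differentiable_def)
  then interpret F': bounded_linear F' by (rule has_derivative_bounded_linear)
  have d: "((\<lambda>t. F (\<xi> t)) has_real_derivative F' w) (at 0)"
    if "(\<xi> has_vector_derivative w) (at 0)" "\<xi> 0 = z" for \<xi> w
  proof -
    have "(F has_derivative F') (at (\<xi> 0))" using F' that by simp
    note d = has_derivative_compose[OF that(1)[unfolded has_vector_derivative_def] this]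
    from d have "((\<lambda>t. F (\<xi> t)) has_derivative (\<lambda>t. t * F' w)) (at 0)" by (simp add: F'.scaleR)
    moreover have "(\<lambda>t. t * F' w) = (*) (F' w)" by (rule ext) (simp add: mult.commute)
    ultimately show ?thesis by (simp add: has_field_derivative_def)
  qed
  have 1: "du F k z = F' (axis k 1, 0)" for k
    unfolding du_def by (rule DERIV_imp_deriv, rule d)
      (auto intro!: derivative_eq_intros has_vector_derivative_Pair)
  have 2: "dv F k z = F' (0, axis k 1)" for k
    unfolding dv_def by (rule DERIV_imp_deriv, rule d)
      (auto intro!: derivative_eq_intros has_vector_derivative_Pair)
  have "y = (\<Sum>k\<in>UNIV. fst y $ k *\<^sub>R (axis k 1, 0) + snd y $ k *\<^sub>R (0, axis k 1))"
  proof (rule prod_eqI)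
    show "fst y = fst (\<Sum>k\<in>UNIV. fst y $ k *\<^sub>R (axis k 1, 0) + snd y $ k *\<^sub>R (0, axis k 1))"
      using basis_expansion[of "fst y"] by (simp add: fst_sum scalar_mult_eq_scaleR)
    show "snd y = snd (\<Sum>k\<in>UNIV. fst y $ k *\<^sub>R (axis k 1, 0) + snd y $ k *\<^sub>R (0, axis k 1))"
      using basis_expansion[of "snd y"] by (simp add: snd_sum scalar_mult_eq_scaleR)
  qed
  then have "F' y = F' (\<Sum>k\<in>UNIV. fst y $ k *\<^sub>R (axis k 1, 0) + snd y $ k *\<^sub>R (0, axis k 1))"
    by simp
  also have "\<dots> = (\<Sum>k\<in>UNIV. fst y $ k * du F k z + snd y $ k * dv F k z)"
    by (simp only: F'.sum F'.add F'.scaleR 1 2 real_scaleR_def)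
  finally show ?thesis using d[OF z] by simp
qed

definition step_u :: "real \<Rightarrow> 'a::finite phase \<Rightarrow> 'a phase" where
  "step_u h x = (\<chi> k. fst x $ k * (1 + h * snd x $ k) / (1 + h * snd x $ prv k), snd x)"

definition step_v :: "real \<Rightarrow> 'a::finite phase \<Rightarrow> 'a phase" where
  "step_v h x = (fst x, \<chi> k. snd x $ k * (1 + h * fst x $ nxt k) / (1 + h * fst x $ k))"

lemma dmap_steps: "dmap h x = step_v h (step_u h x)"
  by (simp add: dmap_def step_u_def step_v_def Let_def)

lemma sum_axis: "(\<Sum>j\<in>UNIV. (axis k (1::real) $ j) * w j) = w k"
proof -
  have "(\<Sum>j\<in>UNIV. (axis k (1::real) $ j) * w j) = (\<Sum>j\<in>UNIV. if j = k then w j else 0)"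
    by (rule sum.cong) (auto simp: axis_def)
  then show ?thesis by simp
qed

text \<open>
  In the logarithmic coordinates \<open>log u\<^sub>k\<close>, \<open>log v\<^sub>k\<close> the bracket is constant, and each half step adds to
  one half of the coordinates a sum of functions of the other half, which preserves it term by term.
\<close>

lemma pb_log:
  "pb F G x = (\<Sum>k\<in>UNIV.
      - ((fst x $ k * du F k x) * (snd x $ k * dv G k x) - (snd x $ k * dv F k x) * (fst x $ k * du G k x))
      - ((snd x $ k * dv F k x) * (fst x $ nxt k * du G (nxt k) x)
          - (fst x $ nxt k * du F (nxt k) x) * (snd x $ k * dv G k x)))"
  unfolding pb_def by (rule sum.cong) (simp_all add: algebra_simps)

text \<open>Reindexed so that site k pairs u_k with its two neighbours v_k and v_{k-1}. In this
  grouping the step that moves v acts term by term.\<close>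

lemma pb_log':
  "pb F G x = (\<Sum>k\<in>UNIV.
      - ((fst x $ k * du F k x) * (snd x $ k * dv G k x) - (snd x $ k * dv F k x) * (fst x $ k * du G k x))
      - ((snd x $ prv k * dv F (prv k) x) * (fst x $ k * du G k x)
          - (fst x $ k * du F k x) * (snd x $ prv k * dv G (prv k) x)))"
  unfolding pb_log sum_subtractf
  using sum_shift[of "\<lambda>k. (snd x $ k * dv F k x) * (fst x $ nxt k * du G (nxt k) x)" "-1"]
    sum_shift[of "\<lambda>k. (fst x $ nxt k * du F (nxt k) x) * (snd x $ k * dv G k x)" "-1"]
  by simp

lemma sum_axis_prv: "(\<Sum>j\<in>UNIV. (axis k (1::real) $ prv j) * w j) = w (nxt k)"
  using sum_shift[of "\<lambda>j. (axis k (1::real) $ j) * w (nxt j)" "-1"] by (simp add: sum_axis)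

lemma sum_axis_nxt: "(\<Sum>j\<in>UNIV. (axis k (1::real) $ nxt j) * w j) = w (prv k)"
  using sum_shift[of "\<lambda>j. (axis k (1::real) $ j) * w (prv j)" "1"] by (simp add: sum_axis)

lemma deriv_ratio:
  fixes u v w a b h :: real
  assumes "1 + h * w \<noteq> 0"
  shows "((\<lambda>t. u * (1 + h * (v + t * a)) / (1 + h * (w + t * b))) has_real_derivative
    a * (h * u / (1 + h * w)) - b * (h * u * (1 + h * v) / (1 + h * w)\<^sup>2)) (at 0)"
proof -
  define d where "d = 1 + h * w"
  have d: "d \<noteq> 0" using assms by (simp add: d_def)
  have 1: "((\<lambda>t. u * (1 + h * (v + t * a))) has_real_derivative u * (h * a)) (at 0)"
    "((\<lambda>t. 1 + h * (w + t * b)) has_real_derivative h * b) (at 0)"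
    by (auto intro!: derivative_eq_intros)
  have "1 + h * (w + 0 * b) \<noteq> 0" using assms by simp
  from DERIV_divide[OF 1 this]
  have "((\<lambda>t. u * (1 + h * (v + t * a)) / (1 + h * (w + t * b))) has_real_derivative
    (u * (h * a) * d - u * (1 + h * v) * (h * b)) / (d * d)) (at 0)"
    by (simp add: d_def)
  moreover have "(u * (h * a) * d - u * (1 + h * v) * (h * b)) / (d * d)
      = a * (h * u / d) - b * (h * u * (1 + h * v) / d\<^sup>2)"
    using d by (simp add: field_simps power2_eq_square)
  ultimately show ?thesis by (simp add: d_def)
qed

text \<open>log u is translated by a function of v, so u d/du is unchanged. Under v_k d/dv_k the two
  sites whose new u contains v_k contribute with the factor h v_k / (1 + h v_k), the derivative of
  log (1 + h v_k) with respect to log v_k.\<close>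

lemma step_u_log:
  fixes F :: "'a::finite phase \<Rightarrow> real"
  assumes nz: "\<And>k. 1 + h * snd x $ k \<noteq> 0" and F: "F differentiable (at (step_u h x))"
  defines "z \<equiv> step_u h x"
  shows "fst x $ k * du (\<lambda>y. F (step_u h y)) k x = fst z $ k * du F k z"
    "snd x $ k * dv (\<lambda>y. F (step_u h y)) k x = snd z $ k * dv F k z
      + h * snd x $ k / (1 + h * snd x $ k) * (fst z $ k * du F k z - fst z $ nxt k * du F (nxt k) z)"
proof -
  let ?y1 = "(\<chi> j. axis k 1 $ j * ((1 + h * snd x $ j) / (1 + h * snd x $ prv j)), 0) :: 'a phase"
  have "((\<lambda>t. step_u h (fst x + t *\<^sub>R axis k 1, snd x)) has_vector_derivative ?y1) (at 0)"
  proof (rule has_vector_derivative_phase)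
    fix j
    show "((\<lambda>t. fst (step_u h (fst x + t *\<^sub>R axis k 1, snd x)) $ j) has_real_derivative fst ?y1 $ j) (at 0)"
    proof -
      have "(\<lambda>t. fst (step_u h (fst x + t *\<^sub>R axis k 1, snd x)) $ j)
          = (\<lambda>t. (fst x $ j + t * axis k 1 $ j) * ((1 + h * snd x $ j) / (1 + h * snd x $ prv j)))"
        by (simp add: step_u_def)
      then show ?thesis by (simp only:) (rule derivative_eq_intros refl | simp)+
    qed
    show "((\<lambda>t. snd (step_u h (fst x + t *\<^sub>R axis k 1, snd x)) $ j) has_real_derivative snd ?y1 $ j) (at 0)"
      by (simp add: step_u_def)
  qed
  from DERIV_imp_deriv[OF deriv_phase[OF F this]]
  have "du (\<lambda>y. F (step_u h y)) k x = (\<Sum>j\<in>UNIV. axis k 1 $ j * ((1 + h * snd x $ j) / (1 + h * snd x $ prv j) * du F j z))"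
    by (simp add: du_def z_def mult.assoc)
  then have "du (\<lambda>y. F (step_u h y)) k x = (1 + h * snd x $ k) / (1 + h * snd x $ prv k) * du F k z"
    by (simp only: sum_axis)
  then show "fst x $ k * du (\<lambda>y. F (step_u h y)) k x = fst z $ k * du F k z"
    by (simp add: z_def step_u_def)
  let ?y2 = "(\<chi> j. axis k 1 $ j * (h * fst x $ j / (1 + h * snd x $ prv j))
      - axis k 1 $ prv j * (h * fst x $ j * (1 + h * snd x $ j) / (1 + h * snd x $ prv j)\<^sup>2), axis k 1) :: 'a phase"
  have "((\<lambda>t. step_u h (fst x, snd x + t *\<^sub>R axis k 1)) has_vector_derivative ?y2) (at 0)"
  proof (rule has_vector_derivative_phase)
    fix j
    show "((\<lambda>t. fst (step_u h (fst x, snd x + t *\<^sub>R axis k 1)) $ j) has_real_derivative fst ?y2 $ j) (at 0)"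
      using deriv_ratio[OF nz[of "prv j"], of "fst x $ j" "snd x $ j" "axis k 1 $ j" "axis k 1 $ prv j"]
      by (simp add: step_u_def)
    show "((\<lambda>t. snd (step_u h (fst x, snd x + t *\<^sub>R axis k 1)) $ j) has_real_derivative snd ?y2 $ j) (at 0)"
      by (auto simp: step_u_def intro!: derivative_eq_intros)
  qed
  from DERIV_imp_deriv[OF deriv_phase[OF F this]]
  have "dv (\<lambda>y. F (step_u h y)) k x = (\<Sum>j\<in>UNIV. axis k 1 $ j * (h * fst x $ j / (1 + h * snd x $ prv j) * du F j z))
      - (\<Sum>j\<in>UNIV. axis k 1 $ prv j * (h * fst x $ j * (1 + h * snd x $ j) / (1 + h * snd x $ prv j)\<^sup>2 * du F j z))
      + (\<Sum>j\<in>UNIV. axis k 1 $ j * dv F j z)"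
    by (simp add: dv_def z_def mult.assoc left_diff_distrib sum.distrib sum_subtractf)
  then have e: "dv (\<lambda>y. F (step_u h y)) k x = h * fst x $ k / (1 + h * snd x $ prv k) * du F k z
      - h * fst x $ nxt k * (1 + h * snd x $ nxt k) / (1 + h * snd x $ k)\<^sup>2 * du F (nxt k) z + dv F k z"
    by (simp only: sum_axis sum_axis_prv shift_cancel1)
  show "snd x $ k * dv (\<lambda>y. F (step_u h y)) k x = snd z $ k * dv F k z
      + h * snd x $ k / (1 + h * snd x $ k) * (fst z $ k * du F k z - fst z $ nxt k * du F (nxt k) z)"
  proof -
    have z: "fst z $ k = fst x $ k * (1 + h * snd x $ k) / (1 + h * snd x $ prv k)"
      "fst z $ nxt k = fst x $ nxt k * (1 + h * snd x $ nxt k) / (1 + h * snd x $ k)" "snd z $ k = snd x $ k"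
      by (simp_all add: z_def step_u_def)
    have "v * (h * p / e * A - h * q * n / d\<^sup>2 * B + D) = v * D + h * v / d * (p * d / e * A - q * n / d * B)"
      if "d \<noteq> 0" "e \<noteq> 0" for v p q n d e A B D :: real
      using that by (simp add: field_simps power2_eq_square)
    from this[OF nz nz] show ?thesis using e unfolding z by simp
  qed
qed

lemma step_v_log:
  fixes F :: "'a::finite phase \<Rightarrow> real"
  assumes nz: "\<And>k. 1 + h * fst x $ k \<noteq> 0" and F: "F differentiable (at (step_v h x))"
  defines "z \<equiv> step_v h x"
  shows "snd x $ k * dv (\<lambda>y. F (step_v h y)) k x = snd z $ k * dv F k z"
    "fst x $ k * du (\<lambda>y. F (step_v h y)) k x = fst z $ k * du F k z
      + h * fst x $ k / (1 + h * fst x $ k) * (snd z $ prv k * dv F (prv k) z - snd z $ k * dv F k z)"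
proof -
  let ?y1 = "(0, \<chi> j. axis k 1 $ j * ((1 + h * fst x $ nxt j) / (1 + h * fst x $ j))) :: 'a phase"
  have "((\<lambda>t. step_v h (fst x, snd x + t *\<^sub>R axis k 1)) has_vector_derivative ?y1) (at 0)"
  proof (rule has_vector_derivative_phase)
    fix j
    show "((\<lambda>t. snd (step_v h (fst x, snd x + t *\<^sub>R axis k 1)) $ j) has_real_derivative snd ?y1 $ j) (at 0)"
    proof -
      have "(\<lambda>t. snd (step_v h (fst x, snd x + t *\<^sub>R axis k 1)) $ j)
          = (\<lambda>t. (snd x $ j + t * axis k 1 $ j) * ((1 + h * fst x $ nxt j) / (1 + h * fst x $ j)))"
        by (simp add: step_v_def)
      then show ?thesis by (simp only:) (rule derivative_eq_intros refl | simp)+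
    qed
    show "((\<lambda>t. fst (step_v h (fst x, snd x + t *\<^sub>R axis k 1)) $ j) has_real_derivative fst ?y1 $ j) (at 0)"
      by (simp add: step_v_def)
  qed
  from DERIV_imp_deriv[OF deriv_phase[OF F this]]
  have "dv (\<lambda>y. F (step_v h y)) k x = (\<Sum>j\<in>UNIV. axis k 1 $ j * ((1 + h * fst x $ nxt j) / (1 + h * fst x $ j) * dv F j z))"
    by (simp add: dv_def z_def mult.assoc)
  then have "dv (\<lambda>y. F (step_v h y)) k x = (1 + h * fst x $ nxt k) / (1 + h * fst x $ k) * dv F k z"
    by (simp only: sum_axis)
  then show "snd x $ k * dv (\<lambda>y. F (step_v h y)) k x = snd z $ k * dv F k z"
    by (simp add: z_def step_v_def)
  let ?y2 = "(axis k 1, \<chi> j. axis k 1 $ nxt j * (h * snd x $ j / (1 + h * fst x $ j))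
      - axis k 1 $ j * (h * snd x $ j * (1 + h * fst x $ nxt j) / (1 + h * fst x $ j)\<^sup>2)) :: 'a phase"
  have "((\<lambda>t. step_v h (fst x + t *\<^sub>R axis k 1, snd x)) has_vector_derivative ?y2) (at 0)"
  proof (rule has_vector_derivative_phase)
    fix j
    show "((\<lambda>t. snd (step_v h (fst x + t *\<^sub>R axis k 1, snd x)) $ j) has_real_derivative snd ?y2 $ j) (at 0)"
      using deriv_ratio[OF nz[of j], of "snd x $ j" "fst x $ nxt j" "axis k 1 $ nxt j" "axis k 1 $ j"]
      by (simp add: step_v_def)
    show "((\<lambda>t. fst (step_v h (fst x + t *\<^sub>R axis k 1, snd x)) $ j) has_real_derivative fst ?y2 $ j) (at 0)"
      by (auto simp: step_v_def intro!: derivative_eq_intros)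
  qed
  from DERIV_imp_deriv[OF deriv_phase[OF F this]]
  have "du (\<lambda>y. F (step_v h y)) k x = (\<Sum>j\<in>UNIV. axis k 1 $ j * du F j z)
      + ((\<Sum>j\<in>UNIV. axis k 1 $ nxt j * (h * snd x $ j / (1 + h * fst x $ j) * dv F j z))
      - (\<Sum>j\<in>UNIV. axis k 1 $ j * (h * snd x $ j * (1 + h * fst x $ nxt j) / (1 + h * fst x $ j)\<^sup>2 * dv F j z)))"
    by (simp add: du_def z_def mult.assoc left_diff_distrib sum.distrib sum_subtractf)
  then have e: "du (\<lambda>y. F (step_v h y)) k x = du F k z
      + (h * snd x $ prv k / (1 + h * fst x $ prv k) * dv F (prv k) z
      - h * snd x $ k * (1 + h * fst x $ nxt k) / (1 + h * fst x $ k)\<^sup>2 * dv F k z)"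
    by (simp only: sum_axis sum_axis_nxt shift_cancel1)
  show "fst x $ k * du (\<lambda>y. F (step_v h y)) k x = fst z $ k * du F k z
      + h * fst x $ k / (1 + h * fst x $ k) * (snd z $ prv k * dv F (prv k) z - snd z $ k * dv F k z)"
  proof -
    have z: "snd z $ k = snd x $ k * (1 + h * fst x $ nxt k) / (1 + h * fst x $ k)"
      "snd z $ prv k = snd x $ prv k * (1 + h * fst x $ k) / (1 + h * fst x $ prv k)" "fst z $ k = fst x $ k"
      by (simp_all add: z_def step_v_def)
    have "u * (D + (h * p / e * B - h * q * n / d\<^sup>2 * A)) = u * D + h * u / d * (p * d / e * B - q * n / d * A)"
      if "d \<noteq> 0" "e \<noteq> 0" for u p q n d e A B D :: real
      using that by (simp add: field_simps power2_eq_square)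
    from this[OF nz nz] show ?thesis using e unfolding z by simp
  qed
qed

text \<open>Let D be the difference of u d/du at sites k and k + 1. The terms of
  \<open>pb_log\<close> at k are skew in D and v_k d/dv_k; the step adds a multiple of D to the
  latter, which drops out.\<close>

lemma pb_step_u:
  fixes F G :: "'a::finite phase \<Rightarrow> real"
  assumes nz: "\<And>k. 1 + h * snd x $ k \<noteq> 0"
    and "F differentiable (at (step_u h x))" "G differentiable (at (step_u h x))"
  shows "pb (\<lambda>y. F (step_u h y)) (\<lambda>y. G (step_u h y)) x = pb F G (step_u h x)"
  unfolding pb_log step_u_log[OF nz assms(2)] step_u_log[OF nz assms(3)]
  by (rule sum.cong) (simp_all add: algebra_simps)

lemma pb_step_v:
  fixes F G :: "'a::finite phase \<Rightarrow> real"
  assumes nz: "\<And>k. 1 + h * fst x $ k \<noteq> 0"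
    and "F differentiable (at (step_v h x))" "G differentiable (at (step_v h x))"
  shows "pb (\<lambda>y. F (step_v h y)) (\<lambda>y. G (step_v h y)) x = pb F G (step_v h x)"
  unfolding pb_log' step_v_log[OF nz assms(2)] step_v_log[OF nz assms(3)]
  by (rule sum.cong) (simp_all add: algebra_simps)

lemma step_v_differentiable:
  assumes nz: "\<And>k. 1 + h * fst x $ k \<noteq> 0"
  shows "step_v h differentiable (at x)"
proof -
  have "(\<lambda>y. snd (step_v h y) $ k) differentiable (at x)" for k
    unfolding step_v_def snd_conv vec_lambda_beta using nz[of k]
    by (intro differentiable_mult differentiable_divide differentiable_add differentiable_const differentiable_coordinate)
  then obtain D where D: "((\<lambda>y. snd (step_v h y) $ k) has_derivative D k) (at x)" for k
    unfolding differentiable_def by metis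
  have "((\<lambda>y. snd (step_v h y)) has_derivative (\<lambda>y. \<chi> k. D k y)) (at x)"
    unfolding has_derivative_vec_iff using D by simp
  from has_derivative_Pair[OF bounded_linear_imp_has_derivative[OF bounded_linear_fst] this]
  show ?thesis by (auto simp: differentiable_def step_v_def[abs_def])
qed

theorem pb_dmap:
  fixes F G :: "'a::finite phase \<Rightarrow> real"
  assumes "x \<in> dmap_dom h" "F differentiable (at (dmap h x))" "G differentiable (at (dmap h x))"
  shows "pb (\<lambda>y. F (dmap h y)) (\<lambda>y. G (dmap h y)) x = pb F G (dmap h x)"
proof -
  have nz: "1 + h * snd x $ k \<noteq> 0" "1 + h * fst (step_u h x) $ k \<noteq> 0" for k
    using assms(1) by (auto simp: dmap_dom_def dmap_steps step_v_def)
  note d = differentiable_chain_at[OF step_v_differentiable[OF nz(2)], unfolded o_def]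
  show ?thesis
    unfolding dmap_steps
    using pb_step_u[OF nz(1) d d, of F G] pb_step_v[OF nz(2), of F G] assms(2,3)
    by (simp add: dmap_steps)
qed

lemma dmap_rel_iff:
  assumes "x \<in> dmap_dom h"
  shows "dmap_rel h x y \<longleftrightarrow> y = dmap h x"
proof -
  have nz: "1 + h * snd x $ k \<noteq> 0" "1 + h * fst (step_u h x) $ k \<noteq> 0" for k
    using assms by (auto simp: dmap_dom_def dmap_steps step_v_def)
  have 1: "(\<forall>k. fst y $ k * (1 + h * snd x $ prv k) = fst x $ k * (1 + h * snd x $ k))
      \<longleftrightarrow> fst y = fst (step_u h x)"
    using nz(1) by (simp add: step_u_def vec_eq_iff nonzero_eq_divide_eq)
  have "(\<forall>k. snd y $ k * (1 + h * fst (step_u h x) $ k) = snd x $ k * (1 + h * fst (step_u h x) $ nxt k))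
      \<longleftrightarrow> snd y = snd (step_v h (step_u h x))"
    using nz(2) by (simp add: step_v_def vec_eq_iff nonzero_eq_divide_eq) (simp add: step_u_def)
  then show ?thesis
    unfolding dmap_rel_def 1 dmap_steps by (auto simp: step_v_def prod_eq_iff)
qed

section \<open>Analysis in a Banach algebra: norm, exponential, logarithm\<close>

section \<open>The Wiener algebra as a Banach algebra\<close>

text \<open>
  Twisted series multiply like weighted shifts, so the maximum of the coordinates in each degree gives a
  submultiplicative norm with \<open>\<parallel>1\<parallel> = 1\<close>, which \<open>wnorm\<close> does not have.
\<close>

definition rn :: "'a::finite loop \<Rightarrow> int \<Rightarrow> real" where
  "rn L p = Max (range (\<lambda>i. \<bar>coef L p i\<bar>))"

lemma rn_le_iff: "rn L p \<le> c \<longleftrightarrow> (\<forall>i. \<bar>coef L p i\<bar> \<le> c)"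
  unfolding rn_def by (subst Max_le_iff) auto

lemma coef_le_rn: "\<bar>coef L p i\<bar> \<le> rn L p"
  using rn_le_iff[of L p "rn L p"] by blast

lemma rn_nonneg [simp]: "0 \<le> rn L p"
  using coef_le_rn[of L p] abs_ge_zero order_trans by blast

lemma rn_le_norm: "rn L p \<le> norm (L p)"
  unfolding rn_le_iff coef_def
  by (metis Finite_Cartesian_Product.norm_nth_le norm_nth_le order_trans real_norm_def)

text \<open>A row has at most one nonzero entry in each degree, so the matrix norm is at most the
  number of rows times \<open>rn\<close>. This is the origin of the factor
  \<open>CARD('a mod_ring)\<close> in the smallness conditions of the flow.\<close>

lemma norm_le_rn:
  assumes "twisted (L :: 'a::finite loop)"
  shows "norm (L p) \<le> real CARD('a mod_ring) * rn L p"
proof -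
  have "norm (L p) \<le> (\<Sum>i\<in>UNIV. norm (L p $ i))"
    by (rule norm_le_l1_cart[unfolded real_norm_def, THEN order_trans] | simp add: norm_vec_def L2_set_le_sum)+
  also have "\<dots> \<le> (\<Sum>i\<in>(UNIV :: 'a mod_ring set). rn L p)"
  proof (rule sum_mono)
    fix i
    have "norm (L p $ i) \<le> (\<Sum>k\<in>UNIV. \<bar>L p $ i $ k\<bar>)" by (rule norm_le_l1_cart)
    also have "\<dots> = (\<Sum>k\<in>UNIV. if k = shift (- p) i then \<bar>coef L p i\<bar> else 0)"
      by (rule sum.cong) (simp_all add: twisted_nth[OF assms])
    also have "\<dots> \<le> rn L p" by (simp add: coef_le_rn)
    finally show "norm (L p $ i) \<le> rn L p" .
  qed
  finally show ?thesis by simp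
qed

lemma wiener_iff: "L \<in> wiener \<longleftrightarrow> twisted L \<and> rn L summable_on UNIV"
proof
  assume "L \<in> wiener"
  then have s: "twisted L" "(\<lambda>p. norm (L p)) summable_on UNIV" by (auto simp: wiener_def)
  have "(\<lambda>p. norm (rn L p)) summable_on UNIV"
    by (rule Infinite_Sum.abs_summable_on_comparison_test'[OF s(2)]) (simp add: rn_le_norm)
  then show "twisted L \<and> rn L summable_on UNIV" using s(1) by simp
next
  assume a: "twisted L \<and> rn L summable_on UNIV"
  then have "(\<lambda>p. real CARD('a mod_ring) * rn L p) summable_on UNIV"
    by (intro summable_on_cmult_right) simp
  then have "(\<lambda>p. norm (L p)) summable_on UNIV"
    by (rule Infinite_Sum.abs_summable_on_comparison_test') (use a norm_le_rn in blast)
  then show "L \<in> wiener" using a by (simp add: wiener_def)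
qed

lemma wienerD: "L \<in> wiener \<Longrightarrow> twisted L" "L \<in> wiener \<Longrightarrow> rn L summable_on UNIV"
  "L \<in> wiener \<Longrightarrow> (\<lambda>p. norm (L p)) summable_on UNIV"
  using wiener_iff[of L] by (auto simp: wiener_def)

lemma wiener_comparison:
  assumes "twisted L" "g summable_on UNIV" "\<And>p. rn L p \<le> g p"
  shows "L \<in> wiener"
proof -
  have "(\<lambda>p. norm (rn L p)) summable_on UNIV"
    by (rule Infinite_Sum.abs_summable_on_comparison_test'[OF assms(2)]) (simp add: assms(3))
  then show ?thesis using assms(1) by (simp add: wiener_iff)
qed

lemma rn_add: "rn (L + M) p \<le> rn L p + rn M p"
  unfolding rn_le_iff using coef_le_rn[of L p] coef_le_rn[of M p]
  by (auto intro: order_trans[OF abs_triangle_ineq add_mono])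

lemma rn_scale: "rn (\<lambda>q. c *\<^sub>R L q) p = \<bar>c\<bar> * rn L p"
proof (rule antisym)
  show "rn (\<lambda>q. c *\<^sub>R L q) p \<le> \<bar>c\<bar> * rn L p"
    unfolding rn_le_iff by (simp add: coef_scale abs_mult mult_left_mono coef_le_rn)
  show "\<bar>c\<bar> * rn L p \<le> rn (\<lambda>q. c *\<^sub>R L q) p"
  proof (cases "c = 0")
    case False
    then have "rn L p \<le> rn (\<lambda>q. c *\<^sub>R L q) p / \<bar>c\<bar>"
      unfolding rn_le_iff using coef_le_rn[of "\<lambda>q. c *\<^sub>R L q" p]
      by (auto simp: coef_scale abs_mult field_simps)
    then show ?thesis using False by (simp add: field_simps)
  qed simp
qed

lemma wiener_add: "L \<in> wiener \<Longrightarrow> M \<in> wiener \<Longrightarrow> L + M \<in> wiener"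
  by (rule wiener_comparison[OF _ summable_on_add rn_add]) (auto simp: wienerD twisted_add)

lemma wiener_scale: "L \<in> wiener \<Longrightarrow> (\<lambda>p. c *\<^sub>R L p) \<in> wiener"
  by (rule wiener_comparison[OF _ summable_on_cmult_right[of "rn L" _ "\<bar>c\<bar>"]])
    (auto simp: wienerD twisted_scale rn_scale)

lemma wiener_minus: "L \<in> wiener \<Longrightarrow> - L \<in> wiener"
  using wiener_scale[of L "-1"] by (simp add: fun_Compl_def)

lemma wiener_diff: "L \<in> wiener \<Longrightarrow> M \<in> wiener \<Longrightarrow> L - M \<in> wiener"
  using wiener_add[of L "- M"] wiener_minus[of M] by simp

lemma wiener_finite: "twisted L \<Longrightarrow> finite F \<Longrightarrow> (\<And>p. p \<notin> F \<Longrightarrow> L p = 0) \<Longrightarrow> L \<in> wiener"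
  unfolding wiener_def
  using summable_on_cong_neutral[of F UNIV "\<lambda>p. norm (L p)" "\<lambda>p. norm (L p)"] by auto

lemma wiener_mono [simp]: "mono_loop r y \<in> wiener"
  by (rule wiener_finite[of _ "{r}"]) (auto simp: mono_loop_neq)

lemma wiener_zero [simp]: "0 \<in> wiener"
  by (rule wiener_finite[of _ "{}"]) (auto simp: twisted_zero)

lemma wiener_lone [simp]: "lone \<in> wiener"
  by (simp add: lone_mono)

lemma convolution_summable:
  fixes a b :: "int \<Rightarrow> real"
  assumes a: "a summable_on UNIV" "\<And>q. 0 \<le> a q" and b: "b summable_on UNIV" "\<And>q. 0 \<le> b q"
  shows "(\<lambda>(p, q). a q * b (p - q)) summable_on UNIV \<times> UNIV"
    "(\<lambda>p. \<Sum>\<^sub>\<infinity>q. a q * b (p - q)) summable_on UNIV"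
    "(\<Sum>\<^sub>\<infinity>p. \<Sum>\<^sub>\<infinity>q. a q * b (p - q)) = infsum a UNIV * infsum b UNIV"
    "(\<lambda>q. a q * b (p - q)) summable_on UNIV"
proof -
  \<comment> \<open>The shear that sends (p, q) to (q, p - q) turns the convolution into a product
    of two independent sums.\<close>
  let ?g = "\<lambda>(p::int, q::int). (q, p - q)"
  have bij: "bij_betw ?g (UNIV \<times> UNIV) (UNIV \<times> UNIV)"
    by (rule bij_betwI[where g = "\<lambda>(q, r). (q + r, q)"]) auto
  have s: "(\<lambda>(q, r). a q * b r) summable_on UNIV \<times> UNIV"
  proof (rule summable_on_SigmaI[where g = "\<lambda>q. a q * infsum b UNIV"])
    show "((\<lambda>y. case (x, y) of (q, r) \<Rightarrow> a q * b r) has_sum a x * infsum b UNIV) UNIV" for x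
      using has_sum_cmult_right[OF has_sum_infsum[OF b(1)], of "a x"] by simp
    show "(\<lambda>q. a q * infsum b UNIV) summable_on UNIV" by (rule summable_on_cmult_left[OF a(1)])
  qed (auto simp: a b)
  have e: "(\<lambda>x. (\<lambda>(q, r). a q * b r) (?g x)) = (\<lambda>(p, q). a q * b (p - q))" by auto
  show 1: "(\<lambda>(p, q). a q * b (p - q)) summable_on UNIV \<times> UNIV"
    using s summable_on_reindex_bij_betw[OF bij, of "\<lambda>(q, r). a q * b r"] unfolding e by simp
  show "(\<lambda>p. \<Sum>\<^sub>\<infinity>q. a q * b (p - q)) summable_on UNIV"
    using summable_on_Sigma_banach[OF 1] by simp
  have "(\<Sum>\<^sub>\<infinity>p. \<Sum>\<^sub>\<infinity>q. a q * b (p - q)) = infsum (\<lambda>(p, q). a q * b (p - q)) (UNIV \<times> UNIV)"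
    using infsum_Sigma_banach[OF 1] by simp
  also have "\<dots> = infsum (\<lambda>(q, r). a q * b r) (UNIV \<times> UNIV)"
    using infsum_reindex_bij_betw[OF bij, of "\<lambda>(q, r). a q * b r"] unfolding e .
  also have "\<dots> = (\<Sum>\<^sub>\<infinity>q. \<Sum>\<^sub>\<infinity>r. a q * b r)"
    using infsum_Sigma_banach[OF s] by simp
  also have "\<dots> = infsum a UNIV * infsum b UNIV"
    by (simp add: infsum_cmult_right' infsum_cmult_left')
  finally show "(\<Sum>\<^sub>\<infinity>p. \<Sum>\<^sub>\<infinity>q. a q * b (p - q)) = infsum a UNIV * infsum b UNIV" .
  show "(\<lambda>q. a q * b (p - q)) summable_on UNIV"
    using summable_on_SigmaD1[OF 1, of p] 1 by (auto dest: summable_on_Sigma_banach simp: summable_on_SigmaD1)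
qed

lemma matmul_norm_bound: "\<exists>K\<ge>0. \<forall>(A :: real^'n^'m) (B :: real^'k^'n). norm (A ** B) \<le> norm A * norm B * K"
  using bounded_bilinear.nonneg_bounded[OF bounded_bilinear_matmul] by blast

lemma wiener_conv:
  assumes "L \<in> wiener" "M \<in> wiener"
  shows "conv L M"
  unfolding conv_def
proof
  fix p
  obtain K where K: "\<And>(A :: real^'a mod_ring^'a mod_ring) (B :: real^'a mod_ring^'a mod_ring).
      norm (A ** B) \<le> norm A * norm B * K"
    using matmul_norm_bound by blast
  have "(\<lambda>q. norm (L q) * norm (M (p - q)) * K) summable_on UNIV"
    by (intro summable_on_cmult_left convolution_summable(4) wienerD(3) assms) auto
  then have "(\<lambda>q. norm (L q ** M (p - q))) summable_on UNIV"
    by (rule Infinite_Sum.abs_summable_on_comparison_test') (rule K)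
  then show "(\<lambda>q. L q ** M (p - q)) summable_on UNIV" by (rule Infinite_Sum.abs_summable_summable)
qed

lemma wiener_assoc:
  assumes "L \<in> wiener" "M \<in> wiener" "N \<in> wiener"
  shows "L \<star> M \<star> N = L \<star> (M \<star> N)"
proof (rule lmul_assoc_gen[OF wiener_conv[OF assms(1,2)] wiener_conv[OF assms(2,3)]])
  fix p
  obtain K where K0: "K \<ge> 0" and K: "\<And>(A :: real^'a mod_ring^'a mod_ring) (B :: real^'a mod_ring^'a mod_ring).
      norm (A ** B) \<le> norm A * norm B * K"
    using matmul_norm_bound by blast
  \<comment> \<open>A uniform bound suffices for the third factor, since the sum over (q, r)
    converges through the first two.\<close>
  let ?B = "wnorm N"
  have B: "norm (N q) \<le> ?B" for q
    using finite_sum_le_infsum[OF wienerD(3)[OF assms(3)], of "{q}"] by (simp add: wnorm_def)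
  have "(\<lambda>x. (case x of (q, r) \<Rightarrow> norm (L r) * norm (M (q - r))) * (K * ?B * K)) summable_on UNIV \<times> UNIV"
    by (intro summable_on_cmult_left convolution_summable(1) wienerD(3) assms) auto
  then have "(\<lambda>x. norm (case x of (q, r) \<Rightarrow> L r ** M (q - r) ** N (p - q))) summable_on UNIV \<times> UNIV"
  proof (rule Infinite_Sum.abs_summable_on_comparison_test')
    fix x :: "int \<times> int"
    obtain q r where x: "x = (q, r)" by fastforce
    have "norm (L r ** M (q - r) ** N (p - q)) \<le> norm (L r ** M (q - r)) * norm (N (p - q)) * K" by (rule K)
    also have "\<dots> \<le> (norm (L r) * norm (M (q - r)) * K) * ?B * K"
      by (intro mult_right_mono mult_mono K B K0) (auto simp: K0)
    finally show "norm (case x of (q, r) \<Rightarrow> L r ** M (q - r) ** N (p - q))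
        \<le> (case x of (q, r) \<Rightarrow> norm (L r) * norm (M (q - r))) * (K * ?B * K)"
      by (simp add: x algebra_simps)
  qed
  then show "(\<lambda>(q, r). L r ** M (q - r) ** N (p - q)) summable_on UNIV \<times> UNIV"
    by (rule Infinite_Sum.abs_summable_summable)
qed

lemma rn_lmul:
  assumes "L \<in> wiener" "M \<in> wiener"
  shows "rn (L \<star> M) p \<le> (\<Sum>\<^sub>\<infinity>q. rn L q * rn M (p - q))"
  unfolding rn_le_iff
proof
  fix i :: "'a mod_ring"
  have bl: "bounded_linear (\<lambda>A::real^'a mod_ring^'a mod_ring. A $ i $ shift (- p) i)"
    by (intro bounded_linear_compose[OF bounded_linear_vec_nth] bounded_linear_vec_nth)
  have c: "(L q ** M (p - q)) $ i $ shift (- p) i = coef L q i * coef M (p - q) (shift (- q) i)" for q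
    using matmul_coef[of L M q "p - q" i] assms by (simp add: wienerD)
  have "coef (L \<star> M) p i = (\<Sum>\<^sub>\<infinity>q. L q ** M (p - q)) $ i $ shift (- p) i"
    by (simp only: coef_def lmul_def)
  also have "\<dots> = (\<Sum>\<^sub>\<infinity>q. (L q ** M (p - q)) $ i $ shift (- p) i)"
    by (rule infsum_bounded_linear'[OF bl, symmetric]) (use wiener_conv[OF assms] in \<open>simp add: conv_def\<close>)
  finally have "coef (L \<star> M) p i = (\<Sum>\<^sub>\<infinity>q. coef L q i * coef M (p - q) (shift (- q) i))"
    unfolding c .
  moreover have s: "(\<lambda>q. rn L q * rn M (p - q)) summable_on UNIV"
    by (intro convolution_summable(4) wienerD assms) auto
  moreover have le: "\<bar>coef L q i * coef M (p - q) (shift (- q) i)\<bar> \<le> rn L q * rn M (p - q)" for q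
    unfolding abs_mult by (intro mult_mono coef_le_rn) auto
  moreover have as: "(\<lambda>q. norm (coef L q i * coef M (p - q) (shift (- q) i))) summable_on UNIV"
    by (rule Infinite_Sum.abs_summable_on_comparison_test'[OF s]) (use le in simp)
  ultimately show "\<bar>coef (L \<star> M) p i\<bar> \<le> (\<Sum>\<^sub>\<infinity>q. rn L q * rn M (p - q))"
    using norm_infsum_bound[OF as] infsum_mono[OF as s] by (force simp: le)
qed

lemma wiener_lmul:
  assumes "L \<in> wiener" "M \<in> wiener"
  shows "L \<star> M \<in> wiener"
  by (rule wiener_comparison[OF twisted_lmul[OF wiener_conv[OF assms]] convolution_summable(2) rn_lmul[OF assms]])
    (use assms in \<open>auto simp: wienerD\<close>)

definition nn :: "'a::finite loop \<Rightarrow> real" where "nn L = infsum (rn L) UNIV"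

lemma rn_le_nn: "L \<in> wiener \<Longrightarrow> rn L p \<le> nn L"
  using finite_sum_le_infsum[OF wienerD(2), of L "{p}"] by (simp add: nn_def)

lemma nn_le_wnorm: "L \<in> wiener \<Longrightarrow> nn L \<le> wnorm L"
  unfolding nn_def wnorm_def by (rule infsum_mono) (auto simp: wienerD rn_le_norm)

lemma wnorm_le_nn: "(L :: 'a::finite loop) \<in> wiener \<Longrightarrow> wnorm L \<le> real CARD('a mod_ring) * nn L"
  unfolding nn_def wnorm_def infsum_cmult_right'[symmetric]
  by (rule infsum_mono[OF _ _ norm_le_rn]) (auto simp: wienerD intro: summable_on_cmult_right)

lemma nn_add: "L \<in> wiener \<Longrightarrow> M \<in> wiener \<Longrightarrow> nn (L + M) \<le> nn L + nn M"
  unfolding nn_def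
  by (subst infsum_add[symmetric]) (auto intro!: infsum_mono summable_on_add simp: wienerD wiener_add rn_add)

lemma nn_scale: "nn (\<lambda>p. c *\<^sub>R L p) = \<bar>c\<bar> * nn L"
  unfolding nn_def rn_scale infsum_cmult_right' ..

lemma nn_lmul: "L \<in> wiener \<Longrightarrow> M \<in> wiener \<Longrightarrow> nn (L \<star> M) \<le> nn L * nn M"
  unfolding nn_def
  by (subst convolution_summable(3)[symmetric])
    (auto intro!: infsum_mono convolution_summable(2) simp: wienerD wiener_lmul rn_lmul)

lemma nn_eq_0: "L \<in> wiener \<Longrightarrow> nn L = 0 \<Longrightarrow> L = 0"
proof (rule twisted_eqI)
  fix p i assume "L \<in> wiener" "nn L = 0"
  then show "coef L p i = coef 0 p i"
    using rn_le_nn[of L p] coef_le_rn[of L p i] by simp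
qed (auto simp: wienerD twisted_zero)

lemma nn_mono: "nn (mono_loop r y) = Max (range (\<lambda>i. \<bar>y i\<bar>))"
proof -
  have "rn (mono_loop r y) = (\<lambda>p. if p = r then Max (range (\<lambda>i. \<bar>y i\<bar>)) else 0)"
    by (rule ext) (simp add: rn_def)
  then have "nn (mono_loop r y) = (\<Sum>\<^sub>\<infinity>p. if p = r then Max (range (\<lambda>i. \<bar>y i\<bar>)) else 0)"
    by (simp add: nn_def)
  also have "\<dots> = (\<Sum>\<^sub>\<infinity>p\<in>{r}. Max (range (\<lambda>i. \<bar>y i\<bar>)))"
    by (rule infsum_cong_neutral) auto
  finally show ?thesis by simp
qed

text \<open>A type for the algebra makes \<open>exp\<close>, geometric series and the contraction
  principle applicable. Its norm will be \<open>nn\<close>, which is equivalent to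
  \<open>wnorm\<close>.\<close>

typedef (overloaded) 'a wn = "wiener :: 'a::finite loop set" morphisms Rep Abs
  by (rule exI[of _ 0]) simp

lemma Rep_wiener [simp]: "Rep x \<in> wiener" by (rule Rep)

instantiation wn :: (finite) real_normed_vector
begin

definition "(0 :: 'a wn) = Abs 0"
definition "(x :: 'a wn) + y = Abs (Rep x + Rep y)"
definition "(x :: 'a wn) - y = Abs (Rep x - Rep y)"
definition "- (x :: 'a wn) = Abs (- Rep x)"
definition scaleR_wn :: "real \<Rightarrow> 'a wn \<Rightarrow> 'a wn" where
  "scaleR_wn c x = Abs (\<lambda>p. c *\<^sub>R Rep x p)"
definition "norm (x :: 'a wn) = nn (Rep x)"
definition "sgn (x :: 'a wn) = scaleR (inverse (norm x)) x"
definition "dist (x :: 'a wn) y = norm (x - y)"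
definition uniformity_wn :: "('a wn \<times> 'a wn) filter" where
  "uniformity_wn = (INF e\<in>{0<..}. principal {(x, y). dist x y < e})"
definition open_wn :: "'a wn set \<Rightarrow> bool" where
  "open_wn B \<longleftrightarrow> (\<forall>x\<in>B. \<forall>\<^sub>F (x', y) in uniformity. x' = x \<longrightarrow> y \<in> B)"

lemma Rep_ops: "Rep (0 :: 'a wn) = 0" "Rep (x + y :: 'a wn) = Rep x + Rep y" "Rep (x - y) = Rep x - Rep y"
  "Rep (- x) = - Rep x" "Rep (c *\<^sub>R x) = (\<lambda>p. c *\<^sub>R Rep x p)"
  by (simp_all add: zero_wn_def plus_wn_def minus_wn_def uminus_wn_def scaleR_wn_def Abs_inverse
      wiener_add wiener_diff wiener_minus wiener_scale)

instance
proof
  fix x y z :: "'a wn" and a b :: real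
  show "x + y + z = x + (y + z)" "x + y = y + x" "0 + x = x" "- x + x = 0" "x - y = x + - y"
    "a *\<^sub>R (x + y) = a *\<^sub>R x + a *\<^sub>R y" "(a + b) *\<^sub>R x = a *\<^sub>R x + b *\<^sub>R x"
    "a *\<^sub>R b *\<^sub>R x = (a * b) *\<^sub>R x" "1 *\<^sub>R x = x"
    by (simp_all add: Rep_inject[symmetric] Rep_ops fun_eq_iff algebra_simps)
  show "dist x y = norm (x - y)" by (rule dist_wn_def)
  show "sgn x = scaleR (inverse (norm x)) x" by (rule sgn_wn_def)
  show "uniformity = (INF e\<in>{0<..}. principal {(x, y :: 'a wn). dist x y < e})" by (rule uniformity_wn_def)
  show "open B \<longleftrightarrow> (\<forall>x\<in>B. \<forall>\<^sub>F (x', y) in uniformity. x' = x \<longrightarrow> y \<in> B)" for B :: "'a wn set"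
    by (rule open_wn_def)
  show "norm x = 0 \<longleftrightarrow> x = 0"
  proof
    assume "norm x = 0"
    then show "x = 0" using nn_eq_0[of "Rep x"] by (simp add: norm_wn_def Rep_inject[symmetric] Rep_ops)
  next
    assume "x = 0"
    then show "norm x = 0" using nn_scale[of 0 "0 :: 'a loop"] by (simp add: norm_wn_def Rep_ops zero_fun_def)
  qed
  show "norm (x + y) \<le> norm x + norm y" by (simp add: norm_wn_def Rep_ops nn_add)
  show "norm (a *\<^sub>R x) = \<bar>a\<bar> * norm x" by (simp add: norm_wn_def Rep_ops nn_scale)
qed

end

instantiation wn :: (finite) real_normed_algebra_1
begin

definition "(1 :: 'a wn) = Abs lone"
definition "(x :: 'a wn) * y = Abs (Rep x \<star> Rep y)"

lemma Rep_mult: "Rep (1 :: 'a wn) = lone" "Rep (x * y :: 'a wn) = Rep x \<star> Rep y"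
  by (simp_all add: one_wn_def times_wn_def Abs_inverse wiener_lmul)

instance
proof
  fix x y z :: "'a wn" and a :: real
  show "x * y * z = x * (y * z)" by (simp add: Rep_inject[symmetric] Rep_mult wiener_assoc)
  show "1 * x = x" "x * 1 = x" by (simp_all add: Rep_inject[symmetric] Rep_mult)
  show "(x + y) * z = x * z + y * z" "x * (y + z) = x * y + x * z"
    by (simp_all add: Rep_inject[symmetric] Rep_mult Rep_ops lmul_add_left lmul_add_right wiener_conv)
  show "a *\<^sub>R x * y = a *\<^sub>R (x * y)" "x * a *\<^sub>R y = a *\<^sub>R (x * y)"
    by (simp_all add: Rep_inject[symmetric] Rep_mult Rep_ops lmul_scale_left lmul_scale_right)
  show "norm (x * y) \<le> norm x * norm y" by (simp add: norm_wn_def Rep_mult nn_lmul)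
  show n1: "norm (1 :: 'a wn) = 1"
    by (simp add: norm_wn_def Rep_mult lone_mono nn_mono)
  show "(0 :: 'a wn) \<noteq> 1"
    using n1 norm_zero[where 'a = "'a wn"] by force
qed

end

lemma coef_le_norm: "\<bar>coef (Rep x) p i\<bar> \<le> norm x"
  using coef_le_rn[of "Rep x" p i] rn_le_nn[of "Rep x" p] by (simp add: norm_wn_def)

instance wn :: (finite) banach
proof
  fix X :: "nat \<Rightarrow> 'a wn" assume X: "Cauchy X"
  have "Cauchy (\<lambda>n. coef (Rep (X n)) p i)" for p i
  proof (rule metric_CauchyI)
    fix e :: real assume "e > 0"
    then obtain N where N: "\<And>m n. m \<ge> N \<Longrightarrow> n \<ge> N \<Longrightarrow> dist (X m) (X n) < e"
      using metric_CauchyD[OF X] by blast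
    have "dist (coef (Rep (X m)) p i) (coef (Rep (X n)) p i) < e" if "m \<ge> N" "n \<ge> N" for m n
      using N[OF that] coef_le_norm[of "X m - X n" p i] by (simp add: dist_real_def dist_norm Rep_ops)
    then show "\<exists>N. \<forall>m\<ge>N. \<forall>n\<ge>N. dist (coef (Rep (X m)) p i) (coef (Rep (X n)) p i) < e" by blast
  qed
  then have "\<forall>p i. \<exists>c. (\<lambda>n. coef (Rep (X n)) p i) \<longlonglongrightarrow> c"
    using Cauchy_convergent_iff convergent_def by blast
  then obtain c where c: "\<And>p i. (\<lambda>n. coef (Rep (X n)) p i) \<longlonglongrightarrow> c p i" by metis
  define Y :: "'a loop" where "Y = (\<lambda>p. \<chi> i j. if j = shift (- p) i then c p i else 0)"
  have tY: "twisted Y" by (rule twisted_coefI) (simp add: Y_def)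
  have cY: "coef Y p i = c p i" for p i by (simp add: coef_def Y_def)
  have lim: "(\<lambda>n. rn (Rep (X n) - Y) p) \<longlonglongrightarrow> 0" for p
  proof (rule tendsto_sandwich[of "\<lambda>_. 0" _ _ "\<lambda>n. \<Sum>i\<in>UNIV. \<bar>coef (Rep (X n)) p i - c p i\<bar>"])
    show "(\<lambda>n. \<Sum>i\<in>UNIV. \<bar>coef (Rep (X n)) p i - c p i\<bar>) \<longlonglongrightarrow> 0"
      by (rule tendsto_null_sum) (use c[of p] in \<open>auto intro!: tendsto_rabs_zero simp: LIM_zero\<close>)
    have "rn (Rep (X n) - Y) p \<le> (\<Sum>i\<in>UNIV. \<bar>coef (Rep (X n)) p i - c p i\<bar>)" for n
      unfolding rn_le_iff by (auto simp: cY intro: member_le_sum)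
    then show "\<forall>\<^sub>F n in sequentially. rn (Rep (X n) - Y) p \<le> (\<Sum>i\<in>UNIV. \<bar>coef (Rep (X n)) p i - c p i\<bar>)"
      by simp
  qed auto
  \<comment> \<open>As for summable sequences: finite partial sums of the distance to the
    coordinatewise limit Y are bounded by \<open>e\<close>, by letting m tend to infinity. The bound
    is uniform in F and passes to the full sum.\<close>
  have fin: "(\<Sum>p\<in>F. rn (Rep (X n) - Y) p) \<le> e"
    if F: "finite F" and N: "\<And>m. m \<ge> N \<Longrightarrow> dist (X n) (X m) \<le> e" for F n N e
  proof -
    have "(\<lambda>m. e + (\<Sum>p\<in>F. rn (Rep (X m) - Y) p)) \<longlonglongrightarrow> e + (\<Sum>p\<in>F. 0)"
      by (intro tendsto_intros lim)
    moreover have "(\<Sum>p\<in>F. rn (Rep (X n) - Y) p) \<le> e + (\<Sum>p\<in>F. rn (Rep (X m) - Y) p)" if "m \<ge> N" for m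
    proof -
      have "(\<Sum>p\<in>F. rn (Rep (X n) - Rep (X m)) p) \<le> nn (Rep (X n) - Rep (X m))"
        unfolding nn_def by (rule finite_sum_le_infsum) (auto simp: F wienerD wiener_diff)
      also have "\<dots> \<le> e" using N[OF that] by (simp add: dist_norm norm_wn_def Rep_ops)
      finally have e: "(\<Sum>p\<in>F. rn (Rep (X n) - Rep (X m)) p) \<le> e" .
      have "(\<Sum>p\<in>F. rn (Rep (X n) - Y) p) \<le> (\<Sum>p\<in>F. rn (Rep (X n) - Rep (X m)) p + rn (Rep (X m) - Y) p)"
        using rn_add[of "Rep (X n) - Rep (X m)" "Rep (X m) - Y"] by (intro sum_mono) simp
      also have "\<dots> = (\<Sum>p\<in>F. rn (Rep (X n) - Rep (X m)) p) + (\<Sum>p\<in>F. rn (Rep (X m) - Y) p)"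
        by (rule sum.distrib)
      finally show ?thesis using add_right_mono[OF e] by (rule order_trans)
    qed
    ultimately show ?thesis by (intro LIMSEQ_le_const[of _ e]) auto
  qed
  have mem: "Rep (X n) - Y \<in> wiener \<and> nn (Rep (X n) - Y) \<le> e"
    if N: "\<And>m. m \<ge> N \<Longrightarrow> dist (X n) (X m) \<le> e" for n N e
  proof -
    have "rn (Rep (X n) - Y) summable_on UNIV"
      by (rule nonneg_bdd_above_summable_on) (auto intro!: bdd_aboveI2[of _ _ e] fin[OF _ N])
    moreover have "twisted (Rep (X n) - Y)" by (simp add: twisted_diff tY wienerD)
    ultimately have w: "Rep (X n) - Y \<in> wiener" by (simp add: wiener_iff)
    have "nn (Rep (X n) - Y) \<le> e"
      unfolding nn_def by (rule infsum_le_finite_sums) (auto simp: w wienerD intro: fin[OF _ N])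
    with w show ?thesis by simp
  qed
  obtain N1 where N1: "\<And>m n. m \<ge> N1 \<Longrightarrow> n \<ge> N1 \<Longrightarrow> dist (X m) (X n) < 1"
    using metric_CauchyD[OF X, of 1] by auto
  have "Rep (X N1) - Y \<in> wiener" using mem[of N1 N1 1] N1 by (auto intro: less_imp_le)
  from wiener_diff[OF Rep_wiener[of "X N1"] this] have Y: "Y \<in> wiener" by simp
  have "X \<longlonglongrightarrow> Abs Y"
  proof (rule metric_LIMSEQ_I)
    fix e :: real assume "e > 0"
    then obtain N where N: "\<And>m n. m \<ge> N \<Longrightarrow> n \<ge> N \<Longrightarrow> dist (X m) (X n) < e / 2"
      using metric_CauchyD[OF X, of "e / 2"] by auto
    have "dist (X n) (Abs Y) < e" if "n \<ge> N" for n
      using mem[of N n "e / 2"] N[OF that] \<open>e > 0\<close>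
      by (auto simp: dist_norm norm_wn_def Rep_ops Abs_inverse[OF Y] less_imp_le)
    then show "\<exists>N. \<forall>n\<ge>N. dist (X n) (Abs Y) < e" by blast
  qed
  then show "convergent X" by (rule convergentI)
qed

section \<open>Exponential and logarithm in a Banach algebra\<close>

text \<open>The power series of log (1 + h x) / (h x). It serves twice: as the gradient of
  \<open>phi_log\<close> and, multiplied by x, as the function f.\<close>

definition geo_log :: "real \<Rightarrow> 'b::{real_normed_algebra_1,banach} \<Rightarrow> 'b" where
  "geo_log h x = (\<Sum>n. ((-1) ^ n * h ^ n / real (Suc n)) *\<^sub>R x ^ n)"

lemma geo_log_term_le: "norm (((-1) ^ n * h ^ n / real (Suc n)) *\<^sub>R (x :: 'b::{real_normed_algebra_1,banach}) ^ n)
    \<le> (\<bar>h\<bar> * norm x) ^ n"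
proof -
  have "norm (((-1) ^ n * h ^ n / real (Suc n)) *\<^sub>R x ^ n) = \<bar>h\<bar> ^ n / real (Suc n) * norm (x ^ n)"
    by (simp add: abs_mult power_abs)
  also have "\<dots> \<le> \<bar>h\<bar> ^ n * norm x ^ n"
    by (intro mult_mono norm_power_ineq) (auto simp: field_simps)
  finally show ?thesis by (simp add: power_mult_distrib)
qed

lemma summable_geo_log:
  assumes "\<bar>h\<bar> * norm (x :: 'b::{real_normed_algebra_1,banach}) < 1"
  shows "summable (\<lambda>n. ((-1) ^ n * h ^ n / real (Suc n)) *\<^sub>R x ^ n)"
  by (rule summable_comparison_test'[OF summable_geometric[of "\<bar>h\<bar> * norm x"] geo_log_term_le])
    (use assms in simp)

lemma norm_geo_log:
  assumes "\<bar>h\<bar> * norm (x :: 'b::{real_normed_algebra_1,banach}) \<le> 1/2"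
  shows "norm (geo_log h x) \<le> 2"
proof -
  have g: "summable (\<lambda>n. (\<bar>h\<bar> * norm x) ^ n)"
    by (rule summable_geometric) (use assms in simp)
  have "norm (geo_log h x) \<le> (\<Sum>n. (\<bar>h\<bar> * norm x) ^ n)"
    unfolding geo_log_def by (rule norm_suminf_le[OF geo_log_term_le g])
  also have "\<dots> = 1 / (1 - \<bar>h\<bar> * norm x)" by (rule suminf_geometric) (use assms in simp)
  also have "\<dots> \<le> 2" using assms by (simp add: field_simps)
  finally show ?thesis .
qed

lemma power_sandwich: "a * (b * a) ^ n * b = (a * b) ^ Suc n" for a b :: "'b::monoid_mult"
  by (induction n) (simp_all add: mult.assoc power_Suc2)

text \<open>The identity a p(b a) b = (a b) p(a b) for a power series p. It relates f at the three
  cyclic permutations of U V C^-1 without inverting any factor.\<close>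

lemma geo_log_sandwich:
  fixes a b :: "'b::{real_normed_algebra_1,banach}"
  assumes "\<bar>h\<bar> * norm (b * a) < 1" "\<bar>h\<bar> * norm (a * b) < 1"
  shows "a * geo_log h (b * a) * b = (a * b) * geo_log h (a * b)"
proof -
  have "a * geo_log h (b * a) * b = (\<Sum>n. a * (((-1) ^ n * h ^ n / real (Suc n)) *\<^sub>R (b * a) ^ n) * b)"
    unfolding geo_log_def
    by (subst bounded_linear.suminf[OF bounded_linear_mult_right summable_geo_log[OF assms(1)]],
      subst bounded_linear.suminf[OF bounded_linear_mult_left
        bounded_linear.summable[OF bounded_linear_mult_right summable_geo_log[OF assms(1)]]]) simp
  also have "\<dots> = (\<Sum>n. (a * b) * (((-1) ^ n * h ^ n / real (Suc n)) *\<^sub>R (a * b) ^ n))"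
    using power_sandwich[of a b] by simp
  also have "\<dots> = (a * b) * geo_log h (a * b)"
    unfolding geo_log_def
    by (subst bounded_linear.suminf[OF bounded_linear_mult_right summable_geo_log[OF assms(2)]]) simp
  finally show ?thesis .
qed

lemma geo_log_commute:
  fixes a :: "'b::{real_normed_algebra_1,banach}"
  assumes "\<bar>h\<bar> * norm a < 1"
  shows "a * geo_log h a = geo_log h a * a"
  using geo_log_sandwich[of h a 1] geo_log_sandwich[of h 1 a] assms by simp

lemma geo_log_conj:
  fixes a i j :: "'b::{real_normed_algebra_1,banach}"
  assumes "\<bar>h\<bar> * norm a < 1" "\<bar>h\<bar> * norm (i * a * j) < 1" and ij: "j * i = 1"
  shows "i * a * geo_log h a * j = i * a * j * geo_log h (i * a * j)"
proof -
  have "i * a * geo_log h (j * (i * a)) * j = (i * a * j) * geo_log h (i * a * j)"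
    by (rule geo_log_sandwich) (use assms in \<open>simp_all add: mult.assoc[symmetric]\<close>)
  then show ?thesis by (simp add: mult.assoc[symmetric] ij)
qed

lemma norm_exp_minus_one: "norm (exp x - 1) \<le> exp (norm x) - 1"
  for x :: "'b::{real_normed_algebra_1,banach}"
proof -
  have s: "exp x - 1 = (\<Sum>n. inverse (fact (Suc n)) *\<^sub>R x ^ Suc n)"
    using exp_first_term[of x] by simp
  have s': "exp (norm x) - 1 = (\<Sum>n. inverse (fact (Suc n)) *\<^sub>R norm x ^ Suc n)"
    using exp_first_term[of "norm x"] by simp
  have sm: "summable (\<lambda>n. inverse (fact (Suc n)) *\<^sub>R norm x ^ Suc n)"
    using summable_exp_generic[of "norm x"] by (subst summable_Suc_iff)
  show ?thesis unfolding s s'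
  proof (rule norm_suminf_le[OF _ sm])
    show "norm (inverse (fact (Suc n)) *\<^sub>R x ^ Suc n) \<le> inverse (fact (Suc n)) *\<^sub>R norm x ^ Suc n" for n
      using norm_power_ineq[of x "Suc n"] by (simp del: fact_Suc power_Suc add: mult_left_mono)
  qed
qed

lemma norm_exp_two_terms:
  fixes x :: "'b::{real_normed_algebra_1,banach}"
  shows "norm (exp x - 1 - x) \<le> norm x ^ 2 * exp (norm x)"
proof -
  have s: "exp x - 1 - x = (\<Sum>n. inverse (fact (n + 2)) *\<^sub>R x ^ (n + 2))"
    using exp_first_two_terms[of x] by simp
  have sm: "summable (\<lambda>n. norm x ^ 2 * (inverse (fact n) *\<^sub>R norm x ^ n))"
    by (intro summable_mult summable_exp_generic)
  have "norm (exp x - 1 - x) \<le> (\<Sum>n. norm x ^ 2 * (inverse (fact n) *\<^sub>R norm x ^ n))"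
    unfolding s
  proof (rule norm_suminf_le[OF _ sm])
    fix n
    have "norm (inverse (fact (n + 2)) *\<^sub>R x ^ (n + 2)) \<le> inverse (fact (n + 2)) * norm x ^ (n + 2)"
      using norm_power_ineq[of x "n + 2"] by (simp del: fact_Suc power_Suc add: mult_left_mono)
    also have "\<dots> \<le> inverse (fact n) * norm x ^ (n + 2)"
      by (intro mult_right_mono le_imp_inverse_le fact_mono) auto
    also have "\<dots> = norm x ^ 2 * (inverse (fact n) *\<^sub>R norm x ^ n)"
      by (simp only: power_add real_scaleR_def mult_ac)
    finally show "norm (inverse (fact (n + 2)) *\<^sub>R x ^ (n + 2)) \<le> norm x ^ 2 * (inverse (fact n) *\<^sub>R norm x ^ n)" .
  qed
  also have "\<dots> = norm x ^ 2 * exp (norm x)"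
    unfolding exp_def by (rule suminf_mult) (rule summable_exp_generic)
  finally show ?thesis .
qed

lemma has_derivative_exp_0: "(exp has_derivative (\<lambda>y. y)) (at (0 :: 'b::{real_normed_algebra_1,banach}))"
proof (rule has_derivativeI_sandwich[of 1])
  show "((\<lambda>y :: 'b. norm y * exp (norm y)) \<longlongrightarrow> 0) (at 0)"
    by (auto intro!: tendsto_eq_intros)
  show "norm (exp y - exp 0 - (y - 0)) / norm (y - 0) \<le> norm y * exp (norm y)" for y :: 'b
    using norm_exp_two_terms[of y] by (cases "y = 0") (simp_all add: field_simps power2_eq_square)
qed simp_all

text \<open>Commutation with \<open>l s\<close> allows splitting off \<open>exp (l s)\<close>, which
  reduces the claim to the derivative of \<open>exp\<close> at 0.\<close>

lemma exp_commuting_derivative: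
  fixes l :: "real \<Rightarrow> 'b::{real_normed_algebra_1,banach}"
  assumes l: "(l has_vector_derivative l') (at s within T)"
    and comm: "\<And>t. l t * l s = l s * l t"
  shows "((\<lambda>t. exp (l t)) has_vector_derivative exp (l s) * l') (at s within T)"
proof -
  have "((\<lambda>t. l t - l s) has_vector_derivative l') (at s within T)"
    using l by (auto intro!: derivative_eq_intros)
  from has_derivative_compose[OF this[unfolded has_vector_derivative_def], of exp "\<lambda>y. y"]
  have "((\<lambda>t. exp (l t - l s)) has_vector_derivative l') (at s within T)"
    using has_derivative_exp_0 by (simp add: has_vector_derivative_def)
  from has_vector_derivative_mult_right[OF this, of "exp (l s)"]
  have "((\<lambda>t. exp (l s) * exp (l t - l s)) has_vector_derivative exp (l s) * l') (at s within T)" .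
  moreover have "exp (l s) * exp (l t - l s) = exp (l t)" for t
  proof -
    have "l s * (l t - l s) = (l t - l s) * l s"
      unfolding right_diff_distrib left_diff_distrib comm[of t] ..
    from exp_add_commuting[OF this] show ?thesis by simp
  qed
  ultimately show ?thesis by simp
qed

text \<open>Both \<open>exp (- log (1 + s x)) (1 + s x)\<close> and the constant \<open>1\<close> have derivative \<open>0\<close> in \<open>s\<close>.\<close>

lemma exp_geo_log:
  fixes x :: "'b::{real_normed_algebra_1,banach}"
  assumes x: "norm x < 1"
  shows "exp (x * geo_log 1 x) = 1 + x"
proof -
  \<comment> \<open>Coefficients of l(s) = log (1 + s x); \<open>b\<close> belongs to its derivative
    m(s) = x / (1 + s x), which is dominated on [0, 1] by a geometric series in
    \<open>norm x\<close>.\<close>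
  define a where "a n = ((-1) ^ n / real (Suc n)) *\<^sub>R x ^ Suc n" for n
  define b where "b n = (-1) ^ n *\<^sub>R x ^ Suc n" for n
  let ?S = "{0..1::real}"
  have bn: "norm (s ^ n *\<^sub>R b n) \<le> norm x * norm x ^ n" if "s \<in> ?S" for s n
  proof -
    have "norm (s ^ n *\<^sub>R b n) = s ^ n * norm (x ^ Suc n)" using that by (simp add: b_def abs_mult power_abs)
    also have "\<dots> \<le> 1 * norm x ^ Suc n"
      using that by (intro mult_mono norm_power_ineq power_le_one) auto
    finally show ?thesis by simp
  qed
  have gs: "summable (\<lambda>n. norm x * norm x ^ n)" using x by (intro summable_mult summable_geometric) simp
  have sb: "summable (\<lambda>n. s ^ n *\<^sub>R b n)" if "s \<in> ?S" for s
    by (rule summable_comparison_test'[OF gs bn[OF that]])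
  define m where "m s = (\<Sum>n. s ^ n *\<^sub>R b n)" for s
  have "\<exists>g. \<forall>s\<in>?S. (\<lambda>n. s ^ Suc n *\<^sub>R a n) sums g s \<and> (g has_derivative (\<lambda>t. t *\<^sub>R m s)) (at s within ?S)"
  proof (rule has_derivative_series[where f' = "\<lambda>n s t. t *\<^sub>R (s ^ n *\<^sub>R b n)" and x = 0])
    show "((\<lambda>s. s ^ Suc n *\<^sub>R a n) has_derivative (\<lambda>t. t *\<^sub>R (s ^ n *\<^sub>R b n))) (at s within ?S)" for n s
    proof -
      have "((\<lambda>s. s ^ Suc n) has_real_derivative real (Suc n) * s ^ n) (at s within ?S)"
        using has_field_derivative_at_within[OF DERIV_pow[of "Suc n" s]] by simp
      from has_vector_derivative_scaleR[OF this has_vector_derivative_const[of "a n"]]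
      have "((\<lambda>s. s ^ Suc n *\<^sub>R a n) has_vector_derivative (real (Suc n) * s ^ n) *\<^sub>R a n) (at s within ?S)"
        by simp
      moreover have "(real (Suc n) * s ^ n) *\<^sub>R a n = s ^ n *\<^sub>R b n" by (simp add: a_def b_def)
      ultimately show ?thesis by (simp only: has_vector_derivative_def)
    qed
    fix e :: real assume e: "e > 0"
    have "(\<lambda>n. suminf (\<lambda>k. norm x * norm x ^ (k + n))) \<longlonglongrightarrow> 0"
      by (rule suminf_exist_split2[OF gs])
    then have "\<forall>\<^sub>F n in sequentially. suminf (\<lambda>k. norm x * norm x ^ (k + n)) < e"
      using e by (rule order_tendstoD(2))
    then show "\<forall>\<^sub>F n in sequentially. \<forall>s\<in>?S. \<forall>t. norm ((\<Sum>i<n. t *\<^sub>R (s ^ i *\<^sub>R b i)) - t *\<^sub>R m s) \<le> e * norm t"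
    proof (eventually_elim, intro ballI allI)
      fix n s and t :: real assume n: "suminf (\<lambda>k. norm x * norm x ^ (k + n)) < e" and s: "s \<in> ?S"
      have "m s - (\<Sum>i<n. s ^ i *\<^sub>R b i) = (\<Sum>k. s ^ (k + n) *\<^sub>R b (k + n))"
        unfolding m_def by (subst suminf_split_initial_segment[OF sb[OF s], of n]) simp
      moreover have "norm (\<Sum>k. s ^ (k + n) *\<^sub>R b (k + n)) \<le> suminf (\<lambda>k. norm x * norm x ^ (k + n))"
        by (rule norm_suminf_le[OF bn[OF s] summable_ignore_initial_segment[OF gs]])
      ultimately have "norm (m s - (\<Sum>i<n. s ^ i *\<^sub>R b i)) \<le> e" using n by simp
      then have "\<bar>t\<bar> * norm (m s - (\<Sum>i<n. s ^ i *\<^sub>R b i)) \<le> \<bar>t\<bar> * e" by (rule mult_left_mono) simp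
      moreover have "norm ((\<Sum>i<n. t *\<^sub>R (s ^ i *\<^sub>R b i)) - t *\<^sub>R m s) = \<bar>t\<bar> * norm (m s - (\<Sum>i<n. s ^ i *\<^sub>R b i))"
        unfolding scaleR_sum_right[symmetric] scaleR_diff_right[symmetric]
        by (simp add: norm_minus_commute)
      ultimately show "norm ((\<Sum>i<n. t *\<^sub>R (s ^ i *\<^sub>R b i)) - t *\<^sub>R m s) \<le> e * norm t"
        by (simp add: mult.commute)
    qed
  qed (auto simp: sums_def)
  then obtain l where l: "\<And>s. s \<in> ?S \<Longrightarrow> (\<lambda>n. s ^ Suc n *\<^sub>R a n) sums l s"
    "\<And>s. s \<in> ?S \<Longrightarrow> (l has_derivative (\<lambda>t. t *\<^sub>R m s)) (at s within ?S)" by blast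
  have l0: "l 0 = 0" using sums_unique2[OF l(1)[of 0], of 0] by simp
  have l1: "l 1 = x * geo_log 1 x"
  proof -
    have "x * geo_log 1 x = (\<Sum>n. a n)"
      unfolding geo_log_def a_def
      using bounded_linear.suminf[OF bounded_linear_mult_right[of x] summable_geo_log[of 1 x]] x by simp
    moreover have "l 1 = (\<Sum>n. a n)" using sums_unique[OF l(1)[of 1]] by simp
    ultimately show ?thesis by simp
  qed
  have inv: "m s * (1 + s *\<^sub>R x) = x" if s: "s \<in> ?S" for s
  proof -
    have "m s * (1 + s *\<^sub>R x) = (\<Sum>n. s ^ n *\<^sub>R b n * (1 + s *\<^sub>R x))"
      unfolding m_def by (rule bounded_linear.suminf[OF bounded_linear_mult_left sb[OF s]])
    also have "\<dots> = (\<Sum>n. s ^ n *\<^sub>R b n - s ^ Suc n *\<^sub>R b (Suc n))"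
      by (rule arg_cong[where f = suminf], rule ext)
        (simp add: b_def distrib_left power_commutes mult.assoc)
    also have "\<dots> = x"
    proof -
      have "(\<lambda>n. s ^ n *\<^sub>R b n - s ^ Suc n *\<^sub>R b (Suc n)) sums (s ^ 0 *\<^sub>R b 0 - 0)"
        by (rule telescope_sums') (rule summable_LIMSEQ_zero[OF sb[OF s]])
      then show ?thesis by (simp add: sums_iff b_def)
    qed
    finally show ?thesis .
  qed
  have xa: "x * a n = a n * x" for n
  proof -
    have "x * x ^ Suc n = x ^ Suc n * x" by (rule power_commutes[symmetric])
    then show ?thesis unfolding a_def mult_scaleR_left mult_scaleR_right by (rule arg_cong)
  qed
  have lx: "x * l s = l s * x" if "s \<in> ?S" for s
  proof -
    have "(\<lambda>n. x * (s ^ Suc n *\<^sub>R a n)) = (\<lambda>n. s ^ Suc n *\<^sub>R a n * x)"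
      unfolding mult_scaleR_left mult_scaleR_right xa ..
    then show ?thesis
      using sums_mult[OF l(1)[OF that], of x] sums_mult2[OF l(1)[OF that], of x] sums_unique2 by metis
  qed
  have comm: "l s * l t = l t * l s" if "s \<in> ?S" "t \<in> ?S" for s t
  proof -
    have p: "x ^ k * l t = l t * x ^ k" for k
    proof (induction k)
      case (Suc k)
      have "x ^ Suc k * l t = x * (x ^ k * l t)" by (simp only: power_Suc mult.assoc)
      also have "\<dots> = (x * l t) * x ^ k" by (simp only: Suc mult.assoc)
      also have "\<dots> = l t * x ^ Suc k" by (simp only: lx[OF that(2)] power_Suc mult.assoc)
      finally show ?case .
    qed simp
    have "(\<lambda>n. s ^ Suc n *\<^sub>R a n * l t) = (\<lambda>n. l t * (s ^ Suc n *\<^sub>R a n))"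
      unfolding a_def mult_scaleR_left mult_scaleR_right p ..
    then show ?thesis
      using sums_mult[OF l(1)[OF that(1)], of "l t"] sums_mult2[OF l(1)[OF that(1)], of "l t"] sums_unique2 by metis
  qed
  have d0: "((\<lambda>s. exp (- l s) * (1 + s *\<^sub>R x)) has_vector_derivative 0) (at s within ?S)" if s: "s \<in> ?S" for s
  proof -
    \<comment> \<open>\<open>l\<close> is controlled only on \<open>?S\<close>. Freezing the curve
      outside yields one that commutes with its value at \<open>s\<close> for all real
      times.\<close>
    let ?l = "\<lambda>t. if t \<in> ?S then - l t else - l s"
    have d: "((\<lambda>t. - l t) has_vector_derivative - m s) (at s within ?S)"
      using l(2)[OF s] by (auto simp: has_vector_derivative_def intro!: derivative_eq_intros)
    have "(?l has_vector_derivative - m s) (at s within ?S)"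
      by (rule has_vector_derivative_transform[OF s _ d]) simp
    moreover have "?l t * ?l s = ?l s * ?l t" for t
    proof (cases "t \<in> ?S")
      case True
      then show ?thesis using s comm[OF True s] by simp
    next
      case False
      then show ?thesis using s by (simp only: if_False if_True)
    qed
    ultimately have "((\<lambda>t. exp (?l t)) has_vector_derivative exp (?l s) * - m s) (at s within ?S)"
      by (rule exp_commuting_derivative)
    then have "((\<lambda>t. exp (?l t)) has_vector_derivative exp (- l s) * - m s) (at s within ?S)"
      using s by simp
    then have "((\<lambda>t. exp (- l t)) has_vector_derivative exp (- l s) * - m s) (at s within ?S)"
      by (rule has_vector_derivative_transform[OF s, rotated]) simp
    moreover have "((\<lambda>t. 1 + t *\<^sub>R x) has_vector_derivative x) (at s within ?S)"
      by (auto intro!: derivative_eq_intros)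
    ultimately have "((\<lambda>s. exp (- l s) * (1 + s *\<^sub>R x)) has_vector_derivative
        exp (- l s) * x + exp (- l s) * - m s * (1 + s *\<^sub>R x)) (at s within ?S)"
      by (rule has_vector_derivative_mult)
    moreover have "exp (- l s) * x + exp (- l s) * - m s * (1 + s *\<^sub>R x) = 0"
      using inv[OF s] by (simp add: mult.assoc)
    ultimately show ?thesis by simp
  qed
  obtain c where c: "\<And>s. s \<in> ?S \<Longrightarrow> exp (- l s) * (1 + s *\<^sub>R x) = c"
  proof (rule has_vector_derivative_zero_constant[OF convex_real_interval(5) d0])
    fix c assume "\<And>s. s \<in> ?S \<Longrightarrow> exp (- l s) * (1 + s *\<^sub>R x) = c"
    then show thesis by (rule that)
  qed
  have "exp (- l 1) * (1 + x) = 1" using c[of 0] c[of 1] by (simp add: l0)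
  then have "exp (l 1) * (exp (- l 1) * (1 + x)) = exp (l 1)" by (simp only: mult_1_right)
  then show ?thesis
    by (simp only: mult.assoc[symmetric] exp_minus_inverse mult_1_left l1)
qed

text \<open>Difference quotients are the form in which the fixed point estimates for the
  factorization deliver derivatives.\<close>

lemma has_vector_derivative_quotient:
  "(f has_vector_derivative D) (at s within T) \<longleftrightarrow>
    ((\<lambda>t. (1 / (t - s)) *\<^sub>R (f t - f s)) \<longlongrightarrow> D) (at s within T)"
proof -
  have "norm (f t - f s - (t - s) *\<^sub>R D) / norm (t - s) = norm ((1 / (t - s)) *\<^sub>R (f t - f s) - D)"
    if "t \<noteq> s" for t
  proof -
    have "(1 / (t - s)) *\<^sub>R (f t - f s) - D = (1 / (t - s)) *\<^sub>R (f t - f s - (t - s) *\<^sub>R D)"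
      using that by (simp add: scaleR_diff_right)
    then show ?thesis by (simp add: divide_inverse mult.commute)
  qed
  then have "((\<lambda>t. norm (f t - f s - (t - s) *\<^sub>R D) / norm (t - s)) \<longlongrightarrow> 0) (at s within T) \<longleftrightarrow>
      ((\<lambda>t. norm ((1 / (t - s)) *\<^sub>R (f t - f s) - D)) \<longlongrightarrow> 0) (at s within T)"
    by (intro Lim_cong_within) auto
  also have "\<dots> \<longleftrightarrow> ((\<lambda>t. (1 / (t - s)) *\<^sub>R (f t - f s)) \<longlongrightarrow> D) (at s within T)"
    by (simp add: tendsto_norm_zero_iff LIM_zero_iff)
  finally show ?thesis
    unfolding has_vector_derivative_def has_derivative_iff_norm
    by (simp add: bounded_linear_scaleR_left)
qed

text \<open>From g_t - g_s = - g_t (f_t - f_s) g_s: the uniform bound K first gives continuity of g,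
  and dividing by t - s then gives the derivative.\<close>

lemma has_vector_derivative_inverse:
  fixes f :: "real \<Rightarrow> 'b::real_normed_algebra_1"
  assumes f: "(f has_vector_derivative f') (at s within T)" and s: "s \<in> T"
    and fg: "\<And>t. t \<in> T \<Longrightarrow> f t * g t = 1" "\<And>t. t \<in> T \<Longrightarrow> g t * f t = 1"
    and K: "\<And>t. t \<in> T \<Longrightarrow> norm (g t) \<le> K"
  shows "(g has_vector_derivative - (g s * f' * g s)) (at s within T)"
proof -
  have d: "g t - g s = - (g t * (f t - f s) * g s)" if "t \<in> T" for t
    using fg(1)[OF s] fg(2)[OF that] by (simp add: right_diff_distrib left_diff_distrib mult.assoc)
  have "(f \<longlongrightarrow> f s) (at s within T)"
    using has_vector_derivative_continuous[OF f] by (simp add: continuous_within)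
  then have fc: "((\<lambda>t. K * norm (f t - f s) * norm (g s)) \<longlongrightarrow> K * 0 * norm (g s)) (at s within T)"
    by (intro tendsto_intros tendsto_norm_zero) (simp add: LIM_zero_iff)
  have "norm (g t - g s) \<le> K * norm (f t - f s) * norm (g s)" if "t \<in> T" for t
  proof -
    have "norm (g t - g s) \<le> norm (g t * (f t - f s)) * norm (g s)"
      unfolding d[OF that] norm_minus_cancel by (rule norm_mult_ineq)
    also have "\<dots> \<le> (norm (g t) * norm (f t - f s)) * norm (g s)"
      by (intro mult_right_mono norm_mult_ineq) simp
    also have "\<dots> \<le> K * norm (f t - f s) * norm (g s)"
      by (intro mult_right_mono K that) auto
    finally show ?thesis .
  qed
  then have "\<forall>\<^sub>F t in at s within T. norm (g t - g s) \<le> K * norm (f t - f s) * norm (g s)"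
    by (auto simp: eventually_at_filter)
  from Lim_null_comparison[OF this] fc have gc: "(g \<longlongrightarrow> g s) (at s within T)"
    by (simp add: LIM_zero_iff)
  have "((\<lambda>t. - (g t * ((1 / (t - s)) *\<^sub>R (f t - f s)) * g s)) \<longlongrightarrow> - (g s * f' * g s)) (at s within T)"
    using f unfolding has_vector_derivative_quotient by (intro tendsto_intros gc)
  moreover have "\<forall>\<^sub>F t in at s within T.
      - (g t * ((1 / (t - s)) *\<^sub>R (f t - f s)) * g s) = (1 / (t - s)) *\<^sub>R (g t - g s)"
    by (auto simp: eventually_at_filter d)
  ultimately show ?thesis
    unfolding has_vector_derivative_quotient by (rule Lim_transform_eventually)
qed


section \<open>The logarithmic Hamilton function and its vector field\<close>

section \<open>The trace Hamiltonian on the Wiener algebra\<close>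

lemma Rep_Abs [simp]: "L \<in> wiener \<Longrightarrow> Rep (Abs L) = L"
  by (rule Abs_inverse)

lemma Rep_power: "Rep (x ^ n) = lpow (Rep x) n"
  by (induction n) (simp_all add: Rep_mult)

lemma Rep_twisted [simp]: "twisted (Rep x)"
  by (rule wienerD) simp

lemma bounded_linear_Rep: "bounded_linear (\<lambda>x :: 'a::finite wn. Rep x p)"
proof (rule bounded_linear_intro[where K = "real CARD('a mod_ring)"])
  fix x :: "'a wn"
  have "norm (Rep x p) \<le> real CARD('a mod_ring) * rn (Rep x) p" by (rule norm_le_rn) simp
  also have "\<dots> \<le> real CARD('a mod_ring) * norm x"
    unfolding norm_wn_def by (intro mult_left_mono rn_le_nn) auto
  finally show "norm (Rep x p) \<le> norm x * real CARD('a mod_ring)" by (simp add: mult.commute)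
qed (simp_all add: Rep_ops)

lemma bounded_linear_coef: "bounded_linear (\<lambda>x :: 'a::finite wn. coef (Rep x) p i)"
  unfolding coef_def
  by (intro bounded_linear_compose[OF bounded_linear_vec_nth] bounded_linear_compose[OF bounded_linear_vec_nth bounded_linear_Rep])

definition tr :: "'a::finite wn \<Rightarrow> real" where "tr x = trace (Rep x 0)"

lemma bounded_linear_tr: "bounded_linear tr"
  unfolding tr_def by (rule bounded_linear_compose[OF bounded_linear_trace bounded_linear_Rep])

lemma pairing_Rep: "pairing (Rep x) (Rep y) = tr (x * y)"
  by (simp add: pairing_def tr_def Rep_mult)

lemma tr_commute: "tr (x * y) = tr (y * x)"
  unfolding pairing_Rep[symmetric] by (intro pairing_sym wiener_conv) simp_all

lemma power_diff_le:
  fixes x y :: "'b::real_normed_algebra_1"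
  assumes "norm x \<le> \<rho>" "norm y \<le> \<rho>"
  shows "norm (x ^ Suc n - y ^ Suc n) \<le> real (Suc n) * \<rho> ^ n * norm (x - y)"
proof (induction n)
  case (Suc n)
  have \<rho>: "0 \<le> \<rho>" using assms(1) norm_ge_zero[of x] by linarith
  have "x ^ Suc (Suc n) - y ^ Suc (Suc n) = x * (x ^ Suc n - y ^ Suc n) + (x - y) * y ^ Suc n"
    by (simp add: right_diff_distrib left_diff_distrib)
  then have "norm (x ^ Suc (Suc n) - y ^ Suc (Suc n))
      \<le> norm x * norm (x ^ Suc n - y ^ Suc n) + norm (x - y) * norm (y ^ Suc n)"
    by (metis norm_triangle_mono norm_mult_ineq)
  also have "\<dots> \<le> \<rho> * (real (Suc n) * \<rho> ^ n * norm (x - y)) + norm (x - y) * \<rho> ^ Suc n"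
    using \<rho> order_trans[OF norm_power_ineq[of y "Suc n"] power_mono[OF assms(2), of "Suc n"]]
    by (intro add_mono mult_mono assms Suc mult_left_mono) auto
  finally show ?case by (simp add: algebra_simps)
qed simp

text \<open>The derivative of X^n is a sum of n words with M in different places. Under the trace,
  against any B that commutes with X, they all agree; admitting such B closes the induction, which
  replaces B by B X.\<close>

lemma power_trace_derivative:
  fixes X :: "real \<Rightarrow> 'a::finite wn"
  assumes X: "(X has_vector_derivative M) (at s)"
  shows "\<exists>D. ((\<lambda>t. X t ^ n) has_vector_derivative D) (at s) \<and>
    (\<forall>B. B * X s = X s * B \<longrightarrow> tr (B * D) = real n * tr (B * X s ^ (n - 1) * M))"
proof (induction n)
  case 0
  have "tr (B * 0) = 0" for B :: "'a wn"
    using linear_0[OF bounded_linear.linear[OF bounded_linear_tr]] by simp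
  then show ?case by (intro exI[of _ 0]) simp
next
  case (Suc n)
  then obtain D where D: "((\<lambda>t. X t ^ n) has_vector_derivative D) (at s)"
    and tD: "\<And>B. B * X s = X s * B \<Longrightarrow> tr (B * D) = real n * tr (B * X s ^ (n - 1) * M)" by blast
  have "((\<lambda>t. X t * X t ^ n) has_vector_derivative X s * D + M * X s ^ n) (at s)"
    by (rule has_vector_derivative_mult[OF X D])
  moreover have "tr (B * (X s * D + M * X s ^ n)) = real (Suc n) * tr (B * X s ^ n * M)"
    if B: "B * X s = X s * B" for B
  proof -
    have c: "B * X s ^ n = X s ^ n * B" by (induction n) (simp_all add: mult.assoc, metis B mult.assoc)
    have "tr (B * (X s * D + M * X s ^ n)) = tr ((B * X s) * D) + tr (B * M * X s ^ n)"
      by (simp only: distrib_left linear_add[OF bounded_linear.linear[OF bounded_linear_tr]] mult.assoc)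
    also have "tr (B * M * X s ^ n) = tr (X s ^ n * B * M)"
      using tr_commute[of "B * M" "X s ^ n"] by (simp add: mult.assoc)
    also have "tr ((B * X s) * D) = real n * tr (B * X s * X s ^ (n - 1) * M)"
      by (rule tD) (simp add: B mult.assoc[symmetric], simp add: B mult.assoc)
    also have "real n * tr (B * X s * X s ^ (n - 1) * M) = real n * tr (B * X s ^ n * M)"
      by (cases n) (simp_all add: mult.assoc)
    finally show ?thesis by (simp add: c[symmetric] algebra_simps)
  qed
  ultimately show ?case by (intro exI[of _ "X s * D + M * X s ^ n"]) simp
qed

lemma wiener_curve_iff:
  "wiener_curve \<gamma> M \<longleftrightarrow> (\<forall>t. \<gamma> t \<in> wiener) \<and> M \<in> wiener \<and>
    ((\<lambda>t. Abs (\<gamma> t)) has_vector_derivative Abs M) (at 0)"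
proof -
  have "((\<lambda>t. wnorm (\<lambda>p. (1 / t) *\<^sub>R (\<gamma> t p - \<gamma> 0 p) - M p)) \<longlongrightarrow> 0) (at 0) \<longleftrightarrow>
      ((\<lambda>t. Abs (\<gamma> t)) has_vector_derivative Abs M) (at 0)"
    if \<gamma>: "\<And>t. \<gamma> t \<in> wiener" and M: "M \<in> wiener"
  proof -
    let ?q = "\<lambda>t. (1 / (t - 0)) *\<^sub>R (Abs (\<gamma> t) - Abs (\<gamma> 0)) - Abs M"
    have e: "(\<lambda>p. (1 / t) *\<^sub>R (\<gamma> t p - \<gamma> 0 p) - M p) = Rep (?q t)" for t
      using \<gamma> M by (simp add: Rep_ops fun_eq_iff)
    have le: "norm (?q t) \<le> wnorm (Rep (?q t))" "wnorm (Rep (?q t)) \<le> real CARD('a mod_ring) * norm (?q t)" for t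
      unfolding norm_wn_def by (rule nn_le_wnorm, simp) (rule wnorm_le_nn, simp)
    have "((\<lambda>t. wnorm (Rep (?q t))) \<longlongrightarrow> 0) (at 0) \<longleftrightarrow> ((\<lambda>t. norm (?q t)) \<longlongrightarrow> 0) (at 0)"
    proof
      assume "((\<lambda>t. wnorm (Rep (?q t))) \<longlongrightarrow> 0) (at 0)"
      then show "((\<lambda>t. norm (?q t)) \<longlongrightarrow> 0) (at 0)"
        by (rule tendsto_sandwich[of "\<lambda>_. 0", rotated 2, OF tendsto_const])
          (use le(1) in \<open>auto intro: always_eventually\<close>)
    next
      assume "((\<lambda>t. norm (?q t)) \<longlongrightarrow> 0) (at 0)"
      then have "((\<lambda>t. real CARD('a mod_ring) * norm (?q t)) \<longlongrightarrow> real CARD('a mod_ring) * 0) (at 0)"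
        by (intro tendsto_mult tendsto_const)
      then have "((\<lambda>t. real CARD('a mod_ring) * norm (?q t)) \<longlongrightarrow> 0) (at 0)" by simp
      moreover have "0 \<le> wnorm (Rep (?q t))" for t using le(1)[of t] norm_ge_zero order_trans by blast
      ultimately show "((\<lambda>t. wnorm (Rep (?q t))) \<longlongrightarrow> 0) (at 0)"
        by (intro tendsto_sandwich[of "\<lambda>_. 0" "\<lambda>t. wnorm (Rep (?q t))" "at 0" "\<lambda>t. real CARD('a mod_ring) * norm (?q t)"])
          (use le(2) in \<open>auto intro: always_eventually\<close>)
    qed
    also have "\<dots> \<longleftrightarrow> ((\<lambda>t. Abs (\<gamma> t)) has_vector_derivative Abs M) (at 0)"
      unfolding has_vector_derivative_quotient tendsto_norm_zero_iff LIM_zero_iff ..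
    finally show ?thesis unfolding e .
  qed
  then show ?thesis unfolding wiener_curve_def by (auto simp: image_subset_iff)
qed

lemma f_log_Rep:
  fixes x :: "'a::finite wn"
  assumes "h \<noteq> 0" and x: "\<bar>h\<bar> * norm x < 1"
  shows "f_log h (Rep x) = Rep (x * geo_log h x)"
proof (rule ext)
  fix p
  let ?a = "\<lambda>n. ((-1) ^ n * h ^ n / real (Suc n)) *\<^sub>R Rep (x ^ Suc n) p"
  have 1: "(\<lambda>n. ?a n) sums Rep (x * geo_log h x) p"
  proof -
    have "(\<lambda>n. x * (((-1) ^ n * h ^ n / real (Suc n)) *\<^sub>R x ^ n)) sums (x * geo_log h x)"
      unfolding geo_log_def by (rule sums_mult) (rule summable_sums[OF summable_geo_log[OF x]])
    from bounded_linear.sums[OF bounded_linear_Rep this, of p]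
    show ?thesis by (simp add: Rep_ops)
  qed
  have l: "lpow (\<lambda>q. h *\<^sub>R Rep x q) n p = h ^ n *\<^sub>R Rep (x ^ n) p" for n
  proof -
    have "lpow (\<lambda>q. h *\<^sub>R Rep x q) n = Rep ((h *\<^sub>R x) ^ n)" by (simp only: Rep_power Rep_ops)
    then show ?thesis by (simp add: scaleR_power Rep_ops)
  qed
  have "f_log h (Rep x) p = (1 / h) *\<^sub>R (\<Sum>n. h *\<^sub>R ?a n)"
    unfolding f_log_def log1p_def l by (simp add: mult_ac)
  also have "\<dots> = (1 / h) *\<^sub>R (h *\<^sub>R (\<Sum>n. ?a n))"
    unfolding suminf_scaleR_right[OF sums_summable[OF 1], of h] ..
  also have "\<dots> = (\<Sum>n. ?a n)" using assms(1) by (simp del: power_Suc)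
  finally show "f_log h (Rep x) p = Rep (x * geo_log h x) p"
    using sums_unique[OF 1] by simp
qed

lemma phi_log_Rep: "phi_log h (Rep x) = (\<Sum>n. (-1) ^ n * h ^ n / (real (Suc n))\<^sup>2 * tr (x ^ Suc n))"
  by (simp add: phi_log_def tr_def Rep_power Rep_mult)

lemma phi_log_derivative:
  fixes X :: "real \<Rightarrow> 'a::finite wn"
  assumes X: "(X has_vector_derivative M) (at 0)" and h: "\<bar>h\<bar> * norm (X 0) < 1"
  shows "((\<lambda>t. phi_log h (Rep (X t))) has_real_derivative tr (geo_log h (X 0) * M)) (at 0)"
proof -
  note lin = bounded_linear.linear[OF bounded_linear_tr, THEN linear_diff]
    bounded_linear.linear[OF bounded_linear_tr, THEN linear_scale]
  obtain K where K: "\<And>x :: 'a wn. norm (tr x) \<le> norm x * K" "K \<ge> 0"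
    using bounded_linear.nonneg_bounded[OF bounded_linear_tr] by blast
  define c where "c n = (-1) ^ n * h ^ n / (real (Suc n))\<^sup>2" for n
  \<comment> \<open>A radius strictly above \<open>norm (X 0)\<close> with |h| \<rho> < 1: near t =
    0 the norm of X stays below it, and the majorant is a convergent geometric series.\<close>
  define \<rho> where "\<rho> = (if h = 0 then norm (X 0) + 1 else (norm (X 0) + 1 / \<bar>h\<bar>) / 2)"
  have \<rho>: "norm (X 0) < \<rho>" "\<bar>h\<bar> * \<rho> < 1" "\<rho> > 0"
  proof -
    show "norm (X 0) < \<rho>" using h by (auto simp: \<rho>_def field_simps)
    then show "\<rho> > 0" using norm_ge_zero[of "X 0"] by linarith
    show "\<bar>h\<bar> * \<rho> < 1" using h by (auto simp: \<rho>_def field_simps)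
  qed
  let ?a = "\<lambda>n t. c n * ((tr (X t ^ Suc n) - tr (X 0 ^ Suc n)) / (t - 0))"
  let ?b = "\<lambda>n. c n * (real (Suc n) * tr (X 0 ^ n * M))"
  let ?M = "\<lambda>n. (\<bar>h\<bar> * \<rho>) ^ n * (K * (norm M + 1))"
  have lim: "((\<lambda>t. ?a n t) \<longlongrightarrow> ?b n) (at 0)" for n
  proof -
    obtain D where D: "((\<lambda>t. X t ^ Suc n) has_vector_derivative D) (at 0)"
      "tr (1 * D) = real (Suc n) * tr (1 * X 0 ^ (Suc n - 1) * M)"
      using power_trace_derivative[OF X, of "Suc n"] by (metis mult_1 mult_1_right)
    from bounded_linear.has_vector_derivative[OF bounded_linear_tr D(1)]
    have "((\<lambda>t. tr (X t ^ Suc n)) has_real_derivative real (Suc n) * tr (X 0 ^ n * M)) (at 0)"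
      using D(2) by (simp add: has_real_derivative_iff_has_vector_derivative)
    then have "((\<lambda>t. (tr (X t ^ Suc n) - tr (X 0 ^ Suc n)) / (t - 0)) \<longlongrightarrow> real (Suc n) * tr (X 0 ^ n * M)) (at 0)"
      unfolding has_field_derivative_iff .
    then show ?thesis by (intro tendsto_mult tendsto_const)
  qed
  have Xc: "(X \<longlongrightarrow> X 0) (at 0)"
    using has_vector_derivative_continuous[OF X] by (simp add: continuous_within)
  have ev: "\<forall>\<^sub>F t in at 0. norm (X t) < \<rho>"
    by (rule order_tendstoD(2)[OF tendsto_norm[OF Xc] \<rho>(1)])
  have "((\<lambda>t. norm ((1 / (t - 0)) *\<^sub>R (X t - X 0))) \<longlongrightarrow> norm M) (at 0)"
    using X unfolding has_vector_derivative_quotient by (rule tendsto_norm)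
  then have "\<forall>\<^sub>F t in at 0. norm ((1 / (t - 0)) *\<^sub>R (X t - X 0)) < norm M + 1"
    by (rule order_tendstoD(2)) simp
  with ev have bd: "\<forall>\<^sub>F t in at 0. \<forall>n. norm (?a n t) \<le> ?M n"
  proof eventually_elim
    case (elim t)
    show ?case
    proof
      fix n
      have "\<bar>tr (X t ^ Suc n) - tr (X 0 ^ Suc n)\<bar> \<le> norm (X t ^ Suc n - X 0 ^ Suc n) * K"
        using K(1)[of "X t ^ Suc n - X 0 ^ Suc n"] by (simp add: lin(1) del: power_Suc)
      also have "\<dots> \<le> (real (Suc n) * \<rho> ^ n * norm (X t - X 0)) * K"
        by (intro mult_right_mono K(2) power_diff_le) (use elim \<rho> in auto)
      finally have "norm (?a n t) \<le> \<bar>c n\<bar> * ((real (Suc n) * \<rho> ^ n * norm (X t - X 0)) * K / \<bar>t\<bar>)"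
        by (simp add: abs_mult mult_left_mono divide_right_mono del: power_Suc)
      also have "\<dots> = \<bar>c n\<bar> * real (Suc n) * (\<rho> ^ n * K * norm ((1 / (t - 0)) *\<^sub>R (X t - X 0)))"
        by (simp add: divide_inverse mult_ac)
      also have "\<dots> \<le> \<bar>h\<bar> ^ n * (\<rho> ^ n * K * (norm M + 1))"
      proof (rule mult_mono)
        show "\<bar>c n\<bar> * real (Suc n) \<le> \<bar>h\<bar> ^ n"
        proof -
          have "\<bar>c n\<bar> * real (Suc n) = \<bar>h\<bar> ^ n / real (Suc n)"
            by (simp add: c_def abs_mult power_abs power2_eq_square del: of_nat_Suc)
          also have "\<dots> \<le> \<bar>h\<bar> ^ n" by (simp add: field_simps)
          finally show ?thesis .
        qed
        show "\<rho> ^ n * K * norm ((1 / (t - 0)) *\<^sub>R (X t - X 0)) \<le> \<rho> ^ n * K * (norm M + 1)"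
          using elim(2) K(2) \<rho>(3) by (intro mult_left_mono) auto
      qed (use K(2) \<rho>(3) in auto)
      finally show "norm (?a n t) \<le> ?M n" by (simp add: power_mult_distrib mult_ac)
    qed
  qed
  have sM: "summable ?M"
    using \<rho> by (intro summable_mult2 summable_geometric) simp
  have "\<forall>\<^sub>F (k, t) in at_top \<times>\<^sub>F at 0. norm (?a k t) \<le> ?M k"
    using eventually_prodI[of "\<lambda>_. True" at_top, OF _ bd] by (auto elim!: eventually_mono)
  \<comment> \<open>Termwise limit of difference quotients under a summable majorant. The weight 1 /
    (n + 1)^2 absorbs the factor n + 1 from differentiating a power.\<close>
  from tannerys_theorem[OF lim this sM trivial_limit_at]
  have t: "((\<lambda>t. \<Sum>n. ?a n t) \<longlongrightarrow> (\<Sum>n. ?b n)) (at 0)" by blast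
  have sX: "summable (\<lambda>n. c n * tr (x ^ Suc n))" if "\<bar>h\<bar> * norm x < 1" for x :: "'a wn"
  proof (rule summable_comparison_test')
    show "summable (\<lambda>n. (\<bar>h\<bar> * norm x) ^ n * (norm x * K))"
      using that by (intro summable_mult2 summable_geometric) simp
    fix n
    have "norm (c n * tr (x ^ Suc n)) \<le> \<bar>h\<bar> ^ n * (norm x ^ Suc n * K)"
      unfolding norm_mult
    proof (rule mult_mono)
      have "\<bar>h\<bar> ^ n * 1 \<le> \<bar>h\<bar> ^ n * (real (Suc n))\<^sup>2" by (intro mult_left_mono) (auto simp: one_le_power)
      then show "norm (c n) \<le> \<bar>h\<bar> ^ n"
        by (simp add: c_def abs_mult power_abs divide_le_eq del: of_nat_Suc)
      show "norm (tr (x ^ Suc n)) \<le> norm x ^ Suc n * K"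
        by (rule order_trans[OF K(1)]) (intro mult_right_mono norm_power_ineq K(2))
    qed auto
    then show "norm (c n * tr (x ^ Suc n)) \<le> (\<bar>h\<bar> * norm x) ^ n * (norm x * K)"
      by (simp add: power_mult_distrib mult_ac)
  qed
  have "\<forall>\<^sub>F t in at 0. (\<Sum>n. ?a n t) = (phi_log h (Rep (X t)) - phi_log h (Rep (X 0))) / (t - 0)"
    using ev
  proof eventually_elim
    case (elim t)
    have "\<bar>h\<bar> * norm (X t) \<le> \<bar>h\<bar> * \<rho>" using elim by (intro mult_left_mono) auto
    then have "\<bar>h\<bar> * norm (X t) < 1" using \<rho>(2) by linarith
    then have "(\<lambda>n. (c n * tr (X t ^ Suc n) - c n * tr (X 0 ^ Suc n)) / t) sums
        ((phi_log h (Rep (X t)) - phi_log h (Rep (X 0))) / t)"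
      unfolding phi_log_Rep c_def[symmetric]
      by (intro sums_divide sums_diff summable_sums sX h)
    moreover have "(\<lambda>n. (c n * tr (X t ^ Suc n) - c n * tr (X 0 ^ Suc n)) / t) = (\<lambda>n. ?a n t)"
      by (rule ext) (simp add: right_diff_distrib del: power_Suc)
    ultimately show ?case by (simp add: sums_iff)
  qed
  with t have "((\<lambda>t. (phi_log h (Rep (X t)) - phi_log h (Rep (X 0))) / (t - 0)) \<longlongrightarrow> (\<Sum>n. ?b n)) (at 0)"
    by (rule Lim_transform_eventually)
  moreover have "(\<Sum>n. ?b n) = tr (geo_log h (X 0) * M)"
  proof -
    have "(\<lambda>n. (((-1) ^ n * h ^ n / real (Suc n)) *\<^sub>R X 0 ^ n) * M) sums (geo_log h (X 0) * M)"
      unfolding geo_log_def by (rule sums_mult2) (rule summable_sums[OF summable_geo_log[OF h]])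
    from bounded_linear.sums[OF bounded_linear_tr this]
    have "(\<lambda>n. ?b n) sums tr (geo_log h (X 0) * M)"
      by (simp add: lin(2) c_def power2_eq_square mult.assoc del: of_nat_Suc)
    then show ?thesis by (simp add: sums_iff)
  qed
  ultimately show ?thesis unfolding has_field_derivative_iff by simp
qed

lemma wiener_log_domD: "L \<in> wiener_log_dom h \<Longrightarrow> L \<in> wiener"
  "L \<in> wiener_log_dom h \<Longrightarrow> \<bar>h\<bar> * norm (Abs L) < 1"
proof -
  show "L \<in> wiener_log_dom h \<Longrightarrow> L \<in> wiener" by (simp add: wiener_log_dom_def)
  assume L: "L \<in> wiener_log_dom h"
  then have "norm (Abs L) \<le> wnorm L" by (simp add: wiener_log_dom_def norm_wn_def nn_le_wnorm)
  then have "\<bar>h\<bar> * norm (Abs L) \<le> \<bar>h\<bar> * wnorm L" by (rule mult_left_mono) simp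
  also have "\<dots> < 1" using L by (simp add: wiener_log_dom_def)
  finally show "\<bar>h\<bar> * norm (Abs L) < 1" .
qed

lemma has_grad_phi_log:
  assumes "L \<in> wiener_log_dom h"
  shows "has_grad wiener wiener_curve (\<lambda>Ls. phi_log h (hd Ls)) [L] [Rep (geo_log h (Abs L))]"
proof (rule has_grad1I)
  fix \<gamma> M assume "\<gamma> 0 = L" "wiener_curve \<gamma> M"
  then have \<gamma>: "\<And>t. \<gamma> t \<in> wiener" "M \<in> wiener" "((\<lambda>t. Abs (\<gamma> t)) has_vector_derivative Abs M) (at 0)"
    and 0: "\<gamma> 0 = L" by (auto simp: wiener_curve_iff)
  from phi_log_derivative[OF \<gamma>(3), of h] wiener_log_domD(2)[OF assms] 0 \<gamma>(1)
  have "((\<lambda>t. phi_log h (\<gamma> t)) has_real_derivative tr (geo_log h (Abs L) * Abs M)) (at 0)" by simp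
  then show "((\<lambda>t. phi_log h (\<gamma> t)) has_real_derivative pairing (Rep (geo_log h (Abs L))) M) (at 0)"
    using pairing_Rep[of "geo_log h (Abs L)" "Abs M"] \<gamma>(2) by simp
qed simp

theorem ad_hamiltonian_log:
  assumes "h \<noteq> 0"
  shows "ad_hamiltonian wiener wiener_curve (wiener_log_dom h) (phi_log h) (f_log h :: 'a::finite loop \<Rightarrow> _)"
  unfolding ad_hamiltonian_def
proof (intro conjI ballI impI)
  fix A B L :: "'a loop"
  assume a: "A \<in> wiener" "B \<in> wiener" "L \<in> wiener_log_dom h" "A \<star> B = lone" "B \<star> A = lone"
  note w = wiener_log_domD(1)[OF a(3)]
  let ?a = "Abs A" and ?b = "Abs B" and ?x = "Abs L"
  have ba: "?b * ?a = 1" by (simp add: Rep_inject[symmetric] Rep_mult a)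
  have r: "A \<star> L \<star> B = Rep (?a * ?x * ?b)" by (simp add: Rep_mult a w)
  have p: "(?a * ?x * ?b) ^ Suc n = ?a * ?x ^ Suc n * ?b" for n
  proof (induction n)
    case (Suc n)
    have "(?a * ?x * ?b) ^ Suc (Suc n) = ?a * ?x * (?b * ?a) * ?x ^ Suc n * ?b"
      by (subst power_Suc, subst Suc) (simp add: mult.assoc)
    then show ?case by (simp add: ba mult.assoc)
  qed simp
  have "tr (?a * ?x ^ Suc n * ?b) = tr (?x ^ Suc n)" for n
  proof -
    have "tr (?a * ?x ^ Suc n * ?b) = tr (?b * (?a * ?x ^ Suc n))" by (rule tr_commute)
    also have "?b * (?a * ?x ^ Suc n) = ?x ^ Suc n" by (simp only: mult.assoc[symmetric] ba mult_1)
    finally show ?thesis .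
  qed
  then have "phi_log h (Rep (?a * ?x * ?b)) = phi_log h (Rep ?x)" unfolding phi_log_Rep p by simp
  then show "phi_log h (A \<star> L \<star> B) = phi_log h L" unfolding r using w by simp
next
  fix L :: "'a loop" assume L: "L \<in> wiener_log_dom h"
  have "f_log h L = L \<star> Rep (geo_log h (Abs L))"
    using f_log_Rep[OF assms wiener_log_domD(2)[OF L]] wiener_log_domD(1)[OF L] by (simp add: Rep_mult)
  with has_grad_phi_log[OF L]
  show "\<exists>G. has_grad wiener wiener_curve (\<lambda>Ls. phi_log h (hd Ls)) [L] [G] \<and> f_log h L = L \<star> G" by blast
qed

section \<open>Hamiltonian flows on the Wiener algebra\<close>

lemma unip_wiener [simp]: "unip w \<in> wiener" and U_wiener [simp]: "U x \<in> wiener"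
  and V_wiener [simp]: "V x \<in> wiener" and C_wiener [simp]: "C h x \<in> wiener"
  by (simp_all add: unip_def U_mono V_unip C_unip wiener_add)

definition wm :: "int \<Rightarrow> ('a::finite mod_ring \<Rightarrow> real) \<Rightarrow> 'a wn" where "wm r y = Abs (mono_loop r y)"
definition wU :: "'a::finite phase \<Rightarrow> 'a wn" where "wU x = Abs (U x)"
definition wV :: "'a::finite phase \<Rightarrow> 'a wn" where "wV x = Abs (V x)"
definition wC :: "real \<Rightarrow> 'a::finite phase \<Rightarrow> 'a wn" where "wC h x = Abs (C h x)"
definition wCi :: "real \<Rightarrow> 'a::finite phase \<Rightarrow> 'a wn" where "wCi h x = Abs (Cinv h x)"

lemma Rep_w [simp]: "Rep (wm r y) = mono_loop r y" "Rep (wU x) = U x" "Rep (wV x) = V x" "Rep (wC h x) = C h x"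
  by (simp_all add: wm_def wU_def wV_def wC_def)

lemma wn_eqI: "Rep x = Rep y \<Longrightarrow> x = y"
  by (simp add: Rep_inject)

lemma w_wm: "wU x = wm 0 (\<lambda>k. fst x $ k) + wm 1 (\<lambda>_. 1)" "wV x = 1 + wm (-1) (\<lambda>k. snd x $ k)"
  "wC h x = 1 + wm (-1) (cfun h x)"
  by (rule wn_eqI, simp add: Rep_ops Rep_mult U_mono V_unip C_unip unip_def lone_mono)+

lemma norm_wm: "norm (wm r y) = Max (range (\<lambda>i. \<bar>y i\<bar>))"
  by (simp add: norm_wn_def nn_mono)

lemma norm_wm_le: "(\<And>i. \<bar>y i\<bar> \<le> c) \<Longrightarrow> norm (wm r y) \<le> c"
  unfolding norm_wm by (subst Max_le_iff) auto

lemma wm_derivative: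
  fixes y :: "real \<Rightarrow> 'a::finite mod_ring \<Rightarrow> real"
  assumes "\<And>k. ((\<lambda>t. y t k) has_real_derivative y' k) (at s within T)"
  shows "((\<lambda>t. wm r (y t)) has_vector_derivative wm r y') (at s within T)"
proof -
  have e: "wm r w = (\<Sum>k\<in>UNIV. w k *\<^sub>R wm r (\<lambda>j. if j = k then 1 else 0))" for w :: "'a mod_ring \<Rightarrow> real"
  proof (rule wn_eqI, rule twisted_eqI)
    fix p and i :: "'a mod_ring"
    have l: "linear (\<lambda>x. coef (Rep x) p i)" by (rule bounded_linear.linear[OF bounded_linear_coef])
    have "coef (Rep (\<Sum>k\<in>UNIV. w k *\<^sub>R wm r (\<lambda>j. if j = k then 1 else 0))) p i
        = (\<Sum>k\<in>UNIV. if k = i then (if p = r then w k else 0) else 0)"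
      unfolding linear_sum[OF l] linear_scale[OF l] by (rule sum.cong) auto
    then show "coef (Rep (wm r w)) p i = coef (Rep (\<Sum>k\<in>UNIV. w k *\<^sub>R wm r (\<lambda>j. if j = k then 1 else 0))) p i"
      by simp
  qed simp_all
  have "((\<lambda>t. \<Sum>k\<in>UNIV. y t k *\<^sub>R wm r (\<lambda>j. if j = k then 1 else 0)) has_vector_derivative
      (\<Sum>k\<in>UNIV. y' k *\<^sub>R wm r (\<lambda>j. if j = k then 1 else 0))) (at s within T)"
  proof (rule has_vector_derivative_sum)
    fix k
    from has_vector_derivative_scaleR[OF assms[of k] has_vector_derivative_const[of "wm r (\<lambda>j. if j = k then 1 else 0)"]]
    show "((\<lambda>t. y t k *\<^sub>R wm r (\<lambda>j. if j = k then 1 else 0)) has_vector_derivative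
        y' k *\<^sub>R wm r (\<lambda>j. if j = k then 1 else 0)) (at s within T)" by simp
  qed
  then show ?thesis unfolding e[symmetric] .
qed

lemma tr_wm: "tr (x * wm r y) = (\<Sum>i\<in>UNIV. y i * coef (Rep x) (- r) (shift (- r) i))"
proof -
  have "tr (x * wm r y) = pairing (Rep (wm r y)) (Rep x)" by (simp only: pairing_Rep tr_commute)
  then show ?thesis by (simp add: pairing_mono)
qed

text \<open>The geometric series converges in norm, and its coefficients are those of the series
  defining \<open>Cinv\<close>. So the formal inverse lies in the Wiener algebra once I - C is
  small.\<close>

lemma Cinv_wiener:
  assumes "norm (1 - wC h x) < 1"
  shows "Cinv h x \<in> wiener" "norm (wCi h x) \<le> 1 / (1 - norm (1 - wC h x))"
proof -
  let ?z = "1 - wC h x"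
  have sm: "summable (\<lambda>n. ?z ^ n)" by (rule complete_algebra_summable_geometric[OF assms])
  have R: "Cinv h x = Rep (\<Sum>n. ?z ^ n)"
  proof (rule ext)
    fix p
    have "(\<lambda>n. lpow (lone - C h x) n p) sums Rep (\<Sum>n. ?z ^ n) p"
      using bounded_linear.sums[OF bounded_linear_Rep summable_sums[OF sm], of p]
      by (simp add: Rep_power Rep_ops Rep_mult)
    then show "Cinv h x p = Rep (\<Sum>n. ?z ^ n) p" by (simp add: Cinv_def sums_iff)
  qed
  show "Cinv h x \<in> wiener" unfolding R by simp
  have "norm (\<Sum>n. ?z ^ n) \<le> (\<Sum>n. norm ?z ^ n)"
    by (rule norm_suminf_le[OF norm_power_ineq summable_geometric]) (use assms in simp)
  also have "\<dots> = 1 / (1 - norm ?z)" by (rule suminf_geometric) (use assms in simp)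
  finally show "norm (wCi h x) \<le> 1 / (1 - norm ?z)" unfolding wCi_def R by (simp add: Rep_inverse)
qed

lemma wCi_inverse:
  assumes "Cinv h x \<in> wiener"
  shows "Rep (wCi h x) = Cinv h x" "wC h x * wCi h x = 1" "wCi h x * wC h x = 1"
proof -
  show R: "Rep (wCi h x) = Cinv h x" using assms by (simp add: wCi_def)
  show "wC h x * wCi h x = 1" "wCi h x * wC h x = 1" by (rule wn_eqI, simp add: Rep_mult R)+
qed

text \<open>The gradient of \<open>phi_log\<close> refers to norm-differentiable curves, so the
  chain rule is carried out again in the Banach algebra; the answer has the form found in
  \<open>slots_UVC\<close>, with \<open>geo_log\<close> as the gradient.\<close>

lemma slots_phi_log:
  fixes x :: "'a::finite phase"
  assumes C1: "norm (1 - wC h x) < 1" and dom: "\<bar>h\<bar> * norm (wU x * wV x * wCi h x) < 1"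
  defines "G \<equiv> geo_log h (wU x * wV x * wCi h x)"
  shows "slots h (\<lambda>y. phi_log h (UVC h y)) x (Rep (wV x * wCi h x * G))
    (Rep (wCi h x * G * wU x * wV x * wCi h x)) (Rep (wCi h x * G * wU x))"
proof (rule slotsI)
  fix \<xi> :: "real \<Rightarrow> 'a phase" and y assume \<xi>: "(\<xi> has_vector_derivative y) (at 0)" "\<xi> 0 = x"
  \<comment> \<open>Halfway between norm (I - C) and 1: near t = 0 it bounds the norm of I - C,
    hence bounds the inverses uniformly, as the differentiation of C^-1 requires.\<close>
  let ?q = "(1 + norm (1 - wC h x)) / 2"
  note c = phase_components[OF \<xi>(1)]
  let ?mu = "wm 0 (\<lambda>k. fst y $ k)" and ?mv = "wm (-1) (\<lambda>k. snd y $ k)" and ?mc = "wm (-1) (dcf h x y)"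
  have dU: "((\<lambda>t. wU (\<xi> t)) has_vector_derivative ?mu) (at 0)"
    unfolding w_wm by (rule derivative_eq_intros wm_derivative c refl | simp)+
  have dV: "((\<lambda>t. wV (\<xi> t)) has_vector_derivative ?mv) (at 0)"
    unfolding w_wm by (rule derivative_eq_intros wm_derivative c refl | simp)+
  have dC: "((\<lambda>t. wC h (\<xi> t)) has_vector_derivative ?mc) (at 0)"
    unfolding w_wm using cfun_derivative[OF \<xi>(1), of h] \<xi>(2)
    by (auto intro!: derivative_eq_intros wm_derivative)
  have "((\<lambda>t. wC h (\<xi> t)) \<longlongrightarrow> wC h x) (at 0)"
    using has_vector_derivative_continuous[OF dC] \<xi>(2) by (simp add: continuous_within)
  then have "((\<lambda>t. norm (1 - wC h (\<xi> t))) \<longlongrightarrow> norm (1 - wC h x)) (at 0)" by (intro tendsto_intros)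
  then have "\<forall>\<^sub>F t in at 0. norm (1 - wC h (\<xi> t)) < ?q"
    by (rule order_tendstoD(2)) (use C1 in simp)
  then obtain \<delta> where \<delta>: "\<delta> > 0" "\<And>t. t \<noteq> 0 \<Longrightarrow> dist t 0 < \<delta> \<Longrightarrow> norm (1 - wC h (\<xi> t)) < ?q"
    unfolding eventually_at by auto
  let ?T = "ball (0::real) \<delta>"
  have q: "norm (1 - wC h (\<xi> t)) < ?q" if "t \<in> ?T" for t
    using that \<delta>(2)[of t] C1 \<xi>(2) by (cases "t = 0") (auto simp: dist_commute)
  have q1: "norm (1 - wC h (\<xi> t)) < 1" if "t \<in> ?T" for t using q[OF that] C1 by simp
  note iv = wCi_inverse[OF Cinv_wiener(1)[OF q1]]
  have nb: "norm (wCi h (\<xi> t)) \<le> 1 / (1 - ?q)" if "t \<in> ?T" for t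
    using Cinv_wiener(2)[OF q1[OF that]] frac_le[of 1 1 "1 - ?q" "1 - norm (1 - wC h (\<xi> t))"] q[OF that] C1
    by simp
  have 0: "0 \<in> ?T" "open ?T" using \<delta>(1) by auto
  have dCi: "((\<lambda>t. wCi h (\<xi> t)) has_vector_derivative - (wCi h x * ?mc * wCi h x)) (at 0)"
    using has_vector_derivative_inverse[OF has_vector_derivative_at_within[OF dC] 0(1) iv(2,3) nb]
    unfolding has_vector_derivative_within_open[OF 0] \<xi>(2) .
  let ?X = "\<lambda>t. wU (\<xi> t) * wV (\<xi> t) * wCi h (\<xi> t)"
  have "(?X has_vector_derivative wU x * wV x * - (wCi h x * ?mc * wCi h x)
      + (wU x * ?mv + ?mu * wV x) * wCi h x) (at 0)" (is "(_ has_vector_derivative ?D) _")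
    using has_vector_derivative_mult[OF has_vector_derivative_mult[OF dU dV] dCi] unfolding \<xi>(2) .
  from phi_log_derivative[OF this, of h] dom \<xi>(2)
  have "((\<lambda>t. phi_log h (Rep (?X t))) has_real_derivative tr (G * ?D)) (at 0)" by (simp add: G_def)
  moreover have "phi_log h (Rep (?X t)) = phi_log h (UVC h (\<xi> t))" if "t \<in> ?T" for t
    using iv(1)[OF that] by (simp add: Rep_mult)
  ultimately have d: "((\<lambda>t. phi_log h (UVC h (\<xi> t))) has_real_derivative tr (G * ?D)) (at 0)"
    unfolding has_real_derivative_iff_has_vector_derivative
    by (rule has_vector_derivative_transform_within_open[OF _ 0(2,1)])
  note lin = bounded_linear.linear[OF bounded_linear_tr]
  have "G * ?D = G * (?mu * (wV x * wCi h x)) + G * wU x * (?mv * wCi h x)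
      - G * wU x * wV x * wCi h x * (?mc * wCi h x)"
    by (simp add: algebra_simps)
  then have "tr (G * ?D) = tr (G * (?mu * (wV x * wCi h x))) + tr (G * wU x * (?mv * wCi h x))
      - tr (G * wU x * wV x * wCi h x * (?mc * wCi h x))"
    by (simp only: linear_add[OF lin] linear_diff[OF lin])
  also have "tr (G * (?mu * (wV x * wCi h x))) = tr ((wV x * wCi h x * G) * ?mu)"
    using tr_commute[of "G * ?mu" "wV x * wCi h x"] by (simp only: mult.assoc)
  also have "tr (G * wU x * (?mv * wCi h x)) = tr ((wCi h x * G * wU x) * ?mv)"
    using tr_commute[of "G * wU x * ?mv" "wCi h x"] by (simp only: mult.assoc)
  also have "tr (G * wU x * wV x * wCi h x * (?mc * wCi h x)) = tr ((wCi h x * G * wU x * wV x * wCi h x) * ?mc)"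
    using tr_commute[of "G * wU x * wV x * wCi h x * ?mc" "wCi h x"] by (simp only: mult.assoc)
  finally have "tr (G * ?D) = (\<Sum>i\<in>UNIV. fst y $ i * coef (Rep (wV x * wCi h x * G)) 0 i)
      - (\<Sum>i\<in>UNIV. dcf h x y i * coef (Rep (wCi h x * G * wU x * wV x * wCi h x)) 1 (nxt i))
      + (\<Sum>i\<in>UNIV. snd y $ i * coef (Rep (wCi h x * G * wU x)) 1 (nxt i))"
    unfolding tr_wm by simp
  with d show "((\<lambda>t. phi_log h (UVC h (\<xi> t))) has_real_derivative
      (\<Sum>i\<in>UNIV. fst y $ i * coef (Rep (wV x * wCi h x * G)) 0 i)
      - (\<Sum>i\<in>UNIV. dcf h x y i * coef (Rep (wCi h x * G * wU x * wV x * wCi h x)) 1 (nxt i))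
      + (\<Sum>i\<in>UNIV. snd y $ i * coef (Rep (wCi h x * G * wU x)) 1 (nxt i))) (at 0)" by simp
qed

text \<open>The sandwich identity moves a factor through \<open>geo_log\<close>, for example L_2
  p(L_2) = V C^-1 p(L_1) U. The intertwining relations and the products required by
  \<open>ham_field_triad\<close> follow by regrouping.\<close>

lemma log_triad:
  fixes x :: "'a::finite phase"
  assumes h: "h \<noteq> 0" and C1: "norm (1 - wC h x) < 1"
    and n: "\<bar>h\<bar> * norm (wU x * wV x * wCi h x) < 1" "\<bar>h\<bar> * norm (wV x * wCi h x * wU x) < 1"
      "\<bar>h\<bar> * norm (wCi h x * wU x * wV x) < 1"
  defines "G1 \<equiv> geo_log h (wU x * wV x * wCi h x)" and "G2 \<equiv> geo_log h (wV x * wCi h x * wU x)"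
    and "G3 \<equiv> geo_log h (wCi h x * wU x * wV x)"
  shows "f_log h (UVC h x) = Rep (wU x * wV x * wCi h x * G1)"
    "f_log h (VCU h x) = Rep (wV x * wCi h x * wU x * G2)"
    "f_log h (CUV h x) = Rep (wCi h x * wU x * wV x * G3)"
    "U x \<star> f_log h (VCU h x) = f_log h (UVC h x) \<star> U x"
    "C h x \<star> f_log h (CUV h x) = f_log h (UVC h x) \<star> C h x"
    "V x \<star> f_log h (CUV h x) = f_log h (VCU h x) \<star> V x"
    "ham_field (\<lambda>y. phi_log h (UVC h y)) x = triad_field x (f_log h (UVC h x)) (f_log h (VCU h x)) (f_log h (CUV h x))"
proof -
  note iv = wCi_inverse[OF Cinv_wiener(1)[OF C1]]
  have R: "UVC h x = Rep (wU x * wV x * wCi h x)" "VCU h x = Rep (wV x * wCi h x * wU x)"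
    "CUV h x = Rep (wCi h x * wU x * wV x)"
    by (simp_all add: Rep_mult iv)
  show f: "f_log h (UVC h x) = Rep (wU x * wV x * wCi h x * G1)"
    "f_log h (VCU h x) = Rep (wV x * wCi h x * wU x * G2)"
    "f_log h (CUV h x) = Rep (wCi h x * wU x * wV x * G3)"
    unfolding R G1_def G2_def G3_def by (rule f_log_Rep[OF h]; rule n)+
  have b: "wV x * wCi h x * wU x * G2 = wV x * wCi h x * G1 * wU x"
    using geo_log_sandwich[of h "wU x" "wV x * wCi h x"] n(1,2) by (simp add: G1_def G2_def mult.assoc)
  have c: "wCi h x * wU x * wV x * G3 = wCi h x * G1 * wU x * wV x"
    using geo_log_sandwich[of h "wU x * wV x" "wCi h x"] n(1,3) by (simp add: G1_def G3_def mult.assoc)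
  have a: "wU x * wV x * wCi h x * G1 = G1 * wU x * wV x * wCi h x"
    using geo_log_commute[OF n(1)] by (simp add: G1_def mult.assoc)
  have CC: "wC h x * (wCi h x * z) = z" "wCi h x * (wC h x * z) = z" for z
    by (simp_all add: iv flip: mult.assoc)
  have e: "wU x * (wV x * wCi h x * wU x * G2) = wU x * wV x * wCi h x * G1 * wU x"
    unfolding b by (simp only: mult.assoc)
  have e2: "wC h x * (wCi h x * wU x * wV x * G3) = wU x * wV x * wCi h x * G1 * wC h x"
    unfolding a c by (simp only: mult.assoc CC iv mult_1_right)
  have e3: "wV x * (wCi h x * wU x * wV x * G3) = wV x * wCi h x * wU x * G2 * wV x"
    unfolding b c by (simp only: mult.assoc)
  show "U x \<star> f_log h (VCU h x) = f_log h (UVC h x) \<star> U x"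
    "C h x \<star> f_log h (CUV h x) = f_log h (UVC h x) \<star> C h x"
    "V x \<star> f_log h (CUV h x) = f_log h (VCU h x) \<star> V x"
    using e[THEN arg_cong[where f = Rep]] e2[THEN arg_cong[where f = Rep]] e3[THEN arg_cong[where f = Rep]]
    unfolding f Rep_mult(2)[of "wU x"] Rep_mult(2)[of _ "wU x"] Rep_mult(2)[of "wC h x"] Rep_mult(2)[of _ "wC h x"]
      Rep_mult(2)[of "wV x"] Rep_mult(2)[of _ "wV x"]
    by (simp_all only: Rep_mult Rep_w)
  have s: "slots h (\<lambda>y. phi_log h (UVC h y)) x (Rep (wV x * wCi h x * G1))
    (Rep (wCi h x * G1 * wU x * wV x * wCi h x)) (Rep (wCi h x * G1 * wU x))"
    unfolding G1_def by (rule slots_phi_log[OF C1 n(1)])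
  have k: "wU x * wV x * wCi h x * G1 = wU x * (wV x * wCi h x * G1)"
    "wV x * wCi h x * wU x * G2 = wV x * wCi h x * G1 * wU x"
    "wV x * wCi h x * wU x * G2 = wV x * (wCi h x * G1 * wU x)"
    "wCi h x * wU x * wV x * G3 = wCi h x * G1 * wU x * wV x"
    "wCi h x * wU x * wV x * G3 = wCi h x * G1 * wU x * wV x * wCi h x * wC h x"
    unfolding b c by (simp_all only: mult.assoc iv mult_1_right)
  have k2: "wU x * wV x * wCi h x * G1 = wC h x * (wCi h x * G1 * wU x * wV x * wCi h x)"
    unfolding a by (simp only: mult.assoc CC)
  note kR = k[THEN arg_cong[where f = Rep]] k2[THEN arg_cong[where f = Rep]]
  show "ham_field (\<lambda>y. phi_log h (UVC h y)) x = triad_field x (f_log h (UVC h x)) (f_log h (VCU h x)) (f_log h (CUV h x))"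
    unfolding f
  proof (rule ham_field_triad[OF s])
    show "Rep (wU x * wV x * wCi h x * G1) = U x \<star> Rep (wV x * wCi h x * G1)"
      using kR(1) by (simp only: Rep_mult(2)[of "wU x" "_ * G1"] Rep_w)
    show "Rep (wU x * wV x * wCi h x * G1) = C h x \<star> Rep (wCi h x * G1 * wU x * wV x * wCi h x)"
      using kR(6) by (simp only: Rep_mult(2)[of "wC h x"] Rep_w)
    show "Rep (wV x * wCi h x * wU x * G2) = Rep (wV x * wCi h x * G1) \<star> U x"
      using kR(2) by (simp only: Rep_mult(2)[of _ "wU x"] Rep_w)
    show "Rep (wV x * wCi h x * wU x * G2) = V x \<star> Rep (wCi h x * G1 * wU x)"
      using kR(3) by (simp only: Rep_mult(2)[of "wV x" "_ * wU x"] Rep_w)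
    show "Rep (wCi h x * wU x * wV x * G3) = Rep (wCi h x * G1 * wU x) \<star> V x"
      using kR(4) by (simp only: Rep_mult(2)[of "_ * wU x" "wV x"] Rep_w)
    show "Rep (wCi h x * wU x * wV x * G3) = Rep (wCi h x * G1 * wU x * wV x * wCi h x) \<star> C h x"
      using kR(5) by (simp only: Rep_mult(2)[of _ "wC h x"] Rep_w)
  qed simp_all
qed

section \<open>Factorization of the exponential and interpolation of the discrete map\<close>

section \<open>Factorization in the Wiener algebra\<close>

definition deg_ge :: "int \<Rightarrow> 'a::finite wn \<Rightarrow> bool" where "deg_ge a x \<longleftrightarrow> (\<forall>p<a. Rep x p = 0)"
definition deg_le :: "int \<Rightarrow> 'a::finite wn \<Rightarrow> bool" where "deg_le a x \<longleftrightarrow> (\<forall>p>a. Rep x p = 0)"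

lemma deg_ge_mult: "deg_ge a x \<Longrightarrow> deg_ge b y \<Longrightarrow> deg_ge (a + b) (x * y)"
  unfolding deg_ge_def Rep_mult
proof (intro allI impI)
  fix p assume x: "\<forall>p<a. Rep x p = 0" and y: "\<forall>p<b. Rep y p = 0" and p: "p < a + b"
  have "Rep x q ** Rep y (p - q) = 0" for q
    using x y p by (cases "q < a") auto
  then show "(Rep x \<star> Rep y) p = 0" unfolding lmul_def by (intro infsum_0) simp
qed

lemma deg_le_mult: "deg_le a x \<Longrightarrow> deg_le b y \<Longrightarrow> deg_le (a + b) (x * y)"
  unfolding deg_le_def Rep_mult by (auto intro: lmul_above[of a "Rep x" b "Rep y"])

lemma deg_ge_ops: "deg_ge a x \<Longrightarrow> deg_ge a y \<Longrightarrow> deg_ge a (x + y)" "deg_ge a x \<Longrightarrow> deg_ge a y \<Longrightarrow> deg_ge a (x - y)"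
  "deg_ge a x \<Longrightarrow> deg_ge a (- x)" "deg_ge a x \<Longrightarrow> deg_ge a (c *\<^sub>R x)" "deg_ge a 0"
  by (simp_all add: deg_ge_def Rep_ops)

lemma deg_le_ops: "deg_le a x \<Longrightarrow> deg_le a y \<Longrightarrow> deg_le a (x + y)" "deg_le a x \<Longrightarrow> deg_le a y \<Longrightarrow> deg_le a (x - y)"
  "deg_le a x \<Longrightarrow> deg_le a (- x)" "deg_le a x \<Longrightarrow> deg_le a (c *\<^sub>R x)" "deg_le a 0"
  by (simp_all add: deg_le_def Rep_ops)

lemma deg_ge_mono: "deg_ge a x \<Longrightarrow> b \<le> a \<Longrightarrow> deg_ge b x" and deg_le_mono: "deg_le a x \<Longrightarrow> a \<le> b \<Longrightarrow> deg_le b x"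
  by (auto simp: deg_ge_def deg_le_def)

lemma deg_ge_wm: "a \<le> r \<Longrightarrow> deg_ge a (wm r y)" and deg_le_wm: "r \<le> a \<Longrightarrow> deg_le a (wm r y)"
  by (auto simp: deg_ge_def deg_le_def mono_loop_neq)

lemma one_wm: "(1 :: 'a::finite wn) = wm 0 (\<lambda>_. 1)"
  by (rule wn_eqI) (simp add: Rep_mult lone_mono)

lemma deg_ge_one: "a \<le> 0 \<Longrightarrow> deg_ge a 1" and deg_le_one: "0 \<le> a \<Longrightarrow> deg_le a 1"
  by (simp_all add: one_wm deg_ge_wm deg_le_wm)

lemma deg_ge_mult0: "deg_ge 0 x \<Longrightarrow> deg_ge a y \<Longrightarrow> deg_ge a (x * y)" "deg_ge a x \<Longrightarrow> deg_ge 0 y \<Longrightarrow> deg_ge a (x * y)"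
  using deg_ge_mult[of 0 x a y] deg_ge_mult[of a x 0 y] by auto

lemma deg_le_mult0: "deg_le 0 x \<Longrightarrow> deg_le a y \<Longrightarrow> deg_le a (x * y)" "deg_le a x \<Longrightarrow> deg_le 0 y \<Longrightarrow> deg_le a (x * y)"
  using deg_le_mult[of 0 x a y] deg_le_mult[of a x 0 y] by auto

definition wneg :: "'a::finite wn \<Rightarrow> 'a wn" where "wneg x = Abs (pi_minus (Rep x))"

lemma pi_minus_wiener: "L \<in> wiener \<Longrightarrow> pi_minus L \<in> wiener"
  by (rule wiener_comparison[of _ "rn L"]) (auto simp: wienerD twisted_pi_minus rn_le_iff coef_pi_minus coef_le_rn)

lemma Rep_wneg: "Rep (wneg x) = pi_minus (Rep x)"
  by (simp add: wneg_def pi_minus_wiener)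

text \<open>With summable coefficients the projection to negative powers cannot increase the norm;
  this makes the map in \<open>fixpoint_unique\<close> a contraction.\<close>

lemma norm_wneg: "norm (wneg x) \<le> norm x"
  unfolding norm_wn_def Rep_wneg nn_def
  by (rule infsum_mono) (auto simp: wienerD pi_minus_wiener rn_le_iff coef_pi_minus coef_le_rn)

lemma wneg_linear: "wneg (x + y) = wneg x + wneg y" "wneg (x - y) = wneg x - wneg y" "wneg (c *\<^sub>R x) = c *\<^sub>R wneg x"
  "wneg (- x) = - wneg x"
  by (rule wn_eqI, simp add: Rep_wneg Rep_ops fun_eq_iff pi_minus_def)+

lemma wneg_deg_ge: "wneg x = 0 \<longleftrightarrow> deg_ge 0 x"
  by (auto simp: Rep_inject[symmetric] Rep_wneg Rep_ops fun_eq_iff pi_minus_def deg_ge_def)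

lemma wneg_deg_le: "wneg x = x \<longleftrightarrow> deg_le (-1) x"
  by (auto simp: Rep_inject[symmetric] Rep_wneg fun_eq_iff pi_minus_def deg_le_def)

lemma deg_le_wneg: "deg_le (-1) (wneg x)"
  by (auto simp: deg_le_def Rep_wneg pi_minus_def)

text \<open>The degree conditions pass to the geometric series because they are stable under
  products and under coefficientwise limits; i - 1 = i z removes the term of degree 0.\<close>

lemma neumann:
  fixes z :: "'a::finite wn"
  assumes z: "norm z < 1"
  obtains i where "i * (1 - z) = 1" "(1 - z) * i = 1" "norm i \<le> 1 / (1 - norm z)"
    "deg_ge 0 z \<Longrightarrow> deg_ge 0 i" "deg_le (-1) z \<Longrightarrow> deg_le (-1) (i - 1)"
proof -
  let ?i = "\<Sum>n. z ^ n"
  have sm: "summable (\<lambda>n. z ^ n)" by (rule complete_algebra_summable_geometric[OF z])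
  have t: "(\<lambda>n. z ^ n - z ^ Suc n) sums (z ^ 0 - 0)"
    by (rule telescope_sums') (rule summable_LIMSEQ_zero[OF sm])
  have 1: "?i * (1 - z) = 1"
    using sums_unique2[OF sums_mult2[OF summable_sums[OF sm], of "1 - z"], of 1] t
    by (simp add: right_diff_distrib power_commutes)
  have 2: "(1 - z) * ?i = 1"
    using sums_unique2[OF sums_mult[OF summable_sums[OF sm], of "1 - z"], of 1] t
    by (simp add: left_diff_distrib)
  have "norm ?i \<le> (\<Sum>n. norm z ^ n)"
    by (rule norm_suminf_le[OF norm_power_ineq summable_geometric]) (use z in simp)
  also have "\<dots> = 1 / (1 - norm z)" by (rule suminf_geometric) (use z in simp)
  finally have 3: "norm ?i \<le> 1 / (1 - norm z)" .
  have R: "(\<lambda>n. Rep (z ^ n) p) sums Rep ?i p" for p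
    by (rule bounded_linear.sums[OF bounded_linear_Rep summable_sums[OF sm]])
  have 4: "deg_ge 0 ?i" if "deg_ge 0 z"
  proof -
    have "deg_ge 0 (z ^ n)" for n by (induction n) (simp_all add: deg_ge_one deg_ge_mult0 that)
    then have "(\<lambda>n. Rep (z ^ n) p) = (\<lambda>_. 0)" if "p < 0" for p using that by (auto simp: deg_ge_def)
    then show ?thesis using R unfolding deg_ge_def by (metis sums_unique2 sums_zero)
  qed
  have 5: "deg_le (-1) (?i - 1)" if a: "deg_le (-1) z"
  proof -
    have "deg_le 0 z" by (rule deg_le_mono[OF a]) simp
    then have p: "deg_le 0 (z ^ n)" for n by (induction n) (simp_all add: deg_le_one deg_le_mult0)
    have "(\<lambda>n. Rep (z ^ n) q) = (\<lambda>_. 0)" if "q > 0" for q using p that by (auto simp: deg_le_def)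
    then have "deg_le 0 ?i" using R unfolding deg_le_def by (metis sums_unique2 sums_zero)
    then have "deg_le (-1) (?i * z)" by (rule deg_le_mult0(1)[OF _ a])
    moreover have "?i - 1 = ?i * z"
    proof -
      have "?i - ?i * z = 1" using 1 by (simp only: right_diff_distrib mult_1_right)
      then show ?thesis by (metis diff_diff_eq2 add_diff_cancel_left' diff_eq_eq add.commute)
    qed
    ultimately show ?thesis by simp
  qed
  show thesis by (rule that[OF 1 2 3 4 5])
qed

text \<open>One contraction, with varying \<open>w\<close>, provides the factor Y, its derivative
  and, through uniqueness, the identification of the factors at t = h.\<close>

lemma fixpoint_unique:
  assumes "norm (e - 1) \<le> 1/5"
  shows "\<exists>!y. y = w - wneg ((e - 1) * y)"
proof -
  have "\<exists>!y. w - wneg ((e - 1) * y) = y"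
  proof (rule banach_fix_type[of "1/5"])
    show "\<forall>x y. dist (w - wneg ((e - 1) * x)) (w - wneg ((e - 1) * y)) \<le> 1/5 * dist x y"
    proof (intro allI)
      fix x y
      have "w - wneg ((e - 1) * x) - (w - wneg ((e - 1) * y)) = wneg ((e - 1) * (y - x))"
        by (simp add: right_diff_distrib wneg_linear)
      then have "dist (w - wneg ((e - 1) * x)) (w - wneg ((e - 1) * y)) \<le> norm ((e - 1) * (y - x))"
        by (simp only: dist_norm norm_wneg)
      also have "\<dots> \<le> norm (e - 1) * norm (y - x)" by (rule norm_mult_ineq)
      also have "\<dots> \<le> 1/5 * dist x y"
        unfolding dist_norm norm_minus_commute[of x] by (intro mult_right_mono assms) auto
      finally show "dist (w - wneg ((e - 1) * x)) (w - wneg ((e - 1) * y)) \<le> 1/5 * dist x y" .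
    qed
  qed auto
  then show ?thesis by metis
qed

text \<open>5/4 = 1 / (1 - 1/5). Applied to increments and to difference quotients, the bound yields
  continuity and differentiability of the factor.\<close>

lemma fixpoint_bound:
  assumes "norm (e - 1) \<le> 1/5" "y = w - wneg ((e - 1) * y)"
  shows "norm y \<le> 5/4 * norm w"
proof -
  have "norm y \<le> norm w + norm (wneg ((e - 1) * y))" by (subst assms(2)) (rule norm_triangle_ineq4)
  also have "norm (wneg ((e - 1) * y)) \<le> norm (e - 1) * norm y" by (rule order_trans[OF norm_wneg norm_mult_ineq])
  also have "norm (e - 1) * norm y \<le> 1/5 * norm y" by (intro mult_right_mono assms) simp
  finally show ?thesis by simp
qed

text \<open>
  \<open>Y\<close> is the factor of \<open>exp (t F)\<close> which makes \<open>exp (t F) Y\<close> free of negative powers of \<open>\<lambda>\<close>; \<open>I\<close> and \<open>J\<close> are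
  the inverses of the two factors and \<open>Z\<close> is the derivative of \<open>Y\<close>.
\<close>

definition factors :: "'a::finite wn \<Rightarrow> real set \<Rightarrow> (real \<Rightarrow> 'a wn) \<Rightarrow> (real \<Rightarrow> 'a wn) \<Rightarrow> (real \<Rightarrow> 'a wn) \<Rightarrow>
    (real \<Rightarrow> 'a wn) \<Rightarrow> bool" where
  "factors F T Y I J Z \<longleftrightarrow> (\<forall>t\<in>T. deg_le (-1) (Y t - 1) \<and> norm (Y t) \<le> 5/4 \<and>
     I t * Y t = 1 \<and> Y t * I t = 1 \<and> deg_le (-1) (I t - 1) \<and> norm (I t) \<le> 4/3 \<and>
     deg_ge 0 (exp (t *\<^sub>R F) * Y t) \<and> norm (exp (t *\<^sub>R F) * Y t - 1) \<le> 1/2 \<and>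
     J t * (exp (t *\<^sub>R F) * Y t) = 1 \<and> deg_ge 0 (J t) \<and>
     (Y has_vector_derivative Z t) (at t within T) \<and> wneg (I t * F * Y t) = - (I t * Z t) \<and>
     (\<forall>y. deg_le (-1) (y - 1) \<longrightarrow> deg_ge 0 (exp (t *\<^sub>R F) * y) \<longrightarrow> Y t = y))"

text \<open>Expanding e y around e = y = 1 and projecting to negative powers merges the two degree
  conditions into one linear fixed point equation for y - 1.\<close>

lemma factor_fixpoint:
  fixes e :: "'a::finite wn"
  assumes "norm (e - 1) \<le> 1/5"
  shows "deg_le (-1) (y - 1) \<and> deg_ge 0 (e * y) \<longleftrightarrow> y - 1 = - wneg (e - 1) - wneg ((e - 1) * (y - 1))"
proof -
  have w: "wneg (e * y) = wneg (e - 1) + wneg ((e - 1) * (y - 1)) + wneg (y - 1)"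
  proof -
    have "e * y = (e - 1) + (e - 1) * (y - 1) + (y - 1) + 1" by (simp add: algebra_simps)
    moreover have "wneg 1 = (0 :: 'a wn)" by (simp add: wneg_deg_ge deg_ge_one)
    ultimately show ?thesis by (simp only: wneg_linear(1) add_0_right) 
  qed
  show ?thesis
  proof
    assume "deg_le (-1) (y - 1) \<and> deg_ge 0 (e * y)"
    then have "wneg (y - 1) = y - 1" "wneg (e * y) = 0" by (simp_all add: wneg_deg_le wneg_deg_ge)
    then have "wneg (e - 1) + wneg ((e - 1) * (y - 1)) + (y - 1) = 0" using w by simp
    then show "y - 1 = - wneg (e - 1) - wneg ((e - 1) * (y - 1))"
      by (simp only: eq_neg_iff_add_eq_0 diff_conv_add_uminus minus_add_distrib[symmetric] add.commute)
  next
    assume e: "y - 1 = - wneg (e - 1) - wneg ((e - 1) * (y - 1))"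
    have a: "deg_le (-1) (y - 1)" by (subst e) (intro deg_le_ops deg_le_wneg)
    then have "wneg (y - 1) = y - 1" by (simp only: wneg_deg_le)
    then have "wneg (e * y) = wneg (e - 1) + wneg ((e - 1) * (y - 1)) + (- wneg (e - 1) - wneg ((e - 1) * (y - 1)))"
      unfolding w using e by simp
    then have "wneg (e * y) = 0" by simp
    then show "deg_le (-1) (y - 1) \<and> deg_ge 0 (e * y)" using a by (simp add: wneg_deg_ge)
  qed
qed

lemma factors_exist:
  fixes F :: "'a::finite wn"
  assumes small: "\<And>t. t \<in> T \<Longrightarrow> norm (exp (t *\<^sub>R F) - 1) \<le> 1/5"
  shows "\<exists>Y I J Z. factors F T Y I J Z"
proof -
  let ?e = "\<lambda>t. exp (t *\<^sub>R F)"
  have "\<forall>t\<in>T. \<exists>y. y = - wneg (?e t - 1) - wneg ((?e t - 1) * y)"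
    using fixpoint_unique[OF small] by blast
  then obtain y where y: "\<And>t. t \<in> T \<Longrightarrow> y t = - wneg (?e t - 1) - wneg ((?e t - 1) * y t)" by metis
  \<comment> \<open>1/4 is 5/4 times 1/5.\<close>
  have yn: "norm (y t) \<le> 1/4" if "t \<in> T" for t
    using fixpoint_bound[OF small[OF that] y[OF that]] norm_wneg[of "?e t - 1"] small[OF that] by simp
  \<comment> \<open>The fixed point equation for \<open>y\<close>, differentiated formally in t; its
    solution is the candidate for the derivative.\<close>
  have "\<forall>t\<in>T. \<exists>z. z = - wneg (?e t * F * (1 + y t)) - wneg ((?e t - 1) * z)"
    using fixpoint_unique[OF small] by blast
  then obtain Z where Z: "\<And>t. t \<in> T \<Longrightarrow> Z t = - wneg (?e t * F * (1 + y t)) - wneg ((?e t - 1) * Z t)" by metis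
  let ?Y = "\<lambda>t. 1 + y t"
  have fp: "deg_le (-1) (?Y t - 1) \<and> deg_ge 0 (?e t * ?Y t)" if "t \<in> T" for t
    unfolding factor_fixpoint[OF small[OF that]] using y[OF that] by simp
  have "\<exists>I. \<forall>t\<in>T. I t * ?Y t = 1 \<and> ?Y t * I t = 1 \<and> deg_le (-1) (I t - 1) \<and> norm (I t) \<le> 4/3"
  proof (rule bchoice, rule ballI)
    fix t assume t: "t \<in> T"
    have n: "norm (- y t) < 1" "1 / (1 - norm (- y t)) \<le> 4/3" using yn[OF t] by (simp_all add: field_simps)
    show "\<exists>i. i * ?Y t = 1 \<and> ?Y t * i = 1 \<and> deg_le (-1) (i - 1) \<and> norm i \<le> 4/3"
    proof (rule neumann[OF n(1)])
      fix i assume i: "i * (1 - - y t) = 1" "(1 - - y t) * i = 1" "norm i \<le> 1 / (1 - norm (- y t))"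
        "deg_le (-1) (- y t) \<Longrightarrow> deg_le (-1) (i - 1)"
      have "deg_le (-1) (- y t)" using fp[OF t] by (simp add: deg_le_ops(3))
      then show ?thesis using i n(2) by (intro exI[of _ i]) auto
    qed
  qed
  then obtain I where I: "\<And>t. t \<in> T \<Longrightarrow> I t * ?Y t = 1 \<and> ?Y t * I t = 1 \<and> deg_le (-1) (I t - 1) \<and> norm (I t) \<le> 4/3"
    by blast
  have Pn: "norm (?e t * ?Y t - 1) \<le> 1/2" if t: "t \<in> T" for t
  proof -
    \<comment> \<open>The three terms contribute 1/5, 1/20 and 1/4.\<close>
    have "?e t * ?Y t - 1 = (?e t - 1) + (?e t - 1) * y t + y t" by (simp add: algebra_simps)
    then have "norm (?e t * ?Y t - 1) \<le> norm (?e t - 1) + norm ((?e t - 1) * y t) + norm (y t)"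
      by (metis norm_triangle_le norm_triangle_ineq add_right_mono)
    also have "norm ((?e t - 1) * y t) \<le> 1/5 * (1/4)"
      by (rule order_trans[OF norm_mult_ineq]) (intro mult_mono small[OF t] yn[OF t]; simp)
    finally show ?thesis using small[OF t] yn[OF t] by simp
  qed
  have "\<exists>J. \<forall>t\<in>T. J t * (?e t * ?Y t) = 1 \<and> deg_ge 0 (J t)"
  proof (rule bchoice, rule ballI)
    fix t assume t: "t \<in> T"
    have n: "norm (1 - ?e t * ?Y t) < 1" using Pn[OF t] by (simp add: norm_minus_commute)
    show "\<exists>j. j * (?e t * ?Y t) = 1 \<and> deg_ge 0 j"
    proof (rule neumann[OF n])
      fix j assume j: "j * (1 - (1 - ?e t * ?Y t)) = 1" "deg_ge 0 (1 - ?e t * ?Y t) \<Longrightarrow> deg_ge 0 j"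
      have "deg_ge 0 (1 - ?e t * ?Y t)" using fp[OF t] by (intro deg_ge_ops deg_ge_one) auto
      then show ?thesis using j by (intro exI[of _ j]) simp
    qed
  qed
  then obtain J where J: "\<And>t. t \<in> T \<Longrightarrow> J t * (?e t * ?Y t) = 1 \<and> deg_ge 0 (J t)" by blast
  have de: "(?e has_vector_derivative ?e s * F) (at s within T)" for s
    by (rule exp_scaleR_has_vector_derivative_right)
  have dY: "(?Y has_vector_derivative Z s) (at s within T)" if s: "s \<in> T" for s
  proof -
    let ?\<Delta> = "\<lambda>t. y t - y s"
    \<comment> \<open>The increment of \<open>y\<close> solves an equation of the same type, with an
      inhomogeneity controlled by the increment of the exponential.\<close>
    have \<Delta>: "?\<Delta> t = - wneg ((?e t - ?e s) * ?Y t) - wneg ((?e s - 1) * ?\<Delta> t)" if t: "t \<in> T" for t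
      using y[OF t] y[OF s] by (simp add: algebra_simps wneg_linear)
    have \<Delta>n: "norm (?\<Delta> t) \<le> 25/16 * norm (?e t - ?e s)" if t: "t \<in> T" for t
    proof -
      have "norm (?\<Delta> t) \<le> 5/4 * norm (- wneg ((?e t - ?e s) * ?Y t))"
        by (rule fixpoint_bound[OF small[OF s] \<Delta>[OF t]])
      also have "norm (- wneg ((?e t - ?e s) * ?Y t)) \<le> norm (?e t - ?e s) * norm (?Y t)"
        unfolding norm_minus_cancel by (rule order_trans[OF norm_wneg norm_mult_ineq])
      also have "norm (?e t - ?e s) * norm (?Y t) \<le> norm (?e t - ?e s) * (5/4)"
        using norm_triangle_ineq[of 1 "y t"] yn[OF t] by (intro mult_left_mono) auto
      finally show ?thesis by simp
    qed
    have "(?e \<longlongrightarrow> ?e s) (at s within T)"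
      using has_vector_derivative_continuous[OF de] by (simp add: continuous_within)
    then have "((\<lambda>t. 25/16 * norm (?e t - ?e s)) \<longlongrightarrow> 25/16 * 0) (at s within T)"
      by (intro tendsto_intros tendsto_norm_zero) (simp add: LIM_zero_iff)
    then have l: "((\<lambda>t. 25/16 * norm (?e t - ?e s)) \<longlongrightarrow> 0) (at s within T)" by simp
    have "\<forall>\<^sub>F t in at s within T. norm (?\<Delta> t) \<le> 25/16 * norm (?e t - ?e s)"
      using \<Delta>n by (auto simp: eventually_at_filter)
    from Lim_null_comparison[OF this l] have yc: "(y \<longlongrightarrow> y s) (at s within T)"
      by (simp only: LIM_zero_iff)
    let ?q = "\<lambda>t. (1 / (t - s)) *\<^sub>R (?e t - ?e s)"
    have qc: "(?q \<longlongrightarrow> ?e s * F) (at s within T)"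
      using de unfolding has_vector_derivative_quotient .
    let ?r = "\<lambda>t. (1 / (t - s)) *\<^sub>R ?\<Delta> t - Z s"
    \<comment> \<open>So does the error between the difference quotient and \<open>Z s\<close>; its
      inhomogeneity tends to 0.\<close>
    have r: "?r t = - wneg (?q t * ?Y t - ?e s * F * ?Y s) - wneg ((?e s - 1) * ?r t)" if t: "t \<in> T" for t
    proof -
      have 1: "(1 / (t - s)) *\<^sub>R ?\<Delta> t = - wneg (?q t * ?Y t) - wneg ((?e s - 1) * ((1 / (t - s)) *\<^sub>R ?\<Delta> t))"
      proof -
        have "c *\<^sub>R (- wneg (a * z) - wneg (b * d)) = - wneg ((c *\<^sub>R a) * z) - wneg (b * (c *\<^sub>R d))"
          for c and a z b d :: "'a wn"
          by (simp only: scaleR_diff_right scaleR_minus_right wneg_linear(3) mult_scaleR_left mult_scaleR_right)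
        with \<Delta>[OF t] show ?thesis by metis
      qed
      have "?r t = (- wneg (?q t * ?Y t) - wneg ((?e s - 1) * ((1 / (t - s)) *\<^sub>R ?\<Delta> t)))
          - (- wneg (?e s * F * ?Y s) - wneg ((?e s - 1) * Z s))"
        using 1 Z[OF s] by metis
      also have "\<dots> = - wneg (?q t * ?Y t - ?e s * F * ?Y s) - wneg ((?e s - 1) * ?r t)"
        by (simp only: right_diff_distrib wneg_linear) simp
      finally show ?thesis .
    qed
    have l: "((\<lambda>t. 5/4 * norm (?q t * ?Y t - ?e s * F * ?Y s)) \<longlongrightarrow> 5/4 * 0) (at s within T)"
    proof (intro tendsto_intros tendsto_norm_zero)
      have "((\<lambda>t. ?q t * ?Y t) \<longlongrightarrow> ?e s * F * ?Y s) (at s within T)"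
        by (intro tendsto_intros qc yc)
      then show "((\<lambda>t. ?q t * ?Y t - ?e s * F * ?Y s) \<longlongrightarrow> 0) (at s within T)" by (simp only: LIM_zero_iff)
    qed
    have "norm (?r t) \<le> 5/4 * norm (?q t * ?Y t - ?e s * F * ?Y s)" if t: "t \<in> T" for t
    proof -
      have "norm (?r t) \<le> 5/4 * norm (- wneg (?q t * ?Y t - ?e s * F * ?Y s))"
        by (rule fixpoint_bound[OF small[OF s] r[OF t]])
      also have "\<dots> \<le> 5/4 * norm (?q t * ?Y t - ?e s * F * ?Y s)"
        unfolding norm_minus_cancel by (intro mult_left_mono norm_wneg) simp
      finally show ?thesis .
    qed
    then have "\<forall>\<^sub>F t in at s within T. norm (?r t) \<le> 5/4 * norm (?q t * ?Y t - ?e s * F * ?Y s)"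
      by (auto simp: eventually_at_filter)
    from Lim_null_comparison[OF this] l have "(?r \<longlongrightarrow> 0) (at s within T)" by simp
    then have "((\<lambda>t. (1 / (t - s)) *\<^sub>R ?\<Delta> t) \<longlongrightarrow> Z s) (at s within T)" by (simp only: LIM_zero_iff)
    then show ?thesis unfolding has_vector_derivative_quotient by simp
  qed
  \<comment> \<open>The derivative e (F Y + Z) of the nonnegative factor has no negative powers, and
    neither has its product with the inverse J of that factor, which is I (F Y + Z). As I Z consists
    of negative powers, the projection gives the claim.\<close>
  have Zn: "wneg (I t * F * ?Y t) = - (I t * Z t)" if t: "t \<in> T" for t
  proof -
    have aZ: "deg_le (-1) (Z t)" by (subst Z[OF t]) (intro deg_le_ops deg_le_wneg)
    then have "wneg (Z t) = Z t" by (simp only: wneg_deg_le)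
    moreover have "Z t + wneg (?e t * F * ?Y t) + wneg ((?e t - 1) * Z t) = 0"
      by (subst (1) Z[OF t]) simp
    ultimately have "wneg (?e t * (F * ?Y t + Z t)) = 0"
      by (simp add: algebra_simps wneg_linear)
    then have "deg_ge 0 (J t * (?e t * (F * ?Y t + Z t)))"
      using J[OF t] unfolding wneg_deg_ge by (blast intro: deg_ge_mult0(1)[of "J t"])
    moreover have "J t * (?e t * (F * ?Y t + Z t)) = I t * (F * ?Y t + Z t)"
    proof -
      have "J t * ?e t = J t * ?e t * (?Y t * I t)" using I[OF t] by simp
      also have "\<dots> = I t" using J[OF t] by (simp add: mult.assoc[symmetric])
      finally show ?thesis by (simp add: mult.assoc[symmetric])
    qed
    ultimately have "wneg (I t * F * ?Y t + I t * Z t) = 0"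
      by (simp add: wneg_deg_ge distrib_left mult.assoc)
    moreover have "wneg (I t * Z t) = I t * Z t"
    proof -
      have "deg_le (-1) ((I t - 1) * Z t + Z t)"
        using I[OF t] deg_le_mult[of "-1" "I t - 1" "-1" "Z t"] aZ
        by (intro deg_le_ops) (auto intro: deg_le_mono)
      then have "deg_le (-1) (I t * Z t)" by (simp add: left_diff_distrib)
      then show ?thesis by (simp only: wneg_deg_le)
    qed
    ultimately show ?thesis by (simp add: wneg_linear eq_neg_iff_add_eq_0)
  qed
  have uniq: "?Y t = y'" if t: "t \<in> T" and y': "deg_le (-1) (y' - 1)" "deg_ge 0 (?e t * y')" for t y'
  proof -
    have "y' - 1 = - wneg (?e t - 1) - wneg ((?e t - 1) * (y' - 1))"
      using factor_fixpoint[OF small[OF t]] y' by blast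
    then have "y' - 1 = y t" using fixpoint_unique[OF small[OF t]] y[OF t] by blast
    then show ?thesis by (simp add: algebra_simps)
  qed
  have Yn: "norm (?Y t) \<le> 5/4" if "t \<in> T" for t
    using norm_triangle_ineq[of 1 "y t"] yn[OF that] by simp
  have "factors F T ?Y I J Z"
    unfolding factors_def using fp Yn I Pn J dY Zn uniq by blast
  then show ?thesis by blast
qed

section \<open>The discrete map as a time shift\<close>

lemma exp_intertwine:
  fixes a b c :: "'b::{real_normed_algebra_1,banach}"
  assumes "a * c = c * b"
  shows "exp (t *\<^sub>R a) * c = c * exp (t *\<^sub>R b)"
proof -
  have p: "a ^ n * c = c * b ^ n" for n
  proof (induction n)
    case (Suc n)
    have "a ^ Suc n * c = a * (a ^ n * c)" by (simp add: mult.assoc)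
    also have "\<dots> = c * b ^ Suc n" using Suc assms by (simp add: mult.assoc[symmetric])
    finally show ?case .
  qed simp
  have q: "((t *\<^sub>R a) ^ n /\<^sub>R fact n) * c = c * ((t *\<^sub>R b) ^ n /\<^sub>R fact n)" for n
    by (simp add: scaleR_power p)
  have "(\<lambda>n. ((t *\<^sub>R a) ^ n /\<^sub>R fact n) * c) sums (exp (t *\<^sub>R a) * c)"
    by (intro sums_mult2 exp_converges)
  moreover have "(\<lambda>n. c * ((t *\<^sub>R b) ^ n /\<^sub>R fact n)) sums (c * exp (t *\<^sub>R b))"
    by (intro sums_mult exp_converges)
  ultimately show ?thesis unfolding q by (rule sums_unique2)
qed

lemma geo_log_scale: "geo_log 1 (h *\<^sub>R x) = geo_log h x"
  by (simp add: geo_log_def scaleR_power)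

lemma deg_ge_coefI:
  assumes "\<And>p i. p < a \<Longrightarrow> coef (Rep x) p i = 0"
  shows "deg_ge a x"
  using assms by (simp add: deg_ge_def vec_eq_iff twisted_nth[OF Rep_twisted])

lemma deg_le_below_wm:
  assumes "deg_le a x" "deg_ge a x"
  shows "x = wm a (\<lambda>k. coef (Rep x) a k)"
proof (rule wn_eqI, rule twisted_eqI)
  show "coef (Rep x) p i = coef (Rep (wm a (\<lambda>k. coef (Rep x) a k))) p i" for p i
  proof -
    have "coef (Rep x) p i = 0" if "p \<noteq> a"
      using assms that by (cases p a rule: linorder_cases) (auto simp: deg_le_def deg_ge_def coef_def)
    then show ?thesis by auto
  qed
qed simp_all

text \<open>Factors of the form 1 + (negative powers) change \<open>z\<close> only below its top
  degree, so the leading coefficient of the product is that of \<open>z\<close>.\<close>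

lemma deg_le_conj:
  assumes "deg_le (-1) (i - 1)" "deg_le (-1) (y - 1)" "deg_le a (z - w)" "deg_le (a + 1) z" "deg_le (a + 1) w"
  shows "deg_le a (i * z * y - w)"
proof -
  have y: "deg_le 0 y" using deg_le_ops(1)[OF deg_le_mono[OF assms(2), of 0] deg_le_one[of 0]] by simp
  have "i * z * y - w = (i - 1) * (z * y) + z * (y - 1) + (z - w)" by (simp add: algebra_simps)
  moreover have "deg_le a ((i - 1) * (z * y))"
    using deg_le_mult[OF assms(1) deg_le_mult0(2)[OF assms(4) y]] by simp
  moreover have "deg_le a (z * (y - 1))" using deg_le_mult[OF assms(4) assms(2)] by simp
  ultimately show ?thesis using assms(3) by (metis deg_le_ops(1))
qed

lemma factorsD:
  assumes "factors F T Y I J Z" "t \<in> T"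
  shows "deg_le (-1) (Y t - 1)" "deg_le (-1) (I t - 1)" "I t * Y t = 1" "Y t * I t = 1"
    "norm (Y t) \<le> 5/4" "norm (I t) \<le> 4/3" "norm (exp (t *\<^sub>R F) * Y t - 1) \<le> 1/2"
    "deg_ge 0 (exp (t *\<^sub>R F) * Y t)" "J t * (exp (t *\<^sub>R F) * Y t) = 1" "deg_ge 0 (J t)"
    "(Y has_vector_derivative Z t) (at t within T)" "wneg (I t * F * Y t) = - (I t * Z t)"
    "deg_le (-1) (y - 1) \<Longrightarrow> deg_ge 0 (exp (t *\<^sub>R F) * y) \<Longrightarrow> Y t = y"
  using assms unfolding factors_def by blast+

text \<open>Since exp (t F) A = A exp (t F'), dressing A with the negative factors is the same as
  dressing it with the nonnegative ones. The first form bounds the degrees from above, the second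
  from below; therefore U, V and C keep their shape.\<close>

lemma factors_intertwine:
  assumes f: "factors F T Y I J Z" "factors F' T Y' I' J' Z'" and t: "t \<in> T" and A: "F * A = A * F'"
  shows "(exp (t *\<^sub>R F) * Y t) * (I t * A * Y' t) = A * (exp (t *\<^sub>R F') * Y' t)"
    "deg_ge a A \<Longrightarrow> deg_ge a (I t * A * Y' t)"
proof -
  have Y: "Y t * I t = 1" and J: "J t * (exp (t *\<^sub>R F) * Y t) = 1" "deg_ge 0 (J t)" and P: "deg_ge 0 (exp (t *\<^sub>R F') * Y' t)"
    using factorsD[OF f(1) t] factorsD[OF f(2) t] by blast+
  have "(exp (t *\<^sub>R F) * Y t) * (I t * A * Y' t) = exp (t *\<^sub>R F) * (Y t * I t) * A * Y' t"
    by (simp only: mult.assoc)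
  also have "\<dots> = exp (t *\<^sub>R F) * A * Y' t" by (simp add: Y)
  also have "\<dots> = A * (exp (t *\<^sub>R F') * Y' t)" using exp_intertwine[OF A, of t] by (simp add: mult.assoc)
  finally show e: "(exp (t *\<^sub>R F) * Y t) * (I t * A * Y' t) = A * (exp (t *\<^sub>R F') * Y' t)" .
  have "I t * A * Y' t = J t * ((exp (t *\<^sub>R F) * Y t) * (I t * A * Y' t))"
    using J(1) by (simp add: mult.assoc[symmetric])
  also have "\<dots> = J t * (A * (exp (t *\<^sub>R F') * Y' t))" unfolding e ..
  finally show "deg_ge a (I t * A * Y' t)" if "deg_ge a A"
    using deg_ge_mult0(1)[OF J(2) deg_ge_mult0(2)[OF that P]] by simp
qed

text \<open>I F Y is the dressed F, and its negative part is - I Z by the construction of Z. Hence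
  differentiating the dressed A gives a Lax equation with the projections to negative
  powers.\<close>

lemma factors_derivative:
  assumes f: "factors F T Y I J Z" "factors F' T Y' I' J' Z'" and s: "s \<in> T"
  shows "((\<lambda>t. I t * A * Y' t) has_vector_derivative
    wneg (I s * F * Y s) * (I s * A * Y' s) - (I s * A * Y' s) * wneg (I' s * F' * Y' s)) (at s within T)"
proof -
  have p: "\<And>t. t \<in> T \<Longrightarrow> Y t * I t = 1" "\<And>t. t \<in> T \<Longrightarrow> I t * Y t = 1" "\<And>t. t \<in> T \<Longrightarrow> norm (I t) \<le> 4/3"
    "(Y has_vector_derivative Z s) (at s within T)" "wneg (I s * F * Y s) = - (I s * Z s)"
    using factorsD[OF f(1)] s by blast+
  have p': "(Y' has_vector_derivative Z' s) (at s within T)" "wneg (I' s * F' * Y' s) = - (I' s * Z' s)"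
      "Y' s * I' s = 1"
    using factorsD[OF f(2)] s by blast+
  have "(I has_vector_derivative - (I s * Z s * I s)) (at s within T)"
    by (rule has_vector_derivative_inverse[OF p(4) s p(1-3)])
  then have "((\<lambda>t. I t * (A * Y' t)) has_vector_derivative I s * (A * Z' s) + - (I s * Z s * I s) * (A * Y' s))
      (at s within T)"
    by (intro has_vector_derivative_mult has_vector_derivative_mult_right p')
  moreover have "A * Z' s = A * (Y' s * I' s) * Z' s" by (simp add: p')
  then have "I s * (A * Z' s) + - (I s * Z s * I s) * (A * Y' s)
      = wneg (I s * F * Y s) * (I s * A * Y' s) - (I s * A * Y' s) * wneg (I' s * F' * Y' s)"
    unfolding p(5) p'(2) by (simp add: mult.assoc)
  ultimately show ?thesis by (simp add: mult.assoc)
qed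

lemma norm_one_minus_wC: "norm (1 - wC h x) = norm (wm (-1) (cfun h x))"
  by (simp add: w_wm)

lemma card_ge_1: "real CARD('a::finite mod_ring) \<ge> 1"
  using finite_UNIV_card_ge_0[where 'a = "'a mod_ring"] by (simp add: Suc_le_eq)

lemma unipotent_conj:
  assumes "deg_le (-1) (i - 1)" "deg_le (-1) (y - 1)" "deg_ge (-1) (i * (1 + wm (-1) w) * y)"
  shows "i * (1 + wm (-1) w) * y = 1 + wm (-1) (\<lambda>k. coef (Rep (i * (1 + wm (-1) w) * y)) (-1) k)"
proof -
  let ?z = "i * (1 + wm (-1) w) * y"
  have "deg_le (-1) (?z - 1)"
    by (rule deg_le_conj[OF assms(1,2)]) (auto intro!: deg_le_wm deg_le_ops deg_le_one)
  moreover have "deg_ge (-1) (?z - 1)" by (intro deg_ge_ops assms deg_ge_one) simp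
  ultimately have "?z - 1 = wm (-1) (\<lambda>k. coef (Rep (?z - 1)) (-1) k)" by (rule deg_le_below_wm)
  then show ?thesis by (simp add: Rep_ops Rep_mult coef_lone algebra_simps)
qed

lemma deg_ge_unipotent: "deg_ge (-1) (1 + wm (-1) w)"
  by (intro deg_ge_ops deg_ge_one deg_ge_wm) simp_all

text \<open>The lowest coefficient of the nonnegative factor; these diagonals govern the evolution
  of u, v and the coefficients of C.\<close>

definition factor0 :: "'a::finite wn \<Rightarrow> (real \<Rightarrow> 'a wn) \<Rightarrow> real \<Rightarrow> 'a mod_ring \<Rightarrow> real" where
  "factor0 F Y t k = coef (Rep (exp (t *\<^sub>R F) * Y t)) 0 k"

lemma factor0_bounds:
  assumes "factors F T Y I J Z" "t \<in> T"
  shows "factor0 F Y t k \<ge> 1/2" "factor0 F Y t k \<le> 3/2"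
proof -
  have "norm (exp (t *\<^sub>R F) * Y t - 1) \<le> 1/2" by (rule factorsD[OF assms])
  with coef_le_norm[of "exp (t *\<^sub>R F) * Y t - 1" 0 k] have "\<bar>factor0 F Y t k - 1\<bar> \<le> 1/2"
    by (simp add: factor0_def Rep_ops Rep_mult coef_lone)
  then show "factor0 F Y t k \<ge> 1/2" "factor0 F Y t k \<le> 3/2" by linarith+
qed

lemma phase_eqI: "wU x = wU y \<Longrightarrow> wV x = wV y \<Longrightarrow> x = y" for x y :: "'a::finite phase"
proof -
  assume a: "wU x = wU y" "wV x = wV y"
  have "fst x $ k = fst y $ k" "snd x $ k = snd y $ k" for k
    using arg_cong[OF a(1), of "\<lambda>z. coef (Rep z) 0 k"] arg_cong[OF a(2), of "\<lambda>z. coef (Rep z) (-1) k"]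
    by (simp_all add: coef_U V_unip coef_unip)
  then show "x = y" by (simp add: prod_eq_iff vec_eq_iff)
qed

lemma factors_0: "factors F T Y I J Z \<Longrightarrow> 0 \<in> T \<Longrightarrow> Y 0 = 1 \<and> I 0 = (1 :: 'a::finite wn)"
proof -
  assume f: "factors F T Y I J Z" "0 \<in> T"
  have "Y 0 = 1" by (rule factorsD(13)[OF f]) (simp_all add: deg_le_ops deg_ge_one)
  with factorsD(3)[OF f] show ?thesis by simp
qed

lemma exp_h: "\<bar>h\<bar> * norm a < 1 \<Longrightarrow> exp (h *\<^sub>R (a * geo_log h a)) = 1 + h *\<^sub>R a" for a :: "'a::finite wn"
  using exp_geo_log[of "h *\<^sub>R a"] by (simp add: geo_log_scale)

text \<open>The part of h U V in degree -1 is exactly what C subtracts from I. With L = U V C^-1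
  this says that (I + h L) C has no negative powers, so C is the negative factor at t = h.\<close>

lemma deg_ge_C_UV: "deg_ge 0 (wC h x + h *\<^sub>R (wU x * wV x))" for x :: "'a::finite phase"
  by (rule deg_ge_coefI) (simp add: Rep_ops Rep_mult coef_scale coef_U_left V_unip C_unip coef_unip cfun_def)

text \<open>The bound 1/3 leaves room for growth of the coefficients of C - I by a factor 3. The
  factor \<open>CARD('a mod_ring)\<close> converts the norm into \<open>wnorm\<close>, which
  measures \<open>wiener_log_dom\<close>, and 1/20 absorbs the growth by 5/3 under conjugation with
  the factors.\<close>

locale log_flow =
  fixes h :: real and x0 :: "'a::finite phase" and T F1 F2 F3 Y1 Y2 Y3 I1 I2 I3 J1 J2 J3 Z1 Z2 Z3
  assumes h: "h \<noteq> 0" and C0: "norm (1 - wC h x0) < 1/3"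
    and n: "\<bar>h\<bar> * real CARD('a mod_ring) * norm (wU x0 * wV x0 * wCi h x0) \<le> 1/20"
      "\<bar>h\<bar> * real CARD('a mod_ring) * norm (wV x0 * wCi h x0 * wU x0) \<le> 1/20"
      "\<bar>h\<bar> * real CARD('a mod_ring) * norm (wCi h x0 * wU x0 * wV x0) \<le> 1/20"
    and F1: "F1 = wU x0 * wV x0 * wCi h x0 * geo_log h (wU x0 * wV x0 * wCi h x0)"
    and F2: "F2 = wV x0 * wCi h x0 * wU x0 * geo_log h (wV x0 * wCi h x0 * wU x0)"
    and F3: "F3 = wCi h x0 * wU x0 * wV x0 * geo_log h (wCi h x0 * wU x0 * wV x0)"
    and f1: "factors F1 T Y1 I1 J1 Z1" and f2: "factors F2 T Y2 I2 J2 Z2" and f3: "factors F3 T Y3 I3 J3 Z3"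
begin

lemma smallI: "\<bar>h\<bar> * real CARD('a mod_ring) * norm z \<le> 1/20 \<Longrightarrow> \<bar>h\<bar> * norm z < 1" for z :: "'a wn"
proof -
  assume a: "\<bar>h\<bar> * real CARD('a mod_ring) * norm z \<le> 1/20"
  have "\<bar>h\<bar> * 1 * norm z \<le> \<bar>h\<bar> * real CARD('a mod_ring) * norm z"
    by (intro mult_right_mono mult_left_mono card_ge_1) auto
  with a show ?thesis by simp
qed

lemma C01: "norm (1 - wC h x0) < 1" using C0 by simp

lemmas triad0 = log_triad[OF h C01 smallI[OF n(1)] smallI[OF n(2)] smallI[OF n(3)], folded F1 F2 F3]
lemmas inv0 = wCi_inverse[OF Cinv_wiener(1)[OF C01]]

lemma inter: "F1 * wU x0 = wU x0 * F2" "F1 * wC h x0 = wC h x0 * F3" "F2 * wV x0 = wV x0 * F3"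
  using triad0(4-6) unfolding triad0(1-3) by (auto intro!: wn_eqI simp: Rep_mult)

definition cu where "cu t = (\<lambda>k. coef (Rep (I1 t * wU x0 * Y2 t)) 0 k)"
definition cv where "cv t = (\<lambda>k. coef (Rep (I2 t * wV x0 * Y3 t)) (-1) k)"
definition cc where "cc t = (\<lambda>k. coef (Rep (I1 t * wC h x0 * Y3 t)) (-1) k)"
text \<open>The point is read off from the dressed U and V. That the dressed C is the matrix C at
  the same point is a separate fact, shown in \<open>cc_eq\<close>.\<close>

definition X :: "real \<Rightarrow> 'a phase" where "X t = (\<chi> k. cu t k, \<chi> k. cv t k)"

lemma fst_X [simp]: "fst (X t) $ k = cu t k" and snd_X [simp]: "snd (X t) $ k = cv t k"
  by (simp_all add: X_def)

lemmas fD1 = factorsD[OF f1] and fD2 = factorsD[OF f2] and fD3 = factorsD[OF f3]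

lemma wU_X: assumes t: "t \<in> T" shows "wU (X t) = I1 t * wU x0 * Y2 t"
proof -
  let ?z = "I1 t * wU x0 * Y2 t"
  have "deg_le 0 (?z - wm 1 (\<lambda>_. 1))"
    by (rule deg_le_conj) (use fD1(2) fD2(1) t in \<open>auto intro!: deg_le_wm deg_le_ops simp: w_wm\<close>)
  moreover have "deg_ge 0 (?z - wm 1 (\<lambda>_. 1))"
    by (intro deg_ge_ops deg_ge_wm factors_intertwine(2)[OF f1 f2 t inter(1)]) (auto simp: w_wm intro!: deg_ge_ops deg_ge_wm)
  ultimately have "?z - wm 1 (\<lambda>_. 1) = wm 0 (\<lambda>k. coef (Rep (?z - wm 1 (\<lambda>_. 1))) 0 k)" by (rule deg_le_below_wm)
  then show ?thesis by (simp add: Rep_ops w_wm(1)[of "X t"] cu_def algebra_simps)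
qed

lemma wV_X: assumes t: "t \<in> T" shows "wV (X t) = I2 t * wV x0 * Y3 t"
proof -
  have "deg_ge (-1) (I2 t * wV x0 * Y3 t)"
    by (rule factors_intertwine(2)[OF f2 f3 t inter(3)]) (simp only: w_wm deg_ge_unipotent)
  then show ?thesis unfolding w_wm snd_X cv_def by (rule unipotent_conj[OF fD2(2)[OF t] fD3(1)[OF t], symmetric])
qed

lemma wcc: assumes t: "t \<in> T" shows "I1 t * wC h x0 * Y3 t = 1 + wm (-1) (cc t)"
proof -
  have "deg_ge (-1) (I1 t * wC h x0 * Y3 t)"
    by (rule factors_intertwine(2)[OF f1 f3 t inter(2)]) (simp only: w_wm deg_ge_unipotent)
  then show ?thesis unfolding w_wm cc_def by (rule unipotent_conj[OF fD1(2)[OF t] fD3(1)[OF t]])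
qed

text \<open>Lowest coefficients of P A' = A P' for A = U, V, C and its dressed form A', with P, P'
  the nonnegative factors. As these have no negative powers, a single product remains on each
  side.\<close>

lemma evolution:
  assumes t: "t \<in> T"
  shows "factor0 F1 Y1 t k * cu t k = fst x0 $ k * factor0 F2 Y2 t k"
    "factor0 F2 Y2 t k * cv t k = snd x0 $ k * factor0 F3 Y3 t (nxt k)"
    "factor0 F1 Y1 t k * cc t k = cfun h x0 k * factor0 F3 Y3 t (nxt k)"
proof -
  have b: "coef (Rep (exp (t *\<^sub>R F) * Y t)) (-1) i = 0" if "factors F T Y I J Z" for F Y I J Z i
  proof -
    have "deg_ge 0 (exp (t *\<^sub>R F) * Y t)" by (rule factorsD[OF that t])
    then show ?thesis by (simp add: deg_ge_def coef_def)
  qed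
  let ?P1 = "exp (t *\<^sub>R F1) * Y1 t" and ?P2 = "exp (t *\<^sub>R F2) * Y2 t" and ?P3 = "exp (t *\<^sub>R F3) * Y3 t"
  have u: "unip w = Rep (1 + wm (-1) w)" for w :: "'a mod_ring \<Rightarrow> real"
    by (simp add: Rep_ops Rep_mult unip_def lone_mono)
  have 1: "?P1 * wU (X t) = wU x0 * ?P2" using factors_intertwine(1)[OF f1 f2 t inter(1)] wU_X[OF t] by simp
  have 2: "?P2 * wV (X t) = wV x0 * ?P3" using factors_intertwine(1)[OF f2 f3 t inter(3)] wV_X[OF t] by simp
  have 3: "?P1 * (1 + wm (-1) (cc t)) = wC h x0 * ?P3"
    using factors_intertwine(1)[OF f1 f3 t inter(2)] wcc[OF t] by simp
  have "coef (Rep ?P1 \<star> U (X t)) 0 k = coef (U x0 \<star> Rep ?P2) 0 k"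
    using arg_cong[where f = "\<lambda>z. coef (Rep z) 0 k", OF 1] by (simp only: Rep_mult(2)[of ?P1] Rep_mult(2)[of _ ?P2] Rep_w)
  then show "factor0 F1 Y1 t k * cu t k = fst x0 $ k * factor0 F2 Y2 t k"
    by (simp add: coef_U_left coef_U_right b[OF f1] b[OF f2] factor0_def)
  have "coef (Rep ?P2 \<star> unip (cv t)) (-1) k = coef (unip (\<lambda>k. snd x0 $ k) \<star> Rep ?P3) (-1) k"
    using arg_cong[where f = "\<lambda>z. coef (Rep z) (-1) k", OF 2]
    by (simp only: Rep_mult(2)[of ?P2] Rep_mult(2)[of _ ?P3] Rep_w V_unip snd_X)
  then show "factor0 F2 Y2 t k * cv t k = snd x0 $ k * factor0 F3 Y3 t (nxt k)"
    by (simp add: coef_unip_left coef_unip_right b[OF f2] b[OF f3] factor0_def)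
  have "coef (Rep ?P1 \<star> unip (cc t)) (-1) k = coef (unip (cfun h x0) \<star> Rep ?P3) (-1) k"
    using arg_cong[where f = "\<lambda>z. coef (Rep z) (-1) k", OF 3]
    by (simp only: Rep_mult(2)[of ?P1] Rep_mult(2)[of _ ?P3] Rep_w C_unip u[symmetric])
  then show "factor0 F1 Y1 t k * cc t k = cfun h x0 k * factor0 F3 Y3 t (nxt k)"
    by (simp add: coef_unip_left coef_unip_right b[OF f1] b[OF f3] factor0_def)
qed

text \<open>The first two identities of \<open>evolution\<close>, multiplied and compared with the
  third, give the relation up to the diagonals of the first two factors; these are at least 1/2 and
  cancel.\<close>

lemma cc_eq: assumes t: "t \<in> T" shows "cc t = cfun h (X t)"
proof (rule ext)
  fix k
  note b = factor0_bounds[OF f1 t, of k] factor0_bounds[OF f2 t, of k]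
  note e = evolution[OF t, of k]
  let ?p = "factor0 F1 Y1 t k * factor0 F2 Y2 t k"
  have "?p * cc t k = factor0 F2 Y2 t k * (factor0 F1 Y1 t k * cc t k)" by simp
  also have "\<dots> = - h * (fst x0 $ k * factor0 F2 Y2 t k) * (snd x0 $ k * factor0 F3 Y3 t (nxt k))"
    unfolding e(3) by (simp add: cfun_def)
  also have "\<dots> = ?p * cfun h (X t) k" unfolding e(1,2)[symmetric] by (simp add: cfun_def)
  finally show "cc t k = cfun h (X t) k" using b by simp
qed

lemma wC_X: assumes t: "t \<in> T" shows "wC h (X t) = I1 t * wC h x0 * Y3 t"
  unfolding wcc[OF t] cc_eq[OF t] by (rule w_wm)

text \<open>A ratio of two numbers in [1/2, 3/2] is at most 3, and the initial norm is below
  1/3.\<close>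

lemma C_small: assumes t: "t \<in> T" shows "norm (1 - wC h (X t)) < 1"
proof -
  have "norm (wm (-1) (cfun h (X t))) \<le> 3 * norm (1 - wC h x0)"
  proof (rule norm_wm_le)
    fix k
    let ?c = "\<bar>cc t k\<bar>" and ?p = "factor0 F1 Y1 t k" and ?q = "factor0 F3 Y3 t (nxt k)"
    have b: "?p \<ge> 1/2" "?q \<ge> 1/2" "?q \<le> 3/2" using factor0_bounds f1 f3 t by blast+
    have "1/2 * ?c \<le> ?p * ?c" by (intro mult_right_mono b) simp
    also have "\<dots> = \<bar>?p * cc t k\<bar>" using b(1) by (simp add: abs_mult)
    also have "\<dots> = \<bar>cfun h x0 k\<bar> * ?q" unfolding evolution[OF t] using b(2) by (simp add: abs_mult)
    also have "\<dots> \<le> \<bar>cfun h x0 k\<bar> * (3/2)" by (intro mult_left_mono b) simp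
    finally have "?c \<le> 3 * \<bar>cfun h x0 k\<bar>" by simp
    also have "\<bar>cfun h x0 k\<bar> \<le> norm (1 - wC h x0)"
      using coef_le_norm[of "wm (-1) (cfun h x0)" "-1" k] by (simp add: norm_one_minus_wC)
    finally show "\<bar>cfun h (X t) k\<bar> \<le> 3 * norm (1 - wC h x0)" by (simp add: cc_eq[OF t])
  qed
  then show ?thesis using C0 unfolding norm_one_minus_wC[of h "X t"] by linarith
qed

lemma wCi_X: assumes t: "t \<in> T" shows "wCi h (X t) = I3 t * wCi h x0 * Y1 t"
proof -
  note iv = wCi_inverse[OF Cinv_wiener(1)[OF C_small[OF t]]]
  have Y: "Y3 t * I3 t = 1" "I1 t * Y1 t = 1" by (rule fD3(4)[OF t], rule fD1(3)[OF t])
  have "wC h (X t) * (I3 t * wCi h x0 * Y1 t) = I1 t * (wC h x0 * ((Y3 t * I3 t) * wCi h x0)) * Y1 t"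
    unfolding wC_X[OF t] by (simp only: mult.assoc)
  also have "\<dots> = 1" by (simp add: Y inv0)
  finally have "wCi h (X t) * (wC h (X t) * (I3 t * wCi h x0 * Y1 t)) = wCi h (X t)" by simp
  then show ?thesis by (simp add: mult.assoc[symmetric] iv)
qed

lemma L_X:
  assumes t: "t \<in> T"
  shows "wU (X t) * wV (X t) * wCi h (X t) = I1 t * (wU x0 * wV x0 * wCi h x0) * Y1 t"
    "wV (X t) * wCi h (X t) * wU (X t) = I2 t * (wV x0 * wCi h x0 * wU x0) * Y2 t"
    "wCi h (X t) * wU (X t) * wV (X t) = I3 t * (wCi h x0 * wU x0 * wV x0) * Y3 t"
proof -
  have Y: "Y1 t * (I1 t * z) = z" "Y2 t * (I2 t * z) = z" "Y3 t * (I3 t * z) = z" for z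
    by (simp_all add: fD1(4) fD2(4) fD3(4) t flip: mult.assoc)
  show "wU (X t) * wV (X t) * wCi h (X t) = I1 t * (wU x0 * wV x0 * wCi h x0) * Y1 t"
    "wV (X t) * wCi h (X t) * wU (X t) = I2 t * (wV x0 * wCi h x0 * wU x0) * Y2 t"
    "wCi h (X t) * wU (X t) * wV (X t) = I3 t * (wCi h x0 * wU x0 * wV x0) * Y3 t"
    unfolding wU_X[OF t] wV_X[OF t] wCi_X[OF t] by (simp_all only: mult.assoc Y)
qed

text \<open>The conjugating factors are bounded by 4/3 and 5/4, so norms grow at most by 5/3, and
  5/3 times 1/20 is below 1.\<close>

lemma small_conj:
  fixes a :: "'a wn"
  assumes f: "factors F T Y I J Z" and t: "t \<in> T" and a: "\<bar>h\<bar> * real CARD('a mod_ring) * norm a \<le> 1/20"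
  shows "\<bar>h\<bar> * norm (I t * a * Y t) < 1" "Rep (I t * a * Y t) \<in> wiener_log_dom h"
proof -
  let ?z = "I t * a * Y t" and ?c = "\<bar>h\<bar> * real CARD('a mod_ring)"
  have b: "norm (Y t) \<le> 5/4" "norm (I t) \<le> 4/3" by (rule factorsD[OF f t])+
  have "norm ?z \<le> norm (I t * a) * norm (Y t)" by (rule norm_mult_ineq)
  also have "\<dots> \<le> (norm (I t) * norm a) * norm (Y t)" by (intro mult_right_mono norm_mult_ineq) simp
  also have "\<dots> \<le> (4/3 * norm a) * (5/4)" by (intro mult_mono b) auto
  finally have "?c * norm ?z \<le> ?c * ((4/3 * norm a) * (5/4))" by (intro mult_left_mono) auto
  also have "\<dots> = 5/3 * (?c * norm a)" by simp
  finally have c: "?c * norm ?z < 1" using a by linarith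
  have "\<bar>h\<bar> * 1 * norm ?z \<le> ?c * norm ?z" by (intro mult_right_mono mult_left_mono card_ge_1) auto
  with c show "\<bar>h\<bar> * norm ?z < 1" by simp
  have "wnorm (Rep ?z) \<le> real CARD('a mod_ring) * nn (Rep ?z)"
    using wnorm_le_nn[of "Rep ?z"] by simp
  then have "\<bar>h\<bar> * wnorm (Rep ?z) \<le> \<bar>h\<bar> * (real CARD('a mod_ring) * nn (Rep ?z))"
    by (rule mult_left_mono) simp
  with c show "Rep ?z \<in> wiener_log_dom h" by (simp add: wiener_log_dom_def norm_wn_def)
qed

lemma triad_X:
  assumes t: "t \<in> T"
  shows "{UVC h (X t), VCU h (X t), CUV h (X t)} \<subseteq> wiener_log_dom h" (is ?dom)
    "f_log h (UVC h (X t)) = Rep (I1 t * F1 * Y1 t)"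
    "f_log h (VCU h (X t)) = Rep (I2 t * F2 * Y2 t)"
    "f_log h (CUV h (X t)) = Rep (I3 t * F3 * Y3 t)"
    "U (X t) \<star> f_log h (VCU h (X t)) = f_log h (UVC h (X t)) \<star> U (X t)"
    "C h (X t) \<star> f_log h (CUV h (X t)) = f_log h (UVC h (X t)) \<star> C h (X t)"
    "V (X t) \<star> f_log h (CUV h (X t)) = f_log h (VCU h (X t)) \<star> V (X t)"
    "ham_field (\<lambda>y. phi_log h (UVC h y)) (X t) = triad_field (X t)
      (f_log h (UVC h (X t))) (f_log h (VCU h (X t))) (f_log h (CUV h (X t)))"
proof -
  note iv = wCi_inverse[OF Cinv_wiener(1)[OF C_small[OF t]]]
  have R: "UVC h (X t) = Rep (wU (X t) * wV (X t) * wCi h (X t))" "VCU h (X t) = Rep (wV (X t) * wCi h (X t) * wU (X t))"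
    "CUV h (X t) = Rep (wCi h (X t) * wU (X t) * wV (X t))"
    by (simp_all add: Rep_mult iv)
  show ?dom
    unfolding R L_X[OF t] using small_conj(2)[OF f1 t n(1)] small_conj(2)[OF f2 t n(2)] small_conj(2)[OF f3 t n(3)] by simp
  note s = small_conj(1)[OF f1 t n(1)] small_conj(1)[OF f2 t n(2)] small_conj(1)[OF f3 t n(3)]
  note l = log_triad[OF h C_small[OF t], unfolded L_X[OF t], OF s]
  have Y: "Y1 t * I1 t = 1" "Y2 t * I2 t = 1" "Y3 t * I3 t = 1" by (rule fD1(4) fD2(4) fD3(4), rule t)+
  \<comment> \<open>f commutes with conjugation, so f at the moving point is the dressed F.\<close>
  show "f_log h (UVC h (X t)) = Rep (I1 t * F1 * Y1 t)"
    "f_log h (VCU h (X t)) = Rep (I2 t * F2 * Y2 t)"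
    "f_log h (CUV h (X t)) = Rep (I3 t * F3 * Y3 t)"
    using geo_log_conj[OF smallI[OF n(1)] s(1) Y(1)] geo_log_conj[OF smallI[OF n(2)] s(2) Y(2)]
      geo_log_conj[OF smallI[OF n(3)] s(3) Y(3)]
    unfolding l(1-3) F1 F2 F3 by (simp_all only: mult.assoc)
  show "U (X t) \<star> f_log h (VCU h (X t)) = f_log h (UVC h (X t)) \<star> U (X t)"
    "C h (X t) \<star> f_log h (CUV h (X t)) = f_log h (UVC h (X t)) \<star> C h (X t)"
    "V (X t) \<star> f_log h (CUV h (X t)) = f_log h (VCU h (X t)) \<star> V (X t)"
    "ham_field (\<lambda>y. phi_log h (UVC h y)) (X t) = triad_field (X t)
      (f_log h (UVC h (X t))) (f_log h (VCU h (X t))) (f_log h (CUV h (X t)))"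
    by (fact l)+
qed

lemma X_derivative:
  assumes s: "s \<in> T"
  shows "(X has_vector_derivative triad_field (X s) (f_log h (UVC h (X s))) (f_log h (VCU h (X s))) (f_log h (CUV h (X s))))
    (at s within T)" (is "(_ has_vector_derivative ?f) _")
proof (rule has_vector_derivative_phase)
  fix k
  note t = triad_X[OF s]
  have tw: "twisted (f_log h (UVC h (X s)))" "twisted (f_log h (VCU h (X s)))" "twisted (f_log h (CUV h (X s)))"
    unfolding t(2-4) by simp_all
  \<comment> \<open>The factorization works with negative projections, so it delivers the triads
    with the lower sign, \<open>pm_pi False\<close>.\<close>
  have e: "Rep (wneg a * z - z * wneg b) = Rep z \<star> pm_pi False (Rep b) - pm_pi False (Rep a) \<star> Rep z" for a b z :: "'a wn"
  proof -
    have "wneg a * z - z * wneg b = z * (- wneg b) - (- wneg a) * z" by simp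
    then show ?thesis by (simp only: Rep_ops Rep_mult Rep_wneg pm_pi_def if_False)
  qed
  have dfst: "((\<lambda>t. coef (Rep (I1 t * wU x0 * Y2 t)) (0) k) has_vector_derivative
      coef (Rep (wneg (I1 s * F1 * Y1 s) * wU (X s) - wU (X s) * wneg (I2 s * F2 * Y2 s))) (0) k) (at s within T)"
    unfolding wU_X[OF s]
    by (rule bounded_linear.has_vector_derivative[OF bounded_linear_coef factors_derivative[OF f1 f2 s]])
  have efst: "coef (Rep (wneg (I1 s * F1 * Y1 s) * wU (X s) - wU (X s) * wneg (I2 s * F2 * Y2 s))) (0) k = fst ?f $ k"
    unfolding e Rep_w t(2,3)[symmetric] by (subst U_pm_pi[OF tw(1,2) t(5)]) (simp add: triad_field_def)
  show "((\<lambda>\<tau>. fst (X \<tau>) $ k) has_real_derivative fst ?f $ k) (at s within T)"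
    using dfst unfolding efst has_real_derivative_iff_has_vector_derivative fst_X cu_def .
  have dsnd: "((\<lambda>t. coef (Rep (I2 t * wV x0 * Y3 t)) (-1) k) has_vector_derivative
      coef (Rep (wneg (I2 s * F2 * Y2 s) * wV (X s) - wV (X s) * wneg (I3 s * F3 * Y3 s))) (-1) k) (at s within T)"
    unfolding wV_X[OF s]
    by (rule bounded_linear.has_vector_derivative[OF bounded_linear_coef factors_derivative[OF f2 f3 s]])
  have esnd: "coef (Rep (wneg (I2 s * F2 * Y2 s) * wV (X s) - wV (X s) * wneg (I3 s * F3 * Y3 s))) (-1) k = snd ?f $ k"
    unfolding e Rep_w t(3,4)[symmetric] by (subst V_pm_pi[OF tw(2,3) t(7)]) (simp add: triad_field_def)
  show "((\<lambda>\<tau>. snd (X \<tau>) $ k) has_real_derivative snd ?f $ k) (at s within T)"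
    using dsnd unfolding esnd has_real_derivative_iff_has_vector_derivative snd_X cv_def .
qed

lemma X_solves:
  assumes t: "t \<in> T"
  shows "hier_eq h (phi_log h) X t T" "lax_triad s h (f_log h) X t T"
proof -
  note x = triad_X[OF t]
  show "hier_eq h (phi_log h) X t T"
    unfolding hier_eq_def x(8) by (rule X_derivative[OF t])
  have tw: "twisted (f_log h (UVC h (X t)))" "twisted (f_log h (VCU h (X t)))" "twisted (f_log h (CUV h (X t)))"
    unfolding x(2-4) by simp_all
  show "lax_triad s h (f_log h) X t T"
    unfolding lax_triad_iff[where f = "f_log h" and x = X and t = t, OF tw x(5-7)] by (rule X_derivative[OF t])
qed

lemma X_0: assumes "0 \<in> T" shows "X 0 = x0"
  using wU_X[OF assms] wV_X[OF assms] factors_0[OF f1 assms] factors_0[OF f2 assms] factors_0[OF f3 assms]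
  by (intro phase_eqI) simp_all

lemma X_h:
  assumes hT: "h \<in> T" and y: "dmap_rel h x0 y"
  shows "X h = y"
proof -
  \<comment> \<open>The coefficients of the middle factor Y_2, with old v and new u; they are those
    for which U Y_2 = C U' holds, primes marking the image point \<open>y\<close>.\<close>
  let ?w = "\<lambda>k. - (h * (snd x0 $ k * fst y $ nxt k))"
  let ?Y2 = "1 + wm (-1) ?w"
  have y1: "fst y $ k * (1 + h * snd x0 $ prv k) = fst x0 $ k * (1 + h * snd x0 $ k)"
    and y2: "snd y $ k * (1 + h * fst y $ k) = snd x0 $ k * (1 + h * fst y $ nxt k)" for k
    using y by (simp_all add: dmap_rel_def)
  have u: "Rep ?Y2 = unip ?w"
    by (simp add: Rep_ops Rep_mult unip_def lone_mono)
  have UY: "wU x0 * ?Y2 = wC h x0 * wU y"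
  proof (rule wn_eqI, rule twisted_eqI)
    fix p i
    \<comment> \<open>Degree 0 of U Y_2 = C U' is the first equation of the map.\<close>
    have "- (h * snd x0 $ prv i * fst y $ i) + fst x0 $ i = fst y $ i - h * fst x0 $ i * snd x0 $ i"
      using y1[of i] by (simp add: algebra_simps)
    then show "coef (Rep (wU x0 * ?Y2)) p i = coef (Rep (wC h x0 * wU y)) p i"
      unfolding Rep_mult(2) Rep_w u C_unip
      by (auto simp: coef_U_left coef_unip_left coef_U coef_unip cfun_def algebra_simps)
  qed simp_all
  have VC: "wV x0 * wC h y = ?Y2 * wV y"
  proof (rule wn_eqI, rule twisted_eqI)
    fix p i
    \<comment> \<open>Degree -1 of V C' = Y_2 V' is the second equation of the map.\<close>
    have "snd x0 $ i - h * fst y $ i * snd y $ i = snd y $ i - h * snd x0 $ i * fst y $ nxt i"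
      using y2[of i] by (simp add: algebra_simps)
    then show "coef (Rep (wV x0 * wC h y)) p i = coef (Rep (?Y2 * wV y)) p i"
      unfolding Rep_mult(2) Rep_w u C_unip V_unip
      by (auto simp: coef_unip_left coef_unip cfun_def algebra_simps)
  qed simp_all
  have deg_ge: "deg_ge 0 (?Y2 + h *\<^sub>R (wV x0 * wU y))"
  proof (rule deg_ge_coefI)
    fix p :: int and i :: "'a mod_ring" assume "p < 0"
    then show "coef (Rep (?Y2 + h *\<^sub>R (wV x0 * wU y))) p i = 0"
      unfolding Rep_ops(2)[of ?Y2] u Rep_ops(5) Rep_mult(2) Rep_w V_unip
      by (auto simp: coef_scale coef_unip_left coef_U coef_unip)
  qed
  have CC: "wC h x0 * (wCi h x0 * z) = z" "wCi h x0 * (wC h x0 * z) = z" for z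
    by (simp_all add: inv0 flip: mult.assoc)
  \<comment> \<open>At t = h the exponential is 1 + h a. So a candidate z of the form 1 + (negative
    powers) is the factor as soon as (1 + h a) z has no negative powers.\<close>
  have uniq: "Y h = z" if "factors (a * geo_log h a) T Y I J Z" "\<bar>h\<bar> * real CARD('a mod_ring) * norm a \<le> 1/20"
      "deg_le (-1) (z - 1)" "deg_ge 0 (z + h *\<^sub>R (a * z))" for a z :: "'a wn" and Y I J Z
  proof -
    have "exp (h *\<^sub>R (a * geo_log h a)) * z = z + h *\<^sub>R (a * z)"
      unfolding exp_h[OF smallI[OF that(2)]] by (simp add: distrib_right)
    then show ?thesis using factorsD(13)[OF that(1) hT that(3)] that(4) by simp
  qed
  have aw: "deg_le (-1) (wC h x - 1)" for x :: "'a phase" by (simp add: w_wm deg_le_wm)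
  have Y1: "Y1 h = wC h x0"
    by (rule uniq[OF f1[unfolded F1] n(1) aw]) (simp only: mult.assoc inv0 mult_1_right deg_ge_C_UV)
  have Y2: "Y2 h = ?Y2"
    by (rule uniq[OF f2[unfolded F2] n(2)]) (simp_all only: mult.assoc UY CC deg_ge add_diff_cancel_left' deg_le_wm order.refl)
  \<comment> \<open>Both equations of the map enter: C^-1 U V C' = C^-1 U Y_2 V' = U' V'. Hence (I +
    h C^-1 U V) C' = C' + h U' V', which has no negative powers.\<close>
  have "(wCi h x0 * wU x0 * wV x0) * wC h y = wU y * wV y"
  proof -
    have "(wCi h x0 * wU x0 * wV x0) * wC h y = wCi h x0 * (wU x0 * ?Y2 * wV y)"
      by (simp only: mult.assoc VC)
    then show ?thesis unfolding UY by (simp only: mult.assoc CC)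
  qed
  then have Y3: "Y3 h = wC h y"
    by (intro uniq[OF f3[unfolded F3] n(3) aw]) (simp only: deg_ge_C_UV)
  have I: "I1 h * wC h x0 = 1" "I2 h * ?Y2 = 1" using fD1(3)[OF hT] fD2(3)[OF hT] unfolding Y1 Y2 by blast+
  have "wU (X h) = wU y"
  proof -
    have "I1 h * (wC h x0 * wU y) = wU y" by (simp only: mult.assoc[symmetric] I mult_1_left)
    then show ?thesis unfolding wU_X[OF hT] Y2 mult.assoc UY .
  qed
  moreover have "wV (X h) = wV y"
  proof -
    have "I2 h * (?Y2 * wV y) = wV y" by (simp only: mult.assoc[of "I2 h" ?Y2, symmetric] I mult_1_left)
    then show ?thesis unfolding wV_X[OF hT] Y3 mult.assoc VC .
  qed
  ultimately show ?thesis by (rule phase_eqI)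
qed

end

lemma norm_mult3:
  fixes x y z :: "'b::real_normed_algebra"
  assumes "norm x \<le> a" "norm y \<le> b" "norm z \<le> c"
  shows "norm (x * y * z) \<le> a * b * c"
proof -
  have "norm (x * y * z) \<le> norm x * norm y * norm z"
    by (rule order_trans[OF norm_mult_ineq mult_right_mono[OF norm_mult_ineq]]) simp
  also have "\<dots> \<le> a * b * c"
    using norm_ge_zero[of x] norm_ge_zero[of y] norm_ge_zero[of z] assms by (intro mult_mono assms mult_nonneg_nonneg) linarith+
  finally show ?thesis .
qed

text \<open>1/20 times the bound 2 of \<open>norm_geo_log\<close> bounds the exponent by 1/10, and
  exp (1/10) - 1 <= 1/10 + 1/100.\<close>

lemma norm_log_exp:
  fixes a :: "'b::{real_normed_algebra_1,banach}"
  assumes "\<bar>h\<bar> * norm a \<le> 1/20" "\<bar>t\<bar> \<le> \<bar>h\<bar>"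
  shows "norm (exp (t *\<^sub>R (a * geo_log h a)) - 1) \<le> 1/5"
proof -
  let ?z = "t *\<^sub>R (a * geo_log h a)"
  have "norm ?z = \<bar>t\<bar> * norm (a * geo_log h a)" by simp
  also have "\<dots> \<le> \<bar>h\<bar> * (norm a * norm (geo_log h a))" by (intro mult_mono norm_mult_ineq assms) auto
  also have "\<dots> \<le> \<bar>h\<bar> * (norm a * 2)" by (intro mult_left_mono norm_geo_log) (use assms in auto)
  finally have z: "norm ?z \<le> 1/10" using assms by simp
  have "norm (exp ?z - 1) \<le> exp (norm ?z) - 1" by (rule norm_exp_minus_one)
  also have "\<dots> \<le> exp (1/10) - 1" using z by simp
  also have "\<dots> \<le> 1/5" using exp_bound[of "1/10"] by (simp add: power2_eq_square)
  finally show ?thesis .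
qed

theorem dmap_time_shift:
  assumes r: "r > 0"
  shows "\<exists>h\<^sub>0>0. \<forall>\<eta>. 0 < \<bar>\<eta>\<bar> \<and> \<bar>\<eta>\<bar> < h\<^sub>0 \<longrightarrow>
           (\<forall>x\<^sub>0 :: 'a::finite phase. norm x\<^sub>0 \<le> r \<longrightarrow>
              x\<^sub>0 \<in> dmap_dom \<eta>
              \<and> (\<exists>x. x 0 = x\<^sub>0 \<and> x \<eta> = dmap \<eta> x\<^sub>0
                    \<and> (\<forall>t \<in> closed_segment 0 \<eta>.
                         {UVC \<eta> (x t), VCU \<eta> (x t), CUV \<eta> (x t)} \<subseteq> wiener_log_dom \<eta>
                         \<and> hier_eq \<eta> (phi_log \<eta>) x t (closed_segment 0 \<eta>)
                         \<and> (\<forall>s. lax_triad s \<eta> (f_log \<eta>) x t (closed_segment 0 \<eta>)))))"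
proof -
  \<comment> \<open>Bounds the three cyclic products on the ball of radius r: 1 + r for U and for V,
    and 2 for C^-1.\<close>
  define B where "B = 2 * (1 + r)\<^sup>2"
  let ?N = "real CARD('a mod_ring)"
  have N: "?N \<ge> 1" by (rule card_ge_1)
  have B: "B > 0" "r \<le> B" "r\<^sup>2 \<le> B"
    using r by (simp_all add: B_def power2_eq_square algebra_simps add_pos_pos)
  have NB: "20 * (?N * B) > 0" using N B by simp
  have "x0 \<in> dmap_dom h \<and> (\<exists>x. x 0 = x0 \<and> x h = dmap h x0
      \<and> (\<forall>t \<in> closed_segment 0 h. {UVC h (x t), VCU h (x t), CUV h (x t)} \<subseteq> wiener_log_dom h
         \<and> hier_eq h (phi_log h) x t (closed_segment 0 h)
         \<and> (\<forall>s. lax_triad s h (f_log h) x t (closed_segment 0 h))))"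
    if h: "h \<noteq> 0" "\<bar>h\<bar> < 1 / (20 * (?N * B))" and x0: "norm x0 \<le> r" for h and x0 :: "'a phase"
  proof -
    let ?T = "closed_segment 0 h"
    have hNB: "\<bar>h\<bar> * ?N * B \<le> 1/20"
      using h(2) NB by (simp add: pos_less_divide_eq mult_ac)
    have "\<bar>h\<bar> * 1 * B \<le> \<bar>h\<bar> * ?N * B" using B N by (intro mult_right_mono mult_left_mono) auto
    with hNB have hB: "\<bar>h\<bar> * B \<le> 1/20" by simp
    have c: "\<bar>fst x0 $ k\<bar> \<le> r" "\<bar>snd x0 $ k\<bar> \<le> r" for k
      using component_le_norm_cart[of "fst x0" k] component_le_norm_cart[of "snd x0" k]
        norm_fst_le[of "fst x0" "snd x0"] norm_snd_le[of "snd x0" "fst x0"] x0 by simp_all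
    have nU: "norm (wU x0) \<le> 1 + r"
    proof -
      have "norm (wU x0) \<le> norm (wm 0 (\<lambda>k. fst x0 $ k)) + norm (wm 1 (\<lambda>_. 1) :: 'a wn)"
        unfolding w_wm by (rule norm_triangle_ineq)
      also have "norm (wm 0 (\<lambda>k. fst x0 $ k)) \<le> r" by (rule norm_wm_le) (rule c)
      also have "norm (wm 1 (\<lambda>_. 1) :: 'a wn) \<le> 1" by (rule norm_wm_le) simp
      finally show ?thesis by simp
    qed
    have nV: "norm (wV x0) \<le> 1 + r"
    proof -
      have "norm (wV x0) \<le> norm (1 :: 'a wn) + norm (wm (-1) (\<lambda>k. snd x0 $ k))"
        unfolding w_wm by (rule norm_triangle_ineq)
      also have "norm (wm (-1) (\<lambda>k. snd x0 $ k)) \<le> r" by (rule norm_wm_le) (rule c)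
      finally show ?thesis by simp
    qed
    have nC: "norm (1 - wC h x0) \<le> 1/20"
      unfolding norm_one_minus_wC
    proof (rule norm_wm_le)
      fix k
      have "\<bar>cfun h x0 k\<bar> = \<bar>h\<bar> * (\<bar>fst x0 $ k\<bar> * \<bar>snd x0 $ k\<bar>)" by (simp add: cfun_def abs_mult)
      also have "\<dots> \<le> \<bar>h\<bar> * (r * r)" using r by (intro mult_left_mono mult_mono c) auto
      also have "\<dots> \<le> \<bar>h\<bar> * B" using B(3) by (intro mult_left_mono) (auto simp: power2_eq_square)
      finally show "\<bar>cfun h x0 k\<bar> \<le> 1/20" using hB by simp
    qed
    have nK: "norm (wCi h x0) \<le> 2"
    proof -
      have "norm (wCi h x0) \<le> 1 / (1 - norm (1 - wC h x0))" by (rule Cinv_wiener) (use nC in simp)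
      also have "\<dots> \<le> 2" using nC by (simp add: divide_le_eq)
      finally show ?thesis .
    qed
    let ?a = "wU x0 * wV x0 * wCi h x0" and ?b = "wV x0 * wCi h x0 * wU x0" and ?c = "wCi h x0 * wU x0 * wV x0"
    have L: "norm ?a \<le> B" "norm ?b \<le> B" "norm ?c \<le> B"
      using norm_mult3[OF nU nV nK] norm_mult3[OF nV nK nU] norm_mult3[OF nK nU nV]
      by (simp_all add: B_def power2_eq_square algebra_simps)
    have n: "\<bar>h\<bar> * ?N * norm ?a \<le> 1/20" "\<bar>h\<bar> * ?N * norm ?b \<le> 1/20" "\<bar>h\<bar> * ?N * norm ?c \<le> 1/20"
      by (rule order_trans[OF mult_left_mono hNB], rule L, simp)+
    have "\<exists>Y I J Z. factors (z * geo_log h z) ?T Y I J Z" if z: "norm z \<le> B" for z :: "'a wn"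
    proof (rule factors_exist, rule norm_log_exp)
      show "\<bar>h\<bar> * norm z \<le> 1/20" by (rule order_trans[OF mult_left_mono[OF z] hB]) simp
      show "\<bar>t\<bar> \<le> \<bar>h\<bar>" if "t \<in> ?T" for t
        using that by (auto simp: closed_segment_eq_real_ivl split: if_splits)
    qed
    with L obtain Y1 I1 J1 Z1 Y2 I2 J2 Z2 Y3 I3 J3 Z3 where f: "factors (?a * geo_log h ?a) ?T Y1 I1 J1 Z1"
      "factors (?b * geo_log h ?b) ?T Y2 I2 J2 Z2" "factors (?c * geo_log h ?c) ?T Y3 I3 J3 Z3" by metis
    interpret log_flow h x0 ?T "?a * geo_log h ?a" "?b * geo_log h ?b" "?c * geo_log h ?c"
      Y1 Y2 Y3 I1 I2 I3 J1 J2 J3 Z1 Z2 Z3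
      by unfold_locales (use h nC n f in auto)
    have hr: "\<bar>h\<bar> * r \<le> 1/20" by (rule order_trans[OF mult_left_mono[OF B(2)] hB]) simp
    have hv: "\<bar>h * snd x0 $ k\<bar> \<le> 1/20" and hu: "\<bar>h * fst x0 $ k\<bar> \<le> 1/20" for k
      unfolding abs_mult by (rule order_trans[OF mult_left_mono[OF c(2)] hr] order_trans[OF mult_left_mono[OF c(1)] hr], simp)+
    \<comment> \<open>The numerator of 1 + h u'_k differs from 1 + h v_{k-1} >= 19/20 by at most
      21/400, so it stays positive.\<close>
    have nz: "1 + h * snd x0 $ k \<noteq> 0" "1 + h * fst (dmap h x0) $ k \<noteq> 0" for k
    proof -
      let ?q = "1 + h * snd x0 $ prv k" and ?p = "1 + h * snd x0 $ k"
      show "?p \<noteq> 0" using hv[of k] by linarith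
      have q: "?q \<ge> 19/20" "\<bar>?p\<bar> \<le> 21/20" using hv[of k] hv[of "prv k"] by linarith+
      have "\<bar>(h * fst x0 $ k) * ?p\<bar> \<le> 1/20 * (21/20)" unfolding abs_mult[of _ ?p] by (intro mult_mono hu q) auto
      then have "(h * fst x0 $ k) * ?p + ?q > 0" using q by linarith
      moreover have "1 + h * fst (dmap h x0) $ k = ((h * fst x0 $ k) * ?p + ?q) / ?q"
        using q by (simp add: dmap_def Let_def field_simps)
      ultimately show "1 + h * fst (dmap h x0) $ k \<noteq> 0" using q by simp
    qed
    then have dom: "x0 \<in> dmap_dom h" by (simp add: dmap_dom_def)
    have X: "X 0 = x0" "X h = dmap h x0"
      by (rule X_0, simp, rule X_h, simp) (simp add: dmap_rel_iff[OF dom])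
    show ?thesis
      using dom X triad_X(1) X_solves by blast
  qed
  \<comment> \<open>The threshold \<open>1 / (20 * (?N * B))\<close> makes |h| N times the norm of
    each product at most 1/20, which yields both the smallness of the exponentials and membership in
    the domain of the logarithm.\<close>
  then show ?thesis
    using NB by (intro exI[of _ "1 / (20 * (?N * B))"]) auto
qed

theorem theorem4p8:
  fixes h :: real
  shows
    "\<comment> \<open>(1)\<close>
     poisson_lax_map 3 A1_mat A2_mat S_mat (\<lambda>x :: 'a::finite phase. [U x, Cinv h x, V x])
   \<and> \<comment> \<open>(2)\<close>
     (poisson_lax_map 1 [[A1]] [[A2]] [[S]] (\<lambda>x :: 'a phase. [UVC h x])
      \<and> poisson_lax_map 1 [[A1]] [[A2]] [[S]] (\<lambda>x :: 'a phase. [VCU h x])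
      \<and> poisson_lax_map 1 [[A1]] [[A2]] [[S]] (\<lambda>x :: 'a phase. [CUV h x]))
   \<and> \<comment> \<open>(3)\<close>
     (\<forall>\<phi> f. ad_hamiltonian loop_alg formal_curve loop_alg \<phi> f \<longrightarrow>
        (\<forall>(x :: real \<Rightarrow> 'a phase) t T s.
           (hier_eq h \<phi> x t T \<longleftrightarrow> lax_triad s h f x t T)
           \<and> (hier_eq h \<phi> x t T \<longrightarrow>
                ((\<lambda>\<tau>. UVC h (x \<tau>)) has_loop_derivative
                   UVC h (x t) \<star> pm_pi s (f (UVC h (x t))) - pm_pi s (f (UVC h (x t))) \<star> UVC h (x t))
                 (at t within T))))
   \<and> \<comment> \<open>(4)\<close>
     (ad_hamiltonian loop_alg formal_curve loop_alg (\<lambda>L :: 'a loop. trace (L 0)) (\<lambda>L. L)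
      \<and> (\<forall>\<phi>. ad_hamiltonian loop_alg formal_curve loop_alg \<phi> (\<lambda>L. L) \<longrightarrow>
            (\<forall>x :: 'a phase. ham_field (\<lambda>y. \<phi> (UVC h y)) x = first_flow h x))
      \<and> (\<forall>x :: 'a phase. let u = fst x; v = snd x in
           pi_plus (UVC h x) = lam 0 (\<Sum>k\<in>UNIV. (u $ k + v $ prv k + h * u $ prv k * v $ prv k) *\<^sub>R E k k)
                               + lam 1 (\<Sum>k\<in>UNIV. E (nxt k) k)
           \<and> pi_plus (CUV h x) = lam 0 (\<Sum>k\<in>UNIV. (u $ k + v $ prv k + h * u $ k * v $ k) *\<^sub>R E k k)
                               + lam 1 (\<Sum>k\<in>UNIV. E (nxt k) k)
           \<and> pi_plus (VCU h x) = lam 0 (\<Sum>k\<in>UNIV. (u $ k + v $ k + h * u $ k * v $ k) *\<^sub>R E k k)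
                               + lam 1 (\<Sum>k\<in>UNIV. E (nxt k) k)))
   \<and> \<comment> \<open>(5)\<close>
     ((\<forall>x \<in> dmap_dom h. \<forall>y :: 'a phase. dmap_rel h x y \<longleftrightarrow> y = dmap h x)
      \<and> (\<forall>x \<in> dmap_dom h. \<forall>F G :: 'a phase \<Rightarrow> real.
            F differentiable (at (dmap h x)) \<longrightarrow> G differentiable (at (dmap h x)) \<longrightarrow>
            pb (\<lambda>y. F (dmap h y)) (\<lambda>y. G (dmap h y)) x = pb F G (dmap h x))
      \<and> (\<forall>\<eta>. \<eta> \<noteq> 0 \<longrightarrow> ad_hamiltonian wiener wiener_curve (wiener_log_dom \<eta>) (phi_log \<eta>) (f_log \<eta> :: 'a loop \<Rightarrow> 'a loop))
      \<and> (\<forall>r>0. \<exists>h\<^sub>0>0. \<forall>\<eta>. 0 < \<bar>\<eta>\<bar> \<and> \<bar>\<eta>\<bar> < h\<^sub>0 \<longrightarrow>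
           (\<forall>x\<^sub>0 :: 'a phase. norm x\<^sub>0 \<le> r \<longrightarrow>
              x\<^sub>0 \<in> dmap_dom \<eta>
              \<and> (\<exists>x. x 0 = x\<^sub>0 \<and> x \<eta> = dmap \<eta> x\<^sub>0
                    \<and> (\<forall>t \<in> closed_segment 0 \<eta>.
                         {UVC \<eta> (x t), VCU \<eta> (x t), CUV \<eta> (x t)} \<subseteq> wiener_log_dom \<eta>
                         \<and> hier_eq \<eta> (phi_log \<eta>) x t (closed_segment 0 \<eta>)
                         \<and> (\<forall>s. lax_triad s \<eta> (f_log \<eta>) x t (closed_segment 0 \<eta>)))))))"
  by (intro conjI allI ballI impI poisson_lax_triple poisson_lax_products hierarchy_triads ad_hamiltonian_trace
      first_flow_eq pi_plus_lax dmap_rel_iff pb_dmap ad_hamiltonian_log dmap_time_shift) assumption+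

end
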